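(* Let $n\ge0$ be an integer and let $f_n$ and $A_n$ be as in the context. Then $\sigma_c(A_n)=[0,\infty)$, $\sigma_r(A_n)=\emptyset$, and $\sigma_p(A_n)$ consists of exactly $n$ real numbers $\lambda_1,\dots,\lambda_n$ with $0>\lambda_1>\lambda_2>\dots>\lambda_n$ (so $\sigma_p(A_0)=\emptyset$).
   Context: $H:=L^2_w(0,1)$, $w(\rho)=\frac{\rho^2}{(1-\rho^2)^2}$. $\mathcal D(A):=\{u\in H:\ u,\ \rho^2u'\in AC_{\mathrm{loc}}(0,1),\ \frac1w(-(\rho^2u')'+2u)\in H\}$, $Au:=\frac1w(-(\rho^2u')'+2u)$. For integer $n\ge0$, $f_n$ is the $n$-th self-similar wave map profile: a real-analytic function on $[0,1]$ solving $f''+\frac2\rho f'-\frac{\sin(2f)}{\rho^2(1-\rho^2)}=0$ on $(0,1)$, with $f_n(0)=0$, $f_n(1)=\pi/2$, such that $f_n$ crosses the value $\pi/2$ exactly $n$ times on $[0,1)$ and the function $\theta_n(\rho)=\rho\sqrt{1-\rho^2}f_n'(\rho)$ has exactly $n$ zeros in $(0,1)$ ($f_0(\rho)=2\arctan\rho$). Put $g_n(\rho)=\frac{2(1-\rho^2)\cos(2f_n(\rho))-\rho^2-2(1-\rho^2)^2}{\rho^2}$ and $\mathcal D(A_n)=\mathcal D(A)$, $A_nu=Au+g_nu$. Spectral parts: $\sigma_p$ = eigenvalues; $\lambda\in\sigma_c$ iff $\lambda-A_n$ injective, not surjective, dense range; $\lambda\in\sigma_r$ iff $\lambda-A_n$ injective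 with non-dense range. *)

theory Defs
  imports "HOL-Analysis.Analysis"
begin

definition wt :: "real \<Rightarrow> real" where
  "wt \<rho> = \<rho>\<^sup>2 / (1 - \<rho>\<^sup>2)\<^sup>2"

(* u (a representative of an element of) H = L^2_w(0,1), complex valued *)
definition inH :: "(real \<Rightarrow> complex) \<Rightarrow> bool" where
  "inH u \<longleftrightarrow> set_borel_measurable lebesgue {0<..<1} u \<and>
     set_integrable lebesgue {0<..<1} (\<lambda>\<rho>. wt \<rho> * (cmod (u \<rho>))\<^sup>2)"

definition normH :: "(real \<Rightarrow> complex) \<Rightarrow> real" where
  "normH u = sqrt (LINT \<rho>:{0<..<1}|lebesgue. wt \<rho> * (cmod (u \<rho>))\<^sup>2)"

definition aeq :: "(real \<Rightarrow> complex) \<Rightarrow> (real \<Rightarrow> complex) \<Rightarrow> bool" where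
  "aeq u v \<longleftrightarrow> (AE \<rho> in lebesgue. \<rho> \<in> {0<..<1} \<longrightarrow> u \<rho> = v \<rho>)"

definition abs_cont_on :: "real \<Rightarrow> real \<Rightarrow> (real \<Rightarrow> complex) \<Rightarrow> bool" where
  "abs_cont_on a b u \<longleftrightarrow> (\<forall>\<epsilon>>0. \<exists>\<delta>>0. \<forall>(m::nat) (x::nat\<Rightarrow>real) (y::nat\<Rightarrow>real).
      (\<forall>i<m. a \<le> x i \<and> x i \<le> y i \<and> y i \<le> b) \<and>
      (\<forall>i<m. \<forall>j<m. i \<noteq> j \<longrightarrow> y i \<le> x j \<or> y j \<le> x i) \<and>
      (\<Sum>i<m. y i - x i) < \<delta> \<longrightarrow> (\<Sum>i<m. cmod (u (y i) - u (x i))) < \<epsilon>)"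

definition AC_loc :: "(real \<Rightarrow> complex) \<Rightarrow> bool" where
  "AC_loc u \<longleftrightarrow> (\<forall>a b. 0 < a \<and> a \<le> b \<and> b < 1 \<longrightarrow> abs_cont_on a b u)"

definition ae_deriv :: "(real \<Rightarrow> complex) \<Rightarrow> (real \<Rightarrow> complex) \<Rightarrow> bool" where
  "ae_deriv u u' \<longleftrightarrow> (AE \<rho> in lebesgue. \<rho> \<in> {0<..<1} \<longrightarrow> (u has_vector_derivative u' \<rho>) (at \<rho>))"

(* graph of A: u \<in> D(A) and A u = f (in H, i.e. a.e.).
   u1 = u', v = rho^2 u' (AC_loc representative), v1 = (rho^2 u')' *)
definition A_graph :: "(real \<Rightarrow> complex) \<Rightarrow> (real \<Rightarrow> complex) \<Rightarrow> bool" where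
  "A_graph u f \<longleftrightarrow> inH u \<and> AC_loc u \<and>
     (\<exists>u1 v v1. ae_deriv u u1 \<and> AC_loc v \<and> aeq v (\<lambda>\<rho>. complex_of_real (\<rho>\<^sup>2) * u1 \<rho>) \<and>
        ae_deriv v v1 \<and>
        inH (\<lambda>\<rho>. (- v1 \<rho> + 2 * u \<rho>) / complex_of_real (wt \<rho>)) \<and>
        aeq f (\<lambda>\<rho>. (- v1 \<rho> + 2 * u \<rho>) / complex_of_real (wt \<rho>)))"

definition domA :: "(real \<Rightarrow> complex) set" where
  "domA = {u. \<exists>f. A_graph u f}"

definition gpot :: "(real \<Rightarrow> real) \<Rightarrow> real \<Rightarrow> real" where
  "gpot f \<rho> = (2 * (1 - \<rho>\<^sup>2) * cos (2 * f \<rho>) - \<rho>\<^sup>2 - 2 * (1 - \<rho>\<^sup>2)\<^sup>2) / \<rho>\<^sup>2"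

definition An_graph :: "(real \<Rightarrow> real) \<Rightarrow> (real \<Rightarrow> complex) \<Rightarrow> (real \<Rightarrow> complex) \<Rightarrow> bool" where
  "An_graph f u h \<longleftrightarrow> (\<exists>a. A_graph u a \<and> aeq h (\<lambda>\<rho>. a \<rho> + complex_of_real (gpot f \<rho>) * u \<rho>))"

definition shifted_graph :: "(real \<Rightarrow> real) \<Rightarrow> complex \<Rightarrow> (real \<Rightarrow> complex) \<Rightarrow> (real \<Rightarrow> complex) \<Rightarrow> bool" where
  "shifted_graph f z u h \<longleftrightarrow> (\<exists>a. An_graph f u a \<and> aeq h (\<lambda>\<rho>. z * u \<rho> - a \<rho>))"

definition inj_shift :: "(real \<Rightarrow> real) \<Rightarrow> complex \<Rightarrow> bool" where
  "inj_shift f z \<longleftrightarrow> (\<forall>u. shifted_graph f z u (\<lambda>_. 0) \<longrightarrow> aeq u (\<lambda>_. 0))"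

definition surj_shift :: "(real \<Rightarrow> real) \<Rightarrow> complex \<Rightarrow> bool" where
  "surj_shift f z \<longleftrightarrow> (\<forall>h. inH h \<longrightarrow> (\<exists>u. shifted_graph f z u h))"

definition dense_range_shift :: "(real \<Rightarrow> real) \<Rightarrow> complex \<Rightarrow> bool" where
  "dense_range_shift f z \<longleftrightarrow> (\<forall>h. inH h \<longrightarrow> (\<forall>\<epsilon>>0. \<exists>u k. shifted_graph f z u k \<and>
       normH (\<lambda>\<rho>. k \<rho> - h \<rho>) < \<epsilon>))"

definition point_spec :: "(real \<Rightarrow> real) \<Rightarrow> complex set" where
  "point_spec f = {z. \<not> inj_shift f z}"

definition cont_spec :: "(real \<Rightarrow> real) \<Rightarrow> complex set" where
  "cont_spec f = {z. inj_shift f z \<and> \<not> surj_shift f z \<and> dense_range_shift f z}"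

definition res_spec :: "(real \<Rightarrow> real) \<Rightarrow> complex set" where
  "res_spec f = {z. inj_shift f z \<and> \<not> dense_range_shift f z}"

definition real_analytic_01 :: "(real \<Rightarrow> real) \<Rightarrow> bool" where
  "real_analytic_01 f \<longleftrightarrow> (\<forall>x\<in>{0..1}. \<exists>r>0. \<exists>c::nat \<Rightarrow> real.
      \<forall>y\<in>{0..1}. \<bar>y - x\<bar> < r \<longrightarrow> (\<lambda>k. c k * (y - x) ^ k) sums f y)"

definition crosses_at :: "(real \<Rightarrow> real) \<Rightarrow> real \<Rightarrow> real \<Rightarrow> bool" where
  "crosses_at f c x \<longleftrightarrow> f x = c \<and> (\<exists>\<delta>>0. \<forall>y z. x - \<delta> < y \<and> y < x \<and> x < z \<and> z < x + \<delta> \<longrightarrow>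
      (f y - c) * (f z - c) < 0)"

definition is_profile :: "nat \<Rightarrow> (real \<Rightarrow> real) \<Rightarrow> bool" where
  "is_profile n f \<longleftrightarrow> real_analytic_01 f \<and>
     (\<forall>\<rho>\<in>{0<..<1}. (deriv ^^ 2) f \<rho> + 2 / \<rho> * deriv f \<rho>
          - sin (2 * f \<rho>) / (\<rho>\<^sup>2 * (1 - \<rho>\<^sup>2)) = 0) \<and>
     f 0 = 0 \<and> f 1 = pi / 2 \<and>
     finite {x\<in>{0..<1}. crosses_at f (pi/2) x} \<and> card {x\<in>{0..<1}. crosses_at f (pi/2) x} = n \<and>
     finite {\<rho>\<in>{0<..<1}. \<rho> * sqrt (1 - \<rho>\<^sup>2) * deriv f \<rho> = 0} \<and>
     card {\<rho>\<in>{0<..<1}. \<rho> * sqrt (1 - \<rho>\<^sup>2) * deriv f \<rho> = 0} = n"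

end

(*
  With r = tanh x and y x = sinh x * u (tanh x) the operator A_n becomes the Schroedinger operator -y'' + V y on the
  half line, V x = 2 cos (2 f (tanh x)) / (sinh x)^2, which behaves like 2/x^2 at 0 and decays at infinity. Square
  integrability at 0 singles out the regular solution y ~ x^2; square integrability at infinity singles out the
  solution y ~ exp (-k x), k^2 = -z, if Re k > 0, and excludes all solutions if Re k = 0. So z is an eigenvalue iff
  the regular solution is square integrable, which happens only for z < 0. If z is neither an eigenvalue nor in
  [0, oo), the Green kernel is dominated by exp (-Re k |x - t|) and Schur's test inverts z - A_n. For z >= 0 the range
  is proper but contains every compactly supported datum orthogonal to the regular solution, hence is dense.

  For z = 0 the regular solution is a multiple of (tanh x)^2 f'(tanh x), which has n zeros. By Sturm comparison
  the number of zeros of the regular solution increases strictly from one eigenvalue to a larger one, and it can jump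
  only at eigenvalues. As it vanishes for very negative z, there are exactly n negative eigenvalues.
*)
theory Submission
  imports Defs "HOL-Analysis.Analysis" "HOL-Real_Asymp.Real_Asymp"
begin

section \<open>Absolutely continuous functions\<close>

text \<open>The domain carries no boundary condition because both ends are of limit point type: the
  second solution at 0 behaves like 1 / x, and at infinity the solutions are close to exponentials,
  or to 1 and x if z = 0. The obstacle is that membership in the domain gives only an L2 bound on u
  and derivatives almost everywhere. Absolute continuity therefore has to be turned into integral
  identities, and the Wronskian at an end is evaluated by averaging the solution over intervals
  instead of by pointwise asymptotics. Self-adjointness and the spectral theorem are not invoked:
  surjectivity, its failure and density of the range are all read off from explicit solutions. These
  are constructed for complex z and, for the zero count, with Lipschitz dependence on real z. All of
  them come from one Volterra equation (p eta')' = p U eta with |p| nondecreasing. The weight is x^4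
  at the origin and, in the variable s = 1 / x, it is s^2 exp (-2 k / s) or 1 at infinity. The
  coefficient 2 of 1 / x^2 reflects f 0 = 0, that is cos (2 f) = 1 at the origin.\<close>

lemma sum_integral_disjoint_intervals_le:
  fixes x y :: "nat \<Rightarrow> real" and \<phi> :: "real \<Rightarrow> real"
  assumes int: "\<phi> integrable_on G" and nn: "\<And>t. t \<in> G \<Longrightarrow> 0 \<le> \<phi> t"
    and sub: "\<And>i. i < m \<Longrightarrow> x i \<le> y i \<and> {x i..y i} \<subseteq> G"
    and disj: "\<And>i j. i < m \<Longrightarrow> j < m \<Longrightarrow> i \<noteq> j \<Longrightarrow> y i \<le> x j \<or> y j \<le> x i"
  shows "(\<Sum>i<m. integral {x i..y i} \<phi>) \<le> integral G \<phi>"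
proof -
  have ii: "\<phi> integrable_on {x i..y i}" if "i < m" for i
    using integrable_on_subinterval[OF int] sub[OF that] by auto
  have h1: "((\<lambda>t. if t \<in> {x i<..<y i} then \<phi> t else 0) has_integral integral {x i..y i} \<phi>) UNIV"
    if "i < m" for i
    using integrable_integral[OF ii[OF that]]
    by (simp only: has_integral_restrict_UNIV has_integral_Icc_iff_Ioo)
  have h2: "((\<lambda>t. \<Sum>i<m. if t \<in> {x i<..<y i} then \<phi> t else 0) has_integral
      (\<Sum>i<m. integral {x i..y i} \<phi>)) UNIV"
    by (intro has_integral_sum h1) auto
  have h3: "((\<lambda>t. if t \<in> G then \<phi> t else 0) has_integral integral G \<phi>) UNIV"
    using integrable_integral[OF int] by (simp only: has_integral_restrict_UNIV)
  show ?thesis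
  proof (rule has_integral_le[OF h2 h3])
    fix t :: real
    show "(\<Sum>i<m. if t \<in> {x i<..<y i} then \<phi> t else 0) \<le> (if t \<in> G then \<phi> t else 0)"
    proof (cases "\<exists>j<m. t \<in> {x j<..<y j}")
      case True
      then obtain j where j: "j < m" "t \<in> {x j<..<y j}" by blast
      have eq: "t \<in> {x i<..<y i} \<longleftrightarrow> i = j" if "i < m" for i
        using disj[OF that j(1)] j(2) by (cases "i = j") auto
      have "(\<Sum>i<m. if t \<in> {x i<..<y i} then \<phi> t else 0) = (\<Sum>i<m. if i = j then \<phi> t else 0)"
        by (rule sum.cong) (use eq in auto)
      also have "\<dots> = \<phi> t" using j(1) by simp
      finally have eq: "(\<Sum>i<m. if t \<in> {x i<..<y i} then \<phi> t else 0) = \<phi> t" .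
      moreover have "t \<in> G" using sub[OF j(1)] j(2) by auto
      ultimately show ?thesis by simp
    next
      case False
      then have "(\<Sum>i<m. if t \<in> {x i<..<y i} then \<phi> t else 0) = 0"
        by (intro sum.neutral) auto
      then show ?thesis using nn by auto
    qed
  qed
qed

definition ordered_subintervals :: "real \<Rightarrow> real \<Rightarrow> nat \<Rightarrow> (nat \<Rightarrow> real) \<Rightarrow> (nat \<Rightarrow> real) \<Rightarrow> bool" where
  "ordered_subintervals a b m x y \<longleftrightarrow> (\<forall>i<m. a \<le> x i \<and> x i \<le> y i \<and> y i \<le> b) \<and>
     (\<forall>i<m. \<forall>j<m. i \<noteq> j \<longrightarrow> y i \<le> x j \<or> y j \<le> x i)"

lemma abs_cont_on_alt:
  "abs_cont_on a b u \<longleftrightarrow> (\<forall>e>0. \<exists>d>0. \<forall>m x y. ordered_subintervals a b m x y \<longrightarrow>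
     (\<Sum>i<m. y i - x i) < d \<longrightarrow> (\<Sum>i<m. cmod (u (y i) - u (x i))) < e)"
  unfolding abs_cont_on_def ordered_subintervals_def by (simp only: imp_conjL)

lemma abs_cont_onD:
  assumes "abs_cont_on a b u" "0 < e"
  obtains d where "d > 0" "\<And>m x y. ordered_subintervals a b m x y \<Longrightarrow>
     (\<Sum>i<m. y i - x i) < d \<Longrightarrow> (\<Sum>i<m. cmod (u (y i) - u (x i))) < e"
proof -
  from assms(1)[unfolded abs_cont_on_alt, rule_format, OF assms(2)] obtain d where
    "d > 0" "\<forall>m x y. ordered_subintervals a b m x y \<longrightarrow>
     (\<Sum>i<m. y i - x i) < d \<longrightarrow> (\<Sum>i<m. cmod (u (y i) - u (x i))) < e" by (elim exE conjE)
  then show ?thesis using that by simp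
qed

lemma abs_cont_onI:
  assumes "\<And>e. 0 < e \<Longrightarrow> \<exists>d>0. \<forall>m x y. ordered_subintervals a b m x y \<longrightarrow>
     (\<Sum>i<m. y i - x i) < d \<longrightarrow> (\<Sum>i<m. cmod (u (y i) - u (x i))) < e"
  shows "abs_cont_on a b u"
  unfolding abs_cont_on_alt by (intro allI impI assms)

text \<open>Fundamental theorem of calculus for absolutely continuous functions, proved directly
  with gauges. Away from N the gauge comes from differentiability. Tags in N are confined to an open
  superset G of N of small measure, so absolute continuity makes the increments of u over their
  intervals small in total.\<close>

lemma abs_cont_on_has_integral:
  fixes u g :: "real \<Rightarrow> complex"
  assumes ac: "abs_cont_on a b u" and ab: "a \<le> b" and N: "negligible N"
    and deriv: "\<And>x. x \<in> {a..b} \<Longrightarrow> x \<notin> N \<Longrightarrow> (u has_vector_derivative g x) (at x within {a..b})"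
  shows "(g has_integral (u b - u a)) {a..b}"
proof -
  \<comment> \<open>With the value 0 on N, an interval tagged in N contributes the bare increment of
    u to the error.\<close>
  define g0 where "g0 x = (if x \<in> N then 0 else g x)" for x
  have "(g0 has_integral (u b - u a)) (cbox a b)"
    unfolding has_integral
  proof (intro allI impI)
    fix e :: real assume e: "e > 0"
    from abs_cont_onD[OF ac half_gt_zero[OF e]] obtain \<delta> where d: "\<delta> > 0"
      and dac: "\<And>m x y. ordered_subintervals a b m x y \<Longrightarrow>
        (\<Sum>i<m. y i - x i) < \<delta> \<Longrightarrow> (\<Sum>i<m. cmod (u (y i) - u (x i))) < e / 2" by metis
    obtain G where G: "open G" "N \<subseteq> G" "G - N \<in> lmeasurable" "emeasure lebesgue (G - N) < ennreal \<delta>"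
      using sets_lebesgue_outer_open[OF negligible_imp_sets[OF N] d] by blast
    have Gm: "G \<in> lmeasurable"
    proof -
      have "(G - N) \<union> N \<in> lmeasurable"
        using G(3) negligible_imp_measurable[OF N] by (rule fmeasurable.Un)
      moreover have "(G - N) \<union> N = G" using G(2) by auto
      ultimately show ?thesis by simp
    qed
    have mG: "measure lebesgue G < \<delta>"
    proof -
      have "measure lebesgue G = measure lebesgue (G - N)"
        using measure_Diff_null_set[of G lebesgue N] N Gm
        by (simp add: negligible_iff_null_sets fmeasurableD)
      also have "\<dots> < \<delta>"
        using G(3,4) d by (simp add: emeasure_eq_measure2 ennreal_less_iff)
      finally show ?thesis .
    qed
    \<comment> \<open>The differentiability errors then sum to c * (b - a), at most e / 2; the
      summand 1 covers the case a = b.\<close>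
    define c where "c = e / (2 * (b - a + 1))"
    have c: "c > 0" using e ab by (simp add: c_def)
    have "\<exists>d>0. \<forall>y\<in>{a..b}. \<bar>y - x\<bar> < d \<longrightarrow> norm (u y - u x - (y - x) *\<^sub>R g x) \<le> c * \<bar>y - x\<bar>"
      if "x \<in> {a..b}" "x \<notin> N" for x
      using deriv[OF that] c unfolding has_vector_derivative_def has_derivative_within_alt real_norm_def
      by blast
    then obtain dd where dd: "\<And>x. x \<in> {a..b} \<Longrightarrow> x \<notin> N \<Longrightarrow> dd x > 0 \<and>
        (\<forall>y\<in>{a..b}. \<bar>y - x\<bar> < dd x \<longrightarrow> norm (u y - u x - (y - x) *\<^sub>R g x) \<le> c * \<bar>y - x\<bar>)"
      by metis
    define \<gamma> where "\<gamma> x = (if x \<in> N then G else if x \<in> {a..b} then ball x (dd x) else UNIV)" for x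
    have gauge: "gauge \<gamma>"
      using G dd by (auto simp: gauge_def \<gamma>_def)
    show "\<exists>\<gamma>. gauge \<gamma> \<and> (\<forall>\<D>. \<D> tagged_division_of cbox a b \<and> \<gamma> fine \<D> \<longrightarrow>
        norm ((\<Sum>(x, k)\<in>\<D>. measure lborel k *\<^sub>R g0 x) - (u b - u a)) < e)"
    proof (intro exI[of _ \<gamma>] conjI gauge allI impI, elim conjE)
      fix p assume p: "p tagged_division_of cbox a b" and fine: "\<gamma> fine p"
      have p': "p tagged_division_of {a..b}" using p by simp
      have fp: "finite p" using p by auto
      have KD: "\<exists>l r. K = {l..r} \<and> l \<le> r \<and> x \<in> {l..r} \<and> {l..r} \<subseteq> {a..b}" if xK: "(x, K) \<in> p" for x K
      proof -
        obtain l r where "K = cbox l r" using tagged_division_ofD(4)[OF p xK] by blast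
        then show ?thesis using tagged_division_ofD(2,3)[OF p xK] by auto
      qed
      \<comment> \<open>Degenerate intervals are left out: their error is 0, and one lying inside
        another interval would have disjoint interior without being ordered relative to it as
        absolute continuity demands.\<close>
      define B where "B = {q \<in> p. fst q \<in> N \<and> Inf (snd q) < Sup (snd q)}"
      define E where "E q = norm (measure lborel (snd q) *\<^sub>R g0 (fst q) - (u (Sup (snd q)) - u (Inf (snd q))))" for q :: "real \<times> real set"
      have "u b - u a = (\<Sum>(x,K)\<in>p. u (Sup K) - u (Inf K))"
        using additive_tagged_division_1[OF ab p', of u] by simp
      then have "norm ((\<Sum>(x, k)\<in>p. measure lborel k *\<^sub>R g0 x) - (u b - u a)) \<le> (\<Sum>q\<in>p. E q)"
        unfolding E_def by (simp add: sum_subtractf[symmetric] case_prod_unfold) (rule norm_sum)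
      also have "\<dots> = (\<Sum>q\<in>p - B. E q) + (\<Sum>q\<in>B. E q)"
        using fp by (intro sum.subset_diff) (auto simp: B_def)
      also have "(\<Sum>q\<in>p - B. E q) \<le> (\<Sum>q\<in>p - B. c * (Sup (snd q) - Inf (snd q)))"
      proof (rule sum_mono)
        fix q assume q: "q \<in> p - B"
        obtain x K where xK: "q = (x, K)" by force
        obtain l r where K: "K = {l..r}" "l \<le> r" "x \<in> {l..r}" "{l..r} \<subseteq> {a..b}"
          using KD q xK by blast
        show "E q \<le> c * (Sup (snd q) - Inf (snd q))"
        proof (cases "x \<in> N")
          case True
          then have "l = r" using q K unfolding B_def xK by auto
          then show ?thesis using K by (simp add: E_def xK)
        next
          case False
          have xab: "x \<in> {a..b}" using K by auto
          have "K \<subseteq> \<gamma> x" using fine q xK by (auto simp: fine_def)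
          then have sub: "{l..r} \<subseteq> ball x (dd x)" using False xab K by (simp add: \<gamma>_def)
          have "l \<in> ball x (dd x)" "r \<in> ball x (dd x)" using sub K(2) by auto
          then have "\<bar>l - x\<bar> < dd x" "\<bar>r - x\<bar> < dd x" by (auto simp: dist_real_def)
          moreover have lab: "l \<in> {a..b}" "r \<in> {a..b}" using K by auto
          ultimately have 1: "norm (u l - u x - (l - x) *\<^sub>R g x) \<le> c * \<bar>l - x\<bar>"
              "norm (u r - u x - (r - x) *\<^sub>R g x) \<le> c * \<bar>r - x\<bar>"
            using dd[OF xab False] lab by blast+
          have "measure lborel K *\<^sub>R g0 x - (u r - u l)
             = (u l - u x - (l - x) *\<^sub>R g x) - (u r - u x - (r - x) *\<^sub>R g x)"
            using K False by (simp add: g0_def algebra_simps)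
          then have "E q = norm ((u l - u x - (l - x) *\<^sub>R g x) - (u r - u x - (r - x) *\<^sub>R g x))"
            using K by (simp only: E_def xK fst_conv snd_conv cInf_atLeastAtMost cSup_atLeastAtMost)
          then have "E q \<le> c * \<bar>l - x\<bar> + c * \<bar>r - x\<bar>"
            using norm_triangle_ineq4[of "u l - u x - (l - x) *\<^sub>R g x" "u r - u x - (r - x) *\<^sub>R g x"] 1
            by linarith
          also have "\<dots> = c * (r - l)" using K by (simp add: algebra_simps)
          finally show ?thesis using K by (simp add: xK)
        qed
      qed
      also have "\<dots> \<le> (\<Sum>q\<in>p. c * (Sup (snd q) - Inf (snd q)))"
      proof (rule sum_mono2[OF fp])
        fix q assume "q \<in> p - (p - B)"
        then have "Inf (snd q) \<le> Sup (snd q)" by (auto simp: B_def)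
        then show "0 \<le> c * (Sup (snd q) - Inf (snd q))" using c by simp
      qed auto
      also have "\<dots> = c * (b - a)"
        using additive_tagged_division_1[OF ab p', of "\<lambda>x. x"]
        by (simp add: sum_distrib_left[symmetric] case_prod_unfold)
      also have "\<dots> \<le> e / 2"
        using e ab by (simp add: c_def divide_simps)
      also have "(\<Sum>q\<in>B. E q) < e / 2"
      proof -
        have fB: "finite B" using fp by (auto simp: B_def)
        obtain en where en: "bij_betw en {0..<card B} B" using ex_bij_betw_nat_finite[OF fB] by blast
        define m where "m = card B"
        have enB: "en i \<in> B" if "i < m" for i using en that by (auto simp: bij_betw_def m_def)
        define x where "x i = Inf (snd (en i))" for i
        define y where "y i = Sup (snd (en i))" for i
        have ivl: "snd (en i) = {x i..y i} \<and> x i < y i \<and> {x i..y i} \<subseteq> {a..b} \<inter> G \<and> E (en i) = cmod (u (y i) - u (x i))"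
          if "i < m" for i
        proof -
          have B: "en i \<in> p" "fst (en i) \<in> N" "x i < y i" using enB[OF that] by (auto simp: B_def x_def y_def)
          obtain l r where K: "snd (en i) = {l..r}" "l \<le> r" "{l..r} \<subseteq> {a..b}"
            using KD[of "fst (en i)" "snd (en i)"] B by auto
          have "snd (en i) \<subseteq> \<gamma> (fst (en i))" using fineD[OF fine, of "fst (en i)" "snd (en i)"] B(1) by simp
          then have "{l..r} \<subseteq> G" using B(2) K by (simp add: \<gamma>_def)
          moreover have "E (en i) = cmod (u (y i) - u (x i))"
            using B(2) by (simp add: E_def g0_def x_def y_def norm_minus_commute)
          ultimately show ?thesis using K B by (simp add: x_def y_def)
        qed
        have disj: "y i \<le> x j \<or> y j \<le> x i" if "i < m" "j < m" "i \<noteq> j" for i j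
        proof -
          have ne: "en i \<noteq> en j" using en that by (auto simp: bij_betw_def m_def inj_on_def)
          have "interior (snd (en i)) \<inter> interior (snd (en j)) = {}"
            using tagged_division_ofD(5)[OF p, of "fst (en i)" "snd (en i)" "fst (en j)" "snd (en j)"] ne
              enB[OF that(1)] enB[OF that(2)] by (auto simp: B_def)
          then have "{x i<..<y i} \<inter> {x j<..<y j} = {}" using ivl that by simp
          moreover have "max (x i) (x j) < min (y i) (y j) \<Longrightarrow>
              (max (x i) (x j) + min (y i) (y j)) / 2 \<in> {x i<..<y i} \<inter> {x j<..<y j}"
            by (auto simp: field_simps)
          ultimately have "\<not> max (x i) (x j) < min (y i) (y j)" by blast
          then show ?thesis using ivl[OF that(1)] ivl[OF that(2)] by (auto simp: max_def min_def split: if_splits)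
        qed
        have "(\<Sum>i<m. y i - x i) = (\<Sum>i<m. integral {x i..y i} (\<lambda>_. 1::real))"
          using ivl by (intro sum.cong) (auto simp: less_imp_le)
        also have "\<dots> \<le> integral G (\<lambda>_. 1)"
        proof (rule sum_integral_disjoint_intervals_le)
          show "(\<lambda>_. 1::real) integrable_on G" using Gm integrable_on_const by blast
        qed (use ivl disj in \<open>auto simp: less_imp_le\<close>)
        also have "\<dots> < \<delta>" using lmeasure_integral[OF Gm] mG by simp
        finally have "(\<Sum>i<m. cmod (u (y i) - u (x i))) < e / 2"
        proof (intro dac)
          have "\<forall>i<m. a \<le> x i \<and> x i \<le> y i \<and> y i \<le> b" using ivl by force
          then show "ordered_subintervals a b m x y" using disj unfolding ordered_subintervals_def by blast
        qed
        also have "(\<Sum>i<m. cmod (u (y i) - u (x i))) = (\<Sum>i<m. E (en i))"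
          using ivl by (intro sum.cong) auto
        also have "\<dots> = (\<Sum>q\<in>B. E q)"
          using sum.reindex_bij_betw[OF en, of E] by (simp add: m_def lessThan_atLeast0)
        finally show ?thesis .
      qed
      finally show "norm ((\<Sum>(x, k)\<in>p. measure lborel k *\<^sub>R g0 x) - (u b - u a)) < e" by simp
    qed
  qed
  then show ?thesis
    by (intro has_integral_spike[OF N, of _ g g0]) (auto simp: g0_def)
qed

section \<open>Almost everywhere derivatives and primitives\<close>

lemma ae_negligible:
  assumes "AE x in lebesgue. P x"
  obtains N where "negligible N" "\<And>x. x \<notin> N \<Longrightarrow> P x"
proof -
  obtain N where "{x \<in> space lebesgue. \<not> P x} \<subseteq> N" "N \<in> null_sets lebesgue"
    using AE_E[OF assms] by (metis null_setsI)
  then show ?thesis using that[of N] by (auto simp: negligible_iff_null_sets)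
qed

lemma negligible_AE:
  assumes "negligible N" "\<And>x. x \<notin> N \<Longrightarrow> P x"
  shows "AE x in lebesgue. P x"
  using assms by (intro AE_I'[of N]) (auto simp: negligible_iff_null_sets)

lemma AC_loc_has_integral:
  assumes "AC_loc u" "ae_deriv u g" "0 < a" "a \<le> b" "b < 1"
  shows "(g has_integral (u b - u a)) {a..b}"
proof -
  obtain N where N: "negligible N" "\<And>x. x \<notin> N \<Longrightarrow> x \<in> {0<..<1} \<longrightarrow> (u has_vector_derivative g x) (at x)"
    using ae_negligible[OF assms(2)[unfolded ae_deriv_def]] by metis
  show ?thesis
  proof (rule abs_cont_on_has_integral[OF _ assms(4) N(1)])
    show "abs_cont_on a b u" using assms by (auto simp: AC_loc_def)
    fix x assume "x \<in> {a..b}" "x \<notin> N"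
    then have "(u has_vector_derivative g x) (at x)"
      using N(2)[of x] assms(3,5) by auto
    then show "(u has_vector_derivative g x) (at x within {a..b})"
      by (rule has_vector_derivative_at_within)
  qed
qed

text \<open>Regularity bootstrap: u is the integral of its almost everywhere derivative, and the
  integral does not distinguish \<open>u1\<close> from its continuous version g. This turns the
  almost everywhere equations of the domain into classical ones.\<close>

lemma AC_loc_continuous_deriv:
  assumes "AC_loc u" "ae_deriv u u1" "aeq u1 g" "continuous_on {0<..<1} g" "\<rho> \<in> {0<..<1}"
  shows "(u has_vector_derivative g \<rho>) (at \<rho>)"
proof -
  define a where "a = \<rho> / 2"
  define b where "b = (\<rho> + 1) / 2"
  have ab: "0 < a" "a < \<rho>" "\<rho> < b" "b < 1" using assms by (auto simp: a_def b_def)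
  have "ae_deriv u g"
    using assms(2,3) unfolding ae_deriv_def aeq_def by eventually_elim auto
  then have I: "(g has_integral (u x - u a)) {a..x}" if "x \<in> {a..b}" for x
    using AC_loc_has_integral[OF assms(1), of g a x] ab that by auto
  have c: "continuous_on {a..b} g" by (rule continuous_on_subset[OF assms(4)]) (use ab in auto)
  have "((\<lambda>x. integral {a..x} g) has_vector_derivative g \<rho>) (at \<rho> within {a..b})"
    using c ab by (intro integral_has_vector_derivative) auto
  then have "((\<lambda>x. u a + integral {a..x} g) has_vector_derivative g \<rho>) (at \<rho> within {a..b})"
    by (auto intro!: derivative_eq_intros)
  then have "(u has_vector_derivative g \<rho>) (at \<rho> within {a..b})"
    by (rule has_vector_derivative_transform[rotated 2]) (use I[THEN integral_unique] ab in auto)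
  then show ?thesis
    using ab at_within_interior[of \<rho> "{a..b}"] by simp
qed

text \<open>Lebesgue differentiation of a primitive. \<open>integrable_ccontinuous_explicit\<close>
  concerns averages over {x..x + h}; averages to the left of x are obtained by applying it to the
  reflected function. The truncations \<open>f n\<close> exhaust the open interval, on which g is
  only locally integrable.\<close>

lemma ae_deriv_indefinite_integral:
  assumes I: "\<And>a b. 0 < a \<Longrightarrow> a \<le> b \<Longrightarrow> b < 1 \<Longrightarrow> (g has_integral (P b - P a)) {a..b}"
  shows "ae_deriv P g"
proof -
  define a where "a n = 1 / (real n + 2)" for n
  define b where "b n = 1 - a n" for n
  have ab: "0 < a n" "a n \<le> b n" "b n < 1" for n
    by (auto simp: a_def b_def field_simps)
  define f where "f n x = (if x \<in> {a n..b n} then g x else 0)" for n x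
  have fU: "f n integrable_on UNIV" for n
    using I[OF ab] unfolding f_def integrable_restrict_UNIV by blast
  have f1: "f n integrable_on cbox c d" for n c d
    using integrable_on_subcbox[OF fU] by auto
  have f2: "(\<lambda>x. f n (- x)) integrable_on cbox c d" for n :: nat and c d :: real
    using Henstock_Kurzweil_Integration.integrable_reflect_real[where f = "f n" and a = "-d" and b = "-c"] f1[of n "-d" "-c"] by simp
  have "\<exists>N. negligible N \<and> (\<forall>x e. x \<notin> N \<and> 0 < e \<longrightarrow> (\<exists>d>0. \<forall>h. 0 < h \<and> h < d \<longrightarrow>
      norm (integral (cbox x (x + h *\<^sub>R One)) (f n) /\<^sub>R h ^ DIM(real) - f n x) < e))" for n
    using integrable_ccontinuous_explicit[OF f1, of n] by metis
  then obtain N1 where N1: "\<And>n. negligible (N1 n)" "\<And>n x e. x \<notin> N1 n \<Longrightarrow> 0 < e \<Longrightarrow> \<exists>d>0. \<forall>h. 0 < h \<and> h < d \<longrightarrow>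
      norm (integral (cbox x (x + h *\<^sub>R One)) (f n) /\<^sub>R h ^ DIM(real) - f n x) < e" by metis
  have "\<exists>N. negligible N \<and> (\<forall>x e. x \<notin> N \<and> 0 < e \<longrightarrow> (\<exists>d>0. \<forall>h. 0 < h \<and> h < d \<longrightarrow>
      norm (integral (cbox x (x + h *\<^sub>R One)) (\<lambda>x. f n (- x)) /\<^sub>R h ^ DIM(real) - f n (- x)) < e))" for n
    using integrable_ccontinuous_explicit[OF f2, of n] by metis
  then obtain N2 where N2: "\<And>n. negligible (N2 n)" "\<And>n x e. x \<notin> N2 n \<Longrightarrow> 0 < e \<Longrightarrow> \<exists>d>0. \<forall>h. 0 < h \<and> h < d \<longrightarrow>
      norm (integral (cbox x (x + h *\<^sub>R One)) (\<lambda>x. f n (- x)) /\<^sub>R h ^ DIM(real) - f n (- x)) < e" by metis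
  define N where "N = (\<Union>n. N1 n) \<union> (\<Union>n. uminus ` N2 n)"
  have "negligible (uminus ` N2 n)" for n
    by (rule negligible_differentiable_image_negligible[OF _ N2(1)]) (auto intro!: derivative_intros simp: differentiable_on_def)
  then have N: "negligible N"
    unfolding N_def by (intro negligible_Un negligible_countable_Union) (auto simp: N1(1))
  have "(P has_vector_derivative g x) (at x)" if x: "x \<notin> N" "x \<in> {0<..<1}" for x
  proof -
    have "0 < min x (1 - x)" using x by simp
    then obtain n where "inverse (of_nat (Suc n)) < min x (1 - x)" using reals_Archimedean by blast
    then have n: "a n < x" "x < b n"
    proof -
      assume *: "inverse (of_nat (Suc n)) < min x (1 - x)"
      have "a n \<le> inverse (of_nat (Suc n))" by (auto simp: a_def field_simps)
      then show "a n < x" "x < b n" using * by (auto simp: b_def)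
    qed
    have fx: "f n x = g x" using n by (simp add: f_def)
    have fI: "integral {c..d} (f n) = P d - P c" if "a n \<le> c" "c \<le> d" "d \<le> b n" for c d
    proof -
      have "integral {c..d} (f n) = integral {c..d} g"
        by (rule integral_cong) (use that in \<open>auto simp: f_def\<close>)
      then show ?thesis using I[of c d] ab[of n] that by (simp add: integral_unique)
    qed
    show ?thesis unfolding has_vector_derivative_def has_derivative_within_alt
    proof (intro conjI allI impI)
      show "bounded_linear (\<lambda>h. h *\<^sub>R g x)" by (rule bounded_linear_scaleR_left)
      fix e :: real assume e: "e > 0"
      have x1: "x \<notin> N1 n" using x by (auto simp: N_def)
      have x2: "- x \<notin> N2 n"
      proof
        assume "- x \<in> N2 n"
        then have "- (- x) \<in> uminus ` N2 n" by (rule imageI)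
        then show False using x by (auto simp: N_def)
      qed
      from N1(2)[OF x1 e] N2(2)[OF x2 e] obtain d1 d2 where d: "d1 > 0" "d2 > 0"
        and d1: "\<And>h. 0 < h \<Longrightarrow> h < d1 \<Longrightarrow> norm (integral {x..x + h} (f n) /\<^sub>R h - g x) < e"
        and d2: "\<And>h. 0 < h \<Longrightarrow> h < d2 \<Longrightarrow> norm (integral {-x..-x + h} (\<lambda>x. f n (- x)) /\<^sub>R h - g x) < e"
        using fx by auto
      define d where "d = min (min d1 d2) (min (x - a n) (b n - x))"
      have "d > 0" using d n by (simp add: d_def)
      moreover have "norm (P y - P x - (y - x) *\<^sub>R g x) \<le> e * norm (y - x)" if y: "norm (y - x) < d" for y
      proof -
        consider "y = x" | "y > x" | "y < x" by linarith
        then show ?thesis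
        proof cases
          case 2
          define h where "h = y - x"
          have h: "0 < h" "h < d1" "y = x + h" "y \<le> b n" using 2 y by (auto simp: h_def d_def)
          have "P y - P x - (y - x) *\<^sub>R g x = h *\<^sub>R (integral {x..x + h} (f n) /\<^sub>R h - g x)"
            using h n fI[of x y] by (simp add: scaleR_diff_right)
          then show ?thesis using d1[OF h(1,2)] h by (simp add: mult.commute less_imp_le)
        next
          case 3
          define h where "h = x - y"
          have h: "0 < h" "h < d2" "y = x - h" "a n \<le> y" using 3 y by (auto simp: h_def d_def)
          have "integral {-x..-x + h} (\<lambda>x. f n (- x)) = integral {y..x} (f n)"
            using Henstock_Kurzweil_Integration.integral_reflect_real[where f = "f n" and a = y and b = x] h by simp
          then have "P y - P x - (y - x) *\<^sub>R g x = - (h *\<^sub>R (integral {-x..-x + h} (\<lambda>x. f n (- x)) /\<^sub>R h - g x))"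
            using h n fI[of y x] by (simp add: scaleR_diff_right)
          then show ?thesis using d2[OF h(1,2)] h by (simp add: mult.commute)
        qed auto
      qed
      ultimately show "\<exists>d>0. \<forall>y\<in>UNIV. norm (y - x) < d \<longrightarrow> norm (P y - P x - (y - x) *\<^sub>R g x) \<le> e * norm (y - x)"
        by blast
    qed
  qed
  then show ?thesis unfolding ae_deriv_def by (intro negligible_AE[OF N]) auto
qed

text \<open>Local square integrability is what weighted L2 data provide. The inequality |g| <= K +
  |g|^2 / K bounds the variation over small intervals by K times their total length plus M / K,
  where K is fixed before the length.\<close>

lemma AC_loc_indefinite_integral:
  assumes I: "\<And>a b. 0 < a \<Longrightarrow> a \<le> b \<Longrightarrow> b < 1 \<Longrightarrow> (g has_integral (P b - P a)) {a..b}"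
    and sq: "\<And>a b. 0 < a \<Longrightarrow> a \<le> b \<Longrightarrow> b < 1 \<Longrightarrow> (\<lambda>x. (cmod (g x))\<^sup>2) integrable_on {a..b}"
  shows "AC_loc P"
  unfolding AC_loc_def
proof (intro allI impI abs_cont_onI, elim conjE)
  fix a b e :: real
  assume ab: "0 < a" "a \<le> b" "b < 1" and e: "e > 0"
  define M where "M = integral {a..b} (\<lambda>x. (cmod (g x))\<^sup>2)"
  have M: "M \<ge> 0" unfolding M_def by (intro integral_nonneg sq ab) auto
  \<comment> \<open>This gives M / K < e / 2, with M + 1 covering M = 0; total length below e / (2 *
    K) yields the other half.\<close>
  define K where "K = 4 * (M + 1) / e"
  have K: "K > 0" using M e by (simp add: K_def)
  have MK: "M / K < e / 2" using M e by (simp add: K_def divide_simps)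
  have "(\<Sum>i<m. cmod (P (y i) - P (x i))) < e"
    if os: "ordered_subintervals a b m x y"
      and len: "(\<Sum>i<m. y i - x i) < e / (2 * K)" for m :: nat and x y :: "nat \<Rightarrow> real"
  proof -
    have xy: "\<forall>i<m. a \<le> x i \<and> x i \<le> y i \<and> y i \<le> b"
      and disj: "\<forall>i<m. \<forall>j<m. i \<noteq> j \<longrightarrow> y i \<le> x j \<or> y j \<le> x i"
      using os by (auto simp: ordered_subintervals_def)
    have "cmod (P (y i) - P (x i)) \<le> K * (y i - x i) + integral {x i..y i} (\<lambda>x. (cmod (g x))\<^sup>2) / K"
      if "i < m" for i
    proof -
      have i: "0 < x i" "x i \<le> y i" "y i < 1" using xy that ab by force+
      have "cmod (integral {x i..y i} g) \<le> integral {x i..y i} (\<lambda>x. K + (cmod (g x))\<^sup>2 / K)"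
      proof (rule integral_norm_bound_integral)
        show "g integrable_on {x i..y i}" using I[OF i] by blast
        show "(\<lambda>x. K + (cmod (g x))\<^sup>2 / K) integrable_on {x i..y i}"
          using sq[OF i] by (intro integrable_add integrable_const_ivl integrable_on_divide)
        fix t
        have "2 * K * cmod (g t) \<le> K\<^sup>2 + (cmod (g t))\<^sup>2"
          using sum_squares_bound[of K "cmod (g t)"] by simp
        moreover have "0 \<le> K * cmod (g t)" using K by simp
        ultimately have "K * cmod (g t) \<le> K\<^sup>2 + (cmod (g t))\<^sup>2" by linarith
        then show "cmod (g t) \<le> K + (cmod (g t))\<^sup>2 / K"
          using K by (simp add: field_simps power2_eq_square)
      qed
      also have "\<dots> = K * (y i - x i) + integral {x i..y i} (\<lambda>x. (cmod (g x))\<^sup>2) / K"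
        using sq[OF i] i by (subst integral_add) (auto intro: integrable_on_divide)
      finally show ?thesis using integral_unique[OF I[OF i]] by simp
    qed
    then have "(\<Sum>i<m. cmod (P (y i) - P (x i))) \<le>
        (\<Sum>i<m. K * (y i - x i) + integral {x i..y i} (\<lambda>x. (cmod (g x))\<^sup>2) / K)"
      by (intro sum_mono) auto
    also have "\<dots> = K * (\<Sum>i<m. y i - x i) + (\<Sum>i<m. integral {x i..y i} (\<lambda>x. (cmod (g x))\<^sup>2)) / K"
      by (simp add: sum.distrib sum_distrib_left sum_divide_distrib)
    finally have 1: "(\<Sum>i<m. cmod (P (y i) - P (x i))) \<le>
      K * (\<Sum>i<m. y i - x i) + (\<Sum>i<m. integral {x i..y i} (\<lambda>x. (cmod (g x))\<^sup>2)) / K" .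
    have "(\<Sum>i<m. integral {x i..y i} (\<lambda>x. (cmod (g x))\<^sup>2)) \<le> M"
      unfolding M_def by (rule sum_integral_disjoint_intervals_le) (use sq ab xy disj in auto)
    then have "(\<Sum>i<m. integral {x i..y i} (\<lambda>x. (cmod (g x))\<^sup>2)) / K \<le> M / K"
      using K by (intro divide_right_mono) auto
    moreover have "K * (\<Sum>i<m. y i - x i) < e / 2" using len K by (simp add: field_simps)
    ultimately show ?thesis using 1 MK by linarith
  qed
  moreover have "e / (2 * K) > 0" using e K by simp
  ultimately show "\<exists>d>0. \<forall>m x y. ordered_subintervals a b m x y \<longrightarrow>
     (\<Sum>i<m. y i - x i) < d \<longrightarrow> (\<Sum>i<m. cmod (P (y i) - P (x i))) < e"
    by blast
qed

lemma AC_loc_continuous_derivI: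
  assumes d: "\<And>x. x \<in> {0<..<1} \<Longrightarrow> (u has_vector_derivative g x) (at x)" and c: "continuous_on {0<..<1} g"
  shows "AC_loc u"
proof (rule AC_loc_indefinite_integral)
  fix a b :: real assume ab: "0 < a" "a \<le> b" "b < 1"
  show "(g has_integral u b - u a) {a..b}"
    by (rule fundamental_theorem_of_calculus)
      (use ab in \<open>auto intro: has_vector_derivative_at_within[OF d]\<close>)
  show "(\<lambda>x. (cmod (g x))\<^sup>2) integrable_on {a..b}"
    by (intro integrable_continuous_real continuous_intros continuous_on_subset[OF c]) (use ab in auto)
qed

section \<open>Continuity, sums and products of absolutely continuous functions\<close>

lemma abs_cont_on_continuous:
  assumes "abs_cont_on a b u"
  shows "continuous_on {a..b} u"
  unfolding continuous_on_iff
proof (intro ballI allI impI)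
  fix x e :: real assume x: "x \<in> {a..b}" and e: "e > 0"
  obtain d where d: "d > 0" and D: "\<And>m x y. ordered_subintervals a b m x y \<Longrightarrow>
     (\<Sum>i<m. y i - x i) < d \<Longrightarrow> (\<Sum>i<m. cmod (u (y i) - u (x i))) < e"
    using abs_cont_onD[OF assms e] by metis
  have "dist (u x') (u x) < e" if x': "x' \<in> {a..b}" "dist x' x < d" for x'
    using D[of "Suc 0" "\<lambda>_. min x x'" "\<lambda>_. max x x'"] x x'
    by (cases "x \<le> x'") (auto simp: dist_norm norm_minus_commute min_def max_def ordered_subintervals_def)
  then show "\<exists>d>0. \<forall>x'\<in>{a..b}. dist x' x < d \<longrightarrow> dist (u x') (u x) < e" using d by blast
qed

lemma AC_loc_continuous:
  assumes "AC_loc u"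
  shows "continuous_on {0<..<1} u"
proof (rule continuous_at_imp_continuous_on, rule)
  fix x :: real assume x: "x \<in> {0<..<1}"
  have "continuous_on {x/2..(x+1)/2} u"
    using assms x by (intro abs_cont_on_continuous) (auto simp: AC_loc_def)
  then have "continuous_on {x/2<..<(x+1)/2} u" by (rule continuous_on_subset) auto
  then show "isCont u x" using x by (simp add: continuous_on_eq_continuous_at)
qed

lemma AC_loc_add:
  assumes "AC_loc u" "AC_loc v"
  shows "AC_loc (\<lambda>x. u x + v x)"
  unfolding AC_loc_def
proof (intro allI impI abs_cont_onI, elim conjE)
  fix a b e :: real assume ab: "0 < a" "a \<le> b" "b < 1" and e: "e > 0"
  let ?Q = "\<lambda>w d e. \<forall>m x y. ordered_subintervals a b m x y \<longrightarrow>
     (\<Sum>i<m. y i - x i) < d \<longrightarrow> (\<Sum>i<m. cmod (w (y i) - w (x i))) < e"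
  have "abs_cont_on a b u" "abs_cont_on a b v"
    using assms[unfolded AC_loc_def] ab by blast+
  then have "\<exists>d>0. ?Q u d (e/2)" "\<exists>d>0. ?Q v d (e/2)"
    unfolding abs_cont_on_alt using half_gt_zero[OF e] by blast+
  then obtain d1 d2 where d: "d1 > 0" "?Q u d1 (e/2)" "d2 > 0" "?Q v d2 (e/2)" by blast
  have "?Q (\<lambda>x. u x + v x) (min d1 d2) e"
  proof (intro allI impI)
    fix m x y assume A: "ordered_subintervals a b m x y" "(\<Sum>i<m. y i - x i) < min d1 d2"
    have "(\<Sum>i<m. cmod (u (y i) + v (y i) - (u (x i) + v (x i)))) \<le>
        (\<Sum>i<m. cmod (u (y i) - u (x i)) + cmod (v (y i) - v (x i)))"
      by (intro sum_mono) (metis add_diff_add norm_triangle_ineq)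
    also have "\<dots> < e"
      using d(2)[rule_format, of m x y] d(4)[rule_format, of m x y] A by (simp add: sum.distrib)
    finally show "(\<Sum>i<m. cmod (u (y i) + v (y i) - (u (x i) + v (x i)))) < e" .
  qed
  then show "\<exists>d>0. ?Q (\<lambda>x. u x + v x) d e" using d by (intro exI[of _ "min d1 d2"]) auto
qed

lemma AC_loc_mult:
  assumes u: "AC_loc u" and v: "AC_loc v"
  shows "AC_loc (\<lambda>x. u x * v x)"
  unfolding AC_loc_def
proof (intro allI impI abs_cont_onI, elim conjE)
  fix a b e :: real assume ab: "0 < a" "a \<le> b" "b < 1" and e: "e > 0"
  let ?Q = "\<lambda>w d e. \<forall>m x y. ordered_subintervals a b m x y \<longrightarrow>
     (\<Sum>i<m. y i - x i) < d \<longrightarrow> (\<Sum>i<m. cmod (w (y i) - w (x i))) < e"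
  have "bounded (u ` {a..b})" "bounded (v ` {a..b})"
    using ab by (auto intro!: compact_imp_bounded compact_continuous_image
        continuous_on_subset[OF AC_loc_continuous[OF u]] continuous_on_subset[OF AC_loc_continuous[OF v]])
  then obtain Mu Mv where M: "Mu > 0" "Mv > 0" "\<And>x. x \<in> {a..b} \<Longrightarrow> cmod (u x) \<le> Mu" "\<And>x. x \<in> {a..b} \<Longrightarrow> cmod (v x) \<le> Mv"
    unfolding bounded_pos by auto
  define e' where "e' = e / (Mu + Mv)"
  have e': "e' > 0" "(Mu + Mv) * e' = e" using e M by (auto simp: e'_def)
  have "abs_cont_on a b u" "abs_cont_on a b v"
    using assms[unfolded AC_loc_def] ab by blast+
  then have "\<exists>d>0. ?Q u d e'" "\<exists>d>0. ?Q v d e'"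
    unfolding abs_cont_on_alt using e'(1) by blast+
  then obtain d1 d2 where d: "d1 > 0" "?Q u d1 e'" "d2 > 0" "?Q v d2 e'" by blast
  have "?Q (\<lambda>x. u x * v x) (min d1 d2) e"
  proof (intro allI impI)
    fix m x y assume A: "ordered_subintervals a b m x y" "(\<Sum>i<m. y i - x i) < min d1 d2"
    have "(\<Sum>i<m. cmod (u (y i) * v (y i) - u (x i) * v (x i))) \<le>
        (\<Sum>i<m. Mu * cmod (v (y i) - v (x i)) + Mv * cmod (u (y i) - u (x i)))"
    proof (rule sum_mono)
      fix i assume "i \<in> {..<m}"
      then have i: "x i \<in> {a..b}" "y i \<in> {a..b}" using A(1) by (auto simp: ordered_subintervals_def intro: order_trans)
      have "u (y i) * v (y i) - u (x i) * v (x i) = u (y i) * (v (y i) - v (x i)) + v (x i) * (u (y i) - u (x i))"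
        by (simp add: algebra_simps)
      then show "cmod (u (y i) * v (y i) - u (x i) * v (x i)) \<le> Mu * cmod (v (y i) - v (x i)) + Mv * cmod (u (y i) - u (x i))"
        using M i by (auto simp: norm_mult intro!: norm_triangle_le add_mono mult_right_mono)
    qed
    also have "\<dots> = Mu * (\<Sum>i<m. cmod (v (y i) - v (x i))) + Mv * (\<Sum>i<m. cmod (u (y i) - u (x i)))"
      by (simp add: sum.distrib sum_distrib_left)
    also have "\<dots> < Mu * e' + Mv * e'"
      using d(2)[rule_format, of m x y] d(4)[rule_format, of m x y] A M by (intro add_strict_mono mult_strict_left_mono) auto
    also have "\<dots> = e" using e'(2) by (simp add: algebra_simps)
    finally show "(\<Sum>i<m. cmod (u (y i) * v (y i) - u (x i) * v (x i))) < e" .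
  qed
  then show "\<exists>d>0. ?Q (\<lambda>x. u x * v x) d e" using d by (intro exI[of _ "min d1 d2"]) auto
qed

section \<open>Volterra equations\<close>

text \<open>Monotonicity of the norm of p makes the division by p harmless although p may vanish at
  0: the inner integral over {0..s} is at most the norm of \<open>p s\<close> times the integral of
  the other factor. The number m is the rate of the exponential weight in which functions are
  measured.\<close>

locale volterra_weight =
  fixes p :: "real \<Rightarrow> 'a::{real_normed_field,banach}" and m :: real
  assumes p_cont: "continuous_on {0<..} p" and p_nz: "\<And>x. 0 < x \<Longrightarrow> p x \<noteq> 0"
    and p_mono: "\<And>s t. 0 \<le> t \<Longrightarrow> t \<le> s \<Longrightarrow> norm (p t) \<le> norm (p s)" and m_pos: "0 < m"
begin

definition D :: "(real \<Rightarrow> 'a) \<Rightarrow> real \<Rightarrow> 'a" where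
  "D k s = integral {0..s} (\<lambda>t. p t * k t) / p s"

definition J :: "(real \<Rightarrow> 'a) \<Rightarrow> real \<Rightarrow> 'a" where
  "J k x = integral {0..x} (D k)"

text \<open>Continuity is demanded of the product with p only, because the coefficients of the
  applications are bounded near 0 but may be discontinuous at 0 itself.\<close>

definition adm :: "real \<Rightarrow> (real \<Rightarrow> 'a) \<Rightarrow> bool" where
  "adm M k \<longleftrightarrow> continuous_on {0..} (\<lambda>t. p t * k t) \<and> (\<forall>t\<ge>0. norm (k t) \<le> M * exp (m * t))"

lemma adm_nonneg:
  assumes "adm M k"
  shows "0 \<le> M"
proof -
  have "norm (k 0) \<le> M * exp (m * 0)" using assms unfolding adm_def by blast
  then have "norm (k 0) \<le> M" by simp
  then show ?thesis using norm_ge_zero order_trans by blast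
qed

lemma adm_integrable: "adm M k \<Longrightarrow> (\<lambda>t. p t * k t) integrable_on {0..s}"
  unfolding adm_def by (intro integrable_continuous_real) (auto elim: continuous_on_subset)

lemma exp_has_integral: "0 \<le> s \<Longrightarrow> ((\<lambda>t. c * exp (m * t)) has_integral (c / m * (exp (m * s) - 1))) {0..s}"
proof -
  assume s: "0 \<le> s"
  have "((\<lambda>t. c * exp (m * t)) has_integral (c / m * exp (m * s) - c / m * exp (m * 0))) {0..s}"
    by (rule fundamental_theorem_of_calculus[OF s])
      (use m_pos in \<open>auto intro!: derivative_eq_intros simp: has_real_derivative_iff_has_vector_derivative[symmetric]\<close>)
  then show ?thesis by (simp add: algebra_simps)
qed

lemma D_bound:
  assumes k: "adm M k" and s: "0 \<le> s"
  shows "norm (D k s) \<le> M / m * (exp (m * s) - 1)"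
proof (cases "s = 0")
  case True
  then show ?thesis by (simp add: D_def)
next
  case False
  then have s0: "s > 0" using s by simp
  have "norm (integral {0..s} (\<lambda>t. p t * k t)) \<le> integral {0..s} (\<lambda>t. norm (p s) * M * exp (m * t))"
  proof (rule integral_norm_bound_integral)
    show "(\<lambda>t. norm (p s) * M * exp (m * t)) integrable_on {0..s}" using exp_has_integral[OF s] by blast
    fix t assume t: "t \<in> {0..s}"
    have "norm (p t * k t) = norm (p t) * norm (k t)" by (rule norm_mult)
    also have "\<dots> \<le> norm (p s) * (M * exp (m * t))"
      using t k p_mono unfolding adm_def by (intro mult_mono) auto
    finally show "norm (p t * k t) \<le> norm (p s) * M * exp (m * t)" by (simp add: mult.assoc)
  qed (rule adm_integrable[OF k])
  also have "\<dots> = norm (p s) * (M / m * (exp (m * s) - 1))"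
    using integral_unique[OF exp_has_integral[OF s]] by simp
  finally show ?thesis using p_nz[OF s0] by (simp add: D_def norm_divide divide_le_eq mult.commute)
qed

lemma exp_minus_one_le: "0 \<le> s \<Longrightarrow> (exp (m * s) - 1) / m \<le> s * exp (m * s)"
proof -
  assume s: "0 \<le> s"
  have "1 - m * s \<le> exp (- (m * s))" using exp_ge_add_one_self[of "- (m * s)"] by simp
  then have "(1 - m * s) * exp (m * s) \<le> exp (- (m * s)) * exp (m * s)" by (intro mult_right_mono) auto
  then show ?thesis using m_pos by (simp add: exp_minus field_simps)
qed

lemma D_bound_linear:
  assumes k: "adm M k" and s: "0 \<le> s"
  shows "norm (D k s) \<le> M * s * exp (m * s)"
proof -
  have "M * ((exp (m * s) - 1) / m) \<le> M * (s * exp (m * s))"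
    by (intro mult_left_mono exp_minus_one_le s adm_nonneg[OF k])
  then show ?thesis using D_bound[OF k s] by (simp add: mult.assoc)
qed

lemma D_bound_exp:
  assumes k: "adm M k" and s: "0 \<le> s"
  shows "norm (D k s) \<le> M / m * exp (m * s)"
proof -
  have "M / m * (exp (m * s) - 1) \<le> M / m * exp (m * s)"
    using m_pos adm_nonneg[OF k] by (intro mult_left_mono) auto
  then show ?thesis using D_bound[OF k s] by linarith
qed

lemma inner_integral_deriv:
  assumes k: "adm M k" and x: "0 < x"
  shows "((\<lambda>s. integral {0..s} (\<lambda>t. p t * k t)) has_vector_derivative (p x * k x)) (at x)"
proof -
  have "((\<lambda>s. integral {0..s} (\<lambda>t. p t * k t)) has_vector_derivative (p x * k x)) (at x within {0..x+1})"
    using k x unfolding adm_def by (intro integral_has_vector_derivative) (auto elim: continuous_on_subset)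
  then show ?thesis using x at_within_interior[of x "{0..x+1}"] by simp
qed

lemma D_cont:
  assumes k: "adm M k"
  shows "continuous_on {0..} (D k)"
  unfolding continuous_on_eq_continuous_within
proof
  fix s :: real assume "s \<in> {0..}"
  then consider "s > 0" | "s = 0" by force
  then show "continuous (at s within {0..}) (D k)"
  proof cases
    case 1
    have "isCont (\<lambda>s. integral {0..s} (\<lambda>t. p t * k t)) s"
      using inner_integral_deriv[OF k 1] has_vector_derivative_continuous by blast
    moreover have "isCont p s" using p_cont 1 by (simp add: continuous_on_eq_continuous_at)
    ultimately have "isCont (D k) s" unfolding D_def using p_nz[OF 1] by (intro continuous_divide) auto
    then show ?thesis by (rule continuous_at_imp_continuous_at_within)
  next
    case 2
    have "((\<lambda>s. M * s * exp (m * s)) \<longlongrightarrow> M * 0 * exp (m * 0)) (at 0 within {0..})"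
      by (intro tendsto_intros)
    then have "((\<lambda>s. M * s * exp (m * s)) \<longlongrightarrow> 0) (at 0 within {0..})" by simp
    moreover have "\<forall>\<^sub>F s in at 0 within {0..}. norm (D k s) \<le> M * s * exp (m * s)"
      unfolding eventually_at_filter by (rule always_eventually) (use D_bound_linear[OF k] in simp)
    ultimately have "(D k \<longlongrightarrow> 0) (at 0 within {0..})"
      by (rule Lim_null_comparison[rotated])
    then show ?thesis using 2 by (simp add: continuous_within D_def)
  qed
qed

lemma D_integrable: "adm M k \<Longrightarrow> D k integrable_on {0..x}"
  by (intro integrable_continuous_real) (auto elim: continuous_on_subset dest!: D_cont)

lemma J_deriv_within:
  assumes k: "adm M k" and x: "0 \<le> x"
  shows "(J k has_vector_derivative D k x) (at x within {0..})"
proof -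
  have "(J k has_vector_derivative D k x) (at x within {0..x+1})"
    using D_cont[OF k] x unfolding J_def[abs_def]
    by (intro integral_has_vector_derivative) (auto elim: continuous_on_subset)
  moreover have "at x within {0..x+1} = at x within {0..}"
    by (rule at_within_nhd[of x "{..<x+1}"]) (use x in auto)
  ultimately show ?thesis by simp
qed

lemma J_deriv:
  assumes k: "adm M k" and x: "0 < x"
  shows "(J k has_vector_derivative D k x) (at x)"
  using J_deriv_within[OF k, of x] x at_within_interior[of x "{0..}"] by simp

lemma J_cont: "adm M k \<Longrightarrow> continuous_on {0..} (J k)"
  by (auto simp: continuous_on_eq_continuous_within intro: has_vector_derivative_continuous J_deriv_within)

lemma J_bound:
  assumes k: "adm M k" and x: "0 \<le> x"
  shows "norm (J k x) \<le> M / m\<^sup>2 * exp (m * x)"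
proof -
  have "norm (J k x) \<le> integral {0..x} (\<lambda>t. M / m * exp (m * t))"
    unfolding J_def
  proof (rule integral_norm_bound_integral[OF D_integrable[OF k]])
    show "(\<lambda>t. M / m * exp (m * t)) integrable_on {0..x}" using exp_has_integral[OF x] by blast
  qed (use D_bound_exp[OF k] in auto)
  also have "\<dots> = M / m / m * (exp (m * x) - 1)" using integral_unique[OF exp_has_integral[OF x]] by simp
  also have "\<dots> \<le> M / m / m * exp (m * x)"
    using m_pos adm_nonneg[OF k] by (intro mult_left_mono) auto
  finally show ?thesis by (simp add: power2_eq_square)
qed

lemma D_diff:
  assumes "adm M k" "adm M' k'"
  shows "D (\<lambda>t. k t - k' t) s = D k s - D k' s"
  using adm_integrable[OF assms(1)] adm_integrable[OF assms(2)]
  by (simp add: D_def right_diff_distrib integral_diff diff_divide_distrib)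

lemma J_diff:
  assumes "adm M k" "adm M' k'"
  shows "J (\<lambda>t. k t - k' t) x = J k x - J k' x"
  unfolding J_def D_diff[OF assms, abs_def]
  by (rule integral_diff) (use assms D_integrable in blast)+

end

text \<open>The condition \<open>2 * Q \<le> m\<^sup>2\<close> makes the integral operator a
  contraction with factor 1 / 2: the two integrations of exp (m t) gain 1 / m^2 and the coefficient
  costs Q.\<close>

locale volterra = volterra_weight +
  fixes U :: "real \<Rightarrow> 'a" and Q :: real
  assumes pU: "continuous_on {0..} (\<lambda>x. p x * U x)"
    and U_bound: "\<And>t. 0 \<le> t \<Longrightarrow> norm (U t) \<le> Q" and m_Q: "2 * Q \<le> m\<^sup>2"
begin

lemma Q_nonneg: "0 \<le> Q"
  using U_bound[of 0] norm_ge_zero[of "U 0"] by linarith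

lemma adm_U:
  assumes "continuous_on {0..} h" "\<And>t. 0 \<le> t \<Longrightarrow> norm (h t) \<le> M * exp (m * t)"
  shows "adm (Q * M) (\<lambda>t. U t * h t)"
  unfolding adm_def
proof (intro conjI allI impI)
  have "continuous_on {0..} (\<lambda>t. (p t * U t) * h t)" using pU assms(1) by (rule continuous_on_mult)
  then show "continuous_on {0..} (\<lambda>t. p t * (U t * h t))" by (simp add: mult.assoc)
  fix t :: real assume t: "0 \<le> t"
  have "norm (U t) * norm (h t) \<le> Q * (M * exp (m * t))"
    using U_bound[OF t] assms(2)[OF t] Q_nonneg by (intro mult_mono) auto
  then show "norm (U t * h t) \<le> Q * M * exp (m * t)" by (simp add: norm_mult mult.assoc)
qed

text \<open>This integral equation encodes \<open>(p \<eta>')' = p U \<eta>\<close> with \<open>\<eta> 0 = 1\<close>.\<close>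

definition is_volterra_solution :: "(real \<Rightarrow> 'a) \<Rightarrow> bool" where
  "is_volterra_solution \<eta> \<longleftrightarrow> continuous_on {0..} \<eta> \<and> (\<forall>x\<ge>0. norm (\<eta> x) \<le> 2 * exp (m * x)) \<and>
     (\<forall>x\<ge>0. \<eta> x = 1 + J (\<lambda>t. U t * \<eta> t) x)"

text \<open>Banach fixed point for z, where the solution is exp (m t) z t. The space
  \<open>bcontfun\<close> consists of functions on the whole line, hence the constant extension
  through \<open>max 0 x\<close>. The fixed point satisfies norm z <= 1 + norm z / 2, the origin of
  the factor 2 in the bound on the solution.\<close>

lemma volterra_solution_exists: "\<exists>\<eta>. is_volterra_solution \<eta>"
proof -
  define H where "H z t = exp (m * t) *\<^sub>R apply_bcontfun z t" for z :: "real \<Rightarrow>\<^sub>C 'a" and t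
  define F where "F z x = exp (- m * max 0 x) *\<^sub>R (1 + J (\<lambda>t. U t * H z t) (max 0 x))" for z :: "real \<Rightarrow>\<^sub>C 'a" and x
  have ac: "continuous_on A (apply_bcontfun z)" for z :: "real \<Rightarrow>\<^sub>C 'a" and A
    using apply_bcontfun[of z] unfolding bcontfun_def by (auto intro: continuous_on_subset)
  have Hc: "continuous_on {0..} (H z)" for z
    unfolding H_def by (intro continuous_intros ac)
  have Hb: "norm (H z t) \<le> norm z * exp (m * t)" for z t
    using norm_bounded[of z t] by (simp add: H_def mult.commute mult_left_mono)
  have adm: "adm (Q * norm z) (\<lambda>t. U t * H z t)" for z by (rule adm_U[OF Hc Hb])
  have Qm: "Q / m\<^sup>2 \<le> 1 / 2" using m_Q m_pos by (simp add: field_simps)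
  have Jb: "norm (exp (- m * x) *\<^sub>R J (\<lambda>t. U t * H z t) x) \<le> norm z / 2" if "0 \<le> x" for z x
  proof -
    have "norm (exp (- m * x) *\<^sub>R J (\<lambda>t. U t * H z t) x) \<le> exp (- m * x) * (Q * norm z / m\<^sup>2 * exp (m * x))"
      unfolding norm_scaleR abs_exp_cancel by (intro mult_left_mono J_bound[OF adm that]) auto
    also have "\<dots> = Q / m\<^sup>2 * norm z" by (simp add: exp_minus field_simps)
    also have "\<dots> \<le> 1 / 2 * norm z" by (intro mult_right_mono Qm) auto
    finally show ?thesis by simp
  qed
  have FB: "F z \<in> bcontfun" for z
  proof (rule bcontfun_normI)
    have "continuous_on UNIV (\<lambda>x. J (\<lambda>t. U t * H z t) (max 0 x))"
      by (rule continuous_on_compose2[OF J_cont[OF adm]]) (auto intro!: continuous_intros)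
    then show "continuous_on UNIV (F z)" unfolding F_def by (intro continuous_intros)
    fix x
    have "norm (F z x) \<le> norm (exp (- m * max 0 x) *\<^sub>R (1::'a)) + norm (exp (- m * max 0 x) *\<^sub>R J (\<lambda>t. U t * H z t) (max 0 x))"
      unfolding F_def scaleR_add_right by (rule norm_triangle_ineq)
    also have "\<dots> \<le> 1 + norm z / 2"
      using Jb[of "max 0 x" z] m_pos by (intro add_mono) auto
    finally show "norm (F z x) \<le> 1 + norm z / 2" .
  qed
  define T where "T z = Bcontfun (F z)" for z
  have T: "apply_bcontfun (T z) = F z" for z
    unfolding T_def by (rule Bcontfun_inverse[OF FB])
  have Hd: "H z t - H w t = H (z - w) t" for z w t
    by (simp add: H_def minus_bcontfun.rep_eq scaleR_diff_right)
  have lip: "dist (T z) (T w) \<le> 1 / 2 * dist z w" for z w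
  proof (rule dist_bound)
    fix x
    have "(\<lambda>t. U t * H z t - U t * H w t) = (\<lambda>t. U t * H (z - w) t)"
      by (simp add: Hd[symmetric] right_diff_distrib)
    then have "J (\<lambda>t. U t * H z t) y - J (\<lambda>t. U t * H w t) y = J (\<lambda>t. U t * H (z - w) t) y" for y
      using J_diff[OF adm adm, of z w y] by simp
    then have "F z x - F w x = exp (- m * max 0 x) *\<^sub>R J (\<lambda>t. U t * H (z - w) t) (max 0 x)"
      unfolding F_def by (simp add: scaleR_diff_right[symmetric])
    then show "dist (apply_bcontfun (T z) x) (apply_bcontfun (T w) x) \<le> 1 / 2 * dist z w"
      using Jb[of "max 0 x" "z - w"] by (simp add: T dist_norm)
  qed
  have "\<exists>!z. T z = z" by (rule banach_fix_type[of "1/2"]) (use lip in auto)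
  then obtain z where z: "T z = z" by (elim ex1E)
  have zx: "apply_bcontfun z x = exp (- m * x) *\<^sub>R (1 + J (\<lambda>t. U t * H z t) x)" if "0 \<le> x" for x
    using T[of z] that unfolding z by (simp add: F_def fun_eq_iff max_def)
  have "norm (apply_bcontfun z x) \<le> 1 + norm z / 2" for x
  proof -
    have "norm (F z x) \<le> norm (exp (- m * max 0 x) *\<^sub>R (1::'a)) + norm (exp (- m * max 0 x) *\<^sub>R J (\<lambda>t. U t * H z t) (max 0 x))"
      unfolding F_def scaleR_add_right by (rule norm_triangle_ineq)
    also have "\<dots> \<le> 1 + norm z / 2"
      using Jb[of "max 0 x" z] m_pos by (intro add_mono) auto
    finally show ?thesis using T[of z] z by simp
  qed
  then have "norm z \<le> 1 + norm z / 2" by (rule norm_bound)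
  then have nz: "norm z \<le> 2" by simp
  have "is_volterra_solution (H z)"
    unfolding is_volterra_solution_def
  proof (intro conjI allI impI)
    fix x :: real assume x: "0 \<le> x"
    show "norm (H z x) \<le> 2 * exp (m * x)"
      using Hb[of z x] nz by (meson exp_ge_zero mult_right_mono order_trans)
    show "H z x = 1 + J (\<lambda>t. U t * H z t) x"
      unfolding H_def[of z x] zx[OF x] by (simp add: exp_minus)
  qed (rule Hc)
  then show ?thesis by blast
qed

context
  fixes \<eta> assumes \<eta>: "is_volterra_solution \<eta>"
begin

lemma vs_adm: "adm (2 * Q) (\<lambda>t. U t * \<eta> t)"
  by (subst mult.commute, rule adm_U) (use \<eta> in \<open>auto simp: is_volterra_solution_def\<close>)

lemma vs_zero: "\<eta> 0 = 1"
  using \<eta> by (simp add: is_volterra_solution_def J_def)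

lemma vs_cont: "continuous_on {0..} \<eta>"
  using \<eta> by (simp add: is_volterra_solution_def)

lemma vs_deriv:
  assumes x: "0 < x"
  shows "(\<eta> has_vector_derivative D (\<lambda>t. U t * \<eta> t) x) (at x)"
proof -
  have "((\<lambda>x. 1 + J (\<lambda>t. U t * \<eta> t) x) has_vector_derivative D (\<lambda>t. U t * \<eta> t) x) (at x)"
    using J_deriv[OF vs_adm x] by (auto intro!: derivative_eq_intros)
  then show ?thesis
  proof (rule has_vector_derivative_transform_within_open)
    show "1 + J (\<lambda>t. U t * \<eta> t) y = \<eta> y" if "y \<in> {0<..}" for y
      using \<eta> that unfolding is_volterra_solution_def by auto
  qed (use x in auto)
qed

lemma vs_weighted_deriv:
  assumes x: "0 < x"
  shows "((\<lambda>x. p x * D (\<lambda>t. U t * \<eta> t) x) has_vector_derivative p x * (U x * \<eta> x)) (at x)"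
proof (rule has_vector_derivative_transform_within_open[OF inner_integral_deriv[OF vs_adm x]])
  show "integral {0..y} (\<lambda>t. p t * (U t * \<eta> t)) = p y * D (\<lambda>t. U t * \<eta> t) y" if "y \<in> {0<..}" for y
    using p_nz that by (simp add: D_def)
qed (use x in auto)

end

end

text \<open>The difference of the solutions is \<open>J k\<close> with k = U1 (eta1 - eta2) + (U1 -
  U2) eta2. Its weighted supremum S therefore satisfies m^2 S <= Q S + 2 eps, and 2 Q <= m^2 absorbs
  half of the left side. This is the source of the continuity in the spectral parameter.\<close>

lemma (in volterra_weight) volterra_solution_dependence:
  assumes U1: "volterra p m U1 Q" and U2: "volterra p m U2 Q"
    and s1: "volterra.is_volterra_solution p m U1 \<eta>1" and s2: "volterra.is_volterra_solution p m U2 \<eta>2"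
    and e: "\<And>t. 0 \<le> t \<Longrightarrow> norm (U1 t - U2 t) \<le> \<epsilon>" and x: "0 \<le> x"
  shows "norm (\<eta>1 x - \<eta>2 x) \<le> 4 * \<epsilon> / m\<^sup>2 * exp (m * x)"
    and "norm (D (\<lambda>t. U1 t * \<eta>1 t) x - D (\<lambda>t. U2 t * \<eta>2 t) x) \<le> 4 * \<epsilon> * x * exp (m * x)"
proof -
  interpret A: volterra p m U1 Q by (rule U1)
  interpret B: volterra p m U2 Q by (rule U2)
  define S where "S = (SUP x\<in>{0..}. norm (\<eta>1 x - \<eta>2 x) * exp (- m * x))"
  have b1: "norm (\<eta>1 x) \<le> 2 * exp (m * x)" and b2: "norm (\<eta>2 x) \<le> 2 * exp (m * x)" if "0 \<le> x" for x
    using s1 s2 that unfolding A.is_volterra_solution_def B.is_volterra_solution_def by auto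
  have e0: "0 \<le> \<epsilon>" using e[of 0] norm_ge_zero order_trans by blast
  have bdd: "bdd_above ((\<lambda>x. norm (\<eta>1 x - \<eta>2 x) * exp (- m * x)) ` {0..})"
  proof (rule bdd_aboveI2)
    fix x :: real assume "x \<in> {0..}"
    then have "norm (\<eta>1 x - \<eta>2 x) \<le> 4 * exp (m * x)"
      using norm_triangle_ineq4[of "\<eta>1 x" "\<eta>2 x"] b1[of x] b2[of x] by simp
    then show "norm (\<eta>1 x - \<eta>2 x) * exp (- m * x) \<le> 4" by (simp add: exp_minus field_simps)
  qed
  have S: "norm (\<eta>1 x - \<eta>2 x) \<le> S * exp (m * x)" if "0 \<le> x" for x
  proof -
    have "norm (\<eta>1 x - \<eta>2 x) * exp (- m * x) \<le> S"
      unfolding S_def by (rule cSUP_upper[OF _ bdd]) (use that in auto)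
    then show ?thesis by (simp add: exp_minus field_simps)
  qed
  define k where "k t = U1 t * \<eta>1 t - U2 t * \<eta>2 t" for t
  have a1: "adm (2 * Q) (\<lambda>t. U1 t * \<eta>1 t)" and a2: "adm (2 * Q) (\<lambda>t. U2 t * \<eta>2 t)"
    using A.vs_adm[OF s1] B.vs_adm[OF s2] by auto
  have k: "adm (Q * S + 2 * \<epsilon>) k"
    unfolding adm_def
  proof (intro conjI allI impI)
    have "continuous_on {0..} (\<lambda>t. p t * (U1 t * \<eta>1 t) - p t * (U2 t * \<eta>2 t))"
      using a1 a2 unfolding adm_def by (intro continuous_on_diff) auto
    then show "continuous_on {0..} (\<lambda>t. p t * k t)" by (simp add: k_def right_diff_distrib)
    fix t :: real assume t: "0 \<le> t"
    have "k t = U1 t * (\<eta>1 t - \<eta>2 t) + (U1 t - U2 t) * \<eta>2 t" by (simp add: k_def algebra_simps)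
    then have "norm (k t) \<le> norm (U1 t) * norm (\<eta>1 t - \<eta>2 t) + norm (U1 t - U2 t) * norm (\<eta>2 t)"
      by (metis norm_mult norm_triangle_ineq)
    also have "\<dots> \<le> Q * (S * exp (m * t)) + \<epsilon> * (2 * exp (m * t))"
      using A.U_bound[OF t] S[OF t] e[OF t] b2[OF t] A.Q_nonneg e0 by (intro add_mono mult_mono) auto
    finally show "norm (k t) \<le> (Q * S + 2 * \<epsilon>) * exp (m * t)" by (simp add: algebra_simps)
  qed
  have d: "\<eta>1 x - \<eta>2 x = J k x" if "0 \<le> x" for x
    using s1 s2 that J_diff[OF a1 a2, of x] unfolding A.is_volterra_solution_def B.is_volterra_solution_def k_def
    by simp
  have m2: "m\<^sup>2 > 0" using m_pos by simp
  have "S \<le> (Q * S + 2 * \<epsilon>) / m\<^sup>2"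
    unfolding S_def
  proof (rule cSUP_least)
    fix x :: real assume "x \<in> {0..}"
    then show "norm (\<eta>1 x - \<eta>2 x) * exp (- m * x) \<le> (Q * (SUP x\<in>{0..}. norm (\<eta>1 x - \<eta>2 x) * exp (- m * x)) + 2 * \<epsilon>) / m\<^sup>2"
      unfolding S_def[symmetric] using J_bound[OF k, of x] d[of x] by (simp add: exp_minus field_simps)
  qed auto
  then have "m\<^sup>2 * S \<le> Q * S + 2 * \<epsilon>" using m2 by (simp add: field_simps)
  moreover have "2 * (Q * S) \<le> m\<^sup>2 * S"
  proof -
    have "norm (\<eta>1 0 - \<eta>2 0) \<le> S" using S[of 0] by simp
    then have "S \<ge> 0" using norm_ge_zero order_trans by blast
    then have "(2 * Q) * S \<le> m\<^sup>2 * S" using A.m_Q by (intro mult_right_mono) auto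
    then show ?thesis by simp
  qed
  ultimately have QS: "Q * S + 2 * \<epsilon> \<le> 4 * \<epsilon>" "m\<^sup>2 * S \<le> 4 * \<epsilon>" by linarith+
  then have "S \<le> 4 * \<epsilon> / m\<^sup>2" using m2 by (simp add: field_simps)
  then show "norm (\<eta>1 x - \<eta>2 x) \<le> 4 * \<epsilon> / m\<^sup>2 * exp (m * x)"
    using S[OF x] by (meson exp_ge_zero mult_right_mono order_trans)
  have "norm (D k x) \<le> (Q * S + 2 * \<epsilon>) * x * exp (m * x)" by (rule D_bound_linear[OF k x])
  also have "\<dots> \<le> 4 * \<epsilon> * x * exp (m * x)" using QS x by (intro mult_right_mono) auto
  finally show "norm (D (\<lambda>t. U1 t * \<eta>1 t) x - D (\<lambda>t. U2 t * \<eta>2 t) x) \<le> 4 * \<epsilon> * x * exp (m * x)"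
    using D_diff[OF a1 a2, of x] by (simp add: k_def[abs_def])
qed

section \<open>Second order linear equations\<close>

definition ode_solution :: "real set \<Rightarrow> (real \<Rightarrow> 'a) \<Rightarrow> (real \<Rightarrow> 'a::real_normed_field) \<Rightarrow> (real \<Rightarrow> 'a) \<Rightarrow> bool" where
  "ode_solution S q y y1 \<longleftrightarrow> (\<forall>x\<in>S. (y has_vector_derivative y1 x) (at x) \<and>
     (y1 has_vector_derivative q x * y x) (at x))"

lemma ode_solutionD:
  assumes "ode_solution S q y y1" "x \<in> S"
  shows "(y has_vector_derivative y1 x) (at x)" "(y1 has_vector_derivative q x * y x) (at x)"
  using assms by (auto simp: ode_solution_def)

lemma ode_solution_continuous:
  assumes "ode_solution S q y y1"
  shows "continuous_on S y" "continuous_on S y1"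
  using assms by (auto simp: ode_solution_def intro!: continuous_at_imp_continuous_on
      intro: has_vector_derivative_continuous)

lemma ode_solution_subset: "ode_solution S q y y1 \<Longrightarrow> T \<subseteq> S \<Longrightarrow> ode_solution T q y y1"
  by (auto simp: ode_solution_def)

section \<open>Wronskians and uniqueness\<close>

lemma ode_solution_lincomb:
  assumes "ode_solution S q y y1" "ode_solution S q s s1"
  shows "ode_solution S q (\<lambda>x. a * y x + b * s x) (\<lambda>x. a * y1 x + b * s1 x)"
  using assms unfolding ode_solution_def
  by (auto intro!: derivative_eq_intros simp: algebra_simps)

lemma wronskian_constant:
  fixes y s :: "real \<Rightarrow> 'a::real_normed_field"
  assumes "ode_solution S q y y1" "ode_solution S q s s1" "convex S"
  obtains W where "\<And>x. x \<in> S \<Longrightarrow> y x * s1 x - y1 x * s x = W"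
proof -
  have "\<exists>W. \<forall>x\<in>S. y x * s1 x - y1 x * s x = W"
  proof (rule has_derivative_zero_constant[OF assms(3)])
    fix x assume x: "x \<in> S"
    have "((\<lambda>x. y x * s1 x - y1 x * s x) has_vector_derivative
        ((y x * (q x * s x) + y1 x * s1 x) - (y1 x * s1 x + (q x * y x) * s x))) (at x)"
      by (intro derivative_intros ode_solutionD[OF assms(1) x] ode_solutionD[OF assms(2) x])
    then have "((\<lambda>x. y x * s1 x - y1 x * s x) has_vector_derivative 0) (at x)"
      by (simp add: algebra_simps)
    then show "((\<lambda>x. y x * s1 x - y1 x * s x) has_derivative (\<lambda>h. 0)) (at x within S)"
      by (auto simp: has_vector_derivative_def intro: has_derivative_at_withinI)
  qed
  then show ?thesis using that by blast
qed

text \<open>The expression on the left is the derivative of the energy |y|^2 + |y1|^2 along a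
  solution of y'' = q y. Using \<open>inner\<close> covers real and complex solutions at
  once.\<close>

lemma ode_energy_bound:
  fixes y y1 q :: "'a::{real_normed_field,real_inner}"
  assumes "norm q \<le> Q"
  shows "\<bar>2 * inner y y1 + 2 * inner y1 (q * y)\<bar> \<le> (1 + Q) * (inner y y + inner y1 y1)"
proof -
  have 0: "2 * norm y * norm y1 \<le> inner y y + inner y1 y1"
    using sum_squares_bound[of "norm y" "norm y1"] by (simp add: power2_norm_eq_inner)
  have Q: "0 \<le> Q" using assms norm_ge_zero order_trans by blast
  have 1: "\<bar>inner y y1\<bar> \<le> norm y * norm y1" by (rule Cauchy_Schwarz_ineq2)
  have "\<bar>inner y1 (q * y)\<bar> \<le> norm y1 * norm (q * y)" by (rule Cauchy_Schwarz_ineq2)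
  also have "\<dots> \<le> norm y1 * (Q * norm y)" using assms by (intro mult_left_mono) (auto simp: norm_mult mult_right_mono)
  finally have 2: "2 * \<bar>inner y1 (q * y)\<bar> \<le> Q * (2 * norm y * norm y1)" by (simp add: mult.commute mult.left_commute)
  also have "\<dots> \<le> Q * (inner y y + inner y1 y1)" by (rule mult_left_mono[OF 0 Q])
  finally have 3: "2 * \<bar>inner y1 (q * y)\<bar> \<le> Q * (inner y y + inner y1 y1)" .
  have "(1 + Q) * (inner y y + inner y1 y1) = (inner y y + inner y1 y1) + Q * (inner y y + inner y1 y1)"
    by (simp only: distrib_right mult_1)
  then show ?thesis using 0 1 3 by linarith
qed

text \<open>Gronwall in both directions: the energy times exp (- (1 + Q) t) is nonincreasing and
  times exp ((1 + Q) t) nondecreasing, so its zero at a spreads to the right and to the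
  left.\<close>

lemma ode_solution_unique:
  fixes y :: "real \<Rightarrow> 'a::{real_normed_field,real_inner}"
  assumes sol: "ode_solution S q y y1" and S: "is_interval S" and q: "continuous_on S q"
    and a: "a \<in> S" "y a = 0" "y1 a = 0" and x: "x \<in> S"
  shows "y x = 0 \<and> y1 x = 0"
proof -
  define l where "l = min a x"
  define r where "r = max a x"
  have lr: "{l..r} \<subseteq> S"
  proof -
    have "l \<in> S" "r \<in> S" using a x by (auto simp: l_def r_def min_def max_def)
    from mem_is_interval_1_I[OF S this] show ?thesis by auto
  qed
  have "bounded (q ` {l..r})"
    by (intro compact_imp_bounded compact_continuous_image continuous_on_subset[OF q lr]) auto
  then obtain Q where Q: "\<And>t. t \<in> {l..r} \<Longrightarrow> norm (q t) \<le> Q"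
    unfolding bounded_iff by blast
  define E where "E t = inner (y t) (y t) + inner (y1 t) (y1 t)" for t
  define E' where "E' t = 2 * inner (y t) (y1 t) + 2 * inner (y1 t) (q t * y t)" for t
  have dE: "(E has_real_derivative E' t) (at t)" if "t \<in> {l..r}" for t
  proof -
    have tS: "t \<in> S" using that lr by auto
    note d = ode_solutionD[OF sol tS, unfolded has_vector_derivative_def]
    have "(E has_derivative (\<lambda>h. (inner (y t) (h *\<^sub>R y1 t) + inner (h *\<^sub>R y1 t) (y t)) +
        (inner (y1 t) (h *\<^sub>R (q t * y t)) + inner (h *\<^sub>R (q t * y t)) (y1 t)))) (at t)"
      unfolding E_def by (intro has_derivative_add has_derivative_inner d)
    moreover have "(\<lambda>h. (inner (y t) (h *\<^sub>R y1 t) + inner (h *\<^sub>R y1 t) (y t)) +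
        (inner (y1 t) (h *\<^sub>R (q t * y t)) + inner (h *\<^sub>R (q t * y t)) (y1 t))) = (*) (E' t)"
      by (auto simp: E'_def fun_eq_iff inner_commute algebra_simps)
    ultimately show ?thesis by (simp add: has_field_derivative_def)
  qed
  have E'b: "\<bar>E' t\<bar> \<le> (1 + Q) * E t" if "t \<in> {l..r}" for t
    unfolding E_def E'_def by (rule ode_energy_bound[OF Q[OF that]])
  have Ea: "E a = 0" using a by (simp add: E_def)
  have "E x \<le> 0"
  proof (cases "a \<le> x")
    case True
    have "E x * exp (- (1 + Q) * x) \<le> E a * exp (- (1 + Q) * a)"
    proof (rule DERIV_nonpos_imp_nonincreasing[OF True, where f = "\<lambda>t. E t * exp (- (1 + Q) * t)"])
      fix t assume t: "a \<le> t" "t \<le> x"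
      then have tl: "t \<in> {l..r}" by (auto simp: l_def r_def)
      have "((\<lambda>t. E t * exp (- (1 + Q) * t)) has_real_derivative (E' t - (1 + Q) * E t) * exp (- (1 + Q) * t)) (at t)"
        by (auto intro!: derivative_eq_intros dE[OF tl] simp: algebra_simps)
      moreover have "(E' t - (1 + Q) * E t) * exp (- (1 + Q) * t) \<le> 0"
        using E'b[OF tl] by (intro mult_nonpos_nonneg) auto
      ultimately show "\<exists>d. ((\<lambda>t. E t * exp (- (1 + Q) * t)) has_real_derivative d) (at t) \<and> d \<le> 0" by blast
    qed
    then show ?thesis using Ea by (simp add: mult_le_0_iff not_le[symmetric])
  next
    case False
    have "E x * exp ((1 + Q) * x) \<le> E a * exp ((1 + Q) * a)"
    proof (rule DERIV_nonneg_imp_nondecreasing[where f = "\<lambda>t. E t * exp ((1 + Q) * t)"])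
      show "x \<le> a" using False by simp
      fix t assume t: "x \<le> t" "t \<le> a"
      then have tl: "t \<in> {l..r}" by (auto simp: l_def r_def)
      have "((\<lambda>t. E t * exp ((1 + Q) * t)) has_real_derivative (E' t + (1 + Q) * E t) * exp ((1 + Q) * t)) (at t)"
        by (auto intro!: derivative_eq_intros dE[OF tl] simp: algebra_simps)
      moreover have "0 \<le> (E' t + (1 + Q) * E t) * exp ((1 + Q) * t)"
        using E'b[OF tl] by (intro mult_nonneg_nonneg) auto
      ultimately show "\<exists>d. ((\<lambda>t. E t * exp ((1 + Q) * t)) has_real_derivative d) (at t) \<and> 0 \<le> d" by blast
    qed
    then show ?thesis using Ea by (simp add: mult_le_0_iff not_le[symmetric])
  qed
  moreover have "0 \<le> inner (y x) (y x)" "0 \<le> inner (y1 x) (y1 x)" by auto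
  ultimately have "inner (y x) (y x) = 0" "inner (y1 x) (y1 x) = 0" unfolding E_def by linarith+
  then show ?thesis by simp
qed

lemma wronskian_zero_imp_proportional:
  fixes y s :: "real \<Rightarrow> 'a::{real_normed_field,real_inner}"
  assumes y: "ode_solution S q y y1" and s: "ode_solution S q s s1" and S: "is_interval S" and q: "continuous_on S q"
    and a: "a \<in> S" "s a \<noteq> 0 \<or> s1 a \<noteq> 0" and W: "y a * s1 a - y1 a * s a = 0"
  obtains c where "\<And>x. x \<in> S \<Longrightarrow> y x = c * s x \<and> y1 x = c * s1 x"
proof -
  have "\<exists>c. y a = c * s a \<and> y1 a = c * s1 a"
  proof (cases "s a = 0")
    case True
    then show ?thesis using a W by (intro exI[of _ "y1 a / s1 a"]) auto
  next
    case False
    then show ?thesis using W by (intro exI[of _ "y a / s a"]) (auto simp: field_simps)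
  qed
  then obtain c where c: "y a = c * s a" "y1 a = c * s1 a" by blast
  have "ode_solution S q (\<lambda>x. 1 * y x + (- c) * s x) (\<lambda>x. 1 * y1 x + (- c) * s1 x)"
    by (rule ode_solution_lincomb[OF y s])
  then have "1 * y x + (- c) * s x = 0 \<and> 1 * y1 x + (- c) * s1 x = 0" if "x \<in> S" for x
    by (rule ode_solution_unique[OF _ S q a(1) _ _ that]) (use c in auto)
  then show ?thesis using that[of c] by (auto simp: add_eq_0_iff2)
qed

text \<open>Integrating the Wronskian against a bump \<open>(t - a) (b - t)\<close> moves the derivative off \<open>y\<close>, so that
  only the \<open>L\<^sup>1\<close> norm of \<open>y\<close> is needed.\<close>

lemma wronskian_average_bound:
  fixes y s :: "real \<Rightarrow> 'a::{real_normed_field,banach}"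
  assumes ab: "a < b"
    and dy: "\<And>x. x \<in> {a..b} \<Longrightarrow> (y has_vector_derivative y1 x) (at x)"
    and ds: "\<And>x. x \<in> {a..b} \<Longrightarrow> (s has_vector_derivative s1 x) (at x)"
    and s1c: "continuous_on {a..b} s1"
    and W: "\<And>x. x \<in> {a..b} \<Longrightarrow> y x * s1 x - y1 x * s x = W"
    and b1: "\<And>x. x \<in> {a..b} \<Longrightarrow> norm (s x) \<le> K0" and b2: "\<And>x. x \<in> {a..b} \<Longrightarrow> norm (s1 x) \<le> K1"
  shows "norm W * (b - a) ^ 3 \<le> 6 * (K1 * (b - a)\<^sup>2 + K0 * (b - a)) * integral {a..b} (\<lambda>x. norm (y x))"
proof -
  define \<phi> where "\<phi> t = (t - a) * (b - t)" for t
  define F where "F t = \<phi> t *\<^sub>R (y t * s t)" for t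
  define G where "G t = y t * ((2 * \<phi> t) *\<^sub>R s1 t + (a + b - 2 * t) *\<^sub>R s t)" for t
  have yc: "continuous_on {a..b} y" and sc: "continuous_on {a..b} s"
    using has_vector_derivative_continuous[OF dy] has_vector_derivative_continuous[OF ds]
    by (auto intro!: continuous_at_imp_continuous_on)
  have dF: "(F has_vector_derivative (G t - \<phi> t *\<^sub>R W)) (at t within {a..b})" if t: "t \<in> {a..b}" for t
  proof -
    have d\<phi>: "(\<phi> has_real_derivative (a + b - 2 * t)) (at t)"
      unfolding \<phi>_def by (auto intro!: derivative_eq_intros)
    have "(F has_vector_derivative (\<phi> t *\<^sub>R (y t * s1 t + y1 t * s t) + (a + b - 2 * t) *\<^sub>R (y t * s t))) (at t)"
      unfolding F_def by (intro derivative_intros d\<phi> dy[OF t] ds[OF t])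
    \<comment> \<open>The constant Wronskian replaces y1 * s by y * s1 - W, which removes the
      uncontrolled derivative of y.\<close>
    moreover have "\<phi> t *\<^sub>R (y t * s1 t + y1 t * s t) + (a + b - 2 * t) *\<^sub>R (y t * s t) = G t - \<phi> t *\<^sub>R W"
      unfolding W[OF t, symmetric] G_def by (simp add: scaleR_conv_of_real algebra_simps)
    ultimately show ?thesis by (simp add: has_vector_derivative_at_within)
  qed
  have "((\<lambda>t. G t - \<phi> t *\<^sub>R W) has_integral (F b - F a)) {a..b}"
    by (rule fundamental_theorem_of_calculus) (use ab dF in auto)
  then have 1: "((\<lambda>t. G t - \<phi> t *\<^sub>R W) has_integral 0) {a..b}" by (simp add: F_def \<phi>_def)
  have "(\<phi> has_integral (((b - a) * (b - a)\<^sup>2 / 2 - (b - a) ^ 3 / 3) - ((b - a) * (a - a)\<^sup>2 / 2 - (a - a) ^ 3 / 3))) {a..b}"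
  proof (rule fundamental_theorem_of_calculus)
    fix t
    have "((\<lambda>t. (b - a) * (t - a)\<^sup>2 / 2 - (t - a) ^ 3 / 3) has_real_derivative \<phi> t) (at t within {a..b})"
      unfolding \<phi>_def by (auto intro!: derivative_eq_intros simp: power2_eq_square field_simps)
    then show "((\<lambda>t. (b - a) * (t - a)\<^sup>2 / 2 - (t - a) ^ 3 / 3) has_vector_derivative \<phi> t) (at t within {a..b})"
      by (simp add: has_real_derivative_iff_has_vector_derivative)
  qed (use ab in auto)
  then have "(\<phi> has_integral (b - a) ^ 3 / 6) {a..b}"
    by (simp add: power3_eq_cube power2_eq_square field_simps)
  then have "((\<lambda>t. \<phi> t *\<^sub>R W) has_integral ((b - a) ^ 3 / 6) *\<^sub>R W) {a..b}" by (rule has_integral_scaleR_left)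
  from has_integral_add[OF 1 this] have G: "(G has_integral ((b - a) ^ 3 / 6) *\<^sub>R W) {a..b}" by simp
  have "norm (integral {a..b} G) \<le> integral {a..b} (\<lambda>t. (K1 * (b - a)\<^sup>2 + K0 * (b - a)) * norm (y t))"
  proof (rule integral_norm_bound_integral)
    show "G integrable_on {a..b}" using G by blast
    show "(\<lambda>t. (K1 * (b - a)\<^sup>2 + K0 * (b - a)) * norm (y t)) integrable_on {a..b}"
      by (intro integrable_continuous_real continuous_intros yc)
    fix t assume t: "t \<in> {a..b}"
    have K0: "0 \<le> K0" "0 \<le> K1" using b1[OF t] b2[OF t] norm_ge_zero order_trans by blast+
    have p0: "0 \<le> \<phi> t" using t by (auto simp: \<phi>_def)
    have "0 \<le> (2 * t - a - b)\<^sup>2" by simp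
    then have p1: "2 * \<phi> t \<le> (b - a)\<^sup>2" using p0 by (simp add: \<phi>_def power2_eq_square algebra_simps)
    have "norm ((2 * \<phi> t) *\<^sub>R s1 t + (a + b - 2 * t) *\<^sub>R s t) \<le> (2 * \<phi> t) * norm (s1 t) + \<bar>a + b - 2 * t\<bar> * norm (s t)"
      using norm_triangle_ineq[of "(2 * \<phi> t) *\<^sub>R s1 t" "(a + b - 2 * t) *\<^sub>R s t"] p0 by simp
    also have "\<dots> \<le> (b - a)\<^sup>2 * K1 + (b - a) * K0"
      using p0 p1 t b1[OF t] b2[OF t] K0 by (intro add_mono mult_mono) auto
    finally have "norm (y t) * norm ((2 * \<phi> t) *\<^sub>R s1 t + (a + b - 2 * t) *\<^sub>R s t) \<le>
        norm (y t) * ((b - a)\<^sup>2 * K1 + (b - a) * K0)" by (intro mult_left_mono) auto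
    then show "norm (G t) \<le> (K1 * (b - a)\<^sup>2 + K0 * (b - a)) * norm (y t)"
      unfolding G_def norm_mult by (simp only: mult.commute add.commute)
  qed
  then have "norm (((b - a) ^ 3 / 6) *\<^sub>R W) \<le> (K1 * (b - a)\<^sup>2 + K0 * (b - a)) * integral {a..b} (\<lambda>x. norm (y x))"
    unfolding integral_unique[OF G] by simp
  then have "(b - a) ^ 3 / 6 * norm W \<le> (K1 * (b - a)\<^sup>2 + K0 * (b - a)) * integral {a..b} (\<lambda>x. norm (y x))"
    using ab by simp
  then have "(b - a) ^ 3 * norm W \<le> 6 * ((K1 * (b - a)\<^sup>2 + K0 * (b - a)) * integral {a..b} (\<lambda>x. norm (y x)))"
    by (simp add: field_simps)
  then show ?thesis by (simp only: mult.assoc mult.commute[of "norm W"])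
qed

text \<open>Square integrability expressed through compact subintervals, on which the continuous
  solutions are integrable anyway; restriction to smaller sets is then immediate.\<close>

definition sq_bounded :: "real set \<Rightarrow> (real \<Rightarrow> 'a::real_normed_vector) \<Rightarrow> bool" where
  "sq_bounded S y \<longleftrightarrow> (\<exists>M. \<forall>a b. a < b \<longrightarrow> {a..b} \<subseteq> S \<longrightarrow> integral {a..b} (\<lambda>x. (norm (y x))\<^sup>2) \<le> M)"

lemma sq_bounded_subset: "sq_bounded S y \<Longrightarrow> T \<subseteq> S \<Longrightarrow> sq_bounded T y"
  unfolding sq_bounded_def by (meson subset_trans)

section \<open>Vanishing of Wronskians at the ends\<close>

lemma integral_norm_le_square:
  fixes y :: "real \<Rightarrow> 'a::real_normed_vector"
  assumes "continuous_on {a..b} y" "a \<le> b" "c > 0"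
  shows "2 * integral {a..b} (\<lambda>x. norm (y x)) \<le> c * (b - a) + integral {a..b} (\<lambda>x. (norm (y x))\<^sup>2) / c"
proof -
  have "integral {a..b} (\<lambda>x. 2 * norm (y x)) \<le> integral {a..b} (\<lambda>x. c + (norm (y x))\<^sup>2 / c)"
  proof (rule integral_le)
    fix x
    have "2 * c * norm (y x) \<le> c\<^sup>2 + (norm (y x))\<^sup>2" by (rule sum_squares_bound)
    then show "2 * norm (y x) \<le> c + (norm (y x))\<^sup>2 / c" using assms(3) by (simp add: field_simps power2_eq_square)
  qed (use assms in \<open>auto intro!: integrable_continuous_real continuous_intros\<close>)
  also have "\<dots> = integral {a..b} (\<lambda>x. c) + integral {a..b} (\<lambda>x. (norm (y x))\<^sup>2 / c)"
    by (rule integral_add) (use assms in \<open>auto intro!: integrable_continuous_real continuous_intros\<close>)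
  finally show ?thesis using assms by (simp add: mult.commute)
qed

text \<open>On {a..2 * a} the bounds s = O(x^2) and s1 = O(x) turn the averaging inequality into |W|
  a^3 <= 36 K a^3 times the L1 norm of y. By Cauchy-Schwarz that norm is O(sqrt a), since the
  interval has length a.\<close>

lemma wronskian_zero_at_zero:
  fixes y s :: "real \<Rightarrow> 'a::{real_normed_field,banach}"
  assumes y: "ode_solution {0<..<\<delta>} q y y1" and s: "ode_solution {0<..<\<delta>} q s s1" and \<delta>: "\<delta> > 0"
    and bs: "\<And>x. x \<in> {0<..<\<delta>} \<Longrightarrow> norm (s x) \<le> K * x\<^sup>2 \<and> norm (s1 x) \<le> K * x"
    and L2: "sq_bounded {0<..<\<delta>} y" and x: "x \<in> {0<..<\<delta>}"
  shows "y x * s1 x - y1 x * s x = 0"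
proof -
  obtain W where W: "\<And>x. x \<in> {0<..<\<delta>} \<Longrightarrow> y x * s1 x - y1 x * s x = W"
    using wronskian_constant[OF y s] by (metis convex_real_interval(8))
  obtain M where M: "\<And>a b. a < b \<Longrightarrow> {a..b} \<subseteq> {0<..<\<delta>} \<Longrightarrow> integral {a..b} (\<lambda>x. (norm (y x))\<^sup>2) \<le> M"
    using L2 unfolding sq_bounded_def by blast
  have K: "0 \<le> K" using bs[OF x] x norm_ge_zero[of "s1 x"]
    by (smt (verit) greaterThanLessThan_iff mult_neg_pos)
  have le: "norm W \<le> 18 * K * (1 + M) * e" if e: "0 < e" "2 * e\<^sup>2 < \<delta>" for e
  proof -
    \<comment> \<open>With a = e^2 and the parameter 1 / e in the Cauchy-Schwarz estimate, both of
      its terms become multiples of e.\<close>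
    define a where "a = e\<^sup>2"
    have a: "0 < a" "2 * a < \<delta>" using e by (auto simp: a_def)
    have sub: "{a..2*a} \<subseteq> {0<..<\<delta>}" using a by auto
    have A: "norm W * (2 * a - a) ^ 3 \<le> 6 * ((K * (2 * a)) * (2 * a - a)\<^sup>2 + (K * (2 * a)\<^sup>2) * (2 * a - a)) *
        integral {a..2 * a} (\<lambda>x. norm (y x))"
    proof (rule wronskian_average_bound)
      fix x assume x: "x \<in> {a..2 * a}"
      then have xs: "x \<in> {0<..<\<delta>}" using sub by auto
      show "(y has_vector_derivative y1 x) (at x)" "(s has_vector_derivative s1 x) (at x)"
        using ode_solutionD[OF y xs] ode_solutionD[OF s xs] by auto
      show "y x * s1 x - y1 x * s x = W" by (rule W[OF xs])
      have "x\<^sup>2 \<le> (2 * a)\<^sup>2" using x a by (intro power_mono) auto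
      then have "K * x\<^sup>2 \<le> K * (2 * a)\<^sup>2" "K * x \<le> K * (2 * a)" using K x by (auto intro!: mult_left_mono)
      then show "norm (s x) \<le> K * (2 * a)\<^sup>2" "norm (s1 x) \<le> K * (2 * a)" using bs[OF xs] by auto
    qed (use a in \<open>auto intro: continuous_on_subset[OF ode_solution_continuous(2)[OF s] sub]\<close>)
    have c: "continuous_on {a..2*a} y" by (rule continuous_on_subset[OF ode_solution_continuous(1)[OF y] sub])
    have "2 * integral {a..2*a} (\<lambda>x. norm (y x)) \<le> (1/e) * (2 * a - a) + integral {a..2*a} (\<lambda>x. (norm (y x))\<^sup>2) / (1/e)"
      by (rule integral_norm_le_square[OF c]) (use a e in auto)
    also have "\<dots> \<le> (1/e) * (2 * a - a) + M / (1/e)"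
      using M[of a "2*a"] sub a e by (intro add_mono divide_right_mono) auto
    also have "\<dots> = (1 + M) * e" using e by (simp add: a_def power2_eq_square field_simps)
    finally have I: "2 * integral {a..2*a} (\<lambda>x. norm (y x)) \<le> (1 + M) * e" .
    have "norm W * a ^ 3 \<le> 36 * K * a ^ 3 * integral {a..2 * a} (\<lambda>x. norm (y x))"
      using A by (simp add: power2_eq_square power3_eq_cube algebra_simps)
    then have "norm W \<le> 36 * K * integral {a..2 * a} (\<lambda>x. norm (y x))"
      using a(1) by (simp add: algebra_simps)
    also have "\<dots> = 18 * K * (2 * integral {a..2 * a} (\<lambda>x. norm (y x)))" by simp
    also have "\<dots> \<le> 18 * K * ((1 + M) * e)" using I K by (intro mult_left_mono) auto
    finally show ?thesis by (simp add: mult.assoc)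
  qed
  have "((\<lambda>e. 18 * K * (1 + M) * e) \<longlongrightarrow> 18 * K * (1 + M) * 0) (at_right 0)" by (intro tendsto_intros)
  moreover have "\<forall>\<^sub>F e in at_right 0. norm W \<le> 18 * K * (1 + M) * e"
  proof -
    have "((\<lambda>e. 2 * e\<^sup>2) \<longlongrightarrow> 2 * 0\<^sup>2) (at_right (0::real))" by (intro tendsto_intros)
    then have "\<forall>\<^sub>F e in at_right (0::real). 2 * e\<^sup>2 < \<delta>" using \<delta> by (intro order_tendstoD) auto
    moreover have "\<forall>\<^sub>F e in at_right (0::real). 0 < e" by (simp add: eventually_at_right_less)
    ultimately show ?thesis by eventually_elim (use le in auto)
  qed
  ultimately have "norm W \<le> 18 * K * (1 + M) * 0"
    using tendsto_lowerbound trivial_limit_at_right_real by blast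
  then show ?thesis using W[OF x] by simp
qed

text \<open>Otherwise n consecutive unit intervals would carry more than n * e in total, for every
  n.\<close>

lemma sq_bounded_small_integral:
  fixes y :: "real \<Rightarrow> 'a::real_normed_vector"
  assumes L2: "sq_bounded {R<..} y" and c: "continuous_on {R<..} y" and e: "e > 0"
  shows "\<exists>a>R. integral {a..a+1} (\<lambda>x. (norm (y x))\<^sup>2) \<le> e"
proof (rule ccontr)
  assume "\<not> ?thesis"
  then have gt: "integral {a..a+1} (\<lambda>x. (norm (y x))\<^sup>2) > e" if "a > R" for a using that by (meson not_le)
  obtain M where M: "\<And>a b. a < b \<Longrightarrow> {a..b} \<subseteq> {R<..} \<Longrightarrow> integral {a..b} (\<lambda>x. (norm (y x))\<^sup>2) \<le> M"
    using L2 unfolding sq_bounded_def by blast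
  have ii: "(\<lambda>x. (norm (y x))\<^sup>2) integrable_on {a..b}" if "a > R" for a b
    by (intro integrable_continuous_real continuous_intros continuous_on_subset[OF c]) (use that in auto)
  have ge: "integral {R+1..R+1+real n} (\<lambda>x. (norm (y x))\<^sup>2) \<ge> real n * e" for n
  proof (induction n)
    case (Suc n)
    have "integral {R+1..R+1+real n} (\<lambda>x. (norm (y x))\<^sup>2) + integral {R+1+real n..R+1+real (Suc n)} (\<lambda>x. (norm (y x))\<^sup>2)
        = integral {R+1..R+1+real (Suc n)} (\<lambda>x. (norm (y x))\<^sup>2)"
      by (rule Henstock_Kurzweil_Integration.integral_combine) (auto intro!: ii)
    moreover have "integral {R+1+real n..R+1+real (Suc n)} (\<lambda>x. (norm (y x))\<^sup>2) > e"
      using gt[of "R+1+real n"] by (simp add: algebra_simps)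
    ultimately show ?case using Suc by (simp add: algebra_simps)
  qed auto
  obtain n where n: "real n * e > M" using reals_Archimedean3[OF e] by blast
  have "n > 0"
  proof (rule ccontr)
    assume "\<not> n > 0"
    then have "M < 0" using n by simp
    moreover have "0 \<le> integral {R+1..R+2} (\<lambda>x. (norm (y x))\<^sup>2)" by (intro integral_nonneg ii) auto
    moreover have "integral {R+1..R+2} (\<lambda>x. (norm (y x))\<^sup>2) \<le> M"
      by (rule M) auto
    ultimately show False by linarith
  qed
  then have "integral {R+1..R+1+real n} (\<lambda>x. (norm (y x))\<^sup>2) \<le> M" by (intro M) auto
  then show False using ge[of n] n by linarith
qed

text \<open>Some unit interval far out carries an arbitrarily small part of the L2 norm of y, while
  s and s1 stay bounded; averaging over it makes the constant Wronskian arbitrarily small.\<close>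

lemma wronskian_zero_at_infinity:
  fixes y s :: "real \<Rightarrow> 'a::{real_normed_field,banach}"
  assumes y: "ode_solution {R<..} q y y1" and s: "ode_solution {R<..} q s s1"
    and bs: "\<And>x. x > R \<Longrightarrow> norm (s x) \<le> K \<and> norm (s1 x) \<le> K"
    and L2: "sq_bounded {R<..} y" and x: "x > R"
  shows "y x * s1 x - y1 x * s x = 0"
proof -
  obtain W where W: "\<And>x. x \<in> {R<..} \<Longrightarrow> y x * s1 x - y1 x * s x = W"
    using wronskian_constant[OF y s] by (metis convex_real_interval(3))
  have K: "0 \<le> K" using bs[OF x] norm_ge_zero order_trans by blast
  have le: "norm W \<le> 12 * K * e" if e: "0 < e" for e
  proof -
    obtain a where a: "a > R" "integral {a..a+1} (\<lambda>x. (norm (y x))\<^sup>2) \<le> e\<^sup>2"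
      using sq_bounded_small_integral[OF L2 ode_solution_continuous(1)[OF y], of "e\<^sup>2"] e by auto
    have sub: "{a..a+1} \<subseteq> {R<..}" using a by auto
    have A: "norm W * (a + 1 - a) ^ 3 \<le> 6 * (K * (a + 1 - a)\<^sup>2 + K * (a + 1 - a)) * integral {a..a + 1} (\<lambda>x. norm (y x))"
    proof (rule wronskian_average_bound)
      fix x assume x: "x \<in> {a..a + 1}"
      then have xs: "x \<in> {R<..}" using sub by auto
      show "(y has_vector_derivative y1 x) (at x)" "(s has_vector_derivative s1 x) (at x)"
        using ode_solutionD[OF y xs] ode_solutionD[OF s xs] by auto
      show "y x * s1 x - y1 x * s x = W" by (rule W[OF xs])
      show "norm (s x) \<le> K" "norm (s1 x) \<le> K" using bs xs by auto
    qed (auto intro: continuous_on_subset[OF ode_solution_continuous(2)[OF s] sub])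
    have c: "continuous_on {a..a+1} y" by (rule continuous_on_subset[OF ode_solution_continuous(1)[OF y] sub])
    have "2 * integral {a..a+1} (\<lambda>x. norm (y x)) \<le> e * (a + 1 - a) + integral {a..a+1} (\<lambda>x. (norm (y x))\<^sup>2) / e"
      by (rule integral_norm_le_square[OF c]) (use e in auto)
    also have "\<dots> \<le> e * (a + 1 - a) + e\<^sup>2 / e"
      using a e by (intro add_mono divide_right_mono) auto
    finally have I: "integral {a..a+1} (\<lambda>x. norm (y x)) \<le> e" by (simp add: power2_eq_square)
    have "norm W \<le> 12 * K * integral {a..a + 1} (\<lambda>x. norm (y x))" using A by simp
    also have "\<dots> \<le> 12 * K * e" using I K by (intro mult_left_mono) auto
    finally show ?thesis .
  qed
  have "norm W \<le> 0 + e" if "e > 0" for e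
  proof -
    have "norm W \<le> 12 * K * (e / (12 * K + 1))" using le[of "e / (12 * K + 1)"] that K by simp
    also have "\<dots> \<le> e" using that K by (simp add: field_simps)
    finally show ?thesis by simp
  qed
  then have "norm W \<le> 0" by (rule field_le_epsilon)
  then show ?thesis using W x by auto
qed

section \<open>Solutions for inverse square potentials\<close>

lemma continuous_on_weight_times_bounded:
  fixes p U :: "real \<Rightarrow> 'a::real_normed_field"
  assumes p: "continuous_on {0..} p" "p 0 = 0" and U: "continuous_on {0<..} U"
    and b: "\<And>t. 0 \<le> t \<Longrightarrow> norm (U t) \<le> Q"
  shows "continuous_on {0..} (\<lambda>x. p x * U x)"
  unfolding continuous_on_eq_continuous_within
proof
  fix s :: real assume "s \<in> {0..}"
  then consider "s > 0" | "s = 0" by force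
  then show "continuous (at s within {0..}) (\<lambda>x. p x * U x)"
  proof cases
    case 1
    have "continuous_on {0<..} p" by (rule continuous_on_subset[OF p(1)]) auto
    then have "isCont p s" "isCont U s" using U 1 by (auto simp: continuous_on_eq_continuous_at)
    then have "isCont (\<lambda>x. p x * U x) s" by (intro continuous_mult)
    then show ?thesis by (rule continuous_at_imp_continuous_at_within)
  next
    case 2
    have "(p \<longlongrightarrow> 0) (at 0 within {0..})" using p unfolding continuous_on_def by (metis atLeast_iff order_refl)
    then have lim: "((\<lambda>t. norm (p t) * Q) \<longlongrightarrow> norm (0::'a) * Q) (at 0 within {0..})" by (intro tendsto_intros)
    have ev: "\<forall>\<^sub>F t in at 0 within {0..}. norm (p t * U t) \<le> norm (p t) * Q"
      unfolding eventually_at_filter norm_mult by (rule always_eventually) (use b in \<open>auto intro: mult_left_mono\<close>)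
    have "((\<lambda>t. p t * U t) \<longlongrightarrow> 0) (at 0 within {0..})"
      by (rule Lim_null_comparison[OF ev]) (use lim in simp)
    then show ?thesis using 2 p(2) by (simp add: continuous_within)
  qed
qed

text \<open>The upper bounds feed the Wronskian argument at 0. The lower bound excludes the zero
  solution and allows division by s near 0.\<close>

definition regular_at_zero :: "(real \<Rightarrow> 'a) \<Rightarrow> (real \<Rightarrow> 'a::real_normed_field) \<Rightarrow> (real \<Rightarrow> 'a) \<Rightarrow> bool" where
  "regular_at_zero q s s1 \<longleftrightarrow> ode_solution {0<..} q s s1 \<and> (\<exists>K>0. \<exists>\<delta>>0. \<forall>x\<in>{0<..<\<delta>}.
     norm (s x) \<le> K * x\<^sup>2 \<and> norm (s1 x) \<le> K * x \<and> x\<^sup>2 / 2 \<le> norm (s x))"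

text \<open>Normalised to behave like exp (-k x) together with its derivative. Imaginary k is
  included, so that k and -k yield the two oscillating solutions.\<close>

definition jost_solution :: "complex \<Rightarrow> (real \<Rightarrow> complex) \<Rightarrow> (real \<Rightarrow> complex) \<Rightarrow> (real \<Rightarrow> complex) \<Rightarrow> bool" where
  "jost_solution k q y y1 \<longleftrightarrow> ode_solution {0<..} q y y1 \<and>
     ((\<lambda>x. exp (k * of_real x) * y x) \<longlongrightarrow> 1) at_top \<and> ((\<lambda>x. exp (k * of_real x) * y1 x) \<longlongrightarrow> - k) at_top"

text \<open>In the variable \<open>s = 1 / x\<close> the equation at infinity has the coefficient \<open>V (1 / s) / s ^ 4\<close>. The decay
  assumptions make it bounded and continuous at \<open>s = 0\<close>, where \<open>1 / 0 = 0\<close> and \<open>V 0 = 0\<close>.\<close>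

locale inverse_square_potential =
  fixes V :: "real \<Rightarrow> real" and B C :: real
  assumes V_cont: "continuous_on {0<..} V" and V_near: "\<And>x. 0 < x \<Longrightarrow> \<bar>V x - 2 / x\<^sup>2\<bar> \<le> B"
    and V_zero: "V 0 = 0" and V_decay4: "\<And>x. 0 < x \<Longrightarrow> \<bar>V x\<bar> \<le> C / x ^ 4"
    and V_decay6: "\<And>x. 0 < x \<Longrightarrow> \<bar>V x\<bar> \<le> C / x ^ 6"
begin

lemma B_nonneg: "0 \<le> B" using V_near[of 1] by linarith

lemma C_nonneg: "0 \<le> C" using V_decay4[of 1] by simp

text \<open>Polymorphic in the field: the operator lives over the complex numbers, whereas zeros are
  counted for the real solution.\<close>

definition V_shift :: "'a::real_normed_field \<Rightarrow> real \<Rightarrow> 'a" where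
  "V_shift z x = of_real (V x) - z"

lemma V_shift_cont: "continuous_on {0<..} (V_shift z)"
  unfolding V_shift_def[abs_def] by (intro continuous_intros V_cont)

text \<open>The substitution \<open>y = x\<^sup>2 \<eta>\<close> turns \<open>y'' = (V - z) y\<close> into \<open>(x\<^sup>4 \<eta>')' = x\<^sup>4 (V - 2 / x\<^sup>2 - z) \<eta>\<close>.\<close>

definition U_reg :: "'a::{real_normed_field,banach} \<Rightarrow> real \<Rightarrow> 'a" where
  "U_reg z t = of_real (V t - 2 / t\<^sup>2) - z"

definition p_reg :: "real \<Rightarrow> 'a::{real_normed_field,banach}" where
  "p_reg t = of_real (t ^ 4)"

section \<open>The regular solution at the origin\<close>

lemma volterra_reg:
  assumes "norm z \<le> L" "m > 0" "2 * (B + L) \<le> m\<^sup>2"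
  shows "volterra p_reg m (U_reg z) (B + L)"
proof
  show "continuous_on {0<..} p_reg" unfolding p_reg_def[abs_def] by (intro continuous_intros)
  show "p_reg x \<noteq> 0" if "0 < x" for x using that by (simp add: p_reg_def)
  show "norm (p_reg t) \<le> norm (p_reg s)" if "0 \<le> t" "t \<le> s" for s t
    using that by (simp add: p_reg_def norm_power power_mono)
  show U: "norm (U_reg z t) \<le> B + L" if "0 \<le> t" for t
  proof -
    have "norm (of_real (V t - 2 / t\<^sup>2) :: 'a) \<le> B"
      using V_near[of t] B_nonneg V_zero that unfolding norm_of_real by (cases "t = 0") auto
    then show ?thesis unfolding U_reg_def using norm_triangle_ineq4[of "of_real (V t - 2 / t\<^sup>2) :: 'a" z] assms(1) by linarith
  qed
  show "continuous_on {0..} (\<lambda>x. p_reg x * U_reg z x)"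
  proof (rule continuous_on_weight_times_bounded[OF _ _ _ U])
    show "continuous_on {0..} p_reg" unfolding p_reg_def[abs_def] by (intro continuous_intros)
    show "continuous_on {0<..} (U_reg z)" unfolding U_reg_def[abs_def]
      by (intro continuous_intros V_cont) auto
  qed (auto simp: p_reg_def)
qed (use assms in auto)

definition reg_eta :: "'a::{real_normed_field,banach} \<Rightarrow> real \<Rightarrow> 'a" where
  "reg_eta z = (SOME \<eta>. volterra.is_volterra_solution p_reg (2 * (B + norm z) + 1) (U_reg z) \<eta>)"

text \<open>Solutions for different z have to be compared in one exponential weight. The integral
  equation does not mention m, and the growth bound with the rate of z implies the one with the rate
  of any L above its norm. The choice m = 2 Q + 1 is positive and satisfies 2 Q <= m^2 for every Q
  >= 0.\<close>

lemma reg_eta: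
  fixes z :: "'a::{real_normed_field,banach}"
  assumes "norm z \<le> L" "m = 2 * (B + L) + 1"
  shows "volterra p_reg m (U_reg z) (B + L)" "volterra.is_volterra_solution p_reg m (U_reg z) (reg_eta z)"
proof -
  have sq: "2 * Q \<le> (2 * Q + 1)\<^sup>2" if "0 \<le> Q" for Q :: real
    using that by (simp add: power2_eq_square algebra_simps)
  have L: "0 \<le> L" using assms(1) norm_ge_zero order_trans by blast
  show v: "volterra p_reg m (U_reg z) (B + L)"
    using B_nonneg L assms sq[of "B + L"] by (intro volterra_reg) auto
  define m0 where "m0 = 2 * (B + norm z) + 1"
  interpret A: volterra p_reg m0 "U_reg z" "B + norm z"
    using B_nonneg sq[of "B + norm z"] norm_ge_zero[of z]
    by (intro volterra_reg) (auto simp: m0_def simp del: norm_ge_zero)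
  interpret A': volterra p_reg m "U_reg z" "B + L" by (rule v)
  have "A.is_volterra_solution (reg_eta z)"
    unfolding reg_eta_def m0_def[symmetric] by (rule someI_ex[OF A.volterra_solution_exists])
  moreover have "exp (m0 * x) \<le> exp (m * x)" if "0 \<le> x" for x
    using that assms by (auto simp: m0_def intro!: mult_right_mono)
  ultimately show "A'.is_volterra_solution (reg_eta z)"
    unfolding A.is_volterra_solution_def A'.is_volterra_solution_def by (meson mult_left_mono order_trans zero_le_numeral)
qed

definition reg_eta1 :: "'a::{real_normed_field,banach} \<Rightarrow> real \<Rightarrow> 'a" where
  "reg_eta1 z = volterra_weight.D p_reg (\<lambda>t. U_reg z t * reg_eta z t)"

definition reg :: "'a::{real_normed_field,banach} \<Rightarrow> real \<Rightarrow> 'a" where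
  "reg z x = of_real (x\<^sup>2) * reg_eta z x"

definition reg1 :: "'a::{real_normed_field,banach} \<Rightarrow> real \<Rightarrow> 'a" where
  "reg1 z x = of_real (2 * x) * reg_eta z x + of_real (x\<^sup>2) * reg_eta1 z x"

lemma reg_ode: "ode_solution {0<..} (V_shift z) (reg z) (reg1 z)"
  unfolding ode_solution_def
proof (intro ballI conjI)
  fix x :: real assume "x \<in> {0<..}"
  then have x: "0 < x" by simp
  interpret volterra p_reg "2 * (B + norm z) + 1" "U_reg z" "B + norm z" by (rule reg_eta(1)) auto
  have s: "is_volterra_solution (reg_eta z)" by (rule reg_eta(2)) auto
  note dv = vs_deriv[OF s x, folded reg_eta1_def]
  have dw: "((\<lambda>x. of_real (x ^ 4) * reg_eta1 z x) has_vector_derivative of_real (x ^ 4) * (U_reg z x * reg_eta z x)) (at x)"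
    using vs_weighted_deriv[OF s x] unfolding reg_eta1_def p_reg_def .
  have sq: "((\<lambda>x. of_real (x\<^sup>2)) has_vector_derivative (of_real (2 * x) :: 'a)) (at x)"
    by (rule has_vector_derivative_of_real) (auto intro!: derivative_eq_intros)
  have d2: "((\<lambda>x. of_real (2 * x)) has_vector_derivative (of_real 2 :: 'a)) (at x)"
    by (rule has_vector_derivative_of_real) (auto intro!: derivative_eq_intros)
  have "(reg z has_vector_derivative (of_real (x\<^sup>2) * reg_eta1 z x + of_real (2 * x) * reg_eta z x)) (at x)"
    unfolding reg_def[abs_def] by (rule has_vector_derivative_mult[OF sq dv])
  then show "(reg z has_vector_derivative reg1 z x) (at x)" by (simp add: reg1_def add.commute)
  have di: "((\<lambda>x. of_real (1 / x\<^sup>2)) has_vector_derivative (of_real (- 2 / x ^ 3) :: 'a)) (at x)"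
    using x by (intro has_vector_derivative_of_real) (auto intro!: derivative_eq_intros simp: power2_eq_square power3_eq_cube)
  \<comment> \<open>Writing x^2 eta' as x^(-2) (x^4 eta') brings in the flux x^4 eta', whose
    derivative the Volterra equation supplies.\<close>
  have "((\<lambda>x. of_real (2 * x) * reg_eta z x + of_real (1 / x\<^sup>2) * (of_real (x ^ 4) * reg_eta1 z x)) has_vector_derivative
     ((of_real (2 * x) * reg_eta1 z x + of_real 2 * reg_eta z x) +
      (of_real (1 / x\<^sup>2) * (of_real (x ^ 4) * (U_reg z x * reg_eta z x)) + of_real (- 2 / x ^ 3) * (of_real (x ^ 4) * reg_eta1 z x)))) (at x)"
    by (intro has_vector_derivative_add has_vector_derivative_mult d2 dv di dw)
  moreover have "((of_real (2 * x) * reg_eta1 z x + of_real 2 * reg_eta z x) +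
      (of_real (1 / x\<^sup>2) * (of_real (x ^ 4) * (U_reg z x * reg_eta z x)) + of_real (- 2 / x ^ 3) * (of_real (x ^ 4) * reg_eta1 z x)))
      = V_shift z x * reg z x"
  proof -
    have r: "1 / x\<^sup>2 * x ^ 4 = x\<^sup>2" "- 2 / x ^ 3 * x ^ 4 = - (2 * x)"
      using x by (simp_all add: eval_nat_numeral)
    have "of_real (1 / x\<^sup>2) * (of_real (x ^ 4) * w) = of_real (x\<^sup>2) * w" for w :: 'a
      by (metis mult.assoc of_real_mult r(1))
    moreover have "of_real (- 2 / x ^ 3) * (of_real (x ^ 4) * w) = - of_real (2 * x) * w" for w :: 'a
      by (metis mult.assoc of_real_mult of_real_minus r(2))
    moreover have "of_real (x\<^sup>2) * U_reg z x = of_real (x\<^sup>2) * V_shift z x - of_real 2"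
      using x by (simp add: U_reg_def V_shift_def algebra_simps of_real_mult[symmetric] del: of_real_mult)
    ultimately show ?thesis
      by (simp add: reg_def mult.assoc[symmetric] del: of_real_mult of_real_numeral of_real_power) (simp add: algebra_simps)
  qed
  ultimately have D: "((\<lambda>x. of_real (2 * x) * reg_eta z x + of_real (1 / x\<^sup>2) * (of_real (x ^ 4) * reg_eta1 z x)) has_vector_derivative V_shift z x * reg z x) (at x)"
    by simp
  show "(reg1 z has_vector_derivative V_shift z x * reg z x) (at x)"
  proof (rule has_vector_derivative_transform_within_open[OF D])
    fix t :: real assume "t \<in> {0<..}"
    then have "1 / t\<^sup>2 * t ^ 4 = t\<^sup>2" by (simp add: eval_nat_numeral)
    then have "of_real (1 / t\<^sup>2) * (of_real (t ^ 4) * reg_eta1 z t) = of_real (t\<^sup>2) * reg_eta1 z t"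
      by (metis mult.assoc of_real_mult)
    then show "of_real (2 * t) * reg_eta z t + of_real (1 / t\<^sup>2) * (of_real (t ^ 4) * reg_eta1 z t) = reg1 z t"
      by (simp only: reg1_def)
  qed (use x in auto)
qed

lemma reg_eta1_bound:
  fixes z :: "'a::{real_normed_field,banach}"
  assumes "0 \<le> x"
  shows "norm (reg_eta1 z x) \<le> 2 * (B + norm z) * x * exp ((2 * (B + norm z) + 1) * x)"
proof -
  interpret volterra p_reg "2 * (B + norm z) + 1" "U_reg z" "B + norm z" by (rule reg_eta(1)) auto
  have s: "is_volterra_solution (reg_eta z)" by (rule reg_eta(2)) auto
  show ?thesis using D_bound_linear[OF vs_adm[OF s] assms] unfolding reg_eta1_def by (simp add: algebra_simps)
qed

lemma reg_eta_tendsto: "(reg_eta z \<longlongrightarrow> 1) (at_right 0)"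
proof -
  interpret volterra p_reg "2 * (B + norm z) + 1" "U_reg z" "B + norm z" by (rule reg_eta(1)) auto
  have s: "is_volterra_solution (reg_eta z)" by (rule reg_eta(2)) auto
  have "(reg_eta z \<longlongrightarrow> 1) (at 0 within {0..})"
    using vs_cont[OF s] vs_zero[OF s] unfolding continuous_on_def by force
  then show ?thesis by (rule tendsto_within_subset) auto
qed

lemma reg_regular: "regular_at_zero (V_shift z) (reg z) (reg1 z)"
  unfolding regular_at_zero_def
proof (intro conjI reg_ode)
  define K where "K = 4 + 2 * (B + norm z) * exp (2 * (B + norm z) + 1)"
  have Bz: "0 \<le> B + norm z" using B_nonneg by simp
  have "((\<lambda>x. norm (reg_eta z x)) \<longlongrightarrow> norm (1::'a)) (at_right 0)" by (intro tendsto_norm reg_eta_tendsto)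
  then have "\<forall>\<^sub>F x in at_right 0. norm (reg_eta z x) > 1 / 2" "\<forall>\<^sub>F x in at_right 0. norm (reg_eta z x) < 2"
    by (rule order_tendstoD; simp)+
  then have "\<forall>\<^sub>F x in at_right 0. norm (reg_eta z x) > 1 / 2 \<and> norm (reg_eta z x) < 2" by eventually_elim auto
  then obtain d where d: "d > 0" "\<And>x. 0 < x \<Longrightarrow> x < d \<Longrightarrow> norm (reg_eta z x) > 1 / 2 \<and> norm (reg_eta z x) < 2"
    unfolding eventually_at_right_field by auto
  have "norm (reg z x) \<le> K * x\<^sup>2 \<and> norm (reg1 z x) \<le> K * x \<and> x\<^sup>2 / 2 \<le> norm (reg z x)"
    if "x \<in> {0<..<min d 1}" for x
  proof -
    have x: "0 < x" "x < d" "x < 1" using that by auto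
    note e = d(2)[OF x(1,2)]
    have K4: "4 \<le> K" using Bz by (simp add: K_def)
    have "norm (reg z x) = x\<^sup>2 * norm (reg_eta z x)" by (simp add: reg_def norm_mult norm_power)
    moreover have "x\<^sup>2 * norm (reg_eta z x) \<le> x\<^sup>2 * K" by (rule mult_left_mono) (use e K4 in auto)
    moreover have "x\<^sup>2 * (1 / 2) \<le> x\<^sup>2 * norm (reg_eta z x)" by (rule mult_left_mono) (use e in auto)
    moreover have "norm (reg1 z x) \<le> 2 * x * norm (reg_eta z x) + x\<^sup>2 * norm (reg_eta1 z x)"
      unfolding reg1_def using x norm_triangle_ineq[of "of_real (2 * x) * reg_eta z x" "of_real (x\<^sup>2) * reg_eta1 z x"]
      by (simp add: norm_mult norm_power)
    moreover have "2 * x * norm (reg_eta z x) \<le> 2 * x * 2" using e x by (intro mult_left_mono) auto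
    moreover have "x\<^sup>2 * norm (reg_eta1 z x) \<le> x * (2 * (B + norm z) * exp (2 * (B + norm z) + 1))"
    proof -
      have "norm (reg_eta1 z x) \<le> 2 * (B + norm z) * x * exp ((2 * (B + norm z) + 1) * x)"
        using x by (intro reg_eta1_bound) auto
      also have "\<dots> \<le> 2 * (B + norm z) * 1 * exp ((2 * (B + norm z) + 1) * 1)"
        using x Bz by (intro mult_mono mult_left_mono) (auto intro!: mult_left_le simp: )
      finally have "x\<^sup>2 * norm (reg_eta1 z x) \<le> x\<^sup>2 * (2 * (B + norm z) * exp (2 * (B + norm z) + 1))"
        by (intro mult_left_mono) auto
      also have "\<dots> \<le> x * (2 * (B + norm z) * exp (2 * (B + norm z) + 1))"
        using x Bz by (intro mult_right_mono) (auto simp: power2_eq_square mult_left_le)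
      finally show ?thesis .
    qed
    ultimately show ?thesis by (simp add: K_def algebra_simps)
  qed
  moreover have "K > 0" using Bz by (simp add: K_def add_pos_nonneg)
  ultimately show "\<exists>K>0. \<exists>\<delta>>0. \<forall>x\<in>{0<..<\<delta>}.
     norm (reg z x) \<le> K * x\<^sup>2 \<and> norm (reg1 z x) \<le> K * x \<and> x\<^sup>2 / 2 \<le> norm (reg z x)"
    using d(1) by (intro exI[of _ K] conjI exI[of _ "min d 1"]) auto
qed

section \<open>Solutions prescribed at infinity\<close>

lemma U_inf_bound: "norm (of_real (V (1 / s) / s ^ 4) :: 'a::real_normed_field) \<le> C" if "0 \<le> s"
proof (cases "s = 0")
  case False
  then have "\<bar>V (1 / s)\<bar> \<le> C / (1 / s) ^ 4" using that by (intro V_decay4) auto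
  then show ?thesis using False that unfolding norm_of_real by (simp add: divide_le_eq power_one_over abs_mult)
qed (simp add: C_nonneg V_zero)

lemma U_inf_cont: "continuous_on {0<..} (\<lambda>s. of_real (V (1 / s) / s ^ 4) :: 'a::real_normed_field)"
proof -
  have "continuous_on {0<..} (\<lambda>s. V (1 / s))"
    by (rule continuous_on_compose2[OF V_cont]) (auto intro!: continuous_intros)
  then show ?thesis by (intro continuous_intros) auto
qed

text \<open>With y = exp (-k x) eta (1 / x) and s = 1 / x, the equation y'' = (V + k^2) y becomes (p
  eta')' = p U eta for p s = s^2 exp (-2 k / s) and U s = V (1 / s) / s^4. The norm of p is
  nondecreasing precisely because Re k >= 0, and the normalisation at infinity becomes the initial
  value 1 at s = 0.\<close>

lemma jost_exists:
  assumes k: "0 \<le> Re k"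
  obtains y y1 where "jost_solution k (V_shift (- (k\<^sup>2))) y y1"
proof -
  define p :: "real \<Rightarrow> complex" where "p s = of_real (s\<^sup>2) * exp (- 2 * k * of_real (1 / s))" for s
  define U :: "real \<Rightarrow> complex" where "U s = of_real (V (1 / s) / s ^ 4)" for s
  define m where "m = 2 * C + 1"
  have np: "norm (p s) = s\<^sup>2 * exp (- 2 * Re k / s)" for s by (simp add: p_def norm_mult norm_power)
  have pc: "continuous_on {0<..} p" unfolding p_def[abs_def] by (intro continuous_intros) auto
  interpret volterra p m U C
  proof
    show "continuous_on {0<..} p" by (rule pc)
    show "p x \<noteq> 0" if "0 < x" for x using that by (simp add: p_def)
    show "norm (p t) \<le> norm (p s)" if "0 \<le> t" "t \<le> s" for s t
    proof (cases "t = 0")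
      case False
      have "- 2 * Re k / t \<le> - 2 * Re k / s"
        using that False k by (simp add: divide_left_mono frac_le)
      then show ?thesis unfolding np using that by (intro mult_mono power_mono) auto
    qed (simp add: np)
    show "norm (U t) \<le> C" if "0 \<le> t" for t unfolding U_def by (rule U_inf_bound[OF that])
    then show "continuous_on {0..} (\<lambda>x. p x * U x)"
    proof (rule continuous_on_weight_times_bounded[rotated 3])
      show "continuous_on {0..} p"
        unfolding continuous_on_eq_continuous_within
      proof
        fix s :: real assume "s \<in> {0..}"
        then consider "s > 0" | "s = 0" by force
        then show "continuous (at s within {0..}) p"
        proof cases
          case 1
          then show ?thesis using pc by (simp add: continuous_on_eq_continuous_at continuous_at_imp_continuous_at_within)
        next
          case 2
          have lim: "((\<lambda>s::real. s\<^sup>2) \<longlongrightarrow> 0\<^sup>2) (at 0 within {0..})" by (intro tendsto_intros)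
          have ev: "\<forall>\<^sub>F t in at 0 within {0..}. norm (p t) \<le> t\<^sup>2"
            unfolding eventually_at_filter np by (rule always_eventually) (use k in \<open>auto intro!: mult_left_le\<close>)
          have "(p \<longlongrightarrow> 0) (at 0 within {0..})"
            by (rule Lim_null_comparison[OF ev]) (use lim in simp)
          then show ?thesis using 2 by (simp add: continuous_within p_def)
        qed
      qed
      show "continuous_on {0<..} U" unfolding U_def[abs_def] by (rule U_inf_cont)
    qed (auto simp: p_def)
    show "0 < m" "2 * C \<le> m\<^sup>2" using C_nonneg by (auto simp: m_def power2_eq_square algebra_simps)
  qed
  obtain \<eta> where s: "is_volterra_solution \<eta>" using volterra_solution_exists by blast
  define \<eta>1 where "\<eta>1 = D (\<lambda>t. U t * \<eta> t)"
  define P where "P t = p t * \<eta>1 t" for t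
  define y where "y x = exp (- k * of_real x) * \<eta> (1 / x)" for x
  define y1 where "y1 x = exp (- k * of_real x) * (- k * \<eta> (1 / x) - \<eta>1 (1 / x) / of_real (x\<^sup>2))" for x
  have ode: "ode_solution {0<..} (V_shift (- (k\<^sup>2))) y y1"
    unfolding ode_solution_def
  proof (intro ballI conjI)
    fix x :: real assume "x \<in> {0<..}"
    then have x: "0 < x" by simp
    have ix: "0 < 1 / x" using x by simp
    have di: "((\<lambda>x. 1 / x) has_vector_derivative (- 1 / x\<^sup>2)) (at x)"
      using x by (auto intro!: derivative_eq_intros simp: has_real_derivative_iff_has_vector_derivative[symmetric] power2_eq_square)
    have de: "((\<lambda>x. exp (c * of_real x)) has_vector_derivative (c * exp (c * of_real x))) (at x)" for c :: complex
    proof -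
      have "((\<lambda>w. exp (c * w)) has_field_derivative (c * exp (c * of_real x))) (at (of_real x))"
        by (auto intro!: derivative_eq_intros)
      from has_vector_derivative_real_field[OF this] show ?thesis by simp
    qed
    have d\<eta>: "((\<lambda>x. \<eta> (1 / x)) has_vector_derivative (- 1 / x\<^sup>2) *\<^sub>R \<eta>1 (1 / x)) (at x)"
      using vector_diff_chain_at[OF di vs_deriv[OF s ix]] by (simp add: o_def \<eta>1_def)
    have dP: "((\<lambda>x. P (1 / x)) has_vector_derivative (- 1 / x\<^sup>2) *\<^sub>R (p (1 / x) * (U (1 / x) * \<eta> (1 / x)))) (at x)"
      using vector_diff_chain_at[OF di vs_weighted_deriv[OF s ix]] by (simp add: o_def P_def \<eta>1_def)
    \<comment> \<open>\<open>P (1 / t)\<close> is the flux exp (-2 k t) eta1 / t^2. Expressing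
      \<open>y1\<close> through it makes the second derivative computable, as for the regular
      solution.\<close>
    have Py: "exp (- k * of_real t) * (\<eta>1 (1 / t) / of_real (t\<^sup>2)) = exp (k * of_real t) * P (1 / t)" if "0 < t" for t
    proof -
      have "exp (- k * of_real t) = exp (k * of_real t) * exp (- 2 * k * of_real t)"
        by (simp add: exp_add[symmetric] algebra_simps)
      then show ?thesis using that by (simp add: P_def p_def power_one_over)
    qed
    have "(y has_vector_derivative (exp (- k * of_real x) * ((- 1 / x\<^sup>2) *\<^sub>R \<eta>1 (1 / x)) + (- k * exp (- k * of_real x)) * \<eta> (1 / x))) (at x)"
      unfolding y_def[abs_def] by (rule has_vector_derivative_mult[OF de d\<eta>])
    moreover have "exp (- k * of_real x) * ((- 1 / x\<^sup>2) *\<^sub>R \<eta>1 (1 / x)) + (- k * exp (- k * of_real x)) * \<eta> (1 / x) = y1 x"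
      by (simp add: y1_def scaleR_conv_of_real algebra_simps)
    ultimately show "(y has_vector_derivative y1 x) (at x)" by simp
    have D: "((\<lambda>x. - k * (exp (- k * of_real x) * \<eta> (1 / x)) - exp (k * of_real x) * P (1 / x)) has_vector_derivative
      (- k * (exp (- k * of_real x) * ((- 1 / x\<^sup>2) *\<^sub>R \<eta>1 (1 / x)) + (- k * exp (- k * of_real x)) * \<eta> (1 / x)) -
      (exp (k * of_real x) * ((- 1 / x\<^sup>2) *\<^sub>R (p (1 / x) * (U (1 / x) * \<eta> (1 / x)))) + (k * exp (k * of_real x)) * P (1 / x)))) (at x)"
      by (intro has_vector_derivative_diff has_vector_derivative_mult has_vector_derivative_mult_right de d\<eta> dP)
    have "exp (k * of_real x) * ((- 1 / x\<^sup>2) *\<^sub>R (p (1 / x) * (U (1 / x) * \<eta> (1 / x)))) = - of_real (V x) * y x"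
    proof -
      have "exp (k * of_real x) * p (1 / x) = exp (- k * of_real x) / of_real (x\<^sup>2)"
      proof -
        have "exp (- k * of_real x) = exp (k * of_real x) * exp (- 2 * k * of_real x)"
          by (simp add: exp_add[symmetric] algebra_simps)
        then show ?thesis using x by (simp add: p_def power_one_over)
      qed
      moreover have "U (1 / x) = of_real (V x) * of_real (x\<^sup>2) * of_real (x\<^sup>2)"
        using x by (simp add: U_def power_one_over power4_eq_xxxx power2_eq_square)
      ultimately show ?thesis using x
        by (simp add: y_def scaleR_conv_of_real) (simp add: field_simps)
    qed
    moreover have "(k * exp (k * of_real x)) * P (1 / x) = k * (exp (- k * of_real x) * (\<eta>1 (1 / x) / of_real (x\<^sup>2)))"
      using Py[OF x] by (simp add: mult.assoc)
    ultimately have "- k * (exp (- k * of_real x) * ((- 1 / x\<^sup>2) *\<^sub>R \<eta>1 (1 / x)) + (- k * exp (- k * of_real x)) * \<eta> (1 / x)) -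
      (exp (k * of_real x) * ((- 1 / x\<^sup>2) *\<^sub>R (p (1 / x) * (U (1 / x) * \<eta> (1 / x)))) + (k * exp (k * of_real x)) * P (1 / x))
      = V_shift (- (k\<^sup>2)) x * y x"
      by (simp add: V_shift_def y_def scaleR_conv_of_real power2_eq_square) (simp add: algebra_simps)
    then have D': "((\<lambda>x. - k * (exp (- k * of_real x) * \<eta> (1 / x)) - exp (k * of_real x) * P (1 / x)) has_vector_derivative
      V_shift (- (k\<^sup>2)) x * y x) (at x)" using D by simp
    show "(y1 has_vector_derivative V_shift (- (k\<^sup>2)) x * y x) (at x)"
    proof (rule has_vector_derivative_transform_within_open[OF D'])
      fix t :: real assume "t \<in> {0<..}"
      then show "- k * (exp (- k * of_real t) * \<eta> (1 / t)) - exp (k * of_real t) * P (1 / t) = y1 t"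
        using Py[of t] by (simp add: y1_def right_diff_distrib mult.left_commute)
    qed (use x in auto)
  qed
  have inv: "filterlim (\<lambda>x::real. 1 / x) (at 0 within {0..}) at_top"
  proof -
    have "filterlim (\<lambda>x::real. inverse x) (at_right 0) at_top" by (rule filterlim_inverse_at_right_top)
    then show ?thesis unfolding inverse_eq_divide
      by (rule filterlim_mono) (auto intro: at_le)
  qed
  have "(\<eta> \<longlongrightarrow> 1) (at 0 within {0..})"
    using vs_cont[OF s] vs_zero[OF s] unfolding continuous_on_def by force
  from filterlim_compose[OF this inv] have l1: "((\<lambda>x. \<eta> (1 / x)) \<longlongrightarrow> 1) at_top" .
  have "(\<eta>1 \<longlongrightarrow> 0) (at 0 within {0..})"
    using D_cont[OF vs_adm[OF s]] unfolding continuous_on_def \<eta>1_def D_def by force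
  from filterlim_compose[OF this inv] have l2: "((\<lambda>x. \<eta>1 (1 / x)) \<longlongrightarrow> 0) at_top" .
  have "filterlim (\<lambda>x::real. x\<^sup>2) at_top at_top" by real_asymp
  then have l3: "((\<lambda>x::real. 1 / x\<^sup>2) \<longlongrightarrow> 0) at_top" by real_asymp
  have e: "exp (k * of_real x) * (exp (- k * of_real x) * w) = w" for x w
    by (simp add: mult.assoc[symmetric] exp_add[symmetric])
  have "((\<lambda>x. exp (k * of_real x) * y x) \<longlongrightarrow> 1) at_top" using l1 by (simp only: y_def e)
  moreover have "((\<lambda>x. - k * \<eta> (1 / x) - \<eta>1 (1 / x) * of_real (1 / x\<^sup>2)) \<longlongrightarrow> - k * 1 - 0 * of_real 0) at_top"
    by (intro tendsto_intros l1 l2 l3)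
  then have "((\<lambda>x. exp (k * of_real x) * y1 x) \<longlongrightarrow> - k) at_top" by (simp only: y1_def e) simp
  ultimately have "jost_solution k (V_shift (- (k\<^sup>2))) y y1" using ode by (simp add: jost_solution_def)
  then show ?thesis by (rule that)
qed

text \<open>For k = 0 the substitution y = x eta (1 / x) leads to eta'' = U eta, that is to the
  weight 1. This weight does not vanish at 0, so U itself must be continuous there; this is the
  purpose of the decay of order 6.\<close>

lemma growing_solution_exists:
  obtains y y1 :: "real \<Rightarrow> complex" where "ode_solution {0<..} (V_shift 0) y y1" "((\<lambda>x. y x / of_real x) \<longlongrightarrow> 1) at_top"
proof -
  define U :: "real \<Rightarrow> complex" where "U s = of_real (V (1 / s) / s ^ 4)" for s
  define m where "m = 2 * C + 1"
  interpret volterra "\<lambda>_. 1" m U C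
  proof
    show "norm (U t) \<le> C" if "0 \<le> t" for t unfolding U_def by (rule U_inf_bound[OF that])
    show "0 < m" "2 * C \<le> m\<^sup>2" using C_nonneg by (auto simp: m_def power2_eq_square algebra_simps)
    have "continuous (at s within {0..}) U" if s: "s \<ge> 0" for s
    proof -
      consider "s > 0" | "s = 0" using s by force
      then show ?thesis
      proof cases
        case 1
        have "continuous_on {0<..} U" unfolding U_def[abs_def] by (rule U_inf_cont)
        then have "isCont U s" using 1 by (simp add: continuous_on_eq_continuous_at)
        then show ?thesis by (rule continuous_at_imp_continuous_at_within)
      next
        case 2
        have lim: "((\<lambda>s::real. C * s\<^sup>2) \<longlongrightarrow> C * 0\<^sup>2) (at 0 within {0..})" by (intro tendsto_intros)
        have "norm (U t) \<le> C * t\<^sup>2" if "0 \<le> t" for t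
        proof (cases "t = 0")
          case False
          then have t: "0 < t" using that by simp
          then have "\<bar>V (1 / t)\<bar> \<le> C / (1 / t) ^ 6" by (intro V_decay6) auto
          also have "\<dots> = C * t\<^sup>2 * t ^ 4" by (simp add: power_one_over power_add[symmetric])
          finally show ?thesis using t unfolding U_def norm_of_real by (simp add: divide_le_eq)
        qed (simp add: U_def)
        then have ev: "\<forall>\<^sub>F t in at 0 within {0..}. norm (U t) \<le> C * t\<^sup>2"
          unfolding eventually_at_filter by (intro always_eventually) auto
        have "(U \<longlongrightarrow> 0) (at 0 within {0..})"
          by (rule Lim_null_comparison[OF ev]) (use lim in simp)
        then show ?thesis using 2 by (simp add: continuous_within U_def)
      qed
    qed
    then show "continuous_on {0..} (\<lambda>x. 1 * U x)" by (simp add: continuous_on_eq_continuous_within)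
  qed auto
  obtain \<eta> where s: "is_volterra_solution \<eta>" using volterra_solution_exists by blast
  define \<eta>1 where "\<eta>1 = D (\<lambda>t. U t * \<eta> t)"
  define y where "y x = of_real x * \<eta> (1 / x)" for x
  define y1 where "y1 x = \<eta> (1 / x) - of_real (1 / x) * \<eta>1 (1 / x)" for x
  have "ode_solution {0<..} (V_shift 0) y y1"
    unfolding ode_solution_def
  proof (intro ballI conjI)
    fix x :: real assume "x \<in> {0<..}"
    then have x: "0 < x" by simp
    have ix: "0 < 1 / x" using x by simp
    have di: "((\<lambda>x. 1 / x) has_real_derivative (- 1 / x\<^sup>2)) (at x)"
      using x by (auto intro!: derivative_eq_intros simp: power2_eq_square)
    note div = di[unfolded has_real_derivative_iff_has_vector_derivative]
    have d\<eta>: "((\<lambda>x. \<eta> (1 / x)) has_vector_derivative (- 1 / x\<^sup>2) *\<^sub>R \<eta>1 (1 / x)) (at x)"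
      using vector_diff_chain_at[OF div vs_deriv[OF s ix]] by (simp add: o_def \<eta>1_def)
    have d\<eta>1: "((\<lambda>x. \<eta>1 (1 / x)) has_vector_derivative (- 1 / x\<^sup>2) *\<^sub>R (U (1 / x) * \<eta> (1 / x))) (at x)"
      using vector_diff_chain_at[OF div vs_weighted_deriv[OF s ix]] by (simp add: o_def \<eta>1_def)
    have "(y has_vector_derivative (of_real x * ((- 1 / x\<^sup>2) *\<^sub>R \<eta>1 (1 / x)) + of_real 1 * \<eta> (1 / x))) (at x)"
      unfolding y_def[abs_def] by (intro has_vector_derivative_mult d\<eta> has_vector_derivative_of_real) auto
    moreover have "of_real x * ((- 1 / x\<^sup>2) *\<^sub>R \<eta>1 (1 / x)) + of_real 1 * \<eta> (1 / x) = y1 x"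
      using x by (simp add: y1_def scaleR_conv_of_real power2_eq_square field_simps)
    ultimately show "(y has_vector_derivative y1 x) (at x)" by simp
    have "(y1 has_vector_derivative ((- 1 / x\<^sup>2) *\<^sub>R \<eta>1 (1 / x) - (of_real (1 / x) * ((- 1 / x\<^sup>2) *\<^sub>R (U (1 / x) * \<eta> (1 / x)))
        + of_real (- 1 / x\<^sup>2) * \<eta>1 (1 / x)))) (at x)"
      unfolding y1_def[abs_def]
      by (intro has_vector_derivative_mult has_vector_derivative_diff d\<eta> d\<eta>1 has_vector_derivative_of_real di)
    moreover have "(- 1 / x\<^sup>2) *\<^sub>R \<eta>1 (1 / x) - (of_real (1 / x) * ((- 1 / x\<^sup>2) *\<^sub>R (U (1 / x) * \<eta> (1 / x)))
        + of_real (- 1 / x\<^sup>2) * \<eta>1 (1 / x)) = V_shift 0 x * y x"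
      using x by (simp add: V_shift_def y_def U_def scaleR_conv_of_real power2_eq_square power4_eq_xxxx power_one_over)
    ultimately show "(y1 has_vector_derivative V_shift 0 x * y x) (at x)" by simp
  qed
  moreover have "((\<lambda>x. y x / of_real x) \<longlongrightarrow> 1) at_top"
  proof -
    have "filterlim (\<lambda>x::real. inverse x) (at_right 0) at_top" by (rule filterlim_inverse_at_right_top)
    then have inv: "filterlim (\<lambda>x::real. 1 / x) (at 0 within {0..}) at_top" unfolding inverse_eq_divide
      by (rule filterlim_mono) (auto intro: at_le)
    have "(\<eta> \<longlongrightarrow> 1) (at 0 within {0..})"
      using vs_cont[OF s] vs_zero[OF s] unfolding continuous_on_def by force
    from filterlim_compose[OF this inv] have "((\<lambda>x. \<eta> (1 / x)) \<longlongrightarrow> 1) at_top" .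
    then show ?thesis
      by (rule Lim_transform_eventually) (auto simp: y_def eventually_at_top_dense intro!: exI[of _ 0])
  qed
  ultimately show ?thesis by (rule that)
qed

end

lemma norm_diff_le_deriv_bound:
  fixes f :: "real \<Rightarrow> 'a::banach"
  assumes ab: "a \<le> b" and df: "\<And>x. x \<in> {a..b} \<Longrightarrow> (f has_vector_derivative f' x) (at x)"
    and dg: "\<And>x. x \<in> {a..b} \<Longrightarrow> (g has_real_derivative g' x) (at x)"
    and le: "\<And>x. x \<in> {a..b} \<Longrightarrow> norm (f' x) \<le> g' x"
  shows "norm (f b - f a) \<le> g b - g a"
proof -
  have 1: "(f' has_integral (f b - f a)) {a..b}"
    by (rule fundamental_theorem_of_calculus[OF ab]) (use df has_vector_derivative_at_within in blast)
  have 2: "(g' has_integral (g b - g a)) {a..b}"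
    by (rule fundamental_theorem_of_calculus[OF ab])
      (use dg[unfolded has_real_derivative_iff_has_vector_derivative] has_vector_derivative_at_within in blast)
  have "norm (integral {a..b} f') \<le> integral {a..b} g'"
    by (rule integral_norm_bound_integral) (use 1 2 le in auto)
  then show ?thesis using integral_unique[OF 1] integral_unique[OF 2] by simp
qed

text \<open>The quotient of f by g is continuous, hence bounded, on the compact interval between the
  two end regions.\<close>

lemma bound_from_ends:
  fixes f :: "real \<Rightarrow> 'a::real_normed_vector" and g :: "real \<Rightarrow> real"
  assumes f: "continuous_on {0<..} f" and g: "continuous_on {0<..} g" "\<And>x. 0 < x \<Longrightarrow> 0 < g x"
    and \<delta>: "0 < \<delta>" "\<And>x. 0 < x \<Longrightarrow> x < \<delta> \<Longrightarrow> norm (f x) \<le> C1 * g x"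
    and X: "\<And>x. X \<le> x \<Longrightarrow> norm (f x) \<le> C2 * g x"
  obtains C where "C > 0" "\<And>x. 0 < x \<Longrightarrow> norm (f x) \<le> C * g x"
proof -
  have "continuous_on {\<delta>..X} (\<lambda>x. norm (f x) / g x)"
  proof (intro continuous_on_divide continuous_on_norm continuous_on_subset[OF f] continuous_on_subset[OF g(1)])
    show "\<forall>x\<in>{\<delta>..X}. g x \<noteq> 0"
    proof
      fix x assume "x \<in> {\<delta>..X}"
      then show "g x \<noteq> 0" using g(2)[of x] \<delta>(1) by simp
    qed
  qed (use \<delta>(1) in auto)
  then have "bounded ((\<lambda>x. norm (f x) / g x) ` {\<delta>..X})"
    by (intro compact_imp_bounded compact_continuous_image) auto
  then obtain C3 where C3: "\<And>x. x \<in> {\<delta>..X} \<Longrightarrow> norm (norm (f x) / g x) \<le> C3"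
    unfolding bounded_iff by blast
  define C where "C = 1 + \<bar>C1\<bar> + \<bar>C2\<bar> + \<bar>C3\<bar>"
  have "norm (f x) \<le> C * g x" if x: "0 < x" for x
  proof -
    have le: "c * g x \<le> C * g x" if "c \<le> C" for c using g(2)[OF x] that by (intro mult_right_mono) auto
    consider "x < \<delta>" | "X \<le> x" | "x \<in> {\<delta>..X}" by force
    then show ?thesis
    proof cases
      case 1
      then show ?thesis using \<delta>(2)[OF x] le[of C1] by (simp add: C_def) linarith
    next
      case 2
      then show ?thesis using X[of x] le[of C2] by (simp add: C_def) linarith
    next
      case 3
      have "norm (f x) \<le> C3 * g x" using C3[OF 3] g(2)[OF x] by (simp add: field_simps)
      then show ?thesis using le[of C3] by (simp add: C_def) linarith
    qed
  qed
  moreover have "C > 0" by (simp add: C_def)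
  ultimately show ?thesis using that by blast
qed

lemma quotient_deriv:
  fixes y s :: "real \<Rightarrow> complex"
  assumes "(y has_vector_derivative y1) (at x)" "(s has_vector_derivative s1) (at x)" "s x \<noteq> 0"
  shows "((\<lambda>x. y x / s x) has_vector_derivative ((y1 * s x - y x * s1) / (s x)\<^sup>2)) (at x)"
proof -
  have "((\<lambda>x. inverse (s x)) has_vector_derivative (- (inverse (s x) * s1 * inverse (s x)))) (at x)"
    using Deriv.has_derivative_inverse[OF assms(3) assms(2)[unfolded has_vector_derivative_def]]
    by (simp add: has_vector_derivative_def)
  from has_vector_derivative_mult[OF assms(1) this] show ?thesis
    using assms(3) by (simp add: field_simps power2_eq_square)
qed

lemma jost_solutionD:
  assumes "jost_solution k q y y1"
  obtains X where "X > 0" "\<And>x. X \<le> x \<Longrightarrow> exp (- Re k * x) / 2 \<le> norm (y x) \<and> norm (y x) \<le> 2 * exp (- Re k * x)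
      \<and> norm (y1 x) \<le> (norm k + 1) * exp (- Re k * x)"
proof -
  have l: "((\<lambda>x. exp (k * of_real x) * y x) \<longlongrightarrow> 1) at_top" "((\<lambda>x. exp (k * of_real x) * y1 x) \<longlongrightarrow> - k) at_top"
    using assms by (auto simp: jost_solution_def)
  have "((\<lambda>x. norm (exp (k * of_real x) * y x)) \<longlongrightarrow> norm (1::complex)) at_top"
    by (intro tendsto_norm l)
  then have "\<forall>\<^sub>F x in at_top. norm (exp (k * of_real x) * y x) > 1 / 2" "\<forall>\<^sub>F x in at_top. norm (exp (k * of_real x) * y x) < 2"
    by (rule order_tendstoD; simp)+
  moreover have "((\<lambda>x. norm (exp (k * of_real x) * y1 x)) \<longlongrightarrow> norm (- k)) at_top"
    by (intro tendsto_norm l)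
  then have "\<forall>\<^sub>F x in at_top. norm (exp (k * of_real x) * y1 x) < norm k + 1"
    by (rule order_tendstoD) simp
  ultimately have "\<forall>\<^sub>F x in at_top. exp (- Re k * x) / 2 \<le> norm (y x) \<and> norm (y x) \<le> 2 * exp (- Re k * x)
      \<and> norm (y1 x) \<le> (norm k + 1) * exp (- Re k * x)"
    by eventually_elim (simp add: norm_mult exp_minus field_simps)
  then obtain X where "\<And>x. X \<le> x \<Longrightarrow> exp (- Re k * x) / 2 \<le> norm (y x) \<and> norm (y x) \<le> 2 * exp (- Re k * x)
      \<and> norm (y1 x) \<le> (norm k + 1) * exp (- Re k * x)" unfolding eventually_at_top_linorder by blast
  then show ?thesis using that[of "max X 1"] by simp
qed

lemma csqrt_neg_Re_pos:
  assumes "z \<notin> complex_of_real ` {0..}"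
  shows "0 < Re (csqrt (- z))"
proof (rule ccontr)
  assume "\<not> 0 < Re (csqrt (- z))"
  then have R: "Re (csqrt (- z)) = 0" using csqrt_principal[of "- z"] by auto
  then have "csqrt (- z) = \<i> * of_real (Im (csqrt (- z)))" by (simp add: complex_eq_iff)
  then have "(csqrt (- z))\<^sup>2 = (\<i> * of_real (Im (csqrt (- z))))\<^sup>2" by metis
  then have "- z = - of_real ((Im (csqrt (- z)))\<^sup>2)" by (simp add: power_mult_distrib)
  then have "z = of_real ((Im (csqrt (- z)))\<^sup>2)" by (metis minus_minus)
  then show False using assms by (metis atLeast_iff imageI zero_le_power2)
qed

section \<open>Square integrable solutions and the growth of solutions at the two ends\<close>

context inverse_square_potential
begin

lemma regular_nonzero:
  assumes "regular_at_zero q s s1" "0 < r"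
  obtains a where "0 < a" "a < r" "s a \<noteq> 0"
proof -
  obtain \<delta> where \<delta>: "\<delta> > 0" "\<And>x. x \<in> {0<..<\<delta>} \<Longrightarrow> x\<^sup>2 / 2 \<le> norm (s x)"
    using assms unfolding regular_at_zero_def by blast
  define a where "a = min \<delta> r / 2"
  have a: "0 < a" "a < r" "a < \<delta>" using \<delta> assms(2) by (auto simp: a_def)
  then have "0 < norm (s a)" using \<delta>(2)[of a] by (smt (verit) greaterThanLessThan_iff half_gt_zero zero_less_power)
  then show ?thesis using that a by simp
qed

lemma sq_bounded_multiple_of_regular:
  fixes y :: "real \<Rightarrow> 'a::{real_normed_field,real_inner,banach}"
  assumes y: "ode_solution {0<..<r} (V_shift z) y y1" and r: "0 < r" and s: "regular_at_zero (V_shift z) s s1"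
    and L2: "sq_bounded {0<..<r} y"
  obtains c where "\<And>x. x \<in> {0<..<r} \<Longrightarrow> y x = c * s x \<and> y1 x = c * s1 x"
proof -
  obtain K \<delta> where \<delta>: "\<delta> > 0" and K: "\<And>x. x \<in> {0<..<\<delta>} \<Longrightarrow> norm (s x) \<le> K * x\<^sup>2 \<and> norm (s1 x) \<le> K * x"
    using s unfolding regular_at_zero_def by blast
  have so: "ode_solution {0<..} (V_shift z) s s1" using s by (simp add: regular_at_zero_def)
  have "0 < min r \<delta>" using r \<delta> by simp
  from regular_nonzero[OF s this] obtain a where a: "0 < a" "a < min r \<delta>" "s a \<noteq> 0" .
  have W: "y a * s1 a - y1 a * s a = 0"
  proof (rule wronskian_zero_at_zero)
    show "ode_solution {0<..<min r \<delta>} (V_shift z) y y1" by (rule ode_solution_subset[OF y]) auto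
    show "ode_solution {0<..<min r \<delta>} (V_shift z) s s1" by (rule ode_solution_subset[OF so]) auto
    show "sq_bounded {0<..<min r \<delta>} y" by (rule sq_bounded_subset[OF L2]) auto
  qed (use r \<delta> K a in auto)
  have so': "ode_solution {0<..<r} (V_shift z) s s1" by (rule ode_solution_subset[OF so]) auto
  show ?thesis
  proof (rule wronskian_zero_imp_proportional[OF y so' _ _ _ _ W])
    show "continuous_on {0<..<r} (V_shift z :: real \<Rightarrow> 'a)" by (rule continuous_on_subset[OF V_shift_cont]) auto
  qed (use a that in \<open>auto simp: is_interval_oo\<close>)
qed

lemma ode_multiple_extend:
  fixes y s :: "real \<Rightarrow> 'a::{real_normed_field,real_inner}"
  assumes y: "ode_solution {0<..} (V_shift z) y y1" and s: "ode_solution {0<..} (V_shift z) s s1"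
    and a: "0 < a" "y a = c * s a" "y1 a = c * s1 a" and x: "0 < x"
  shows "y x = c * s x \<and> y1 x = c * s1 x"
proof -
  have "ode_solution {0<..} (V_shift z) (\<lambda>x. 1 * y x + (- c) * s x) (\<lambda>x. 1 * y1 x + (- c) * s1 x)"
    by (rule ode_solution_lincomb[OF y s])
  then have "1 * y x + (- c) * s x = 0 \<and> 1 * y1 x + (- c) * s1 x = 0"
    by (rule ode_solution_unique[where a = a]) (use a x V_shift_cont in \<open>auto simp: is_interval_1\<close>)
  then show ?thesis by (auto simp: add_eq_0_iff2)
qed

lemma sq_bounded_multiple_of_regular':
  fixes y :: "real \<Rightarrow> 'a::{real_normed_field,real_inner,banach}"
  assumes y: "ode_solution {0<..} (V_shift z) y y1" and s: "regular_at_zero (V_shift z) s s1"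
    and L2: "sq_bounded {0<..<1} y"
  obtains c where "\<And>x. 0 < x \<Longrightarrow> y x = c * s x \<and> y1 x = c * s1 x"
proof -
  have y': "ode_solution {0<..<1} (V_shift z) y y1" by (rule ode_solution_subset[OF y]) auto
  obtain c where c: "\<And>x. x \<in> {0<..<1} \<Longrightarrow> y x = c * s x \<and> y1 x = c * s1 x"
    using sq_bounded_multiple_of_regular[OF y' _ s L2] by auto
  have so: "ode_solution {0<..} (V_shift z) s s1" using s by (simp add: regular_at_zero_def)
  have c2: "y (1/2) = c * s (1/2)" "y1 (1/2) = c * s1 (1/2)" using c[of "1/2"] by auto
  show ?thesis by (rule that[OF ode_multiple_extend[OF y so _ c2]]) auto
qed

text \<open>The Wronskian with the Jost solution vanishes at infinity, which forces proportionality.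
  If Re k = 0, the Jost solution keeps modulus at least 1 / 2, so a nonzero multiple would carry a
  fixed amount of L2 norm on every unit interval far out.\<close>

lemma sq_bounded_multiple_of_jost:
  assumes k: "0 \<le> Re k" and y: "ode_solution {R<..} (V_shift z) y y1" and R: "0 \<le> R"
    and p: "jost_solution k (V_shift z) p p1" and L2: "sq_bounded {R<..} y"
  obtains c where "\<And>x. x > R \<Longrightarrow> y x = c * p x \<and> y1 x = c * p1 x" "Re k = 0 \<longrightarrow> c = 0"
proof -
  obtain X where X: "X > 0" "\<And>x. X \<le> x \<Longrightarrow> exp (- Re k * x) / 2 \<le> norm (p x) \<and> norm (p x) \<le> 2 * exp (- Re k * x)
      \<and> norm (p1 x) \<le> (norm k + 1) * exp (- Re k * x)" using jost_solutionD[OF p] by blast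
  have po: "ode_solution {0<..} (V_shift z) p p1" using p by (simp add: jost_solution_def)
  define R' where "R' = max R X"
  define a where "a = R' + 1"
  have a: "a > R'" "a > R" "a > X" by (auto simp: a_def R'_def)
  have le1: "exp (- Re k * x) \<le> 1" if "x > R'" for x
  proof -
    have "0 \<le> Re k * x" using k that X(1) by (auto simp: R'_def)
    then show ?thesis by simp
  qed
  have W: "y a * p1 a - y1 a * p a = 0"
  proof (rule wronskian_zero_at_infinity)
    show "ode_solution {R'<..} (V_shift z) y y1" by (rule ode_solution_subset[OF y]) (auto simp: R'_def)
    show "ode_solution {R'<..} (V_shift z) p p1" by (rule ode_solution_subset[OF po]) (use R in \<open>auto simp: R'_def\<close>)
    show "sq_bounded {R'<..} y" by (rule sq_bounded_subset[OF L2]) (auto simp: R'_def)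
    fix x assume x: "x > R'"
    then have b: "norm (p x) \<le> 2 * exp (- Re k * x)" "norm (p1 x) \<le> (norm k + 1) * exp (- Re k * x)"
      using X(2)[of x] by (auto simp: R'_def)
    have le: "2 * exp (- Re k * x) \<le> (norm k + 2) * 1" "(norm k + 1) * exp (- Re k * x) \<le> (norm k + 2) * 1"
      using le1[OF x] by (intro mult_mono; simp)+
    then show "norm (p x) \<le> norm k + 2 \<and> norm (p1 x) \<le> norm k + 2" using order_trans[OF b(1) le(1)] order_trans[OF b(2) le(2)] by simp
  qed (rule a)
  have po': "ode_solution {R<..} (V_shift z) p p1" by (rule ode_solution_subset[OF po]) (use R in auto)
  have pa: "p a \<noteq> 0" using X(2)[of a] a by (smt (verit) exp_gt_zero half_gt_zero norm_zero)
  obtain c where c: "\<And>x. x \<in> {R<..} \<Longrightarrow> y x = c * p x \<and> y1 x = c * p1 x"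
  proof (rule wronskian_zero_imp_proportional[OF y po' _ _ _ _ W])
    show "continuous_on {R<..} (V_shift z :: real \<Rightarrow> complex)" by (rule continuous_on_subset[OF V_shift_cont]) (use R in auto)
  qed (use a pa in \<open>auto simp: is_interval_1\<close>)
  have "c = 0" if k0: "Re k = 0"
  proof (rule ccontr)
    assume c0: "c \<noteq> 0"
    have L2': "sq_bounded {R'<..} y" by (rule sq_bounded_subset[OF L2]) (auto simp: R'_def)
    have yc: "continuous_on {R'<..} y"
      by (rule continuous_on_subset[OF ode_solution_continuous(1)[OF y]]) (auto simp: R'_def)
    obtain b where b: "b > R'" "integral {b..b+1} (\<lambda>x. (norm (y x))\<^sup>2) \<le> (norm c)\<^sup>2 / 8"
      using sq_bounded_small_integral[OF L2' yc, of "(norm c)\<^sup>2 / 8"] c0 by auto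
    have "integral {b..b+1} (\<lambda>x. (norm c)\<^sup>2 / 4) \<le> integral {b..b+1} (\<lambda>x. (norm (y x))\<^sup>2)"
    proof (rule integral_le)
      show "(\<lambda>x. (norm (y x))\<^sup>2) integrable_on {b..b+1}"
        by (intro integrable_continuous_real continuous_intros continuous_on_subset[OF yc]) (use b in auto)
      fix x assume x: "x \<in> {b..b+1}"
      then have xR: "x \<ge> X" "x > R" using b by (auto simp: R'_def)
      have "1 / 2 \<le> norm (p x)" using X(2)[OF xR(1)] k0 by simp
      then have "norm c * (1 / 2) \<le> norm c * norm (p x)" by (rule mult_left_mono) simp
      then have "norm c * (1 / 2) \<le> norm (y x)" using c[of x] xR by (simp add: norm_mult)
      then have "(norm c * (1 / 2))\<^sup>2 \<le> (norm (y x))\<^sup>2" by (intro power_mono) auto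
      then show "(norm c)\<^sup>2 / 4 \<le> (norm (y x))\<^sup>2" by (simp add: power_mult_distrib power2_eq_square)
    qed auto
    then have "integral {b..b+1} (\<lambda>x. (norm c)\<^sup>2 / 4) \<le> (norm c)\<^sup>2 / 8" using b(2) by (rule order_trans)
    then have "(norm c)\<^sup>2 / 4 \<le> (norm c)\<^sup>2 / 8" by simp
    moreover have "0 < (norm c)\<^sup>2" using c0 by simp
    ultimately show False by linarith
  qed
  then show ?thesis using that[of c] c by simp
qed

text \<open>Formulated on {R<..} because it is applied not only to the whole half line but also
  beyond the support of a bump datum.\<close>

lemma no_sq_bounded_nonneg:
  fixes y :: "real \<Rightarrow> complex"
  assumes y: "ode_solution {R<..} (V_shift (of_real z)) y y1" and R: "0 \<le> R" and L2: "sq_bounded {R<..} y"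
    and z: "0 \<le> z" and x: "x > R"
  shows "y x = 0 \<and> y1 x = 0"
proof -
  define k where "k = \<i> * of_real (sqrt z)"
  have k: "Re k = 0" "- (k\<^sup>2) = of_real z" using z by (auto simp: k_def power_mult_distrib of_real_power[symmetric] simp del: of_real_power)
  obtain p p1 where p: "jost_solution k (V_shift (of_real z)) p p1"
    using jost_exists[of k] k by auto
  obtain c where "\<And>x. x > R \<Longrightarrow> y x = c * p x \<and> y1 x = c * p1 x" "c = 0"
    using sq_bounded_multiple_of_jost[OF _ y R p L2] k by auto
  then show ?thesis using x by simp
qed

text \<open>Symmetry of the operator made explicit: Im (cnj y * y1) / (- Im z) has derivative |y|^2
  and tends to 0 at both ends, because y is a multiple of the regular solution and also of the Jost
  solution. Being monotone, it vanishes identically.\<close>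

lemma no_sq_bounded_nonreal:
  assumes y: "ode_solution {0<..} (V_shift z) y y1" and L2: "sq_bounded {0<..} y" and z: "Im z \<noteq> 0" and x: "0 < x"
  shows "y x = 0"
proof -
  have zn: "z \<notin> complex_of_real ` {0..}" using z by auto
  define k where "k = csqrt (- z)"
  have k: "0 < Re k" "- (k\<^sup>2) = z" using csqrt_neg_Re_pos[OF zn] by (auto simp: k_def)
  obtain p p1 where p: "jost_solution k (V_shift z) p p1" using jost_exists[of k] k by auto
  obtain c where c: "\<And>x. x > 0 \<Longrightarrow> y x = c * p x \<and> y1 x = c * p1 x"
    using sq_bounded_multiple_of_jost[OF _ y _ p L2] k by auto
  have L2': "sq_bounded {0<..<1} y" by (rule sq_bounded_subset[OF L2]) auto
  obtain d where d: "\<And>x. 0 < x \<Longrightarrow> y x = d * reg z x \<and> y1 x = d * reg1 z x"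
    using sq_bounded_multiple_of_regular'[OF y reg_regular L2'] by blast
  define P where "P x = Im (cnj (y x) * y1 x) / (- Im z)" for x
  have dP: "(P has_real_derivative (norm (y x))\<^sup>2) (at x)" if x: "0 < x" for x
  proof -
    note dy = ode_solutionD[OF y, of x]
    have "((\<lambda>x. cnj (y x) * y1 x) has_vector_derivative (cnj (y x) * (V_shift z x * y x) + cnj (y1 x) * y1 x)) (at x)"
      using x by (intro has_vector_derivative_mult has_vector_derivative_cnj dy) auto
    from bounded_linear.has_vector_derivative[OF bounded_linear_Im this]
    have "((\<lambda>x. Im (cnj (y x) * y1 x)) has_real_derivative Im (cnj (y x) * (V_shift z x * y x) + cnj (y1 x) * y1 x)) (at x)"
      by (simp add: has_real_derivative_iff_has_vector_derivative)
    then have "(P has_real_derivative Im (cnj (y x) * (V_shift z x * y x) + cnj (y1 x) * y1 x) / (- Im z)) (at x)"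
      unfolding P_def by (rule DERIV_cdivide)
    moreover have "Im (cnj (y x) * (V_shift z x * y x) + cnj (y1 x) * y1 x) = - Im z * (norm (y x))\<^sup>2"
      unfolding cmod_power2 by (simp add: V_shift_def algebra_simps power2_eq_square)
    ultimately show ?thesis using z by simp
  qed
  have mono: "P a \<le> P b" if "0 < a" "a \<le> b" for a b
  proof (rule DERIV_nonneg_imp_nondecreasing[OF that(2)])
    fix t assume "a \<le> t" "t \<le> b"
    then have "0 < t" using that by simp
    then show "\<exists>d. (P has_real_derivative d) (at t) \<and> 0 \<le> d" using dP zero_le_power2 by blast
  qed
  have Pn: "norm (P x) \<le> norm (y x) * norm (y1 x) / \<bar>Im z\<bar>" for x
    unfolding P_def using abs_Im_le_cmod[of "cnj (y x) * y1 x"] by (simp add: norm_mult divide_right_mono)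
  have "(P \<longlongrightarrow> 0) at_top"
  proof -
    obtain X where X: "\<And>x. X \<le> x \<Longrightarrow> norm (p x) \<le> 2 * exp (- Re k * x)
      \<and> norm (p1 x) \<le> (norm k + 1) * exp (- Re k * x)" using jost_solutionD[OF p] by metis
    have ev: "\<forall>\<^sub>F x in at_top. norm (P x) \<le> (norm c * 2) * (norm c * (norm k + 1)) / \<bar>Im z\<bar> * exp (- 2 * Re k * x)"
      using eventually_ge_at_top[of "max X 1"]
    proof eventually_elim
      case (elim x)
      have "norm (y x) \<le> norm c * (2 * exp (- Re k * x))" "norm (y1 x) \<le> norm c * ((norm k + 1) * exp (- Re k * x))"
        using c[of x] X[of x] elim by (auto simp: norm_mult intro!: mult_left_mono)
      then have "norm (y x) * norm (y1 x) \<le> (norm c * (2 * exp (- Re k * x))) * (norm c * ((norm k + 1) * exp (- Re k * x)))"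
        by (intro mult_mono) auto
      also have "\<dots> = (norm c * 2) * (norm c * (norm k + 1)) * exp (- 2 * Re k * x)"
        by (simp add: exp_add[symmetric] algebra_simps)
      finally have "norm (y x) * norm (y1 x) / \<bar>Im z\<bar> \<le> (norm c * 2) * (norm c * (norm k + 1)) * exp (- 2 * Re k * x) / \<bar>Im z\<bar>"
        by (rule divide_right_mono) simp
      then show ?case using Pn[of x] by simp
    qed
    have "((\<lambda>x. exp (- 2 * Re k * x)) \<longlongrightarrow> 0) at_top" using k(1) by real_asymp
    then have "((\<lambda>x. (norm c * 2) * (norm c * (norm k + 1)) / \<bar>Im z\<bar> * exp (- 2 * Re k * x)) \<longlongrightarrow> 0) at_top"
      by (rule tendsto_mult_right_zero)
    then show ?thesis by (rule Lim_null_comparison[OF ev])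
  qed
  moreover have "\<forall>\<^sub>F t in at_top. P x \<le> P t" if "0 < x" for x
    using eventually_ge_at_top[of x] by eventually_elim (use mono that in auto)
  ultimately have le0: "P x \<le> 0" if "0 < x" for x
    using tendsto_lowerbound[of P 0 at_top "P x"] that by auto
  have "(P \<longlongrightarrow> 0) (at_right 0)"
  proof -
    obtain K \<delta> where \<delta>: "\<delta> > 0" and K: "\<And>x. x \<in> {0<..<\<delta>} \<Longrightarrow> norm (reg z x) \<le> K * x\<^sup>2 \<and> norm (reg1 z x) \<le> K * x"
      using reg_regular[of z] unfolding regular_at_zero_def by blast
    have "\<forall>\<^sub>F x in at_right 0. 0 < x \<and> x < \<delta>" using \<delta> eventually_at_right_field by blast
    then have ev: "\<forall>\<^sub>F x in at_right 0. norm (P x) \<le> (norm d * (K * x\<^sup>2)) * (norm d * (K * x)) / \<bar>Im z\<bar>"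
    proof eventually_elim
      case (elim x)
      have a: "norm (y x) \<le> norm d * (K * x\<^sup>2)" "norm (y1 x) \<le> norm d * (K * x)"
        using d[of x] K[of x] elim by (auto simp: norm_mult intro!: mult_left_mono)
      then have "norm (y x) * norm (y1 x) \<le> (norm d * (K * x\<^sup>2)) * (norm d * (K * x))"
        by (intro mult_mono a order_trans[OF norm_ge_zero a(1)] norm_ge_zero)
      then have "norm (y x) * norm (y1 x) / \<bar>Im z\<bar> \<le> (norm d * (K * x\<^sup>2)) * (norm d * (K * x)) / \<bar>Im z\<bar>"
        by (rule divide_right_mono) simp
      then show ?case using Pn[of x] by simp
    qed
    have "((\<lambda>x. (norm d * (K * x\<^sup>2)) * (norm d * (K * x)) / \<bar>Im z\<bar>) \<longlongrightarrow> (norm d * (K * 0\<^sup>2)) * (norm d * (K * 0)) / \<bar>Im z\<bar>) (at_right 0)"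
      using z by (intro tendsto_intros) auto
    then show ?thesis by (intro Lim_null_comparison[OF ev]) simp
  qed
  moreover have "\<forall>\<^sub>F t in at_right 0. P t \<le> P x" if "0 < x" for x
  proof -
    have "\<forall>\<^sub>F t in at_right 0. 0 < t \<and> t < x" using that eventually_at_right_field by blast
    then show ?thesis by eventually_elim (use mono in auto)
  qed
  ultimately have "0 \<le> P x" if "0 < x" for x
    using tendsto_upperbound[of P 0 "at_right 0" "P x"] that by auto
  then have P0: "P x = 0" if "0 < x" for x using le0 that by (simp add: order_antisym)
  have "((\<lambda>_. 0::real) has_real_derivative (norm (y x))\<^sup>2) (at x)"
    by (rule DERIV_cong_ev[OF refl _ refl, THEN iffD1, OF _ dP[OF x]])
      (use x P0 in \<open>auto intro!: eventually_mono[OF eventually_nhds_in_open[of "{0<..}" x]]\<close>)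
  then have "(norm (y x))\<^sup>2 = 0" using DERIV_unique DERIV_const by blast
  then show ?thesis by simp
qed

text \<open>Reduction of order: (y / s)' = - W / s^2 is O(x^(-4)), hence y / s = O(x^(-3)) and y =
  O(1 / x).\<close>

lemma solution_bound_at_zero:
  fixes y :: "real \<Rightarrow> complex"
  assumes y: "ode_solution {0<..} (V_shift z) y y1" and s: "regular_at_zero (V_shift z) s s1"
  obtains M \<delta> where "0 < \<delta>" "\<And>x. 0 < x \<Longrightarrow> x < \<delta> \<Longrightarrow> norm (y x) \<le> M / x"
proof -
  have so: "ode_solution {0<..} (V_shift z) s s1" using s by (simp add: regular_at_zero_def)
  obtain K \<delta> where K: "K > 0" and \<delta>: "\<delta> > 0" and Ks: "\<And>x. x \<in> {0<..<\<delta>} \<Longrightarrow> norm (s x) \<le> K * x\<^sup>2 \<and> x\<^sup>2 / 2 \<le> norm (s x)"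
    using s unfolding regular_at_zero_def by blast
  obtain W where W: "\<And>x. x \<in> {0<..} \<Longrightarrow> y x * s1 x - y1 x * s x = W"
    using wronskian_constant[OF y so] by (metis convex_real_interval(3))
  define b where "b = min (\<delta> / 2) 1"
  have b: "0 < b" "b < \<delta>" "b \<le> 1" using \<delta> by (auto simp: b_def)
  define N where "N = norm (y b / s b)"
  have "norm (y x) \<le> (K * (N + 4 * norm W)) / x" if x: "0 < x" "x < b" for x
  proof -
    have "norm (y b / s b - y x / s x) \<le> (- (4 * norm W / 3) * (1 / b ^ 3)) - (- (4 * norm W / 3) * (1 / x ^ 3))"
    proof (rule norm_diff_le_deriv_bound)
      show "x \<le> b" using x by simp
      fix t assume t: "t \<in> {x..b}"
      then have t': "t \<in> {0<..<\<delta>}" "t \<in> {0<..}" using x b by auto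
      have st: "t\<^sup>2 / 2 \<le> norm (s t)" using Ks[OF t'(1)] by simp
      then have s0: "s t \<noteq> 0" using t' by (auto simp: power2_eq_square mult_le_0_iff)
      show "((\<lambda>x. y x / s x) has_vector_derivative ((y1 t * s t - y t * s1 t) / (s t)\<^sup>2)) (at t)"
        by (rule quotient_deriv[OF ode_solutionD(1)[OF y t'(2)] ode_solutionD(1)[OF so t'(2)] s0])
      show "((\<lambda>x. - (4 * norm W / 3) * (1 / x ^ 3)) has_real_derivative 4 * norm W / t ^ 4) (at t)"
        using t' by (auto intro!: derivative_eq_intros simp: field_simps eval_nat_numeral)
      have "y1 t * s t - y t * s1 t = - W" using W[OF t'(2)] by (simp add: algebra_simps)
      then have "norm ((y1 t * s t - y t * s1 t) / (s t)\<^sup>2) = norm W / (norm (s t))\<^sup>2"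
        by (simp add: norm_divide norm_power)
      also have "\<dots> \<le> norm W / (t\<^sup>2 / 2)\<^sup>2"
        using st t' s0 by (intro divide_left_mono power_mono mult_pos_pos) auto
      also have "\<dots> = 4 * norm W / t ^ 4" by (simp add: power_divide power_mult[symmetric])
      finally show "norm ((y1 t * s t - y t * s1 t) / (s t)\<^sup>2) \<le> 4 * norm W / t ^ 4" .
    qed
    also have "\<dots> \<le> 4 * norm W / x ^ 3"
    proof -
      have "0 \<le> 4 * norm W / 3 * (1 / b ^ 3)" using b by simp
      moreover have "4 * norm W / 3 * (1 / x ^ 3) \<le> 4 * norm W / x ^ 3" using x by (simp add: field_simps)
      ultimately show ?thesis by linarith
    qed
    finally have "norm (y x / s x) \<le> N + 4 * norm W / x ^ 3"
      unfolding N_def using norm_triangle_sub[of "y x / s x" "y b / s b"] by (simp add: norm_minus_commute)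
    also have "\<dots> \<le> (N + 4 * norm W) / x ^ 3"
    proof -
      have "x ^ 3 \<le> 1" using x b by (intro power_le_one) auto
      then have "N \<le> N / x ^ 3" using x by (simp add: N_def le_divide_eq mult_left_le)
      then show ?thesis by (simp add: add_divide_distrib)
    qed
    finally have q: "norm (y x / s x) \<le> (N + 4 * norm W) / x ^ 3" .
    have s0: "s x \<noteq> 0" using Ks[of x] x b by (auto simp: power2_eq_square mult_le_0_iff)
    have "norm (y x) = norm (s x) * norm (y x / s x)" using s0 by (simp add: norm_divide)
    also have "\<dots> \<le> (K * x\<^sup>2) * ((N + 4 * norm W) / x ^ 3)"
      using Ks[of x] x b q K by (intro mult_mono) auto
    also have "\<dots> = (K * (N + 4 * norm W)) / x" using x by (simp add: field_simps eval_nat_numeral)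
    finally show ?thesis .
  qed
  then show ?thesis using that b(1) by blast
qed

text \<open>Reduction of order with the Jost solution: (y / p)' = - W / p^2 is O(exp (2 Re k x)),
  and multiplication by p leaves exp (Re k x).\<close>

lemma solution_bound_at_infinity:
  assumes y: "ode_solution {0<..} (V_shift z) y y1" and k: "0 < Re k" and p: "jost_solution k (V_shift z) p p1"
  obtains M X where "0 < X" "\<And>x. X \<le> x \<Longrightarrow> norm (y x) \<le> M * exp (Re k * x)"
proof -
  obtain X where X: "X > 0" "\<And>x. X \<le> x \<Longrightarrow> exp (- Re k * x) / 2 \<le> norm (p x) \<and> norm (p x) \<le> 2 * exp (- Re k * x)"
    using jost_solutionD[OF p] by metis
  have po: "ode_solution {0<..} (V_shift z) p p1" using p by (simp add: jost_solution_def)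
  obtain W where W: "\<And>x. x \<in> {0<..} \<Longrightarrow> y x * p1 x - y1 x * p x = W"
    using wronskian_constant[OF y po] by (metis convex_real_interval(3))
  define N where "N = norm (y X / p X)"
  define c where "c = 2 * norm W / Re k"
  have c0: "0 \<le> c" using k by (simp add: c_def)
  have "norm (y x) \<le> 2 * (N + c) * exp (Re k * x)" if x: "X \<le> x" for x
  proof -
    have p0: "p t \<noteq> 0" if "X \<le> t" for t using X(2)[OF that] by (smt (verit) exp_gt_zero half_gt_zero norm_zero)
    have "norm (y x / p x - y X / p X) \<le> c * exp (2 * Re k * x) - c * exp (2 * Re k * X)"
    proof (rule norm_diff_le_deriv_bound[OF x])
      fix t assume t: "t \<in> {X..x}"
      then have t': "X \<le> t" "t \<in> {0<..}" using X by auto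
      show "((\<lambda>x. y x / p x) has_vector_derivative ((y1 t * p t - y t * p1 t) / (p t)\<^sup>2)) (at t)"
        by (rule quotient_deriv[OF ode_solutionD(1)[OF y t'(2)] ode_solutionD(1)[OF po t'(2)] p0[OF t'(1)]])
      show "((\<lambda>x. c * exp (2 * Re k * x)) has_real_derivative 4 * norm W * exp (2 * Re k * t)) (at t)"
        using k by (auto intro!: derivative_eq_intros simp: c_def)
      have "y1 t * p t - y t * p1 t = - W" using W[OF t'(2)] by (simp add: algebra_simps)
      then have "norm ((y1 t * p t - y t * p1 t) / (p t)\<^sup>2) = norm W / (norm (p t))\<^sup>2"
        by (simp add: norm_divide norm_power)
      also have "\<dots> \<le> norm W / (exp (- Re k * t) / 2)\<^sup>2"
        using X(2)[OF t'(1)] p0[OF t'(1)] by (intro divide_left_mono power_mono mult_pos_pos) auto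
      also have "\<dots> = 4 * norm W * exp (2 * Re k * t)"
        by (simp add: power_divide exp_minus field_simps power2_eq_square exp_add[symmetric])
      finally show "norm ((y1 t * p t - y t * p1 t) / (p t)\<^sup>2) \<le> 4 * norm W * exp (2 * Re k * t)" .
    qed
    also have "\<dots> \<le> c * exp (2 * Re k * x)" using c0 by simp
    finally have "norm (y x / p x) \<le> N + c * exp (2 * Re k * x)"
      unfolding N_def using norm_triangle_sub[of "y x / p x" "y X / p X"] by simp
    also have "\<dots> \<le> (N + c) * exp (2 * Re k * x)"
    proof -
      have "1 \<le> exp (2 * Re k * x)" using k x X(1) by simp
      then have "N * 1 \<le> N * exp (2 * Re k * x)" by (intro mult_left_mono) (auto simp: N_def)
      then show ?thesis by (simp add: algebra_simps)
    qed
    finally have q: "norm (y x / p x) \<le> (N + c) * exp (2 * Re k * x)" .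
    have "norm (y x) = norm (p x) * norm (y x / p x)" using p0[OF x] by (simp add: norm_divide)
    also have "\<dots> \<le> (2 * exp (- Re k * x)) * ((N + c) * exp (2 * Re k * x))"
      using X(2)[OF x] q by (intro mult_mono) auto
    also have "\<dots> = 2 * (N + c) * exp (Re k * x)"
      by (simp add: exp_add[symmetric] algebra_simps)
    finally show ?thesis .
  qed
  then show ?thesis using that X(1) by blast
qed

text \<open>The order x^2 at the origin is weakened to x / (1 + x) on purpose: the Jost bound has
  the reciprocal factor, and since x / (1 + x) is increasing the two factors multiply to at most 1
  in the Green kernel, where t <= x.\<close>

lemma regular_bound:
  assumes s: "regular_at_zero (V_shift z) s s1" and k: "0 < Re k" and p: "jost_solution k (V_shift z) p p1"
  obtains M where "M > 0" "\<And>x. 0 < x \<Longrightarrow> norm (s x) \<le> M * (x / (1 + x) * exp (Re k * x))"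
proof -
  have so: "ode_solution {0<..} (V_shift z) s s1" using s by (simp add: regular_at_zero_def)
  obtain K \<delta> where K: "K > 0" and \<delta>: "\<delta> > 0" and Ks: "\<And>x. x \<in> {0<..<\<delta>} \<Longrightarrow> norm (s x) \<le> K * x\<^sup>2"
    using s unfolding regular_at_zero_def by blast
  obtain M X where X: "0 < X" and M: "\<And>x. X \<le> x \<Longrightarrow> norm (s x) \<le> M * exp (Re k * x)"
    using solution_bound_at_infinity[OF so k p] by blast
  show ?thesis
  proof (rule bound_from_ends)
    show "continuous_on {0<..} s" by (rule ode_solution_continuous(1)[OF so])
    show "continuous_on {0<..} (\<lambda>x. x / (1 + x) * exp (Re k * x))" by (intro continuous_intros) auto
    show "0 < x / (1 + x) * exp (Re k * x)" if "0 < x" for x using that by simp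
    show "0 < min \<delta> 1" using \<delta> by simp
    show "norm (s x) \<le> (2 * K) * (x / (1 + x) * exp (Re k * x))" if x: "0 < x" "x < min \<delta> 1" for x
    proof -
      have "norm (s x) \<le> K * x\<^sup>2" using Ks x by simp
      also have "\<dots> \<le> K * (2 * (x / (1 + x)) * 1)"
      proof (intro mult_left_mono)
        have "x * (1 + x) \<le> 2" using x mult_mono[of x 1 "1 + x" 2] by simp
        then have "x * (x * (1 + x)) \<le> x * 2" using x by (intro mult_left_mono) auto
        then show "x\<^sup>2 \<le> 2 * (x / (1 + x)) * 1" using x by (simp add: field_simps power2_eq_square)
      qed (use K in auto)
      also have "\<dots> \<le> K * (2 * (x / (1 + x)) * exp (Re k * x))"
        using K x k by (intro mult_left_mono) auto
      also have "\<dots> = (2 * K) * (x / (1 + x) * exp (Re k * x))" by (simp only: mult.assoc mult.left_commute mult.commute)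
      finally show ?thesis .
    qed
    show "norm (s x) \<le> (\<bar>M\<bar> * (1 + 1 / X)) * (x / (1 + x) * exp (Re k * x))" if x: "X \<le> x" for x
    proof -
      have "1 \<le> (1 + 1 / X) * (x / (1 + x))"
      proof -
        have "0 < x" using x X by simp
        then have "0 < X + X * x" using X by (intro add_pos_pos) auto
        moreover have "X + X * x \<le> x + X * x" using x by simp
        moreover have "(1 + 1 / X) * (x / (1 + x)) = (x + X * x) / (X + X * x)" using X \<open>0 < x\<close> by (simp add: field_simps)
        ultimately show ?thesis by simp
      qed
      then have "\<bar>M\<bar> * exp (Re k * x) * 1 \<le> \<bar>M\<bar> * exp (Re k * x) * ((1 + 1 / X) * (x / (1 + x)))"
        by (intro mult_left_mono) auto
      moreover have "M * exp (Re k * x) \<le> \<bar>M\<bar> * exp (Re k * x)" by (intro mult_right_mono) auto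
      ultimately have "norm (s x) \<le> \<bar>M\<bar> * exp (Re k * x) * ((1 + 1 / X) * (x / (1 + x)))" using M[OF x] by linarith
      also have "\<dots> = (\<bar>M\<bar> * (1 + 1 / X)) * (x / (1 + x) * exp (Re k * x))" by (simp only: mult.assoc mult.left_commute mult.commute)
      finally show ?thesis .
    qed
  qed (rule that)
qed

lemma jost_bound:
  assumes s: "regular_at_zero (V_shift z) s s1" and k: "0 < Re k" and p: "jost_solution k (V_shift z) p p1"
  obtains M where "M > 0" "\<And>x. 0 < x \<Longrightarrow> norm (p x) \<le> M * ((1 + x) / x * exp (- Re k * x))"
proof -
  have po: "ode_solution {0<..} (V_shift z) p p1" using p by (simp add: jost_solution_def)
  obtain M \<delta> where \<delta>: "0 < \<delta>" and M: "\<And>x. 0 < x \<Longrightarrow> x < \<delta> \<Longrightarrow> norm (p x) \<le> M / x"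
    using solution_bound_at_zero[OF po s] by metis
  obtain X where X: "X > 0" "\<And>x. X \<le> x \<Longrightarrow> norm (p x) \<le> 2 * exp (- Re k * x)"
    using jost_solutionD[OF p] by metis
  show ?thesis
  proof (rule bound_from_ends)
    show "continuous_on {0<..} p" by (rule ode_solution_continuous(1)[OF po])
    show "continuous_on {0<..} (\<lambda>x. (1 + x) / x * exp (- Re k * x))" by (intro continuous_intros) auto
    show "0 < (1 + x) / x * exp (- Re k * x)" if "0 < x" for x using that by simp
    show "norm (p x) \<le> (\<bar>M\<bar> * exp (Re k * \<delta>)) * ((1 + x) / x * exp (- Re k * x))" if x: "0 < x" "x < \<delta>" for x
    proof -
      have "M * 1 \<le> \<bar>M\<bar> * (exp (Re k * \<delta>) * exp (- Re k * x) * (1 + x))"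
      proof (rule mult_mono)
        have "1 \<le> exp (Re k * (\<delta> - x))" using x k by simp
        then have "1 * 1 \<le> exp (Re k * (\<delta> - x)) * (1 + x)" using x by (intro mult_mono) auto
        then show "1 \<le> exp (Re k * \<delta>) * exp (- Re k * x) * (1 + x)"
          by (simp add: exp_add[symmetric] algebra_simps)
      qed auto
      then have "M * 1 / x \<le> \<bar>M\<bar> * (exp (Re k * \<delta>) * exp (- Re k * x) * (1 + x)) / x"
        using x by (intro divide_right_mono) auto
      also have "\<dots> = (\<bar>M\<bar> * exp (Re k * \<delta>)) * ((1 + x) / x * exp (- Re k * x))"
        by (simp only: divide_inverse mult.assoc mult.left_commute mult.commute)
      finally show ?thesis using M[OF x] by linarith
    qed
    show "norm (p x) \<le> 2 * ((1 + x) / x * exp (- Re k * x))" if x: "X \<le> x" for x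
    proof -
      have "2 * exp (- Re k * x) * 1 \<le> 2 * exp (- Re k * x) * ((1 + x) / x)"
        using x X(1) by (intro mult_left_mono) auto
      also have "\<dots> = 2 * ((1 + x) / x * exp (- Re k * x))" by (simp only: mult.assoc mult.left_commute mult.commute)
      finally show ?thesis using X(2)[OF x] by linarith
    qed
  qed (rule \<delta>, rule that)
qed

lemma green_kernel_bound:
  assumes s: "regular_at_zero (V_shift z) s s1" and k: "0 < Re k" and p: "jost_solution k (V_shift z) p p1"
  obtains M where "M > 0" "\<And>t x. 0 < t \<Longrightarrow> t \<le> x \<Longrightarrow> norm (s t) * norm (p x) \<le> M * exp (- Re k * (x - t))"
proof -
  obtain M1 where M1: "M1 > 0" "\<And>x. 0 < x \<Longrightarrow> norm (s x) \<le> M1 * (x / (1 + x) * exp (Re k * x))"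
    using regular_bound[OF assms] by blast
  obtain M2 where M2: "M2 > 0" "\<And>x. 0 < x \<Longrightarrow> norm (p x) \<le> M2 * ((1 + x) / x * exp (- Re k * x))"
    using jost_bound[OF assms] by blast
  have "norm (s t) * norm (p x) \<le> (M1 * M2) * exp (- Re k * (x - t))" if t: "0 < t" "t \<le> x" for t x
  proof -
    have "norm (s t) * norm (p x) \<le> (M1 * (t / (1 + t) * exp (Re k * t))) * (M2 * ((1 + x) / x * exp (- Re k * x)))"
      using M1(1) M2(1) t by (intro mult_mono M1(2) M2(2)) auto
    also have "\<dots> = (M1 * M2) * (exp (Re k * t) * exp (- Re k * x)) * (t / (1 + t) * ((1 + x) / x))"
      by (simp only: mult.assoc mult.left_commute mult.commute)
    also have "\<dots> \<le> (M1 * M2) * (exp (Re k * t) * exp (- Re k * x)) * 1"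
    proof (rule mult_left_mono)
      have "0 < x + t * x" using t by (intro add_pos_pos) auto
      moreover have "t / (1 + t) * ((1 + x) / x) = (t + t * x) / (x + t * x)" using t by (simp add: field_simps)
      ultimately show "t / (1 + t) * ((1 + x) / x) \<le> 1" using t by simp
    qed (use M1 M2 in auto)
    also have "\<dots> = (M1 * M2) * exp (- Re k * (x - t))"
      by (simp add: exp_add[symmetric] algebra_simps)
    finally show ?thesis .
  qed
  then show ?thesis using that[of "M1 * M2"] M1(1) M2(1) by simp
qed

lemma exp_bound_imp_sq_bounded:
  fixes y :: "real \<Rightarrow> 'a::real_normed_vector"
  assumes c: "continuous_on {0<..} y" and k: "0 < \<kappa>" and b: "\<And>x. 0 < x \<Longrightarrow> norm (y x) \<le> M * exp (- \<kappa> * x)"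
  shows "sq_bounded {0<..} y"
  unfolding sq_bounded_def
proof (intro exI allI impI)
  fix a b :: real assume ab: "a < b" "{a..b} \<subseteq> {0<..}"
  then have "a \<in> {a..b}" by simp
  then have a: "0 < a" using ab(2) by blast
  have I: "((\<lambda>x. M\<^sup>2 * exp (- 2 * \<kappa> * x)) has_integral (- M\<^sup>2 / (2 * \<kappa>) * exp (- 2 * \<kappa> * b) - - M\<^sup>2 / (2 * \<kappa>) * exp (- 2 * \<kappa> * a))) {a..b}"
    by (rule fundamental_theorem_of_calculus)
      (use k ab in \<open>auto intro!: derivative_eq_intros simp: has_real_derivative_iff_has_vector_derivative[symmetric]\<close>)
  have "integral {a..b} (\<lambda>x. (norm (y x))\<^sup>2) \<le> integral {a..b} (\<lambda>x. M\<^sup>2 * exp (- 2 * \<kappa> * x))"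
  proof (rule integral_le)
    show "(\<lambda>x. (norm (y x))\<^sup>2) integrable_on {a..b}"
      by (intro integrable_continuous_real continuous_intros continuous_on_subset[OF c] ab)
    show "(\<lambda>x. M\<^sup>2 * exp (- 2 * \<kappa> * x)) integrable_on {a..b}" using I by blast
    fix x assume "x \<in> {a..b}"
    then have "0 < x" using a by auto
    then have "(norm (y x))\<^sup>2 \<le> (M * exp (- \<kappa> * x))\<^sup>2" by (intro power_mono b) auto
    also have "\<dots> = M\<^sup>2 * exp (- 2 * \<kappa> * x)" by (simp add: power_mult_distrib power2_eq_square exp_add[symmetric])
    finally show "(norm (y x))\<^sup>2 \<le> M\<^sup>2 * exp (- 2 * \<kappa> * x)" .
  qed
  also have "\<dots> = M\<^sup>2 / (2 * \<kappa>) * exp (- 2 * \<kappa> * a) - M\<^sup>2 / (2 * \<kappa>) * exp (- 2 * \<kappa> * b)"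
    using integral_unique[OF I] by simp
  also have "\<dots> \<le> M\<^sup>2 / (2 * \<kappa>) * 1 - 0"
  proof (intro diff_mono mult_left_mono)
    show "exp (- 2 * \<kappa> * a) \<le> 1" using k a by simp
  qed (use k in auto)
  finally show "integral {a..b} (\<lambda>x. (norm (y x))\<^sup>2) \<le> M\<^sup>2 / (2 * \<kappa>)" by simp
qed

lemma proportional_sq_bounded:
  assumes s: "regular_at_zero (V_shift z) s s1" and k: "0 < Re k" and p: "jost_solution k (V_shift z) p p1"
    and c: "\<And>x. 0 < x \<Longrightarrow> s x = c * p x"
  shows "sq_bounded {0<..} s"
proof -
  have so: "ode_solution {0<..} (V_shift z) s s1" using s by (simp add: regular_at_zero_def)
  have sc: "continuous_on {0<..} s" by (rule ode_solution_continuous(1)[OF so])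
  obtain K \<delta> where K: "K > 0" and \<delta>: "\<delta> > 0" and Ks: "\<And>x. x \<in> {0<..<\<delta>} \<Longrightarrow> norm (s x) \<le> K * x\<^sup>2"
    using s unfolding regular_at_zero_def by blast
  obtain X where X: "X > 0" "\<And>x. X \<le> x \<Longrightarrow> norm (p x) \<le> 2 * exp (- Re k * x)"
    using jost_solutionD[OF p] by metis
  obtain M where M: "\<And>x. 0 < x \<Longrightarrow> norm (s x) \<le> M * exp (- Re k * x)"
  proof (rule bound_from_ends[OF sc])
    show "continuous_on {0<..} (\<lambda>x. exp (- Re k * x))" by (intro continuous_intros)
    show "norm (s x) \<le> (K * \<delta>\<^sup>2 * exp (Re k * \<delta>)) * exp (- Re k * x)" if x: "0 < x" "x < \<delta>" for x
    proof -
      have "norm (s x) \<le> K * x\<^sup>2" using Ks x by simp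
      also have "\<dots> \<le> K * \<delta>\<^sup>2 * 1" using x K by (auto intro!: mult_left_mono power_mono)
      also have "\<dots> \<le> K * \<delta>\<^sup>2 * exp (Re k * (\<delta> - x))" using x k K by (intro mult_left_mono) auto
      finally show ?thesis by (simp add: exp_add[symmetric] algebra_simps)
    qed
    show "norm (s x) \<le> (norm c * 2) * exp (- Re k * x)" if x: "X \<le> x" for x
    proof -
      have "norm (s x) = norm c * norm (p x)" using c[of x] X(1) x by (simp add: norm_mult)
      also have "\<dots> \<le> norm c * (2 * exp (- Re k * x))" by (intro mult_left_mono X(2) x) auto
      finally show ?thesis by simp
    qed
  qed (use \<delta> in auto)
  show ?thesis by (rule exp_bound_imp_sq_bounded[OF sc k M])
qed

text \<open>A Green formula needs a partner independent of s. Two independent solutions a and b are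
  known from infinity: the Jost solutions for k and -k if z > 0, with Wronskian 2 k, and the bounded
  and the growing one if z = 0. The identity s w = a v - b u among the Wronskians shows that s
  cannot be dependent on both.\<close>

lemma second_solution_exists:
  assumes s: "regular_at_zero (V_shift (of_real z)) s s1" and z: "0 \<le> z"
  obtains y y1 c :: "real \<Rightarrow> complex" and W where "ode_solution {0<..} (V_shift (of_real z)) y y1" "W \<noteq> 0"
    "\<And>x. 0 < x \<Longrightarrow> s x * y1 x - s1 x * y x = W"
proof -
  let ?q = "V_shift (of_real z) :: real \<Rightarrow> complex"
  have so: "ode_solution {0<..} ?q s s1" using s by (simp add: regular_at_zero_def)
  obtain a a1 b b1 :: "real \<Rightarrow> complex" and w where a: "ode_solution {0<..} ?q a a1" and b: "ode_solution {0<..} ?q b b1"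
    and w: "w \<noteq> 0" and ab: "\<And>x. 0 < x \<Longrightarrow> a x * b1 x - a1 x * b x = w"
  proof (cases "z = 0")
    case True
    obtain a a1 where a: "jost_solution 0 ?q a a1" using jost_exists[of 0] True by auto
    obtain b b1 where b: "ode_solution {0<..} ?q b b1" "((\<lambda>x. b x / of_real x) \<longlongrightarrow> 1) at_top"
      using growing_solution_exists True by auto
    have ao: "ode_solution {0<..} ?q a a1" using a by (simp add: jost_solution_def)
    obtain X where X: "X > 0" "\<And>x. X \<le> x \<Longrightarrow> exp (- Re 0 * x) / 2 \<le> norm (a x) \<and> norm (a x) \<le> 2 * exp (- Re 0 * x)"
      using jost_solutionD[OF a] by metis
    obtain w where w: "\<And>x. x \<in> {0<..} \<Longrightarrow> a x * b1 x - a1 x * b x = w"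
      using wronskian_constant[OF ao b(1)] by (metis convex_real_interval(3))
    have "w \<noteq> 0"
    proof
      assume "w = 0"
      then have W0: "b X * a1 X - b1 X * a X = 0" using w[of X] X(1) by (simp add: algebra_simps)
      have aX: "a X \<noteq> 0" using X(2)[of X] by auto
      obtain c where c: "\<And>x. x \<in> {0<..} \<Longrightarrow> b x = c * a x \<and> b1 x = c * a1 x"
        by (rule wronskian_zero_imp_proportional[OF b(1) ao _ V_shift_cont _ _ W0])
          (use X(1) aX in \<open>auto simp: is_interval_1\<close>)
      have lim0: "((\<lambda>x. b x / of_real x) \<longlongrightarrow> 0) at_top"
      proof (rule Lim_null_comparison)
        show "\<forall>\<^sub>F x in at_top. norm (b x / of_real x) \<le> norm c * 2 / x"
          using eventually_ge_at_top[of X]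
        proof eventually_elim
          case (elim x)
          have "norm (b x) \<le> norm c * 2" using c[of x] X elim by (auto simp: norm_mult intro!: mult_left_mono)
          then show ?case using elim X(1) by (simp add: norm_divide divide_right_mono)
        qed
        show "((\<lambda>x. norm c * 2 / x) \<longlongrightarrow> 0) at_top" by real_asymp
      qed
      have "(1::complex) = 0" by (rule tendsto_unique[OF trivial_limit_at_top_linorder b(2) lim0])
      then show False by simp
    qed
    then show ?thesis using that[OF ao b(1)] w by auto
  next
    case False
    define k where "k = \<i> * of_real (sqrt z)"
    have k: "Re k = 0" "- (k\<^sup>2) = of_real z" "- ((- k)\<^sup>2) = of_real z" "k \<noteq> 0"
      using z False by (auto simp: k_def power_mult_distrib of_real_power[symmetric] simp del: of_real_power)
    obtain a a1 where a: "jost_solution k ?q a a1" using jost_exists[of k] k by auto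
    obtain b b1 where b: "jost_solution (- k) ?q b b1" using jost_exists[of "- k"] k by auto
    have ao: "ode_solution {0<..} ?q a a1" and bo: "ode_solution {0<..} ?q b b1"
      using a b by (auto simp: jost_solution_def)
    obtain w where w: "\<And>x. x \<in> {0<..} \<Longrightarrow> a x * b1 x - a1 x * b x = w"
      using wronskian_constant[OF ao bo] by (metis convex_real_interval(3))
    have "((\<lambda>x. (exp (k * of_real x) * a x) * (exp (- k * of_real x) * b1 x) - (exp (k * of_real x) * a1 x) * (exp (- k * of_real x) * b x)) \<longlongrightarrow>
        1 * (- (- k)) - (- k) * 1) at_top"
      using a b unfolding jost_solution_def by (intro tendsto_intros) auto
    moreover have "(exp (k * of_real x) * a x) * (exp (- k * of_real x) * b1 x) - (exp (k * of_real x) * a1 x) * (exp (- k * of_real x) * b x) =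
        a x * b1 x - a1 x * b x" for x
    proof -
      have "exp (k * of_real x) * exp (- k * of_real x) = 1" by (simp add: exp_add[symmetric])
      then have e: "(exp (k * of_real x) * u) * (exp (- k * of_real x) * v) = u * v" for u v
        by (metis mult.assoc mult.left_commute mult.commute mult_1)
      show ?thesis by (simp only: e)
    qed
    ultimately have "((\<lambda>x. a x * b1 x - a1 x * b x) \<longlongrightarrow> 2 * k) at_top" by simp
    moreover have "\<forall>\<^sub>F x in at_top. a x * b1 x - a1 x * b x = w"
      using eventually_gt_at_top[of 0] by eventually_elim (use w in auto)
    ultimately have "w = 2 * k"
      by (intro tendsto_unique[OF trivial_limit_at_top_linorder _ \<open>(_ \<longlongrightarrow> 2 * k) at_top\<close>] tendsto_eventually)
    then show ?thesis using that[OF ao bo _ w] k by auto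
  qed
  obtain u where u: "\<And>x. x \<in> {0<..} \<Longrightarrow> s x * a1 x - s1 x * a x = u"
    using wronskian_constant[OF so a] by (metis convex_real_interval(3))
  obtain v where v: "\<And>x. x \<in> {0<..} \<Longrightarrow> s x * b1 x - s1 x * b x = v"
    using wronskian_constant[OF so b] by (metis convex_real_interval(3))
  obtain t where t: "0 < t" "s t \<noteq> 0" using regular_nonzero[OF s, of 1] by auto
  have "s t * w = a t * v - b t * u"
  proof -
    have vu: "v = s t * b1 t - s1 t * b t" "u = s t * a1 t - s1 t * a t" using u[of t] v[of t] t by auto
    show ?thesis unfolding ab[OF t(1), symmetric] vu by (simp add: algebra_simps)
  qed
  then have "u \<noteq> 0 \<or> v \<noteq> 0" using t w by auto
  then show ?thesis using that[OF a _ u] that[OF b _ v] by auto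
qed

lemma compact_bounds:
  fixes y :: "real \<Rightarrow> complex"
  assumes s: "regular_at_zero (V_shift z) s s1" and y: "ode_solution {0<..} (V_shift z) y y1"
  obtains M where "M > 0" "\<And>x. 0 < x \<Longrightarrow> x \<le> R \<Longrightarrow> norm (s x) \<le> M * x\<^sup>2 \<and> norm (y x) \<le> M / x"
proof -
  have so: "ode_solution {0<..} (V_shift z) s s1" using s by (simp add: regular_at_zero_def)
  obtain K \<delta> where K: "K > 0" and \<delta>: "\<delta> > 0" and Ks: "\<And>x. x \<in> {0<..<\<delta>} \<Longrightarrow> norm (s x) \<le> K * x\<^sup>2"
    using s unfolding regular_at_zero_def by blast
  obtain N \<epsilon> where e: "0 < \<epsilon>" and N: "\<And>x. 0 < x \<Longrightarrow> x < \<epsilon> \<Longrightarrow> norm (y x) \<le> N / x"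
    using solution_bound_at_zero[OF y s] by metis
  define d where "d = min \<delta> \<epsilon>"
  have d: "d > 0" using \<delta> e by (simp add: d_def)
  have "bounded (s ` {d..R})" "bounded (y ` {d..R})"
    using d by (auto intro!: compact_imp_bounded compact_continuous_image
        continuous_on_subset[OF ode_solution_continuous(1)[OF so]] continuous_on_subset[OF ode_solution_continuous(1)[OF y]])
  then obtain A1 A2 where "\<forall>w\<in>s ` {d..R}. norm w \<le> A1" "\<forall>w\<in>y ` {d..R}. norm w \<le> A2"
    unfolding bounded_iff by blast
  then have A: "\<And>x. x \<in> {d..R} \<Longrightarrow> norm (s x) \<le> A1" "\<And>x. x \<in> {d..R} \<Longrightarrow> norm (y x) \<le> A2" by blast+
  define M where "M = K + \<bar>N\<bar> + \<bar>A1\<bar> / d\<^sup>2 + \<bar>A2\<bar> * \<bar>R\<bar>"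
  have M: "K \<le> M" "N \<le> M" "\<bar>A1\<bar> / d\<^sup>2 \<le> M" "\<bar>A2\<bar> * \<bar>R\<bar> \<le> M" "M > 0"
  proof -
    have "0 \<le> \<bar>A1\<bar> / d\<^sup>2" "0 \<le> \<bar>A2\<bar> * \<bar>R\<bar>" by auto
    then show "K \<le> M" "N \<le> M" "\<bar>A1\<bar> / d\<^sup>2 \<le> M" "\<bar>A2\<bar> * \<bar>R\<bar> \<le> M" "M > 0"
      using K unfolding M_def by linarith+
  qed
  have "norm (s x) \<le> M * x\<^sup>2 \<and> norm (y x) \<le> M / x" if x: "0 < x" "x \<le> R" for x
  proof (cases "x < d")
    case True
    have "K * x\<^sup>2 \<le> M * x\<^sup>2" "N / x \<le> M / x" using M x by (auto intro: mult_right_mono divide_right_mono)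
    moreover have "norm (s x) \<le> K * x\<^sup>2" "norm (y x) \<le> N / x" using Ks[of x] N[of x] True x by (auto simp: d_def)
    ultimately show ?thesis by linarith
  next
    case False
    then have xd: "x \<in> {d..R}" using x by simp
    have "\<bar>A1\<bar> = \<bar>A1\<bar> / d\<^sup>2 * d\<^sup>2" using d by simp
    also have "\<dots> \<le> M * x\<^sup>2" using M xd d by (intro mult_mono power_mono) auto
    finally have 1: "norm (s x) \<le> M * x\<^sup>2" using A(1)[OF xd] by linarith
    have "\<bar>A2\<bar> * x \<le> \<bar>A2\<bar> * \<bar>R\<bar>" using x by (intro mult_left_mono) auto
    then have "\<bar>A2\<bar> \<le> M / x" using M(4) x by (simp add: field_simps)
    then show ?thesis using 1 A(2)[OF xd] by linarith
  qed
  then show ?thesis using that M(5) by blast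
qed

end

section \<open>The change of variables\<close>

text \<open>Monotone convergence along the exhausting intervals {a n..1 - a n}; nonnegativity then
  upgrades integrability to absolute integrability.\<close>

lemma absolutely_integrable_on_unit_interval:
  fixes \<phi> :: "real \<Rightarrow> real"
  assumes c: "continuous_on {0<..<1} \<phi>" and nn: "\<And>x. x \<in> {0<..<1} \<Longrightarrow> 0 \<le> \<phi> x"
    and M: "\<And>a b. 0 < a \<Longrightarrow> a < b \<Longrightarrow> b < 1 \<Longrightarrow> integral {a..b} \<phi> \<le> M"
  shows "set_integrable lebesgue {0<..<1} \<phi>"
proof (rule nonnegative_absolutely_integrable_1[OF _ nn])
  define a where "a n = 1 / (real n + 3)" for n :: nat
  have a: "0 < a n" "a n < 1 - a n" "a (Suc n) \<le> a n" for n by (auto simp: a_def field_simps)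
  define g where "g n x = (if x \<in> {a n..1 - a n} then \<phi> x else 0)" for n x
  have sub: "{a n..1 - a n} \<subseteq> {0<..<1}" for n using a(1)[of n] by auto
  have I: "\<phi> integrable_on {a n..1 - a n}" for n
    by (intro integrable_continuous_real continuous_on_subset[OF c] sub)
  have gI: "g n integrable_on {0<..<1}" and ge: "integral {0<..<1} (g n) = integral {a n..1 - a n} \<phi>" for n
  proof -
    have "{0<..<1} \<inter> {a n..1 - a n} = {a n..1 - a n}" using sub by blast
    then show "g n integrable_on {0<..<1}" "integral {0<..<1} (g n) = integral {a n..1 - a n} \<phi>"
      using I[of n] integrable_restrict_Int[of "{a n..1 - a n}" \<phi> "{0<..<1}"] integral_restrict_Int[of "{0<..<1}" "{a n..1 - a n}" \<phi>]
      unfolding g_def by (simp_all add: Int_commute)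
  qed
  have "\<phi> integrable_on {0<..<1} \<and> (\<lambda>n. integral {0<..<1} (g n)) \<longlonglongrightarrow> integral {0<..<1} \<phi>"
  proof (rule monotone_convergence_increasing)
    show "g n integrable_on {0<..<1}" for n by (rule gI)
    show "g n x \<le> g (Suc n) x" if "x \<in> {0<..<1}" for n x
      using nn[OF that] a(3)[of n] by (auto simp: g_def)
    show "(\<lambda>n. g n x) \<longlonglongrightarrow> \<phi> x" if x: "x \<in> {0<..<1}" for x
    proof -
      have "a \<longlonglongrightarrow> 0" unfolding a_def by real_asymp
      then have "\<forall>\<^sub>F n in sequentially. a n < min x (1 - x)" using x by (intro order_tendstoD) auto
      then have "\<forall>\<^sub>F n in sequentially. g n x = \<phi> x" by eventually_elim (auto simp: g_def)
      then show ?thesis by (rule tendsto_eventually)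
    qed
    show "bounded (range (\<lambda>n. integral {0<..<1} (g n)))"
      unfolding bounded_iff ge
    proof (intro exI ballI, elim rangeE)
      fix t n assume t: "t = integral {a n..1 - a n} \<phi>"
      have "0 \<le> integral {a n..1 - a n} \<phi>" by (rule integral_nonneg[OF I]) (use nn sub in blast)
      moreover have "integral {a n..1 - a n} \<phi> \<le> M" using a[of n] by (intro M) auto
      ultimately show "norm t \<le> \<bar>M\<bar>" by (simp add: t)
    qed
  qed
  then show "\<phi> integrable_on {0<..<1}" by simp
qed

lemma set_borel_measurable_lebesgue_continuous:
  assumes "continuous_on {0<..<1} u"
  shows "set_borel_measurable lebesgue {0<..<1::real} (u :: real \<Rightarrow> complex)"
  unfolding set_borel_measurable_def
  using borel_measurable_continuous_on_indicator[OF _ assms] by (intro measurable_completion) simp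

lemma aeq_refl [simp]: "aeq u u" by (simp add: aeq_def)

lemma tanh_cosh_sinh:
  fixes x :: real
  assumes "0 < x"
  shows "1 - (tanh x)\<^sup>2 = 1 / (cosh x)\<^sup>2" "(tanh x)\<^sup>2 = (sinh x)\<^sup>2 / (cosh x)\<^sup>2" "tanh x \<in> {0<..<1}" "0 < sinh x" "0 < cosh x"
    "wt (tanh x) = (sinh x)\<^sup>2 * (cosh x)\<^sup>2"
proof -
  show s: "0 < sinh x" "0 < cosh x" using assms by auto
  show "tanh x \<in> {0<..<1}" using assms tanh_real_lt_1[of x] by simp
  show t2: "(tanh x)\<^sup>2 = (sinh x)\<^sup>2 / (cosh x)\<^sup>2" by (simp add: tanh_def power_divide)
  then show t1: "1 - (tanh x)\<^sup>2 = 1 / (cosh x)\<^sup>2" using s by (simp add: sinh_square_eq field_simps)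
  show "wt (tanh x) = (sinh x)\<^sup>2 * (cosh x)\<^sup>2" unfolding wt_def t1 unfolding t2 using s by (simp add: field_simps power2_eq_square)
qed

lemma tanh_deriv: "(tanh has_real_derivative 1 - (tanh x)\<^sup>2) (at (x::real) within A)"
  by (auto intro!: derivative_eq_intros)

lemma artanh_unit:
  fixes r :: real
  assumes "r \<in> {0<..<1}"
  shows "0 < artanh r" "tanh (artanh r) = r"
proof -
  have "1 < (1 + r) / (1 - r)" using assms by (simp add: field_simps)
  then show "0 < artanh r" using assms by (simp add: artanh_def)
  have e: "exp (- 2 * artanh r) = (1 - r) / (1 + r)"
  proof -
    have "- 2 * artanh r = - ln ((1 + r) / (1 - r))" by (simp add: artanh_def)
    then show ?thesis using assms by (simp add: exp_minus)
  qed
  show "tanh (artanh r) = r" unfolding tanh_real_altdef e using assms by (simp add: field_simps)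
qed

lemma artanh_less_iff:
  "r \<in> {0<..<1} \<Longrightarrow> s \<in> {0<..<1} \<Longrightarrow> artanh r < artanh s \<longleftrightarrow> r < (s::real)"
  using tanh_real_less_iff[of "artanh r" "artanh s"] artanh_unit(2)[of r] artanh_unit(2)[of s] by simp

lemma artanh_le_iff:
  "r \<in> {0<..<1} \<Longrightarrow> s \<in> {0<..<1} \<Longrightarrow> artanh r \<le> artanh s \<longleftrightarrow> r \<le> (s::real)"
  using tanh_real_le_iff[of "artanh r" "artanh s"] artanh_unit(2)[of r] artanh_unit(2)[of s] by simp

lemma artanh_deriv: "r \<in> {0<..<1} \<Longrightarrow> (artanh has_real_derivative 1 / (1 - r\<^sup>2)) (at r)"
  by (auto intro!: derivative_eq_intros)

text \<open>The unitary map taking \<open>u\<close> to \<open>y x = sinh x * u (tanh x)\<close> turns \<open>A\<^sub>n\<close> into \<open>- y'' + V y\<close> on the half line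
  with this potential \<open>V\<close>.\<close>

definition profile_potential :: "(real \<Rightarrow> real) \<Rightarrow> real \<Rightarrow> real" where
  "profile_potential f x = 2 * cos (2 * f (tanh x)) / (sinh x)\<^sup>2"

text \<open>In these terms (z - A) u = h, for the operator A with potential \<open>gpot f\<close>,
  reads (r^2 u')' = coef * u + wt * h.\<close>

definition coef :: "(real \<Rightarrow> real) \<Rightarrow> complex \<Rightarrow> real \<Rightarrow> complex" where
  "coef f z r = 2 + of_real (wt r) * (of_real (gpot f r) - z)"

text \<open>The last term cancels the contribution 2 / w of the unperturbed operator, and the - 1
  cancels the quotient sinh'' / sinh = 1 that the substitution y = sinh x * u produces.\<close>

lemma gpot_tanh:
  assumes "0 < x"
  shows "gpot f (tanh x) = profile_potential f x - 1 - 2 / ((cosh x)\<^sup>2 * (sinh x)\<^sup>2)"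
proof -
  note t = tanh_cosh_sinh[OF assms]
  have "sinh x \<noteq> 0" "cosh x \<noteq> 0" using t by auto
  then show ?thesis unfolding gpot_def profile_potential_def t(1) unfolding t(2)
    by (simp add: field_simps power2_eq_square)
qed

lemma coef_tanh:
  assumes "0 < x"
  shows "coef f z (tanh x) = of_real ((sinh x)\<^sup>2 * (cosh x)\<^sup>2) * (of_real (profile_potential f x - 1) - z)"
proof -
  note t = tanh_cosh_sinh[OF assms]
  have "(sinh x)\<^sup>2 * (cosh x)\<^sup>2 * (2 / ((cosh x)\<^sup>2 * (sinh x)\<^sup>2)) = 2" using t by simp
  then have "complex_of_real ((sinh x)\<^sup>2 * (cosh x)\<^sup>2) * of_real (2 / ((cosh x)\<^sup>2 * (sinh x)\<^sup>2)) = 2"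
    by (metis of_real_mult of_real_numeral)
  then show ?thesis unfolding coef_def gpot_tanh[OF assms] t(6)
    by (simp add: algebra_simps)
qed

locale profile_op = inverse_square_potential "profile_potential f" B C
  for f :: "real \<Rightarrow> real" and B C :: real +
  assumes f_cont: "continuous_on {0<..<1} f"
begin

section \<open>From the operator to the equation on the half line\<close>

lemma wt_cont: "continuous_on {0<..<1} wt"
  unfolding wt_def[abs_def] by (intro continuous_intros) (auto simp: power2_eq_1_iff)

lemma wt_pos: "r \<in> {0<..<1} \<Longrightarrow> 0 < wt r"
  unfolding wt_def by (auto simp: power2_eq_1_iff intro!: divide_pos_pos)

lemma gpot_cont: "continuous_on {0<..<1} (gpot f)"
  unfolding gpot_def[abs_def] by (intro continuous_intros f_cont) auto

lemma coef_cont: "continuous_on {0<..<1} (coef f z)"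
  unfolding coef_def[abs_def] by (intro continuous_intros wt_cont gpot_cont)

text \<open>Collects the nested almost everywhere equalities of the three graph definitions into one
  first order system for u and v = r^2 u', the form in which it is solved and integrated.\<close>

lemma shifted_graph_iff:
  "shifted_graph f z u h \<longleftrightarrow> inH u \<and> AC_loc u \<and> (\<exists>u1 v v1. ae_deriv u u1 \<and> AC_loc v \<and>
     aeq v (\<lambda>r. of_real (r\<^sup>2) * u1 r) \<and> ae_deriv v v1 \<and> inH (\<lambda>r. (- v1 r + 2 * u r) / of_real (wt r)) \<and>
     aeq v1 (\<lambda>r. coef f z r * u r + of_real (wt r) * h r))" (is "?L \<longleftrightarrow> ?R")
proof -
  have eq: "h = z * u - ((- v + 2 * u) / of_real (wt r) + of_real (gpot f r) * u) \<longleftrightarrow> v = coef f z r * u + of_real (wt r) * h"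
    if "r \<in> {0<..<1}" for h u v r
  proof -
    have w: "complex_of_real (wt r) \<noteq> 0" using wt_pos[OF that] by simp
    have "h = z * u - ((- v + 2 * u) / of_real (wt r) + of_real (gpot f r) * u) \<longleftrightarrow>
        of_real (wt r) * h = of_real (wt r) * (z * u - ((- v + 2 * u) / of_real (wt r) + of_real (gpot f r) * u))"
      using w by simp
    also have "of_real (wt r) * (z * u - ((- v + 2 * u) / of_real (wt r) + of_real (gpot f r) * u)) =
        of_real (wt r) * (z * u) - (- v + 2 * u) - of_real (wt r) * (of_real (gpot f r) * u)"
    proof -
      have "of_real (wt r) * ((- v + 2 * u) / of_real (wt r)) = - v + 2 * u" using w by simp
      then show ?thesis by (simp only: right_diff_distrib distrib_left diff_diff_eq)
    qed
    also have "of_real (wt r) * h = \<dots> \<longleftrightarrow> v = coef f z r * u + of_real (wt r) * h"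
      by (auto simp: coef_def algebra_simps)
    finally show ?thesis .
  qed
  show ?thesis
  proof
    assume ?L
    then obtain a b u1 v v1 where *: "aeq h (\<lambda>r. z * u r - a r)" "aeq a (\<lambda>r. b r + of_real (gpot f r) * u r)"
      "aeq b (\<lambda>r. (- v1 r + 2 * u r) / of_real (wt r))" and
      **: "inH u" "AC_loc u" "ae_deriv u u1" "AC_loc v" "aeq v (\<lambda>r. of_real (r\<^sup>2) * u1 r)" "ae_deriv v v1"
        "inH (\<lambda>r. (- v1 r + 2 * u r) / of_real (wt r))"
      unfolding shifted_graph_def An_graph_def A_graph_def by blast
    have "aeq v1 (\<lambda>r. coef f z r * u r + of_real (wt r) * h r)"
      using * unfolding aeq_def
    proof eventually_elim
      case (elim r)
      then show ?case using eq[of r "h r" "u r" "v1 r"] by auto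
    qed
    then show ?R using ** by blast
  next
    assume ?R
    then obtain u1 v v1 where **: "inH u" "AC_loc u" "ae_deriv u u1" "AC_loc v" "aeq v (\<lambda>r. of_real (r\<^sup>2) * u1 r)" "ae_deriv v v1"
        "inH (\<lambda>r. (- v1 r + 2 * u r) / of_real (wt r))" and *: "aeq v1 (\<lambda>r. coef f z r * u r + of_real (wt r) * h r)"
      by blast
    have "A_graph u (\<lambda>r. (- v1 r + 2 * u r) / of_real (wt r))" unfolding A_graph_def using ** aeq_refl by blast
    then have "An_graph f u (\<lambda>r. (- v1 r + 2 * u r) / of_real (wt r) + of_real (gpot f r) * u r)"
      unfolding An_graph_def using aeq_refl by blast
    moreover have "aeq h (\<lambda>r. z * u r - ((- v1 r + 2 * u r) / of_real (wt r) + of_real (gpot f r) * u r))"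
      using * unfolding aeq_def
    proof eventually_elim
      case (elim r)
      then show ?case using eq[of r "h r" "u r" "v1 r"] by auto
    qed
    ultimately show ?L unfolding shifted_graph_def by blast
  qed
qed

lemma tanh_Icc_subset:
  assumes "0 < (a::real)"
  shows "{tanh a..tanh b} \<subseteq> {0<..<1}"
proof
  fix r assume "r \<in> {tanh a..tanh b}"
  then have "tanh a \<le> r" "r \<le> tanh b" by auto
  moreover have "0 < tanh a" using assms by simp
  ultimately have "0 < r" "r < 1" using tanh_real_lt_1[of b] by linarith+
  then show "r \<in> {0<..<1}" by simp
qed

text \<open>The transformation is isometric because wt (tanh x) * (1 - tanh^2 x) = sinh^2 x.\<close>

lemma integral_sq_transfer:
  assumes uc: "continuous_on {0<..<1} u" and a: "0 < a" and ab: "a \<le> b"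
  shows "integral {a..b} (\<lambda>x. (norm (of_real (sinh x) * u (tanh x)))\<^sup>2) = integral {tanh a..tanh b} (\<lambda>r. wt r * (cmod (u r))\<^sup>2)"
proof -
  define F where "F r = wt r * (cmod (u r))\<^sup>2" for r
  have Fc: "continuous_on {0<..<1} F" unfolding F_def by (intro continuous_intros wt_cont uc)
  have "((\<lambda>x. (1 - (tanh x)\<^sup>2) *\<^sub>R F (tanh x)) has_integral (integral {tanh a..tanh b} F)) {a..b}"
  proof (rule has_integral_substitution)
    show "tanh ` {a..b} \<subseteq> {tanh a..tanh b}" by auto
    show "continuous_on {tanh a..tanh b} F"
      by (rule continuous_on_subset[OF Fc tanh_Icc_subset[OF a]])
  qed (use ab tanh_deriv in auto)
  moreover have "(1 - (tanh x)\<^sup>2) *\<^sub>R F (tanh x) = (norm (of_real (sinh x) * u (tanh x)))\<^sup>2" if "x \<in> {a..b}" for x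
  proof -
    have x: "0 < x" using that a by simp
    note t = tanh_cosh_sinh[OF x]
    show ?thesis unfolding F_def t(1) t(6) using t(4,5) by (simp add: norm_mult power_mult_distrib)
  qed
  ultimately have "((\<lambda>x. (norm (of_real (sinh x) * u (tanh x)))\<^sup>2) has_integral (integral {tanh a..tanh b} F)) {a..b}"
    using has_integral_cong by (metis (no_types, lifting))
  then show ?thesis unfolding F_def by (rule integral_unique)
qed

text \<open>For continuous h the derivatives of u and v agree almost everywhere with continuous
  functions, so the system holds classically and can be transported by the chain rule.\<close>

lemma shifted_graph_imp_ode:
  assumes g: "shifted_graph f z u h" and h: "continuous_on {0<..<1} h"
  obtains y1 where "\<And>x. 0 < x \<Longrightarrow> ((\<lambda>x. of_real (sinh x) * u (tanh x)) has_vector_derivative y1 x) (at x)"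
    "\<And>x. 0 < x \<Longrightarrow> (y1 has_vector_derivative (V_shift z x * (of_real (sinh x) * u (tanh x)) + of_real (sinh x) * h (tanh x))) (at x)"
    "sq_bounded {0<..} (\<lambda>x. of_real (sinh x) * u (tanh x))" "continuous_on {0<..<1} u"
proof -
  obtain u1 v v1 where u: "inH u" "AC_loc u" "ae_deriv u u1" "AC_loc v" "aeq v (\<lambda>r. of_real (r\<^sup>2) * u1 r)" "ae_deriv v v1"
    and v1: "aeq v1 (\<lambda>r. coef f z r * u r + of_real (wt r) * h r)"
    using g unfolding shifted_graph_iff by blast
  have uc: "continuous_on {0<..<1} u" and vc: "continuous_on {0<..<1} v" using u AC_loc_continuous by auto
  have "aeq u1 (\<lambda>r. v r / of_real (r\<^sup>2))"
    using u(5) unfolding aeq_def by eventually_elim auto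
  then have du: "(u has_vector_derivative v r / of_real (r\<^sup>2)) (at r)" if "r \<in> {0<..<1}" for r
    by (rule AC_loc_continuous_deriv[OF u(2,3) _ _ that]) (intro continuous_intros vc, auto)
  have dv: "(v has_vector_derivative (coef f z r * u r + of_real (wt r) * h r)) (at r)" if "r \<in> {0<..<1}" for r
    by (rule AC_loc_continuous_deriv[OF u(4,6) v1 _ that]) (intro continuous_intros uc h coef_cont wt_cont)
  \<comment> \<open>The derivative of sinh x * u (tanh x), with u' = v / r^2 and (1 - tanh^2 x) /
    tanh^2 x = 1 / sinh^2 x.\<close>
  define y1 where "y1 x = of_real (cosh x) * u (tanh x) + of_real (1 / sinh x) * v (tanh x)" for x
  show ?thesis
  proof (rule that)
    fix x :: real assume x: "0 < x"
    note t = tanh_cosh_sinh[OF x]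
    note dt = tanh_deriv[of x UNIV, unfolded has_real_derivative_iff_has_vector_derivative]
    have dut: "((\<lambda>x. u (tanh x)) has_vector_derivative (1 - (tanh x)\<^sup>2) *\<^sub>R (v (tanh x) / of_real ((tanh x)\<^sup>2))) (at x)"
      using vector_diff_chain_at[OF dt du[OF t(3)]] by (simp add: o_def)
    have dvt: "((\<lambda>x. v (tanh x)) has_vector_derivative (1 - (tanh x)\<^sup>2) *\<^sub>R (coef f z (tanh x) * u (tanh x) + of_real (wt (tanh x)) * h (tanh x))) (at x)"
      using vector_diff_chain_at[OF dt dv[OF t(3)]] by (simp add: o_def)
    have e1: "(1 - (tanh x)\<^sup>2) *\<^sub>R (v (tanh x) / of_real ((tanh x)\<^sup>2)) = of_real (1 / (sinh x)\<^sup>2) * v (tanh x)"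
      unfolding t(1) unfolding t(2) using t(4,5) by (simp add: scaleR_conv_of_real field_simps)
    have dsinh: "((\<lambda>x. complex_of_real (sinh x)) has_vector_derivative of_real (cosh x)) (at x)"
      and dcosh: "((\<lambda>x. complex_of_real (cosh x)) has_vector_derivative of_real (sinh x)) (at x)"
      by (rule has_vector_derivative_of_real; auto intro!: derivative_eq_intros)+
    have dis: "((\<lambda>x. complex_of_real (1 / sinh x)) has_vector_derivative of_real (- cosh x / (sinh x)\<^sup>2)) (at x)"
      by (rule has_vector_derivative_of_real) (use t(4) in \<open>auto intro!: derivative_eq_intros simp: power2_eq_square\<close>)
    have "((\<lambda>x. of_real (sinh x) * u (tanh x)) has_vector_derivative
        (of_real (sinh x) * (of_real (1 / (sinh x)\<^sup>2) * v (tanh x)) + of_real (cosh x) * u (tanh x))) (at x)"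
      using has_vector_derivative_mult[OF dsinh dut] unfolding e1 .
    moreover have "of_real (sinh x) * (of_real (1 / (sinh x)\<^sup>2) * v (tanh x)) = of_real (1 / sinh x) * v (tanh x)"
      using t(4) by (simp add: power2_eq_square)
    ultimately show "((\<lambda>x. of_real (sinh x) * u (tanh x)) has_vector_derivative y1 x) (at x)"
      by (simp add: y1_def add.commute)
    have dy1: "(y1 has_vector_derivative ((of_real (cosh x) * (of_real (1 / (sinh x)\<^sup>2) * v (tanh x)) + of_real (sinh x) * u (tanh x)) +
        (of_real (1 / sinh x) * ((1 - (tanh x)\<^sup>2) *\<^sub>R (coef f z (tanh x) * u (tanh x) + of_real (wt (tanh x)) * h (tanh x)))
        + of_real (- cosh x / (sinh x)\<^sup>2) * v (tanh x)))) (at x)"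
      unfolding y1_def[abs_def]
      by (intro has_vector_derivative_add has_vector_derivative_mult dcosh dis dvt dut[unfolded e1])
    have e2: "of_real (1 / sinh x) * ((1 - (tanh x)\<^sup>2) *\<^sub>R (coef f z (tanh x) * u (tanh x) + of_real (wt (tanh x)) * h (tanh x)))
      = of_real (sinh x) * ((of_real (profile_potential f x - 1) - z) * u (tanh x) + h (tanh x))"
      unfolding coef_tanh[OF x] t(1) unfolding t(6) using t(4,5)
      by (simp add: scaleR_conv_of_real) (simp add: field_simps power2_eq_square)
    have e3: "of_real (cosh x) * (of_real (1 / (sinh x)\<^sup>2) * v (tanh x)) + of_real (sinh x) * u (tanh x) +
        (of_real (sinh x) * ((of_real (profile_potential f x - 1) - z) * u (tanh x) + h (tanh x)) + of_real (- cosh x / (sinh x)\<^sup>2) * v (tanh x))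
      = V_shift z x * (of_real (sinh x) * u (tanh x)) + of_real (sinh x) * h (tanh x)"
      by (simp add: V_shift_def algebra_simps)
    show "(y1 has_vector_derivative (V_shift z x * (of_real (sinh x) * u (tanh x)) + of_real (sinh x) * h (tanh x))) (at x)"
      using dy1 unfolding e2 e3 .
  next
    have Fi: "(\<lambda>r. wt r * (cmod (u r))\<^sup>2) integrable_on {0<..<1}"
      using u(1) set_lebesgue_integral_eq_integral(1) unfolding inH_def by blast
    show "sq_bounded {0<..} (\<lambda>x. of_real (sinh x) * u (tanh x))"
      unfolding sq_bounded_def
    proof (intro exI allI impI)
      fix a b :: real assume ab: "a < b" "{a..b} \<subseteq> {0<..}"
      then have "a \<in> {a..b}" by simp
      then have a: "0 < a" using ab(2) by blast
      have "integral {a..b} (\<lambda>x. (norm (of_real (sinh x) * u (tanh x)))\<^sup>2) = integral {tanh a..tanh b} (\<lambda>r. wt r * (cmod (u r))\<^sup>2)"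
        by (rule integral_sq_transfer[OF uc a]) (use ab in simp)
      also have "\<dots> \<le> integral {0<..<1} (\<lambda>r. wt r * (cmod (u r))\<^sup>2)"
      proof (rule integral_subset_le[OF tanh_Icc_subset[OF a] _ Fi])
        show "(\<lambda>r. wt r * (cmod (u r))\<^sup>2) integrable_on {tanh a..tanh b}"
          by (intro integrable_continuous_real continuous_intros continuous_on_subset[OF wt_cont] continuous_on_subset[OF uc] tanh_Icc_subset a)
        show "\<forall>r\<in>{0<..<1}. 0 \<le> wt r * (cmod (u r))\<^sup>2" using wt_pos by (simp add: less_imp_le)
      qed
      finally show "integral {a..b} (\<lambda>x. (norm (of_real (sinh x) * u (tanh x)))\<^sup>2) \<le> integral {0<..<1} (\<lambda>r. wt r * (cmod (u r))\<^sup>2)" .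
    qed
  qed (rule uc)
qed

section \<open>The inverse transformation\<close>

definition to_u :: "(real \<Rightarrow> complex) \<Rightarrow> real \<Rightarrow> complex" where
  "to_u y r = y (artanh r) / of_real (sinh (artanh r))"

text \<open>This is r^2 u' for u = \<open>to_u y\<close>, expressed through y and its
  derivative.\<close>

definition to_v :: "(real \<Rightarrow> complex) \<Rightarrow> (real \<Rightarrow> complex) \<Rightarrow> real \<Rightarrow> complex" where
  "to_v y y1 r = of_real (sinh (artanh r)) * y1 (artanh r) - of_real (cosh (artanh r)) * y (artanh r)"

lemma to_u_deriv:
  assumes y: "ode_solution {0<..} (V_shift z) y y1" and r: "r \<in> {0<..<1}"
  shows "(to_u y has_vector_derivative to_v y y1 r / of_real (r\<^sup>2)) (at r)"
    and "(to_v y y1 has_vector_derivative coef f z r * to_u y r) (at r)"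
proof -
  define x where "x = artanh r"
  have x: "0 < x" "tanh x = r" using artanh_unit[OF r] by (auto simp: x_def)
  note t = tanh_cosh_sinh[OF x(1), unfolded x(2)]
  have r2: "1 / (1 - r\<^sup>2) = (cosh x)\<^sup>2" unfolding t(1) by simp
  have dx: "(artanh has_vector_derivative (cosh x)\<^sup>2) (at r)"
    using artanh_deriv[OF r] unfolding r2 has_real_derivative_iff_has_vector_derivative .
  note dy = ode_solutionD[OF y, of x]
  have ch: "((\<lambda>r. w (artanh r)) has_vector_derivative (cosh x)\<^sup>2 *\<^sub>R w') (at r)"
    if "(w has_vector_derivative w') (at x)" for w and w' :: complex
    using vector_diff_chain_at[OF dx, of w w'] that by (simp add: x_def o_def)
  have dsinh: "((\<lambda>x. complex_of_real (sinh x)) has_vector_derivative of_real (cosh x)) (at x)"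
    and dcosh: "((\<lambda>x. complex_of_real (cosh x)) has_vector_derivative of_real (sinh x)) (at x)"
    by (rule has_vector_derivative_of_real; auto intro!: derivative_eq_intros)+
  have s0: "complex_of_real (sinh x) \<noteq> 0" "complex_of_real (cosh x) \<noteq> 0" using t(4,5) by auto
  have "((\<lambda>x. y x / of_real (sinh x)) has_vector_derivative ((y1 x * of_real (sinh x) - y x * of_real (cosh x)) / (of_real (sinh x))\<^sup>2)) (at x)"
    using x by (intro quotient_deriv dy dsinh s0) auto
  from ch[OF this] have "(to_u y has_vector_derivative (cosh x)\<^sup>2 *\<^sub>R ((y1 x * of_real (sinh x) - y x * of_real (cosh x)) / (of_real (sinh x))\<^sup>2)) (at r)"
    by (simp add: to_u_def[abs_def])
  moreover have "(cosh x)\<^sup>2 *\<^sub>R ((y1 x * of_real (sinh x) - y x * of_real (cosh x)) / (of_real (sinh x))\<^sup>2) = to_v y y1 r / of_real (r\<^sup>2)"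
    unfolding to_v_def x_def[symmetric] t(2) using s0 by (simp add: scaleR_conv_of_real field_simps)
  ultimately show "(to_u y has_vector_derivative to_v y y1 r / of_real (r\<^sup>2)) (at r)" by simp
  have "((\<lambda>x. of_real (sinh x) * y1 x - of_real (cosh x) * y x) has_vector_derivative
     ((of_real (sinh x) * (V_shift z x * y x) + of_real (cosh x) * y1 x) - (of_real (cosh x) * y1 x + of_real (sinh x) * y x))) (at x)"
    using x by (intro has_vector_derivative_diff has_vector_derivative_mult dy dsinh dcosh) auto
  from ch[OF this] have "(to_v y y1 has_vector_derivative (cosh x)\<^sup>2 *\<^sub>R
     ((of_real (sinh x) * (V_shift z x * y x) + of_real (cosh x) * y1 x) - (of_real (cosh x) * y1 x + of_real (sinh x) * y x))) (at r)"
    by (simp add: to_v_def[abs_def])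
  moreover have "(cosh x)\<^sup>2 *\<^sub>R ((of_real (sinh x) * (V_shift z x * y x) + of_real (cosh x) * y1 x) - (of_real (cosh x) * y1 x + of_real (sinh x) * y x))
     = coef f z r * to_u y r"
  proof -
    have "of_real ((sinh x)\<^sup>2 * (cosh x)\<^sup>2) * k * (y x / of_real (sinh x)) = of_real ((cosh x)\<^sup>2) * (of_real (sinh x) * k * y x)" for k
      using s0 by (simp add: power2_eq_square)
    note e = this
    show ?thesis
      unfolding coef_tanh[OF x(1), of f z, unfolded x(2)] to_u_def x_def[symmetric] e
      by (simp add: scaleR_conv_of_real V_shift_def algebra_simps)
  qed
  ultimately show "(to_v y y1 has_vector_derivative coef f z r * to_u y r) (at r)" by simp
qed

lemma to_u_cont:
  assumes y: "ode_solution {0<..} (V_shift z) y y1"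
  shows "continuous_on {0<..<1} (to_u y)" "continuous_on {0<..<1} (to_v y y1)"
  using has_vector_derivative_continuous[OF to_u_deriv(1)[OF y]] has_vector_derivative_continuous[OF to_u_deriv(2)[OF y]]
  by (auto intro!: continuous_at_imp_continuous_on)

lemma wt_to_u:
  assumes "r \<in> {0<..<1}"
  shows "wt r * (cmod (to_u y r))\<^sup>2 = (cmod (y (artanh r)))\<^sup>2 / (1 - r\<^sup>2)"
proof -
  define x where "x = artanh r"
  have x: "0 < x" "tanh x = r" using artanh_unit[OF assms] by (auto simp: x_def)
  note t = tanh_cosh_sinh[OF x(1), unfolded x(2)]
  show ?thesis unfolding to_u_def x_def[symmetric] t(1,6) using t(4,5)
    by (simp add: norm_divide power_divide)
qed

lemma to_u_cont':
  assumes y: "continuous_on {0<..} y"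
  shows "continuous_on {0<..<1} (to_u y)"
proof -
  have a: "continuous_on {0<..<1} (artanh :: real \<Rightarrow> real)"
    using DERIV_isCont[OF artanh_deriv] by (auto intro!: continuous_at_imp_continuous_on)
  have "continuous_on {0<..<1} (\<lambda>r. y (artanh r))"
    by (rule continuous_on_compose2[OF y a]) (use artanh_unit(1) in auto)
  moreover have "continuous_on {0<..<1} (\<lambda>r. sinh (artanh r) :: real)" by (intro continuous_intros a)
  ultimately show ?thesis unfolding to_u_def[abs_def]
    using artanh_unit(1) by (intro continuous_intros) force+
qed

lemma inH_to_u:
  assumes yc: "continuous_on {0<..} y" and L2: "sq_bounded {0<..} y"
  shows "inH (to_u y)"
proof -
  obtain M where M: "\<And>a b. a < b \<Longrightarrow> {a..b} \<subseteq> {0<..} \<Longrightarrow> integral {a..b} (\<lambda>x. (norm (y x))\<^sup>2) \<le> M"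
    using L2 unfolding sq_bounded_def by blast
  have "set_integrable lebesgue {0<..<1} (\<lambda>r. wt r * (cmod (to_u y r))\<^sup>2)"
  proof (rule absolutely_integrable_on_unit_interval)
    show "continuous_on {0<..<1} (\<lambda>r. wt r * (cmod (to_u y r))\<^sup>2)"
      by (intro continuous_intros wt_cont to_u_cont'[OF yc])
    show "0 \<le> wt r * (cmod (to_u y r))\<^sup>2" if "r \<in> {0<..<1}" for r using wt_pos[OF that] by simp
    fix a b :: real assume ab: "0 < a" "a < b" "b < 1"
    have mono: "artanh a < artanh b"
      using ab by (subst artanh_less_iff) auto
    have le: "artanh a \<le> artanh r \<and> artanh r \<le> artanh b" if "r \<in> {a..b}" for r
      using ab that by (auto simp: artanh_le_iff)
    have pos: "0 < artanh a" using ab by (intro artanh_unit(1)) auto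
    have sub: "{artanh a..artanh b} \<subseteq> {0<..}" using pos by auto
    have "((\<lambda>r. (1 / (1 - r\<^sup>2)) *\<^sub>R (norm (y (artanh r)))\<^sup>2) has_integral (integral {artanh a..artanh b} (\<lambda>x. (norm (y x))\<^sup>2))) {a..b}"
    proof (rule has_integral_substitution)
      show "artanh ` {a..b} \<subseteq> {artanh a..artanh b}" using le by auto
      show "continuous_on {artanh a..artanh b} (\<lambda>x. (norm (y x))\<^sup>2)"
        by (intro continuous_intros continuous_on_subset[OF yc sub])
      fix r assume "r \<in> {a..b}"
      then have "r \<in> {0<..<1}" using ab by auto
      then show "(artanh has_real_derivative 1 / (1 - r\<^sup>2)) (at r within {a..b})"
        using artanh_deriv has_field_derivative_at_within by blast
    qed (use ab mono in auto)
    then have "integral {a..b} (\<lambda>r. (1 / (1 - r\<^sup>2)) *\<^sub>R (norm (y (artanh r)))\<^sup>2) \<le> M"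
      using M[OF mono sub] by (simp add: integral_unique)
    moreover have "integral {a..b} (\<lambda>r. (1 / (1 - r\<^sup>2)) *\<^sub>R (norm (y (artanh r)))\<^sup>2) = integral {a..b} (\<lambda>r. wt r * (cmod (to_u y r))\<^sup>2)"
      by (rule integral_cong) (use ab in \<open>auto simp: wt_to_u\<close>)
    ultimately show "integral {a..b} (\<lambda>r. wt r * (cmod (to_u y r))\<^sup>2) \<le> M" by simp
  qed
  then show ?thesis unfolding inH_def
    using set_borel_measurable_lebesgue_continuous[OF to_u_cont'[OF yc]] by simp
qed

section \<open>Closure properties of the weighted space\<close>

lemma inH_cmult_bounded:
  assumes u: "inH u" and b: "\<And>r. r \<in> {0<..<1} \<Longrightarrow> cmod (c r) \<le> M" and c: "continuous_on {0<..<1} c"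
  shows "inH (\<lambda>r. c r * u r)"
proof -
  have mu: "(\<lambda>r. indicator {0<..<1} r *\<^sub>R u r) \<in> borel_measurable lebesgue" using u by (simp add: inH_def set_borel_measurable_def)
  have mc: "(\<lambda>r. indicator {0<..<1} r *\<^sub>R c r) \<in> borel_measurable lebesgue"
    using set_borel_measurable_lebesgue_continuous[OF c] by (simp add: set_borel_measurable_def)
  have "(\<lambda>r. (indicator {0<..<1} r *\<^sub>R c r) * (indicator {0<..<1} r *\<^sub>R u r)) \<in> borel_measurable lebesgue"
    using mc mu by (rule borel_measurable_times)
  also have "(\<lambda>r. (indicator {0<..<1} r *\<^sub>R c r) * (indicator {0<..<1} r *\<^sub>R u r)) = (\<lambda>r. indicator {0<..<1} r *\<^sub>R (c r * u r))"
    by (auto simp: fun_eq_iff indicator_def)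
  finally have m: "(\<lambda>r. indicator {0<..<1} r *\<^sub>R (c r * u r)) \<in> borel_measurable lebesgue" .
  have mw: "(\<lambda>r. indicator {0<..<1} r *\<^sub>R wt r) \<in> borel_measurable lebesgue"
    using borel_measurable_continuous_on_indicator[OF _ wt_cont] by (intro measurable_completion) simp
  have "set_integrable lebesgue {0<..<1} (\<lambda>r. wt r * (cmod (c r * u r))\<^sup>2)"
    unfolding set_integrable_def
  proof (rule Bochner_Integration.integrable_bound)
    show "integrable lebesgue (\<lambda>r. M\<^sup>2 * (indicator {0<..<1} r *\<^sub>R (wt r * (cmod (u r))\<^sup>2)))"
      using u unfolding inH_def set_integrable_def by (intro integrable_mult_right) auto
    have "(\<lambda>r. (indicator {0<..<1} r *\<^sub>R wt r) * (cmod (indicator {0<..<1} r *\<^sub>R (c r * u r)))\<^sup>2) \<in> borel_measurable lebesgue"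
      using mw m by measurable
    also have "(\<lambda>r. (indicator {0<..<1} r *\<^sub>R wt r) * (cmod (indicator {0<..<1} r *\<^sub>R (c r * u r)))\<^sup>2) =
        (\<lambda>r. indicator {0<..<1} r *\<^sub>R (wt r * (cmod (c r * u r))\<^sup>2))"
      by (auto simp: fun_eq_iff indicator_def)
    finally show "(\<lambda>r. indicator {0<..<1} r *\<^sub>R (wt r * (cmod (c r * u r))\<^sup>2)) \<in> borel_measurable lebesgue" .
    show "AE r in lebesgue. norm (indicator {0<..<1} r *\<^sub>R (wt r * (cmod (c r * u r))\<^sup>2)) \<le>
        norm (M\<^sup>2 * (indicator {0<..<1} r *\<^sub>R (wt r * (cmod (u r))\<^sup>2)))"
    proof (rule AE_I2)
      fix r
      have "wt r * (cmod (c r * u r))\<^sup>2 \<le> M\<^sup>2 * (wt r * (cmod (u r))\<^sup>2)" if r: "r \<in> {0<..<1}"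
      proof -
        have "(cmod (c r) * cmod (u r))\<^sup>2 \<le> (M * cmod (u r))\<^sup>2" using b[OF r] by (intro power_mono mult_right_mono) auto
        then have "wt r * (cmod (c r) * cmod (u r))\<^sup>2 \<le> wt r * (M * cmod (u r))\<^sup>2" using wt_pos[OF r] by (intro mult_left_mono) auto
        then show ?thesis by (simp add: norm_mult power_mult_distrib mult.left_commute)
      qed
      then show "norm (indicator {0<..<1} r *\<^sub>R (wt r * (cmod (c r * u r))\<^sup>2)) \<le>
        norm (M\<^sup>2 * (indicator {0<..<1} r *\<^sub>R (wt r * (cmod (u r))\<^sup>2)))"
        using wt_pos[of r] by (cases "r \<in> {0<..<1}") (auto simp: abs_mult)
    qed
  qed
  then show ?thesis using m by (simp add: inH_def set_borel_measurable_def)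
qed

lemma inH_add:
  assumes u: "inH u" and v: "inH v"
  shows "inH (\<lambda>r. u r + v r)"
proof -
  have m: "(\<lambda>r. indicator {0<..<1} r *\<^sub>R u r) \<in> borel_measurable lebesgue" "(\<lambda>r. indicator {0<..<1} r *\<^sub>R v r) \<in> borel_measurable lebesgue"
    using u v by (auto simp: inH_def set_borel_measurable_def)
  have "(\<lambda>r. indicator {0<..<1} r *\<^sub>R u r + indicator {0<..<1} r *\<^sub>R v r) \<in> borel_measurable lebesgue"
    using m by (rule borel_measurable_add)
  then have ms: "(\<lambda>r. indicator {0<..<1} r *\<^sub>R (u r + v r)) \<in> borel_measurable lebesgue" by (simp add: scaleR_add_right)
  have mw: "(\<lambda>r. indicator {0<..<1} r *\<^sub>R wt r) \<in> borel_measurable lebesgue"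
    using borel_measurable_continuous_on_indicator[OF _ wt_cont] by (intro measurable_completion) simp
  have "set_integrable lebesgue {0<..<1} (\<lambda>r. wt r * (cmod (u r + v r))\<^sup>2)"
    unfolding set_integrable_def
  proof (rule Bochner_Integration.integrable_bound)
    show "integrable lebesgue (\<lambda>r. 2 * (indicator {0<..<1} r *\<^sub>R (wt r * (cmod (u r))\<^sup>2)) + 2 * (indicator {0<..<1} r *\<^sub>R (wt r * (cmod (v r))\<^sup>2)))"
      using u v unfolding inH_def set_integrable_def by (intro Bochner_Integration.integrable_add integrable_mult_right) auto
    have "(\<lambda>r. (indicator {0<..<1} r *\<^sub>R wt r) * (cmod (indicator {0<..<1} r *\<^sub>R (u r + v r)))\<^sup>2) \<in> borel_measurable lebesgue"
      using mw ms by measurable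
    also have "(\<lambda>r. (indicator {0<..<1} r *\<^sub>R wt r) * (cmod (indicator {0<..<1} r *\<^sub>R (u r + v r)))\<^sup>2) =
        (\<lambda>r. indicator {0<..<1} r *\<^sub>R (wt r * (cmod (u r + v r))\<^sup>2))"
      by (auto simp: fun_eq_iff indicator_def)
    finally show "(\<lambda>r. indicator {0<..<1} r *\<^sub>R (wt r * (cmod (u r + v r))\<^sup>2)) \<in> borel_measurable lebesgue" .
    show "AE r in lebesgue. norm (indicator {0<..<1} r *\<^sub>R (wt r * (cmod (u r + v r))\<^sup>2)) \<le>
        norm (2 * (indicator {0<..<1} r *\<^sub>R (wt r * (cmod (u r))\<^sup>2)) + 2 * (indicator {0<..<1} r *\<^sub>R (wt r * (cmod (v r))\<^sup>2)))"
    proof (rule AE_I2)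
      fix r
      have "wt r * (cmod (u r + v r))\<^sup>2 \<le> 2 * (wt r * (cmod (u r))\<^sup>2) + 2 * (wt r * (cmod (v r))\<^sup>2)" if r: "r \<in> {0<..<1}"
      proof -
        have "(cmod (u r + v r))\<^sup>2 \<le> (cmod (u r) + cmod (v r))\<^sup>2" by (intro power_mono norm_triangle_ineq) auto
        also have "\<dots> \<le> 2 * (cmod (u r))\<^sup>2 + 2 * (cmod (v r))\<^sup>2"
          using sum_squares_bound[of "cmod (u r)" "cmod (v r)"] by (simp add: power2_sum)
        finally have "wt r * (cmod (u r + v r))\<^sup>2 \<le> wt r * (2 * (cmod (u r))\<^sup>2 + 2 * (cmod (v r))\<^sup>2)"
          using wt_pos[OF r] by (intro mult_left_mono) auto
        then show ?thesis by (simp add: algebra_simps)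
      qed
      then show "norm (indicator {0<..<1} r *\<^sub>R (wt r * (cmod (u r + v r))\<^sup>2)) \<le>
        norm (2 * (indicator {0<..<1} r *\<^sub>R (wt r * (cmod (u r))\<^sup>2)) + 2 * (indicator {0<..<1} r *\<^sub>R (wt r * (cmod (v r))\<^sup>2)))"
        using wt_pos[of r] by (cases "r \<in> {0<..<1}") (auto simp: abs_mult)
    qed
  qed
  then show ?thesis using ms by (simp add: inH_def set_borel_measurable_def)
qed

end

section \<open>The Green operator\<close>

lemma schur_test:
  fixes E :: "real \<Rightarrow> real \<Rightarrow> ennreal" and d H :: "real \<Rightarrow> ennreal" and c :: ennreal
  assumes E [measurable]: "(\<lambda>(x, y). E x y) \<in> borel_measurable (lborel \<Otimes>\<^sub>M lborel)"
    and d [measurable]: "d \<in> borel_measurable lborel" and H [measurable]: "H \<in> borel_measurable lborel"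
    and sym: "\<And>x y. E x y = E y x"
    and row: "\<And>x. d x \<noteq> 0 \<Longrightarrow> (\<integral>\<^sup>+y. E x y * d y \<partial>lborel) \<le> c"
  shows "(\<integral>\<^sup>+x. d x * (\<integral>\<^sup>+y. E x y * d y * H y \<partial>lborel)\<^sup>2 \<partial>lborel) \<le> c * c * (\<integral>\<^sup>+y. d y * (H y)\<^sup>2 \<partial>lborel)"
proof -
  have Ex [measurable]: "E x \<in> borel_measurable lborel" for x
    using measurable_compose[OF measurable_Pair1'[of x lborel lborel] E] by (simp add: split_beta')
  have cs: "(\<integral>\<^sup>+y. E x y * d y * H y \<partial>lborel)\<^sup>2 \<le> c * (\<integral>\<^sup>+y. E x y * d y * (H y)\<^sup>2 \<partial>lborel)" if "d x \<noteq> 0" for x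
  proof -
    define N where "N = density lborel (\<lambda>y. E x y * d y)"
    have "(\<integral>\<^sup>+y. 1 * H y \<partial>N)\<^sup>2 \<le> (\<integral>\<^sup>+y. 1\<^sup>2 \<partial>N) * (\<integral>\<^sup>+y. (H y)\<^sup>2 \<partial>N)"
      by (rule Cauchy_Schwarz_nn_integral) (auto simp: N_def)
    moreover have "(\<integral>\<^sup>+y. 1 * H y \<partial>N) = (\<integral>\<^sup>+y. E x y * d y * H y \<partial>lborel)"
      "(\<integral>\<^sup>+y. 1\<^sup>2 \<partial>N) = (\<integral>\<^sup>+y. E x y * d y \<partial>lborel)"
      "(\<integral>\<^sup>+y. (H y)\<^sup>2 \<partial>N) = (\<integral>\<^sup>+y. E x y * d y * (H y)\<^sup>2 \<partial>lborel)"
      unfolding N_def by (subst nn_integral_density; simp)+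
    ultimately have "(\<integral>\<^sup>+y. E x y * d y * H y \<partial>lborel)\<^sup>2 \<le> (\<integral>\<^sup>+y. E x y * d y \<partial>lborel) * (\<integral>\<^sup>+y. E x y * d y * (H y)\<^sup>2 \<partial>lborel)"
      by simp
    also have "\<dots> \<le> c * (\<integral>\<^sup>+y. E x y * d y * (H y)\<^sup>2 \<partial>lborel)" by (intro mult_right_mono row that) simp
    finally show ?thesis .
  qed
  have "(\<integral>\<^sup>+x. d x * (\<integral>\<^sup>+y. E x y * d y * H y \<partial>lborel)\<^sup>2 \<partial>lborel) \<le>
      (\<integral>\<^sup>+x. d x * (c * (\<integral>\<^sup>+y. E x y * d y * (H y)\<^sup>2 \<partial>lborel)) \<partial>lborel)"
  proof (rule nn_integral_mono)
    fix x show "d x * (\<integral>\<^sup>+y. E x y * d y * H y \<partial>lborel)\<^sup>2 \<le> d x * (c * (\<integral>\<^sup>+y. E x y * d y * (H y)\<^sup>2 \<partial>lborel))"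
      using cs[of x] by (cases "d x = 0") (auto intro: mult_left_mono)
  qed
  also have "\<dots> = (\<integral>\<^sup>+x. (\<integral>\<^sup>+y. c * (d x * (E x y * d y * (H y)\<^sup>2)) \<partial>lborel) \<partial>lborel)"
    by (simp add: nn_integral_cmult[symmetric] mult.left_commute)
  also have "\<dots> = (\<integral>\<^sup>+y. (\<integral>\<^sup>+x. c * (d x * (E x y * d y * (H y)\<^sup>2)) \<partial>lborel) \<partial>lborel)"
    by (rule lborel_pair.Fubini'[symmetric]) (use E in \<open>measurable\<close>)
  also have "\<dots> = (\<integral>\<^sup>+y. (\<integral>\<^sup>+x. (c * d y * (H y)\<^sup>2) * (E y x * d x) \<partial>lborel) \<partial>lborel)"
  proof (intro nn_integral_cong)
    fix y x :: real
    have "E x y = E y x" by (rule sym)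
    then show "c * (d x * (E x y * d y * (H y)\<^sup>2)) = (c * d y * (H y)\<^sup>2) * (E y x * d x)" by (simp only: ac_simps)
  qed
  also have "\<dots> = (\<integral>\<^sup>+y. (c * d y * (H y)\<^sup>2) * (\<integral>\<^sup>+x. E y x * d x \<partial>lborel) \<partial>lborel)"
    by (intro nn_integral_cong nn_integral_cmult) simp
  also have "\<dots> \<le> (\<integral>\<^sup>+y. (c * d y * (H y)\<^sup>2) * c \<partial>lborel)"
  proof (rule nn_integral_mono)
    fix y show "(c * d y * (H y)\<^sup>2) * (\<integral>\<^sup>+x. E y x * d x \<partial>lborel) \<le> (c * d y * (H y)\<^sup>2) * c"
      using row[of y] by (cases "d y = 0") (auto intro: mult_left_mono)
  qed
  also have "\<dots> = (\<integral>\<^sup>+y. c * c * (d y * (H y)\<^sup>2) \<partial>lborel)"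
    by (intro nn_integral_cong) (simp add: ac_simps)
  also have "\<dots> = c * c * (\<integral>\<^sup>+y. d y * (H y)\<^sup>2 \<partial>lborel)"
    by (rule nn_integral_cmult) simp
  finally show ?thesis .
qed

text \<open>Lebesgue measure dx pulled back along x = artanh r. It allows the estimate to run on the
  unit interval, where the data live, with the kernel of the half line.\<close>

definition dens :: "real \<Rightarrow> ennreal" where
  "dens r = indicator {0<..<1} r * ennreal (1 / (1 - r\<^sup>2))"

definition expker :: "real \<Rightarrow> real \<Rightarrow> real \<Rightarrow> ennreal" where
  "expker k r s = ennreal (exp (- k * \<bar>artanh r - artanh s\<bar>))"

lemma artanh_measurable [measurable]: "(artanh :: real \<Rightarrow> real) \<in> borel_measurable borel"
  unfolding artanh_def[abs_def] by measurable

lemma dens_measurable [measurable]: "dens \<in> borel_measurable borel"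
  unfolding dens_def[abs_def] by measurable

lemma exp_artanh_powr:
  fixes r k :: real
  assumes "r \<in> {0<..<1}"
  shows "exp (- k * artanh r) = ((1 - r) / (1 + r)) powr (k / 2)"
proof -
  have "ln ((1 - r) / (1 + r)) = - ln ((1 + r) / (1 - r))"
    using assms ln_inverse[of "(1 + r) / (1 - r)"] by simp
  then show ?thesis using assms unfolding powr_def artanh_def by (simp add: algebra_simps)
qed

text \<open>In the coordinate \<open>x = artanh r\<close> this is \<open>\<integral> e\<^sup>-\<^sup>k\<^sup>|\<^sup>x\<^sup>-\<^sup>t\<^sup>| dt \<le> 2 / k\<close>.\<close>

lemma expker_row:
  assumes k: "0 < k" and x: "x \<in> {0<..<1}"
  shows "(\<integral>\<^sup>+y. expker k x y * dens y \<partial>lborel) \<le> ennreal (2 / k)"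
proof -
  \<comment> \<open>This is exp (-k artanh r) rewritten so that it extends continuously by 0 to r =
    1, as the fundamental theorem on {x..1} requires.\<close>
  define S where "S r = ((1 - r) / (1 + r)) powr (k / 2)" for r :: real
  define T where "T r = exp (k * artanh r)" for r :: real
  have dT: "(T has_real_derivative k * T r / (1 - r\<^sup>2)) (at r)" if "r \<in> {0..<1}" for r
    unfolding T_def using that by (auto intro!: derivative_eq_intros)
  have ST: "S r = 1 / T r" if "r \<in> {0<..<1}" for r
    using exp_artanh_powr[OF that, of k] by (simp add: S_def T_def exp_minus inverse_eq_divide)
  have dS: "(S has_real_derivative - (k * S r / (1 - r\<^sup>2))) (at r)" if r: "r \<in> {0<..<1}" for r
  proof -
    have "((\<lambda>r. 1 / T r) has_real_derivative - (k * S r / (1 - r\<^sup>2))) (at r)"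
      using r unfolding ST[OF r] by (auto intro!: derivative_eq_intros dT simp: T_def power2_eq_square)
    then show ?thesis
      by (rule has_field_derivative_transform_within_open[where S = "{0<..<1}"]) (use r ST in auto)
  qed
  have I1: "((\<lambda>r. T r / (1 - r\<^sup>2)) has_integral (T x / k - T 0 / k)) {0..x}"
  proof (rule fundamental_theorem_of_calculus)
    fix r assume "r \<in> {0..x}"
    then have "r \<in> {0..<1}" using x by auto
    then have "((\<lambda>r. T r / k) has_real_derivative T r / (1 - r\<^sup>2)) (at r within {0..x})"
      using k by (auto intro!: derivative_eq_intros has_field_derivative_at_within[OF dT])
    then show "((\<lambda>r. T r / k) has_vector_derivative T r / (1 - r\<^sup>2)) (at r within {0..x})"
      by (simp add: has_real_derivative_iff_has_vector_derivative)
  qed (use x in auto)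
  have I2: "((\<lambda>r. S r / (1 - r\<^sup>2)) has_integral (- (S 1) / k - - (S x) / k)) {x..1}"
  proof (rule fundamental_theorem_of_calculus_interior)
    show "continuous_on {x..1} (\<lambda>r. - (S r) / k)"
      unfolding S_def using x k by (intro continuous_on_divide continuous_on_minus continuous_on_powr' continuous_intros) auto
    fix r assume "r \<in> {x<..<1}"
    then have r: "r \<in> {0<..<1}" using x by auto
    then have "((\<lambda>r. - (S r) / k) has_real_derivative S r / (1 - r\<^sup>2)) (at r)"
      using k by (auto intro!: derivative_eq_intros dS[OF r])
    then show "((\<lambda>r. - (S r) / k) has_vector_derivative S r / (1 - r\<^sup>2)) (at r)"
      by (simp add: has_real_derivative_iff_has_vector_derivative)
  qed (use x in auto)
  have sq: "r\<^sup>2 \<le> 1" if "0 \<le> r" "r \<le> 1" for r :: real using that by (simp add: power_le_one)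
  have N1: "(\<integral>\<^sup>+r. ennreal (T r / (1 - r\<^sup>2)) * indicator {0..x} r \<partial>lborel) = ennreal (T x / k - T 0 / k)"
    by (rule nn_integral_has_integral_lebesgue'[OF _ I1]) (use x sq in \<open>auto simp: T_def intro!: divide_nonneg_nonneg\<close>)
  have N2: "(\<integral>\<^sup>+r. ennreal (S r / (1 - r\<^sup>2)) * indicator {x..1} r \<partial>lborel) = ennreal (- (S 1) / k - - (S x) / k)"
    by (rule nn_integral_has_integral_lebesgue'[OF _ I2]) (use x sq in \<open>auto simp: S_def intro!: divide_nonneg_nonneg\<close>)
  have [measurable]: "T \<in> borel_measurable borel" "S \<in> borel_measurable borel"
    unfolding T_def[abs_def] S_def[abs_def] by measurable
  have "(\<integral>\<^sup>+y. expker k x y * dens y \<partial>lborel) \<le>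
     (\<integral>\<^sup>+y. ennreal (1 / T x) * (ennreal (T y / (1 - y\<^sup>2)) * indicator {0..x} y) + ennreal (T x) * (ennreal (S y / (1 - y\<^sup>2)) * indicator {x..1} y) \<partial>lborel)"
  proof (rule nn_integral_mono)
    fix y
    consider "y \<notin> {0<..<1}" | "y \<in> {0<..<1}" "y \<le> x" | "y \<in> {0<..<1}" "x \<le> y" by linarith
    then show "expker k x y * dens y \<le> ennreal (1 / T x) * (ennreal (T y / (1 - y\<^sup>2)) * indicator {0..x} y) + ennreal (T x) * (ennreal (S y / (1 - y\<^sup>2)) * indicator {x..1} y)"
    proof cases
      case 2
      then have "artanh y \<le> artanh x" using x by (simp add: artanh_le_iff)
      then have "exp (- k * \<bar>artanh x - artanh y\<bar>) = 1 / T x * T y"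
        by (simp add: T_def exp_diff[symmetric] exp_minus[symmetric] exp_add[symmetric] inverse_eq_divide[symmetric] algebra_simps)
      then have "expker k x y * dens y = ennreal (1 / T x) * (ennreal (T y / (1 - y\<^sup>2)) * indicator {0..x} y)"
        using 2 x sq[of y] by (simp add: expker_def dens_def T_def ennreal_mult[symmetric] divide_nonneg_nonneg)
      then show ?thesis by simp
    next
      case 3
      then have "artanh x \<le> artanh y" using x by (simp add: artanh_le_iff)
      then have "exp (- k * \<bar>artanh x - artanh y\<bar>) = T x * S y"
        unfolding ST[OF 3(1)]
        by (simp add: T_def exp_diff[symmetric] exp_minus[symmetric] exp_add[symmetric] inverse_eq_divide[symmetric] algebra_simps)
      then have "expker k x y * dens y = ennreal (T x) * (ennreal (S y / (1 - y\<^sup>2)) * indicator {x..1} y)"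
        using 3 x sq[of y] by (simp add: expker_def dens_def T_def S_def ennreal_mult[symmetric] divide_nonneg_nonneg)
      then show ?thesis by simp
    qed (simp add: dens_def)
  qed
  also have "\<dots> = ennreal (1 / T x) * ennreal (T x / k - T 0 / k) + ennreal (T x) * ennreal (- (S 1) / k - - (S x) / k)"
    by (subst nn_integral_add) (simp_all add: nn_integral_cmult N1 N2)
  also have "\<dots> \<le> ennreal (1 / T x) * ennreal (T x / k) + ennreal (T x) * ennreal (S x / k)"
    using k by (intro add_mono mult_left_mono ennreal_leI) (auto simp: S_def T_def)
  also have "\<dots> = ennreal (2 / k)"
    using k unfolding ST[OF x] by (simp add: T_def ennreal_mult[symmetric] ennreal_plus[symmetric] del: ennreal_plus)
  finally show ?thesis .
qed

section \<open>Estimates for the hyperbolic sine\<close>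

lemma sinh_lower_bounds:
  fixes x :: real
  assumes x: "0 < x"
  shows "x \<le> sinh x" "x ^ 3 / 6 \<le> sinh x"
proof -
  have s: "t \<le> sinh t" if "0 \<le> t" for t :: real
  proof -
    have "sinh 0 - 0 \<le> sinh t - t"
      by (rule DERIV_nonneg_imp_nondecreasing[where f = "\<lambda>x. sinh x - x"])
        (use that in \<open>auto intro!: exI derivative_eq_intros cosh_real_ge_1\<close>)
    then show ?thesis by simp
  qed
  have c: "t\<^sup>2 / 2 \<le> cosh t" if "0 \<le> t" for t :: real
  proof -
    have "cosh 0 - 0\<^sup>2 / 2 \<le> cosh t - t\<^sup>2 / 2"
    proof (rule DERIV_nonneg_imp_nondecreasing[where f = "\<lambda>x. cosh x - x\<^sup>2 / 2"])
      fix u :: real assume "0 \<le> u"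
      then have "((\<lambda>x. cosh x - x\<^sup>2 / 2) has_real_derivative sinh u - u) (at u) \<and> 0 \<le> sinh u - u"
        using s by (auto intro!: derivative_eq_intros)
      then show "\<exists>d. ((\<lambda>x. cosh x - x\<^sup>2 / 2) has_real_derivative d) (at u) \<and> 0 \<le> d" by blast
    qed (use that in auto)
    then show ?thesis by simp
  qed
  have "sinh 0 - 0 ^ 3 / 6 \<le> sinh x - x ^ 3 / 6"
  proof (rule DERIV_nonneg_imp_nondecreasing[where f = "\<lambda>x. sinh x - x ^ 3 / 6"])
    fix u :: real assume u: "0 \<le> u"
    then have "((\<lambda>x. sinh x - x ^ 3 / 6) has_real_derivative cosh u - u\<^sup>2 / 2) (at u) \<and> 0 \<le> cosh u - u\<^sup>2 / 2"
      using c by (auto intro!: derivative_eq_intros simp: power2_eq_square power3_eq_cube)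
    then show "\<exists>d. ((\<lambda>x. sinh x - x ^ 3 / 6) has_real_derivative d) (at u) \<and> 0 \<le> d" by blast
  qed (use x in auto)
  then show "x ^ 3 / 6 \<le> sinh x" by simp
  show "x \<le> sinh x" by (rule s) (use x in simp)
qed

text \<open>Together these say that 1 / x^2 - 1 / sinh^2 x lies between 0 and 1. The second bound is
  tanh x <= x, squared and divided.\<close>

lemma inverse_sinh_square_bounds:
  fixes x :: real
  assumes x: "0 < x"
  shows "1 / (sinh x)\<^sup>2 \<le> 1 / x\<^sup>2" "1 / x\<^sup>2 \<le> 1 + 1 / (sinh x)\<^sup>2"
proof -
  have "0 * cosh 0 - sinh 0 \<le> x * cosh x - sinh x"
  proof (rule DERIV_nonneg_imp_nondecreasing[where f = "\<lambda>x. x * cosh x - sinh x"])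
    fix t :: real assume "0 \<le> t"
    then have "((\<lambda>x. x * cosh x - sinh x) has_real_derivative t * sinh t) (at t) \<and> 0 \<le> t * sinh t"
      by (auto intro!: derivative_eq_intros)
    then show "\<exists>d. ((\<lambda>x. x * cosh x - sinh x) has_real_derivative d) (at t) \<and> 0 \<le> d" by blast
  qed (use x in auto)
  then have "(sinh x)\<^sup>2 \<le> (x * cosh x)\<^sup>2" using x by (intro power_mono) auto
  then have "(sinh x)\<^sup>2 \<le> x\<^sup>2 * (1 + (sinh x)\<^sup>2)" by (simp add: power_mult_distrib cosh_square_eq add.commute)
  then show "1 / x\<^sup>2 \<le> 1 + 1 / (sinh x)\<^sup>2" using x by (simp add: field_simps)
  show "1 / (sinh x)\<^sup>2 \<le> 1 / x\<^sup>2" using sinh_lower_bounds(1)[OF x] x by (intro divide_left_mono power_mono) auto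
qed

context profile_op
begin

section \<open>Integrability of the Green integrands\<close>

lemma product_integrable:
  assumes u: "inH u" and h: "inH h"
  shows "set_integrable lebesgue {0<..<1} (\<lambda>r. u r * h r * of_real (wt r))"
  unfolding set_integrable_def
proof (rule Bochner_Integration.integrable_bound)
  show "integrable lebesgue (\<lambda>r. (indicator {0<..<1} r *\<^sub>R (wt r * (cmod (u r))\<^sup>2)) + (indicator {0<..<1} r *\<^sub>R (wt r * (cmod (h r))\<^sup>2)))"
    using u h unfolding inH_def set_integrable_def by (intro Bochner_Integration.integrable_add) auto
  have m: "(\<lambda>r. indicator {0<..<1} r *\<^sub>R u r) \<in> borel_measurable lebesgue" "(\<lambda>r. indicator {0<..<1} r *\<^sub>R h r) \<in> borel_measurable lebesgue"
    using u h by (auto simp: inH_def set_borel_measurable_def)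
  have mw: "(\<lambda>r. indicator {0<..<1} r *\<^sub>R wt r) \<in> borel_measurable lebesgue"
    using borel_measurable_continuous_on_indicator[OF _ wt_cont] by (intro measurable_completion) simp
  have "(\<lambda>r. (indicator {0<..<1} r *\<^sub>R u r) * (indicator {0<..<1} r *\<^sub>R h r) * of_real (indicator {0<..<1} r *\<^sub>R wt r)) \<in> borel_measurable lebesgue"
    using m mw by measurable
  also have "(\<lambda>r. (indicator {0<..<1} r *\<^sub>R u r) * (indicator {0<..<1} r *\<^sub>R h r) * of_real (indicator {0<..<1} r *\<^sub>R wt r)) =
      (\<lambda>r. indicator {0<..<1} r *\<^sub>R (u r * h r * of_real (wt r)))"
    by (auto simp: fun_eq_iff indicator_def)
  finally show "(\<lambda>r. indicator {0<..<1} r *\<^sub>R (u r * h r * of_real (wt r))) \<in> borel_measurable lebesgue" .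
  show "AE r in lebesgue. norm (indicator {0<..<1} r *\<^sub>R (u r * h r * of_real (wt r))) \<le>
      norm ((indicator {0<..<1} r *\<^sub>R (wt r * (cmod (u r))\<^sup>2)) + (indicator {0<..<1} r *\<^sub>R (wt r * (cmod (h r))\<^sup>2)))"
  proof (rule AE_I2)
    fix r
    have "cmod (u r) * cmod (h r) * wt r \<le> wt r * (cmod (u r))\<^sup>2 + wt r * (cmod (h r))\<^sup>2" if r: "r \<in> {0<..<1}"
    proof -
      have "0 \<le> cmod (u r) * cmod (h r)" by simp
      then have "cmod (u r) * cmod (h r) \<le> (cmod (u r))\<^sup>2 + (cmod (h r))\<^sup>2"
        using sum_squares_bound[of "cmod (u r)" "cmod (h r)"] by linarith
      then have "wt r * (cmod (u r) * cmod (h r)) \<le> wt r * ((cmod (u r))\<^sup>2 + (cmod (h r))\<^sup>2)"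
        using wt_pos[OF r] by (intro mult_left_mono) auto
      then show ?thesis by (simp add: algebra_simps)
    qed
    then show "norm (indicator {0<..<1} r *\<^sub>R (u r * h r * of_real (wt r))) \<le>
      norm ((indicator {0<..<1} r *\<^sub>R (wt r * (cmod (u r))\<^sup>2)) + (indicator {0<..<1} r *\<^sub>R (wt r * (cmod (h r))\<^sup>2)))"
      using wt_pos[of r] by (cases "r \<in> {0<..<1}") (auto simp: norm_mult)
  qed
qed

text \<open>The weight takes the value 0 at both end points, at 1 through division by zero, so
  adding them does not change the integrand.\<close>

lemma set_integrable_wt_closed:
  fixes c :: "real \<Rightarrow> complex"
  shows "set_integrable lebesgue {0<..r} (\<lambda>t. c t * of_real (wt t)) \<longleftrightarrow> set_integrable lebesgue {0..r} (\<lambda>t. c t * of_real (wt t))"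
    and "set_integrable lebesgue {r..<1} (\<lambda>t. c t * of_real (wt t)) \<longleftrightarrow> set_integrable lebesgue {r..1} (\<lambda>t. c t * of_real (wt t))"
proof -
  have "wt 0 = 0" "wt 1 = 0" by (auto simp: wt_def)
  then have "(\<lambda>t. indicator {0<..r} t *\<^sub>R (c t * of_real (wt t))) = (\<lambda>t. indicator {0..r} t *\<^sub>R (c t * of_real (wt t)))"
    "(\<lambda>t. indicator {r..<1} t *\<^sub>R (c t * of_real (wt t))) = (\<lambda>t. indicator {r..1} t *\<^sub>R (c t * of_real (wt t)))"
    by (auto simp: fun_eq_iff indicator_def)
  then show "set_integrable lebesgue {0<..r} (\<lambda>t. c t * of_real (wt t)) \<longleftrightarrow> set_integrable lebesgue {0..r} (\<lambda>t. c t * of_real (wt t))"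
    "set_integrable lebesgue {r..<1} (\<lambda>t. c t * of_real (wt t)) \<longleftrightarrow> set_integrable lebesgue {r..1} (\<lambda>t. c t * of_real (wt t))"
    unfolding set_integrable_def by simp_all
qed

text \<open>Beyond X the function a is frozen at its value there and multiplied by a decaying
  exponential. The result belongs to the Hilbert space and leaves the integrand on {0..tanh X}
  unchanged.\<close>

lemma product_integrable_low:
  assumes a: "continuous_on {0<..} a" "\<And>x. 0 < x \<Longrightarrow> x \<le> X \<Longrightarrow> cmod (a x) \<le> M" and X: "0 < X" and h: "inH h"
  shows "set_integrable lebesgue {0..tanh X} (\<lambda>r. to_u a r * h r * of_real (wt r))"
  unfolding set_integrable_wt_closed(1)[symmetric]
proof -
  define y where "y x = a (min x X) * of_real (exp (- (max x X - X)))" for x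
  have yc: "continuous_on {0<..} y"
    unfolding y_def by (intro continuous_intros continuous_on_compose2[OF a(1)]) (use X in auto)
  have "cmod (y x) \<le> (M * exp X) * exp (- 1 * x)" if "0 < x" for x
  proof -
    have "cmod (a (min x X)) \<le> M" using that X by (intro a(2)) auto
    moreover have "exp (- (max x X - X)) \<le> exp (X - x)" by simp
    ultimately have "cmod (a (min x X)) * exp (- (max x X - X)) \<le> M * exp (X - x)"
      by (intro mult_mono) (auto intro: order_trans[OF norm_ge_zero])
    also have "M * exp (X - x) = (M * exp X) * exp (- 1 * x)" by (simp add: exp_diff exp_minus field_simps)
    finally show ?thesis unfolding y_def norm_mult norm_of_real abs_exp_cancel .
  qed
  then have "inH (to_u y)" by (intro inH_to_u yc exp_bound_imp_sq_bounded[OF yc, of 1]) auto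
  from product_integrable[OF this h]
  have "set_integrable lebesgue {0<..<1} (\<lambda>r. to_u y r * h r * of_real (wt r))" .
  then have "set_integrable lebesgue {0<..tanh X} (\<lambda>r. to_u y r * h r * of_real (wt r))"
    by (rule set_integrable_subset) (use tanh_real_lt_1[of X] in auto)
  then show "set_integrable lebesgue {0<..tanh X} (\<lambda>r. to_u a r * h r * of_real (wt r))"
  proof (rule set_integrable_cong[THEN iffD1, rotated -1])
    fix r assume r: "r \<in> {0<..tanh X}"
    then have r1: "r \<in> {0<..<1}" using tanh_real_lt_1[of X] by auto
    have "artanh r \<le> X" using r artanh_unit(2)[OF r1] by (metis greaterThanAtMost_iff tanh_real_le_iff)
    then show "to_u y r * h r * of_real (wt r) = to_u a r * h r * of_real (wt r)" by (simp add: to_u_def y_def)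
  qed auto
qed

lemma product_integrable_high:
  assumes p: "continuous_on {0<..} p" "\<And>x. X \<le> x \<Longrightarrow> cmod (p x) \<le> M * exp (- k * x)" and X: "0 < X" and k: "0 < k" and h: "inH h"
  shows "set_integrable lebesgue {tanh X..1} (\<lambda>r. to_u p r * h r * of_real (wt r))"
  unfolding set_integrable_wt_closed(2)[symmetric]
proof -
  define y where "y x = p (max x X)" for x
  have yc: "continuous_on {0<..} y"
    unfolding y_def by (intro continuous_intros continuous_on_compose2[OF p(1)]) (use X in auto)
  have "0 \<le> M * exp (- k * X)" using p(2)[of X] by (meson norm_ge_zero order_refl order_trans)
  then have M: "0 \<le> M" by (simp add: zero_le_mult_iff)
  have "cmod (y x) \<le> M * exp (- k * x)" if "0 < x" for x
  proof -
    have "cmod (p (max x X)) \<le> M * exp (- k * max x X)" by (rule p(2)) simp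
    also have "\<dots> \<le> M * exp (- k * x)" using M k by (intro mult_left_mono) (auto intro: mult_left_mono)
    finally show ?thesis by (simp add: y_def)
  qed
  then have "inH (to_u y)" by (intro inH_to_u yc exp_bound_imp_sq_bounded[OF yc k])
  from product_integrable[OF this h]
  have "set_integrable lebesgue {0<..<1} (\<lambda>r. to_u y r * h r * of_real (wt r))" .
  then have "set_integrable lebesgue {tanh X..<1} (\<lambda>r. to_u y r * h r * of_real (wt r))"
  proof (rule set_integrable_subset)
    show "{tanh X..<1} \<subseteq> {0<..<1}"
    proof
      fix r assume "r \<in> {tanh X..<1}"
      then have "tanh X \<le> r" "r < 1" by auto
      moreover have "0 < tanh X" using X by simp
      ultimately show "r \<in> {0<..<1}" using less_le_trans[of 0 "tanh X" r] by auto
    qed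
  qed auto
  then show "set_integrable lebesgue {tanh X..<1} (\<lambda>r. to_u p r * h r * of_real (wt r))"
  proof (rule set_integrable_cong[THEN iffD1, rotated -1])
    fix r assume r: "r \<in> {tanh X..<1}"
    have "0 < tanh X" using X by simp
    then have "0 < r" using r by (meson atLeastLessThan_iff less_le_trans)
    then have r1: "r \<in> {0<..<1}" using r by auto
    have "X \<le> artanh r" using r artanh_unit(2)[OF r1] by (metis atLeastLessThan_iff tanh_real_le_iff)
    then show "to_u y r * h r * of_real (wt r) = to_u p r * h r * of_real (wt r)" by (simp add: to_u_def y_def max_def)
  qed auto
qed

text \<open>Serves to recover the unperturbed operator: A u = z u - h - g u is again in the Hilbert
  space. The singular terms cancel through 2 / sinh^2 - 2 / (cosh^2 sinh^2) = 2 / cosh^2.\<close>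

lemma gpot_bounded: "\<exists>M. \<forall>r\<in>{0<..<1}. \<bar>gpot f r\<bar> \<le> M"
proof (intro exI ballI)
  fix r :: real assume r: "r \<in> {0<..<1}"
  define x where "x = artanh r"
  have x: "0 < x" "tanh x = r" using artanh_unit[OF r] by (auto simp: x_def)
  note t = tanh_cosh_sinh[OF x(1)]
  note s = inverse_sinh_square_bounds[OF x(1)]
  have e: "2 / (sinh x)\<^sup>2 - 2 / ((cosh x)\<^sup>2 * (sinh x)\<^sup>2) = 2 / (cosh x)\<^sup>2"
  proof -
    have S: "(sinh x)\<^sup>2 \<noteq> 0" and Cx: "(cosh x)\<^sup>2 \<noteq> 0" using t(4,5) by auto
    have "2 / (sinh x)\<^sup>2 = 2 * (cosh x)\<^sup>2 / ((cosh x)\<^sup>2 * (sinh x)\<^sup>2)" using S Cx by simp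
    then have "2 / (sinh x)\<^sup>2 - 2 / ((cosh x)\<^sup>2 * (sinh x)\<^sup>2) = (2 * (cosh x)\<^sup>2 - 2) / ((cosh x)\<^sup>2 * (sinh x)\<^sup>2)"
      by (simp only: diff_divide_distrib)
    also have "2 * (cosh x)\<^sup>2 - 2 = 2 * (sinh x)\<^sup>2" by (simp add: cosh_square_eq)
    finally show ?thesis using S Cx by simp
  qed
  have c: "0 \<le> 2 / (cosh x)\<^sup>2" "2 / (cosh x)\<^sup>2 \<le> 2" using cosh_real_ge_1[of x] by (auto simp: divide_le_eq)
  show "\<bar>gpot f r\<bar> \<le> B + 5"
    using V_near[OF x(1)] s e c divide_inverse[of 2 "x\<^sup>2"] divide_inverse[of 1 "x\<^sup>2"]
      divide_inverse[of 2 "(sinh x)\<^sup>2"] divide_inverse[of 1 "(sinh x)\<^sup>2"] gpot_tanh[OF x(1), of f] unfolding x(2) by linarith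
qed

end

section \<open>Variation of constants\<close>

lemma inH_cong: "(\<And>r. r \<in> {0<..<1} \<Longrightarrow> u r = v r) \<Longrightarrow> inH u \<longleftrightarrow> inH v"
  unfolding inH_def set_integrable_def set_borel_measurable_def
  by (intro arg_cong2[where f = "(\<and>)"] arg_cong2[where f = "(\<in>)"] arg_cong2[where f = integrable] refl ext)
    (auto simp: indicator_def)

text \<open>The integrability of the two integrands is an assumption so that two situations fit:
  regular and Jost solution with arbitrary data off the half line, and regular solution with any
  independent partner and cut-off data on it.\<close>

locale green = profile_op f B C for f B C +
  fixes z W :: complex and a a1 b b1 h :: "real \<Rightarrow> complex"
  assumes a: "ode_solution {0<..} (V_shift z) a a1" and b: "ode_solution {0<..} (V_shift z) b b1"
    and W0: "W \<noteq> 0" and W: "\<And>x. 0 < x \<Longrightarrow> a x * b1 x - a1 x * b x = W" and h: "inH h"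
    and Ia: "\<And>r. r \<in> {0<..<1} \<Longrightarrow> set_integrable lebesgue {0..r} (\<lambda>t. to_u a t * h t * of_real (wt t))"
    and Ib: "\<And>r. r \<in> {0<..<1} \<Longrightarrow> set_integrable lebesgue {r..1} (\<lambda>t. to_u b t * h t * of_real (wt t))"
begin

definition P :: "real \<Rightarrow> complex" where "P r = integral {0..r} (\<lambda>t. to_u a t * h t * of_real (wt t))"
definition Q :: "real \<Rightarrow> complex" where "Q r = integral {r..1} (\<lambda>t. to_u b t * h t * of_real (wt t))"
definition gu :: "real \<Rightarrow> complex" where "gu r = (to_u b r * P r + to_u a r * Q r) / W"
text \<open>Equal to r^2 times the derivative of \<open>gu\<close>, since the terms with the
  derivatives of P and Q cancel.\<close>

definition gv :: "real \<Rightarrow> complex" where "gv r = (to_v b b1 r * P r + to_v a a1 r * Q r) / W"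

text \<open>Of the two factors wt in the square, one belongs to the norm of h; the other, together
  with U, is continuous and hence bounded on {c..d}.\<close>

lemma wt_h_sq_integrable:
  assumes U: "continuous_on {0<..<1} U" and cd: "0 < c" "c \<le> d" "d < 1"
  shows "(\<lambda>t. (cmod (U t * h t * of_real (wt t)))\<^sup>2) integrable_on {c..d}"
proof -
  have sub: "{c..d} \<subseteq> {0<..<1}" using cd by auto
  have "set_integrable lebesgue {0<..<1} (\<lambda>r. wt r * (cmod (h r))\<^sup>2)" using h by (simp add: inH_def)
  then have 1: "set_integrable lebesgue {c..d} (\<lambda>r. wt r * (cmod (h r))\<^sup>2)" by (rule set_integrable_subset) (use sub in auto)
  have gc: "continuous_on {c..d} (\<lambda>t. (cmod (U t))\<^sup>2 * wt t)"
    by (intro continuous_intros continuous_on_subset[OF U sub] continuous_on_subset[OF wt_cont sub])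
  have "(\<lambda>t. ((cmod (U t))\<^sup>2 * wt t) * (wt t * (cmod (h t))\<^sup>2)) absolutely_integrable_on {c..d}"
  proof (rule absolutely_integrable_bounded_measurable_product_real[OF _ _ _ 1])
    show "(\<lambda>t. (cmod (U t))\<^sup>2 * wt t) \<in> borel_measurable (lebesgue_on {c..d})"
      by (rule continuous_imp_measurable_on_sets_lebesgue[OF gc]) auto
    show "bounded ((\<lambda>t. (cmod (U t))\<^sup>2 * wt t) ` {c..d})"
      by (intro compact_imp_bounded compact_continuous_image gc) auto
  qed auto
  then have "(\<lambda>t. ((cmod (U t))\<^sup>2 * wt t) * (wt t * (cmod (h t))\<^sup>2)) integrable_on {c..d}"
    by (rule set_lebesgue_integral_eq_integral(1))
  moreover have "((cmod (U t))\<^sup>2 * wt t) * (wt t * (cmod (h t))\<^sup>2) = (cmod (U t * h t * of_real (wt t)))\<^sup>2" for t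
  proof -
    have "(cmod (U t * h t * of_real (wt t)))\<^sup>2 = (cmod (U t))\<^sup>2 * (cmod (h t))\<^sup>2 * (wt t)\<^sup>2"
      by (simp add: norm_mult power_mult_distrib)
    then show ?thesis by (simp only: power2_eq_square[of "wt t"] ac_simps)
  qed
  ultimately show ?thesis by simp
qed

lemma P_has_integral:
  assumes cd: "0 < c" "c \<le> d" "d < 1"
  shows "((\<lambda>t. to_u a t * h t * of_real (wt t)) has_integral (P d - P c)) {c..d}"
proof -
  let ?\<phi> = "\<lambda>t. to_u a t * h t * of_real (wt t)"
  have i: "?\<phi> integrable_on {0..d}" using Ia[of d] cd set_lebesgue_integral_eq_integral(1) by auto
  have "integral {0..c} ?\<phi> + integral {c..d} ?\<phi> = integral {0..d} ?\<phi>"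
    by (rule Henstock_Kurzweil_Integration.integral_combine[OF _ _ i]) (use cd in auto)
  moreover have "?\<phi> integrable_on {c..d}" by (rule integrable_on_subinterval[OF i]) (use cd in auto)
  ultimately show ?thesis by (simp add: P_def has_integral_iff algebra_simps)
qed

lemma Q_has_integral:
  assumes cd: "0 < c" "c \<le> d" "d < 1"
  shows "((\<lambda>t. - (to_u b t * h t * of_real (wt t))) has_integral (Q d - Q c)) {c..d}"
proof -
  let ?\<phi> = "\<lambda>t. to_u b t * h t * of_real (wt t)"
  have i: "?\<phi> integrable_on {c..1}" using Ib[of c] cd set_lebesgue_integral_eq_integral(1) by auto
  have "integral {c..d} ?\<phi> + integral {d..1} ?\<phi> = integral {c..1} ?\<phi>"
    by (rule Henstock_Kurzweil_Integration.integral_combine[OF _ _ i]) (use cd in auto)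
  moreover have "?\<phi> integrable_on {c..d}" by (rule integrable_on_subinterval[OF i]) (use cd in auto)
  ultimately have "(?\<phi> has_integral - (Q d - Q c)) {c..d}" by (simp add: Q_def has_integral_iff algebra_simps)
  from has_integral_neg[OF this] show ?thesis by simp
qed

lemma AC_P: "AC_loc P"
  by (rule AC_loc_indefinite_integral[OF P_has_integral]) (auto intro!: wt_h_sq_integrable to_u_cont[OF a])

lemma AC_Q: "AC_loc Q"
proof (rule AC_loc_indefinite_integral[OF Q_has_integral])
  fix c d :: real assume "0 < c" "c \<le> d" "d < 1"
  from wt_h_sq_integrable[OF to_u_cont(1)[OF b] this]
  show "(\<lambda>t. (cmod (- (to_u b t * h t * of_real (wt t))))\<^sup>2) integrable_on {c..d}" by simp
qed

lemma AC_to_u: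
  assumes y: "ode_solution {0<..} (V_shift z) y y1"
  shows "AC_loc (to_u y)" "AC_loc (to_v y y1)"
proof -
  show "AC_loc (to_u y)"
    by (rule AC_loc_continuous_derivI[OF to_u_deriv(1)[OF y]]) (auto intro!: continuous_intros to_u_cont[OF y])
  show "AC_loc (to_v y y1)"
    by (rule AC_loc_continuous_derivI[OF to_u_deriv(2)[OF y]]) (auto intro!: continuous_intros coef_cont to_u_cont[OF y])
qed

lemma AC_loc_const: "AC_loc (\<lambda>_. c)"
  by (rule AC_loc_continuous_derivI[where g = "\<lambda>_. 0"]) auto

lemma AC_gu: "AC_loc gu" and AC_gv: "AC_loc gv"
proof -
  have "AC_loc (\<lambda>r. (to_u b r * P r + to_u a r * Q r) * (1 / W))" "AC_loc (\<lambda>r. (to_v b b1 r * P r + to_v a a1 r * Q r) * (1 / W))"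
    by (intro AC_loc_mult AC_loc_add AC_P AC_Q AC_to_u[OF a] AC_to_u[OF b] AC_loc_const)+
  then show "AC_loc gu" "AC_loc gv" by (simp_all add: gu_def[abs_def] gv_def[abs_def])
qed

lemma to_uv_wronskian:
  assumes "r \<in> {0<..<1}"
  shows "to_u a r * to_v b b1 r - to_u b r * to_v a a1 r = W"
proof -
  define x where "x = artanh r"
  have x: "0 < x" "tanh x = r" using artanh_unit[OF assms] by (auto simp: x_def)
  have s: "complex_of_real (sinh x) \<noteq> 0" using tanh_cosh_sinh(4)[OF x(1)] by simp
  have "to_u a r * to_v b b1 r - to_u b r * to_v a a1 r = a x * b1 x - a1 x * b x"
    unfolding to_u_def to_v_def x_def[symmetric] using s by (simp add: field_simps)
  then show ?thesis using W[OF x(1)] by simp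
qed

text \<open>P and Q are only almost everywhere differentiable, but so are the derivatives in the
  definition of the domain; the product rule applies at every common point of
  differentiability.\<close>

lemma shifted_graph_gu:
  assumes gH: "inH gu"
  shows "shifted_graph f z gu h"
  unfolding shifted_graph_iff
proof (intro conjI exI)
  have dP: "AE r in lebesgue. r \<in> {0<..<1} \<longrightarrow> (P has_vector_derivative (to_u a r * h r * of_real (wt r))) (at r)"
    using ae_deriv_indefinite_integral[OF P_has_integral] unfolding ae_deriv_def .
  have dQ: "AE r in lebesgue. r \<in> {0<..<1} \<longrightarrow> (Q has_vector_derivative - (to_u b r * h r * of_real (wt r))) (at r)"
    using ae_deriv_indefinite_integral[OF Q_has_integral] unfolding ae_deriv_def .
  show "ae_deriv gu (\<lambda>r. gv r / of_real (r\<^sup>2))"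
    unfolding ae_deriv_def using dP dQ
  proof eventually_elim
    case (elim r)
    show ?case
    proof
      assume r: "r \<in> {0<..<1}"
      have "((\<lambda>r. (to_u b r * P r + to_u a r * Q r) / W) has_vector_derivative
         ((to_u b r * (to_u a r * h r * of_real (wt r)) + to_v b b1 r / of_real (r\<^sup>2) * P r) +
          (to_u a r * (- (to_u b r * h r * of_real (wt r))) + to_v a a1 r / of_real (r\<^sup>2) * Q r)) / W) (at r)"
        using elim r
        by (intro has_vector_derivative_divide has_vector_derivative_add has_vector_derivative_mult to_u_deriv[OF a r] to_u_deriv[OF b r]) auto
      moreover have "((to_u b r * (to_u a r * h r * of_real (wt r)) + to_v b b1 r / of_real (r\<^sup>2) * P r) +
          (to_u a r * (- (to_u b r * h r * of_real (wt r))) + to_v a a1 r / of_real (r\<^sup>2) * Q r)) / W = gv r / of_real (r\<^sup>2)"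
        by (simp add: gv_def add_divide_distrib mult.commute)
      ultimately show "(gu has_vector_derivative gv r / of_real (r\<^sup>2)) (at r)" unfolding gu_def[abs_def] by simp
    qed
  qed
  show "ae_deriv gv (\<lambda>r. coef f z r * gu r + of_real (wt r) * h r)"
    unfolding ae_deriv_def using dP dQ
  proof eventually_elim
    case (elim r)
    show ?case
    proof
      assume r: "r \<in> {0<..<1}"
      have d: "((\<lambda>r. (to_v b b1 r * P r + to_v a a1 r * Q r) / W) has_vector_derivative
         ((to_v b b1 r * (to_u a r * h r * of_real (wt r)) + coef f z r * to_u b r * P r) +
          (to_v a a1 r * (- (to_u b r * h r * of_real (wt r))) + coef f z r * to_u a r * Q r)) / W) (at r)"
        using elim r
        by (intro has_vector_derivative_divide has_vector_derivative_add has_vector_derivative_mult to_u_deriv[OF a r] to_u_deriv[OF b r]) auto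
      \<comment> \<open>The terms with the derivatives of P and Q combine to the Wronskian times wt
        * h, and division by W leaves the datum.\<close>
      have eqn: "(to_v b b1 r * (to_u a r * h r * of_real (wt r)) + coef f z r * to_u b r * P r) +
          (to_v a a1 r * (- (to_u b r * h r * of_real (wt r))) + coef f z r * to_u a r * Q r)
          = coef f z r * (to_u b r * P r + to_u a r * Q r) + W * (of_real (wt r) * h r)"
        unfolding to_uv_wronskian[OF r, symmetric] by (simp add: algebra_simps)
      have e: "((to_v b b1 r * (to_u a r * h r * of_real (wt r)) + coef f z r * to_u b r * P r) +
          (to_v a a1 r * (- (to_u b r * h r * of_real (wt r))) + coef f z r * to_u a r * Q r)) / W
          = coef f z r * gu r + of_real (wt r) * h r"
        unfolding eqn gu_def using W0 by (simp add: field_simps)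
      show "(gv has_vector_derivative coef f z r * gu r + of_real (wt r) * h r) (at r)"
        unfolding gv_def[abs_def] using d unfolding e .
    qed
  qed
  show "aeq gv (\<lambda>r. of_real (r\<^sup>2) * (gv r / of_real (r\<^sup>2)))"
    unfolding aeq_def by (rule AE_I2) auto
  \<comment> \<open>This function is A applied to \<open>gu\<close>, computed from the
    equation.\<close>
  have "inH (\<lambda>r. (z - of_real (gpot f r)) * gu r + (- 1) * h r)"
  proof (intro inH_add)
    obtain M where M: "\<And>r. r \<in> {0<..<1} \<Longrightarrow> \<bar>gpot f r\<bar> \<le> M" using gpot_bounded by blast
    show "inH (\<lambda>r. (z - of_real (gpot f r)) * gu r)"
    proof (rule inH_cmult_bounded[OF gH])
      fix r :: real assume r: "r \<in> {0<..<1}"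
      show "cmod (z - of_real (gpot f r)) \<le> cmod z + M"
        using norm_triangle_ineq4[of z "of_real (gpot f r)"] M[OF r] by simp
    qed (intro continuous_intros gpot_cont)
    show "inH (\<lambda>r. (- 1) * h r)" by (rule inH_cmult_bounded[OF h, of "\<lambda>_. - 1" 1]) auto
  qed
  then show "inH (\<lambda>r. (- (coef f z r * gu r + of_real (wt r) * h r) + 2 * gu r) / of_real (wt r))"
  proof (rule inH_cong[THEN iffD1, rotated])
    fix r :: real assume r: "r \<in> {0<..<1}"
    show "(z - of_real (gpot f r)) * gu r + (- 1) * h r = (- (coef f z r * gu r + of_real (wt r) * h r) + 2 * gu r) / of_real (wt r)"
      using wt_pos[OF r] by (simp add: coef_def field_simps)
  qed
qed (use gH AC_gu AC_gv in auto)

text \<open>The modulus of the transformed \<open>gu\<close> is at most a constant times the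
  exponential kernel applied to that of h, and the Schur test applies. The set J serves both uses:
  everything off the half line, and {..R} for data cut off at R, where the kernel is controlled up
  to R only and \<open>gu\<close> vanishes beyond.\<close>

lemma gu_inH:
  assumes k: "0 < k" and M: "0 \<le> M" and kb: "\<And>t x. 0 < t \<Longrightarrow> t \<le> x \<Longrightarrow> x \<in> J \<Longrightarrow> cmod (a t) * cmod (b x) \<le> M * exp (- k * (x - t))"
    and h0: "\<And>r. r \<in> {0<..<1} \<Longrightarrow> artanh r \<notin> J \<Longrightarrow> h r = 0"
    and u0: "\<And>r. r \<in> {0<..<1} \<Longrightarrow> artanh r \<notin> J \<Longrightarrow> gu r = 0"
  shows "inH gu"
proof -
  define e :: "real \<Rightarrow> real" where "e r = sinh (artanh r)" for r
  define H where "H r = ennreal (indicator {0<..<1} r * (e r * cmod (h r)))" for r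
  have "H \<in> borel_measurable lebesgue"
  proof -
    have "(\<lambda>r. indicator {0<..<1} r *\<^sub>R h r) \<in> borel_measurable lebesgue" using h by (simp add: inH_def set_borel_measurable_def)
    moreover have "e \<in> borel_measurable lebesgue"
    proof -
      have "(sinh :: real \<Rightarrow> real) \<in> borel_measurable borel"
        by (intro borel_measurable_continuous_onI continuous_intros)
      then have "(\<lambda>r. sinh (artanh r) :: real) \<in> borel_measurable borel" using artanh_measurable by measurable
      then show ?thesis unfolding e_def[abs_def] by (intro measurable_completion) simp
    qed
    ultimately have "(\<lambda>r. ennreal (e r * cmod (indicator {0<..<1} r *\<^sub>R h r))) \<in> borel_measurable lebesgue" by measurable
    also have "(\<lambda>r. ennreal (e r * cmod (indicator {0<..<1} r *\<^sub>R h r))) = H"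
      by (auto simp: H_def fun_eq_iff indicator_def)
    finally show ?thesis .
  qed
  \<comment> \<open>A Borel version of H, because the Schur test with its use of Tonelli is
    formulated over \<open>lborel\<close>.\<close>
  then obtain H' where H'm [measurable]: "H' \<in> borel_measurable lborel" and H': "AE r in lborel. H r = H' r"
    using completion_ex_borel_measurable by blast
  have Em [measurable]: "(\<lambda>s. expker k r s) \<in> borel_measurable borel" for r
    unfolding expker_def by measurable
  define N where "N r = (\<integral>\<^sup>+s. expker k r s * dens s * H' s \<partial>lborel)" for r
  have epos: "0 < e r" if "r \<in> {0<..<1}" for r
    unfolding e_def using artanh_unit(1)[OF that] by simp
  have we: "wt r = (e r)\<^sup>2 / (1 - r\<^sup>2)" if "r \<in> {0<..<1}" for r
  proof -
    note t = tanh_cosh_sinh[OF artanh_unit(1)[OF that], unfolded artanh_unit(2)[OF that]]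
    show ?thesis unfolding t(1,6) e_def by simp
  qed
  have r2: "0 < 1 - r\<^sup>2" if "r \<in> {0<..<1}" for r :: real
    using that by (simp add: power_less_one_iff abs_square_less_1)
  have eu: "cmod (to_u y r) = cmod (y (artanh r)) / e r" if "r \<in> {0<..<1}" for y r
    using epos[OF that] by (simp add: to_u_def e_def norm_divide)
  have key: "ennreal (c * cmod (to_u y s * h s * of_real (wt s))) \<le> ennreal M * (expker k r s * dens s * H s)"
    if s: "s \<in> {0<..<1}" and c: "c * cmod (y (artanh s)) \<le> M * exp (- k * \<bar>artanh r - artanh s\<bar>) \<or> h s = 0" for c y s r
  proof -
    have "c * cmod (to_u y s * h s * of_real (wt s)) = c * cmod (y (artanh s)) * (1 / (1 - s\<^sup>2) * (e s * cmod (h s)))"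
    proof -
      have "cmod (to_u y s * h s * of_real (wt s)) = cmod (to_u y s) * cmod (h s) * wt s"
        using wt_pos[OF s] by (simp add: norm_mult)
      then show ?thesis unfolding eu[OF s] we[OF s] using epos[OF s] by (simp add: power2_eq_square)
    qed
    also have "\<dots> \<le> M * exp (- k * \<bar>artanh r - artanh s\<bar>) * (1 / (1 - s\<^sup>2) * (e s * cmod (h s)))"
      using c
    proof
      assume "c * cmod (y (artanh s)) \<le> M * exp (- k * \<bar>artanh r - artanh s\<bar>)"
      then show ?thesis using epos[OF s] r2[OF s] by (intro mult_right_mono) auto
    qed simp
    finally have "ennreal (c * cmod (to_u y s * h s * of_real (wt s))) \<le> ennreal (M * exp (- k * \<bar>artanh r - artanh s\<bar>) * (1 / (1 - s\<^sup>2) * (e s * cmod (h s))))"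
      by (rule ennreal_leI)
    also have "\<dots> = ennreal M * (expker k r s * dens s * H s)"
      using s M epos[OF s] r2[OF s] unfolding expker_def dens_def H_def
      by (simp add: ennreal_mult[symmetric] ac_simps less_imp_le)
    finally show ?thesis .
  qed
  \<comment> \<open>One estimate for both halves of the kernel: c is the modulus of b at the outer
    point for P and that of a for Q, and y is the other solution.\<close>
  have PQ: "ennreal (c * cmod (integral S (\<lambda>t. to_u y t * h t * of_real (wt t)))) \<le> ennreal M * N r"
    if S: "set_integrable lebesgue S (\<lambda>t. to_u y t * h t * of_real (wt t))" "S \<subseteq> {0..1}" and c0: "0 \<le> c" and
      c: "\<And>s. s \<in> S \<Longrightarrow> s \<in> {0<..<1} \<Longrightarrow> c * cmod (y (artanh s)) \<le> M * exp (- k * \<bar>artanh r - artanh s\<bar>) \<or> h s = 0" for c y S r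
  proof -
    let ?\<phi> = "\<lambda>t. to_u y t * h t * of_real (wt t)"
    have "integral S ?\<phi> = (\<integral>t. indicator S t *\<^sub>R ?\<phi> t \<partial>lebesgue)"
      using set_lebesgue_integral_eq_integral(2)[OF S(1)] by (simp add: set_lebesgue_integral_def)
    then have "ennreal (cmod (integral S ?\<phi>)) \<le> (\<integral>\<^sup>+t. norm (indicator S t *\<^sub>R ?\<phi> t) \<partial>lebesgue)"
      using integral_norm_bound_ennreal[OF S(1)[unfolded set_integrable_def]] by simp
    then have "ennreal (c * cmod (integral S ?\<phi>)) \<le> ennreal c * (\<integral>\<^sup>+t. norm (indicator S t *\<^sub>R ?\<phi> t) \<partial>lebesgue)"
      using c0 by (simp add: ennreal_mult mult_left_mono)
    also have "\<dots> = (\<integral>\<^sup>+t. ennreal c * norm (indicator S t *\<^sub>R ?\<phi> t) \<partial>lebesgue)"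
    proof (rule nn_integral_cmult[symmetric])
      have "(\<lambda>t. indicator S t *\<^sub>R ?\<phi> t) \<in> borel_measurable lebesgue" using S(1) unfolding set_integrable_def by (rule borel_measurable_integrable)
      then show "(\<lambda>t. ennreal (norm (indicator S t *\<^sub>R ?\<phi> t))) \<in> borel_measurable lebesgue" by measurable
    qed
    also have "\<dots> \<le> (\<integral>\<^sup>+t. ennreal M * (expker k r t * dens t * H t) \<partial>lebesgue)"
    proof (rule nn_integral_mono)
      fix t
      show "ennreal c * norm (indicator S t *\<^sub>R ?\<phi> t) \<le> ennreal M * (expker k r t * dens t * H t)"
      proof (cases "t \<in> S \<and> t \<in> {0<..<1}")
        case True
        then show ?thesis using key[of t c y r] c[of t] c0 by (simp add: ennreal_mult)
      next
        case False
        have "wt 0 = 0" "wt 1 = 0" by (auto simp: wt_def)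
        then have z0: "indicator S t *\<^sub>R ?\<phi> t = 0" using False S(2) by (cases "t = 0 \<or> t = 1") (auto simp: indicator_def)
        show ?thesis unfolding z0 by simp
      qed
    qed
    also have "\<dots> = (\<integral>\<^sup>+t. ennreal M * (expker k r t * dens t * H t) \<partial>lborel)" by (rule nn_integral_completion)
    also have "\<dots> = (\<integral>\<^sup>+t. ennreal M * (expker k r t * dens t * H' t) \<partial>lborel)"
      by (rule nn_integral_cong_AE) (use H' in eventually_elim, simp)
    also have "\<dots> = ennreal M * N r"
      unfolding N_def by (rule nn_integral_cmult) measurable
    finally show ?thesis .
  qed
  define K where "K = 2 * M / cmod W"
  have K: "0 \<le> K" using M by (simp add: K_def)
  have bound: "ennreal (e r * cmod (gu r)) \<le> ennreal K * N r" if r: "r \<in> {0<..<1}" for r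
  proof (cases "artanh r \<in> J")
    case False
    then show ?thesis using u0[OF r] by simp
  next
    case True
    define x where "x = artanh r"
    have x: "0 < x" using artanh_unit(1)[OF r] by (simp add: x_def)
    have "ennreal (cmod (b x) * cmod (P r)) \<le> ennreal M * N r"
      unfolding P_def
    proof (rule PQ[OF Ia[OF r]])
      fix s assume s: "s \<in> {0..r}" "s \<in> {0<..<1}"
      then have "artanh s \<le> x" "0 < artanh s" using r artanh_unit(1)[of s] by (auto simp: x_def artanh_le_iff)
      then show "cmod (b x) * cmod (a (artanh s)) \<le> M * exp (- k * \<bar>artanh r - artanh s\<bar>) \<or> h s = 0"
        using kb[of "artanh s" x] True by (simp add: x_def mult.commute)
    qed (use r in auto)
    moreover have "ennreal (cmod (a x) * cmod (Q r)) \<le> ennreal M * N r"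
      unfolding Q_def
    proof (rule PQ[OF Ib[OF r]])
      fix s assume s: "s \<in> {r..1}" "s \<in> {0<..<1}"
      then have le: "x \<le> artanh s" using r by (auto simp: x_def artanh_le_iff)
      show "cmod (a x) * cmod (b (artanh s)) \<le> M * exp (- k * \<bar>artanh r - artanh s\<bar>) \<or> h s = 0"
      proof (cases "artanh s \<in> J")
        case True
        then show ?thesis using kb[OF x le True] le by (simp add: x_def)
      qed (use h0[OF s(2)] in simp)
    qed (use r in auto)
    ultimately have "ennreal (cmod (b x) * cmod (P r)) + ennreal (cmod (a x) * cmod (Q r)) \<le> ennreal M * N r + ennreal M * N r"
      by (rule add_mono)
    then have 1: "ennreal (cmod (b x) * cmod (P r) + cmod (a x) * cmod (Q r)) \<le> 2 * (ennreal M * N r)"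
      by (simp add: mult_2)
    have "e r * cmod (gu r) \<le> 1 / cmod W * (cmod (b x) * cmod (P r) + cmod (a x) * cmod (Q r))"
    proof -
      have "cmod (to_u b r * P r + to_u a r * Q r) \<le> cmod (b x) / e r * cmod (P r) + cmod (a x) / e r * cmod (Q r)"
        using norm_triangle_ineq[of "to_u b r * P r" "to_u a r * Q r"] by (simp add: norm_mult eu[OF r] x_def)
      then have "e r * cmod (to_u b r * P r + to_u a r * Q r) \<le> e r * (cmod (b x) / e r * cmod (P r) + cmod (a x) / e r * cmod (Q r))"
        using epos[OF r] by (intro mult_left_mono) auto
      also have "\<dots> = cmod (b x) * cmod (P r) + cmod (a x) * cmod (Q r)"
        using epos[OF r] by (simp add: distrib_left)
      finally show ?thesis using W0 by (simp add: gu_def norm_divide divide_right_mono)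
    qed
    then have "ennreal (e r * cmod (gu r)) \<le> ennreal (1 / cmod W * (cmod (b x) * cmod (P r) + cmod (a x) * cmod (Q r)))"
      by (rule ennreal_leI)
    also have "\<dots> = ennreal (1 / cmod W) * ennreal (cmod (b x) * cmod (P r) + cmod (a x) * cmod (Q r))"
      by (rule ennreal_mult) auto
    also have "\<dots> \<le> ennreal (1 / cmod W) * (2 * (ennreal M * N r))" by (rule mult_left_mono[OF 1]) simp
    also have "\<dots> = ennreal (1 / cmod W) * ennreal 2 * ennreal M * N r" by (simp add: ac_simps)
    also have "ennreal (1 / cmod W) * ennreal 2 * ennreal M = ennreal K"
      using M by (simp add: K_def ennreal_mult[symmetric] del: ennreal_numeral)
    finally show ?thesis .
  qed
  have gc: "continuous_on {0<..<1} gu" by (rule AC_loc_continuous[OF AC_gu])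
  have sqid: "ennreal (indicator {0<..<1} r * (wt r * (cmod (w r))\<^sup>2)) = dens r * (ennreal (indicator {0<..<1} r * (e r * cmod (w r))))\<^sup>2" for w :: "real \<Rightarrow> complex" and r
  proof (cases "r \<in> {0<..<1}")
    case True
    then show ?thesis using epos[OF True] r2[OF True] unfolding dens_def we[OF True]
      by (simp add: ennreal_power ennreal_mult[symmetric] power_mult_distrib)
  qed (simp add: dens_def)
  have "(\<integral>\<^sup>+r. ennreal (indicator {0<..<1} r * (wt r * (cmod (gu r))\<^sup>2)) \<partial>lebesgue)
      = (\<integral>\<^sup>+r. ennreal (indicator {0<..<1} r * (wt r * (cmod (gu r))\<^sup>2)) \<partial>lborel)" by (rule nn_integral_completion)
  also have "\<dots> \<le> (\<integral>\<^sup>+r. dens r * (ennreal K * N r)\<^sup>2 \<partial>lborel)"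
  proof (rule nn_integral_mono)
    fix r
    show "ennreal (indicator {0<..<1} r * (wt r * (cmod (gu r))\<^sup>2)) \<le> dens r * (ennreal K * N r)\<^sup>2"
      unfolding sqid
    proof (cases "r \<in> {0<..<1}")
      case True
      then show "dens r * (ennreal (indicator {0<..<1} r * (e r * cmod (gu r))))\<^sup>2 \<le> dens r * (ennreal K * N r)\<^sup>2"
        using bound[OF True] by (intro mult_left_mono power_mono) auto
    qed (simp add: dens_def)
  qed
  also have "\<dots> = (\<integral>\<^sup>+r. dens r * (\<integral>\<^sup>+s. expker k r s * dens s * (ennreal K * H' s) \<partial>lborel)\<^sup>2 \<partial>lborel)"
  proof (rule nn_integral_cong)
    fix r
    have "(\<integral>\<^sup>+s. expker k r s * dens s * (ennreal K * H' s) \<partial>lborel) = (\<integral>\<^sup>+s. ennreal K * (expker k r s * dens s * H' s) \<partial>lborel)"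
      by (intro nn_integral_cong) (simp add: ac_simps)
    also have "\<dots> = ennreal K * N r" unfolding N_def by (rule nn_integral_cmult) measurable
    finally show "dens r * (ennreal K * N r)\<^sup>2 = dens r * (\<integral>\<^sup>+s. expker k r s * dens s * (ennreal K * H' s) \<partial>lborel)\<^sup>2" by simp
  qed
  also have "\<dots> \<le> ennreal (2 / k) * ennreal (2 / k) * (\<integral>\<^sup>+y. dens y * (ennreal K * H' y)\<^sup>2 \<partial>lborel)"
  proof (rule schur_test)
    have "(\<lambda>(x, y). ennreal (exp (- k * \<bar>artanh x - artanh y\<bar>))) \<in> borel_measurable (borel \<Otimes>\<^sub>M borel)" by measurable
    then show "(\<lambda>(x, y). expker k x y) \<in> borel_measurable (lborel \<Otimes>\<^sub>M lborel)"
      unfolding expker_def by (simp cong: measurable_cong_sets)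
    show "(\<integral>\<^sup>+y. expker k x y * dens y \<partial>lborel) \<le> ennreal (2 / k)" if "dens x \<noteq> 0" for x
      by (rule expker_row[OF k]) (use that in \<open>auto simp: dens_def indicator_def split: if_splits\<close>)
  qed (auto simp: expker_def abs_minus_commute)
  also have "(\<integral>\<^sup>+y. dens y * (ennreal K * H' y)\<^sup>2 \<partial>lborel) = (\<integral>\<^sup>+y. (ennreal K)\<^sup>2 * (dens y * (H' y)\<^sup>2) \<partial>lborel)"
    by (intro nn_integral_cong) (simp add: power_mult_distrib ac_simps)
  also have "\<dots> = (ennreal K)\<^sup>2 * (\<integral>\<^sup>+y. dens y * (H' y)\<^sup>2 \<partial>lborel)"
    by (rule nn_integral_cmult) measurable
  also have "(\<integral>\<^sup>+y. dens y * (H' y)\<^sup>2 \<partial>lborel) = (\<integral>\<^sup>+y. dens y * (H y)\<^sup>2 \<partial>lborel)"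
    by (rule nn_integral_cong_AE) (use H' in eventually_elim, simp)
  also have "\<dots> = (\<integral>\<^sup>+r. ennreal (indicator {0<..<1} r * (wt r * (cmod (h r))\<^sup>2)) \<partial>lborel)"
    unfolding H_def sqid ..
  also have "\<dots> = (\<integral>\<^sup>+r. ennreal (indicator {0<..<1} r * (wt r * (cmod (h r))\<^sup>2)) \<partial>lebesgue)" by (rule nn_integral_completion[symmetric])
  finally have fin0: "(\<integral>\<^sup>+r. ennreal (indicator {0<..<1} r * (wt r * (cmod (gu r))\<^sup>2)) \<partial>lebesgue) \<le>
     ennreal (2 / k) * ennreal (2 / k) * ((ennreal K)\<^sup>2 * (\<integral>\<^sup>+r. ennreal (indicator {0<..<1} r * (wt r * (cmod (h r))\<^sup>2)) \<partial>lebesgue))" .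
  have nrm: "norm (indicator {0<..<1} r *\<^sub>R (wt r * (cmod (w r))\<^sup>2)) = indicator {0<..<1} r * (wt r * (cmod (w r))\<^sup>2)" for w :: "real \<Rightarrow> complex" and r
    using wt_pos[of r] by (cases "r \<in> {0<..<1}") auto
  have "(\<integral>\<^sup>+r. ennreal (indicator {0<..<1} r * (wt r * (cmod (h r))\<^sup>2)) \<partial>lebesgue) < \<infinity>"
  proof -
    have "integrable lebesgue (\<lambda>r. indicator {0<..<1} r *\<^sub>R (wt r * (cmod (h r))\<^sup>2))" using h by (simp add: inH_def set_integrable_def)
    then show ?thesis unfolding integrable_iff_bounded nrm by simp
  qed
  then have fin: "(\<integral>\<^sup>+r. ennreal (indicator {0<..<1} r * (wt r * (cmod (gu r))\<^sup>2)) \<partial>lebesgue) < \<infinity>"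
    using fin0 by (auto simp: ennreal_mult_less_top power2_eq_square less_top intro: le_less_trans)
  have "set_integrable lebesgue {0<..<1} (\<lambda>r. wt r * (cmod (gu r))\<^sup>2)"
    unfolding set_integrable_def
  proof (rule integrableI_bounded)
    have "(\<lambda>r. indicator {0<..<1} r *\<^sub>R (wt r * (cmod (gu r))\<^sup>2)) \<in> borel_measurable borel"
      by (rule borel_measurable_continuous_on_indicator) (auto intro!: continuous_intros gc wt_cont)
    then show "(\<lambda>r. indicator {0<..<1} r *\<^sub>R (wt r * (cmod (gu r))\<^sup>2)) \<in> borel_measurable lebesgue"
      by (intro measurable_completion) simp
    show "(\<integral>\<^sup>+r. ennreal (norm (indicator {0<..<1} r *\<^sub>R (wt r * (cmod (gu r))\<^sup>2))) \<partial>lebesgue) < \<infinity>"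
      unfolding nrm by (rule fin)
  qed
  then show ?thesis using set_borel_measurable_lebesgue_continuous[OF gc] by (simp add: inH_def)
qed

end

section \<open>The spectrum\<close>

lemma (in inverse_square_potential) regular_of_real:
  fixes s s1 :: "real \<Rightarrow> real"
  assumes "regular_at_zero (V_shift l) s s1"
  shows "regular_at_zero (V_shift (complex_of_real l)) (\<lambda>x. of_real (s x)) (\<lambda>x. of_real (s1 x))"
proof -
  have o: "ode_solution {0<..} (V_shift l) s s1" using assms by (simp add: regular_at_zero_def)
  have "ode_solution {0<..} (V_shift (complex_of_real l)) (\<lambda>x. of_real (s x)) (\<lambda>x. of_real (s1 x))"
    unfolding ode_solution_def
  proof (intro ballI conjI)
    fix x :: real assume x: "x \<in> {0<..}"
    show "((\<lambda>x. complex_of_real (s x)) has_vector_derivative of_real (s1 x)) (at x)"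
      using ode_solutionD(1)[OF o x] by (intro has_vector_derivative_of_real) (simp add: has_real_derivative_iff_has_vector_derivative)
    have "((\<lambda>x. complex_of_real (s1 x)) has_vector_derivative of_real (V_shift l x * s x)) (at x)"
      using ode_solutionD(2)[OF o x] by (intro has_vector_derivative_of_real) (simp add: has_real_derivative_iff_has_vector_derivative)
    then show "((\<lambda>x. complex_of_real (s1 x)) has_vector_derivative V_shift (of_real l) x * of_real (s x)) (at x)"
      by (simp add: V_shift_def)
  qed
  then show ?thesis using assms by (simp add: regular_at_zero_def)
qed

context profile_op
begin

lemma shifted_graph_ode_exists:
  assumes g: "shifted_graph f z u h" and h: "continuous_on {0<..<1} h"
  shows "\<exists>y1. (\<forall>x>0. ((\<lambda>x. of_real (sinh x) * u (tanh x)) has_vector_derivative y1 x) (at x)) \<and>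
    (\<forall>x>0. (y1 has_vector_derivative (V_shift z x * (of_real (sinh x) * u (tanh x)) + of_real (sinh x) * h (tanh x))) (at x)) \<and>
    sq_bounded {0<..} (\<lambda>x. of_real (sinh x) * u (tanh x))"
proof (rule shifted_graph_imp_ode[OF g h])
  fix y1
  assume "\<And>x. 0 < x \<Longrightarrow> ((\<lambda>x. of_real (sinh x) * u (tanh x)) has_vector_derivative y1 x) (at x)"
    "\<And>x. 0 < x \<Longrightarrow> (y1 has_vector_derivative (V_shift z x * (of_real (sinh x) * u (tanh x)) + of_real (sinh x) * h (tanh x))) (at x)"
    "sq_bounded {0<..} (\<lambda>x. of_real (sinh x) * u (tanh x))"
  then show ?thesis by (intro exI[of _ y1] conjI allI impI)
qed

text \<open>Kept general in s so that it applies to the complex regular solution and to the real one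
  embedded into the complex numbers.\<close>

lemma not_inj_iff:
  assumes s: "regular_at_zero (V_shift z) s s1"
  shows "\<not> inj_shift f z \<longleftrightarrow> sq_bounded {0<..} s"
proof
  assume "\<not> inj_shift f z"
  then obtain u where u: "shifted_graph f z u (\<lambda>_. 0)" "\<not> aeq u (\<lambda>_. 0)" unfolding inj_shift_def by blast
  define y where "y x = of_real (sinh x) * u (tanh x)" for x
  obtain y1 where y1': "\<forall>x>0. ((\<lambda>x. of_real (sinh x) * u (tanh x)) has_vector_derivative y1 x) (at x)"
    "\<forall>x>0. (y1 has_vector_derivative (V_shift z x * (of_real (sinh x) * u (tanh x)) + of_real (sinh x) * 0)) (at x)"
    "sq_bounded {0<..} (\<lambda>x. of_real (sinh x) * u (tanh x))"
    using shifted_graph_ode_exists[OF u(1) continuous_on_const] by blast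
  have y1: "\<And>x. 0 < x \<Longrightarrow> (y has_vector_derivative y1 x) (at x)"
    "\<And>x. 0 < x \<Longrightarrow> (y1 has_vector_derivative (V_shift z x * y x + of_real (sinh x) * 0)) (at x)" "sq_bounded {0<..} y"
    unfolding y_def[abs_def] using y1' by blast+
  have yo: "ode_solution {0<..} (V_shift z) y y1" using y1 by (simp add: ode_solution_def)
  have L1: "sq_bounded {0<..<1} y" by (rule sq_bounded_subset[OF y1(3)]) auto
  obtain c where c: "\<And>x. 0 < x \<Longrightarrow> y x = c * s x \<and> y1 x = c * s1 x"
    using sq_bounded_multiple_of_regular'[OF yo s L1] by blast
  have c0: "c \<noteq> 0"
  proof
    assume c0: "c = 0"
    have "u r = 0" if r: "r \<in> {0<..<1}" for r
    proof -
      have "y (artanh r) = 0" using c[of "artanh r"] c0 artanh_unit(1)[OF r] by simp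
      then show ?thesis using artanh_unit[OF r] by (simp add: y_def)
    qed
    then have "aeq u (\<lambda>_. 0)" unfolding aeq_def by (intro AE_I2) auto
    then show False using u by blast
  qed
  obtain M where M: "\<And>a b. a < b \<Longrightarrow> {a..b} \<subseteq> {0<..} \<Longrightarrow> integral {a..b} (\<lambda>x. (norm (y x))\<^sup>2) \<le> M"
    using y1(3) unfolding sq_bounded_def by blast
  show "sq_bounded {0<..} s"
    unfolding sq_bounded_def
  proof (intro exI allI impI)
    fix a b :: real assume ab: "a < b" "{a..b} \<subseteq> {0<..}"
    have "integral {a..b} (\<lambda>x. (norm (y x))\<^sup>2) = integral {a..b} (\<lambda>x. (cmod c)\<^sup>2 * (norm (s x))\<^sup>2)"
      by (rule integral_cong) (use ab(2) c in \<open>auto simp: norm_mult power_mult_distrib\<close>)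
    also have "\<dots> = (cmod c)\<^sup>2 * integral {a..b} (\<lambda>x. (norm (s x))\<^sup>2)" by simp
    finally show "integral {a..b} (\<lambda>x. (norm (s x))\<^sup>2) \<le> M / (cmod c)\<^sup>2"
      using M[OF ab] c0 by (simp add: field_simps)
  qed
next
  assume L2: "sq_bounded {0<..} s"
  have so: "ode_solution {0<..} (V_shift z) s s1" using s by (simp add: regular_at_zero_def)
  have sc: "continuous_on {0<..} s" by (rule ode_solution_continuous(1)[OF so])
  have uH: "inH (to_u s)" by (rule inH_to_u[OF sc L2])
  have "shifted_graph f z (to_u s) (\<lambda>_. 0)"
    unfolding shifted_graph_iff
  proof (intro conjI exI)
    show "AC_loc (to_u s)"
      by (rule AC_loc_continuous_derivI[OF to_u_deriv(1)[OF so]]) (auto intro!: continuous_intros to_u_cont[OF so])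
    show "AC_loc (to_v s s1)"
      by (rule AC_loc_continuous_derivI[OF to_u_deriv(2)[OF so]]) (auto intro!: continuous_intros coef_cont to_u_cont[OF so])
    show "ae_deriv (to_u s) (\<lambda>r. to_v s s1 r / of_real (r\<^sup>2))" "ae_deriv (to_v s s1) (\<lambda>r. coef f z r * to_u s r)"
      unfolding ae_deriv_def by (rule AE_I2, intro impI to_u_deriv[OF so], assumption)+
    show "aeq (to_v s s1) (\<lambda>r. of_real (r\<^sup>2) * (to_v s s1 r / of_real (r\<^sup>2)))"
      unfolding aeq_def by (rule AE_I2) auto
    show "aeq (\<lambda>r. coef f z r * to_u s r) (\<lambda>r. coef f z r * to_u s r + of_real (wt r) * 0)" by simp
    obtain M where M: "\<And>r. r \<in> {0<..<1} \<Longrightarrow> \<bar>gpot f r\<bar> \<le> M" using gpot_bounded by blast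
    have "inH (\<lambda>r. (z - of_real (gpot f r)) * to_u s r)"
    proof (rule inH_cmult_bounded[OF uH])
      fix r :: real assume r: "r \<in> {0<..<1}"
      show "cmod (z - of_real (gpot f r)) \<le> cmod z + M"
        using norm_triangle_ineq4[of z "of_real (gpot f r)"] M[OF r] by simp
    qed (intro continuous_intros gpot_cont)
    then show "inH (\<lambda>r. (- (coef f z r * to_u s r) + 2 * to_u s r) / of_real (wt r))"
    proof (rule inH_cong[THEN iffD1, rotated])
      fix r :: real assume r: "r \<in> {0<..<1}"
      show "(z - of_real (gpot f r)) * to_u s r = (- (coef f z r * to_u s r) + 2 * to_u s r) / of_real (wt r)"
        using wt_pos[OF r] by (simp add: coef_def field_simps)
    qed
  qed (rule uH)
  moreover have "\<not> aeq (to_u s) (\<lambda>_. 0)"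
  proof
    assume ae: "aeq (to_u s) (\<lambda>_. 0)"
    obtain N where N: "negligible N" "\<And>r. r \<notin> N \<Longrightarrow> r \<in> {0<..<1} \<longrightarrow> to_u s r = 0"
      using ae_negligible[OF ae[unfolded aeq_def]] by metis
    obtain \<delta> where \<delta>: "\<delta> > 0" "\<And>x. x \<in> {0<..<\<delta>} \<Longrightarrow> x\<^sup>2 / 2 \<le> norm (s x)"
      using s unfolding regular_at_zero_def by blast
    have "{0<..<tanh \<delta>} \<subseteq> N"
    proof
      fix r assume r: "r \<in> {0<..<tanh \<delta>}"
      then have r1: "r \<in> {0<..<1}" using tanh_real_lt_1[of \<delta>] by auto
      note x = artanh_unit[OF r1]
      have "artanh r < \<delta>" using r x by (metis greaterThanLessThan_iff tanh_real_less_iff)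
      then have "(artanh r)\<^sup>2 / 2 \<le> norm (s (artanh r))" using x by (intro \<delta>(2)) auto
      moreover have "0 < (artanh r)\<^sup>2 / 2" using x by simp
      ultimately have "to_u s r \<noteq> 0" using x by (auto simp: to_u_def)
      then show "r \<in> N" using N(2) r1 by blast
    qed
    then have "negligible {0<..<tanh \<delta>}" by (rule negligible_subset[OF N(1)])
    moreover have "{0<..<tanh \<delta>} \<noteq> {}" using \<delta>(1) by simp
    moreover have "open {0<..<tanh \<delta>}" by simp
    ultimately show False using open_not_negligible[of "{0<..<tanh \<delta>}"] by simp
  qed
  ultimately show "\<not> inj_shift f z" unfolding inj_shift_def by blast
qed

lemma inj_nonneg: "0 \<le> l \<Longrightarrow> inj_shift f (of_real l)"
proof (rule ccontr)
  assume l: "0 \<le> l" and "\<not> inj_shift f (of_real l)"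
  then have "sq_bounded {0<..} (reg (complex_of_real l))" using not_inj_iff[OF reg_regular] by blast
  then have "reg (complex_of_real l) x = 0 \<and> reg1 (complex_of_real l) x = 0" if "x > 0" for x
    using no_sq_bounded_nonneg[OF reg_ode _ _ l that] by simp
  moreover obtain a where "0 < a" "reg (complex_of_real l) a \<noteq> 0" using regular_nonzero[OF reg_regular, of 1] by (metis zero_less_one)
  ultimately show False by blast
qed

lemma inj_nonreal: "Im z \<noteq> 0 \<Longrightarrow> inj_shift f z"
proof (rule ccontr)
  assume z: "Im z \<noteq> 0" and "\<not> inj_shift f z"
  then have "sq_bounded {0<..} (reg z)" using not_inj_iff[OF reg_regular] by blast
  then have "reg z x = 0" if "x > 0" for x
    using no_sq_bounded_nonreal[OF reg_ode _ z that] by simp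
  moreover obtain a where "0 < a" "reg z a \<noteq> 0" using regular_nonzero[OF reg_regular, of 1] by (metis zero_less_one)
  ultimately show False by blast
qed

text \<open>Injectivity enters through the Wronskian of the regular and the Jost solution: if it
  vanished, the regular solution would decay like the Jost solution and yield an
  eigenfunction.\<close>

lemma surj_off_half_line:
  assumes z: "z \<notin> complex_of_real ` {0..}" and inj: "inj_shift f z"
  shows "surj_shift f z"
  unfolding surj_shift_def
proof (intro allI impI)
  fix h assume h: "inH h"
  define k where "k = csqrt (- z)"
  have k: "0 < Re k" "- (k\<^sup>2) = z" using csqrt_neg_Re_pos[OF z] by (auto simp: k_def)
  obtain p p1 where p: "jost_solution k (V_shift z) p p1" using jost_exists[of k] k by auto
  have po: "ode_solution {0<..} (V_shift z) p p1" using p by (simp add: jost_solution_def)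
  note ro = reg_ode[of z]
  obtain W where W: "\<And>x. x \<in> {0<..} \<Longrightarrow> reg z x * p1 x - reg1 z x * p x = W"
    using wronskian_constant[OF ro po] by (metis convex_real_interval(3))
  have W0: "W \<noteq> 0"
  proof
    assume "W = 0"
    obtain X where X: "X > 0" "\<And>x. X \<le> x \<Longrightarrow> exp (- Re k * x) / 2 \<le> norm (p x)" using jost_solutionD[OF p] by metis
    have "0 < norm (p X)" using X(2)[of X] by (smt (verit) exp_gt_zero half_gt_zero)
    then have pX: "p X \<noteq> 0" by simp
    have WX: "reg z X * p1 X - reg1 z X * p X = 0" using W[of X] X(1) \<open>W = 0\<close> by simp
    obtain c where c: "\<And>x. x \<in> {0<..} \<Longrightarrow> reg z x = c * p x \<and> reg1 z x = c * p1 x"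
      by (rule wronskian_zero_imp_proportional[OF ro po _ V_shift_cont _ _ WX])
        (use X(1) pX in \<open>auto simp: is_interval_1\<close>)
    have "sq_bounded {0<..} (reg z)" by (rule proportional_sq_bounded[OF reg_regular k(1) p, of c]) (use c in auto)
    then show False using inj not_inj_iff[OF reg_regular] by blast
  qed
  have rc: "continuous_on {0<..} (reg z)" and pc: "continuous_on {0<..} p"
    using ode_solution_continuous(1)[OF ro] ode_solution_continuous(1)[OF po] by auto
  obtain M1 where M1: "M1 > 0" "\<And>x. 0 < x \<Longrightarrow> norm (reg z x) \<le> M1 * (x / (1 + x) * exp (Re k * x))"
    using regular_bound[OF reg_regular k(1) p] by blast
  obtain M2 where M2: "M2 > 0" "\<And>x. 0 < x \<Longrightarrow> norm (p x) \<le> M2 * ((1 + x) / x * exp (- Re k * x))"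
    using jost_bound[OF reg_regular k(1) p] by blast
  obtain M where M: "M > 0" "\<And>t x. 0 < t \<Longrightarrow> t \<le> x \<Longrightarrow> norm (reg z t) * norm (p x) \<le> M * exp (- Re k * (x - t))"
    using green_kernel_bound[OF reg_regular k(1) p] by blast
  interpret green f B C z W "reg z" "reg1 z" p p1 h
  proof
    show "ode_solution {0<..} (V_shift z) (reg z) (reg1 z)" by (rule ro)
    show "ode_solution {0<..} (V_shift z) p p1" by (rule po)
    show "W \<noteq> 0" by (rule W0)
    show "reg z x * p1 x - reg1 z x * p x = W" if "0 < x" for x using W that by simp
    show "inH h" by (rule h)
    fix r :: real assume r: "r \<in> {0<..<1}"
    define X where "X = artanh r"
    have X: "0 < X" "tanh X = r" using artanh_unit[OF r] by (auto simp: X_def)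
    show "set_integrable lebesgue {0..r} (\<lambda>t. to_u (reg z) t * h t * of_real (wt t))"
      unfolding X(2)[symmetric]
    proof (rule product_integrable_low[OF rc _ X(1) h])
      fix x :: real assume x: "0 < x" "x \<le> X"
      have "norm (reg z x) \<le> M1 * (x / (1 + x) * exp (Re k * x))" by (rule M1(2)[OF x(1)])
      also have "\<dots> \<le> M1 * (1 * exp (Re k * X))"
        using M1(1) x k by (intro mult_left_mono mult_mono) (auto intro: mult_left_mono)
      finally show "cmod (reg z x) \<le> M1 * (1 * exp (Re k * X))" .
    qed
    show "set_integrable lebesgue {r..1} (\<lambda>t. to_u p t * h t * of_real (wt t))"
      unfolding X(2)[symmetric]
    proof (rule product_integrable_high[OF pc _ X(1) k(1) h])
      fix x :: real assume x: "X \<le> x"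
      have "norm (p x) \<le> M2 * ((1 + x) / x * exp (- Re k * x))" using x X(1) by (intro M2(2)) auto
      also have "\<dots> \<le> M2 * ((1 + 1 / X) * exp (- Re k * x))"
        using M2(1) x X(1) by (intro mult_left_mono mult_right_mono) (auto simp: field_simps)
      finally show "cmod (p x) \<le> M2 * (1 + 1 / X) * exp (- Re k * x)" by (simp add: mult.assoc)
    qed
  qed
  have "inH gu" by (rule gu_inH[of "Re k" M UNIV]) (use k(1) M in auto)
  then show "\<exists>u. shifted_graph f z u h" using shifted_graph_gu by blast
qed

lemma surj_imp_dense: "surj_shift f z \<Longrightarrow> dense_range_shift f z"
  unfolding surj_shift_def dense_range_shift_def normH_def by fastforce

text \<open>The test datum is the regular solution times a bump: the Wronskian of any preimage with the regular
  solution would be monotone but vanish on both sides of the bump.\<close>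

lemma not_surj_nonneg:
  assumes l: "0 \<le> l"
  shows "\<not> surj_shift f (of_real l)"
proof
  assume surj: "surj_shift f (of_real l)"
  define s :: "real \<Rightarrow> real" where "s = reg l"
  define s1 :: "real \<Rightarrow> real" where "s1 = reg1 l"
  have so: "ode_solution {0<..} (V_shift l) s s1" unfolding s_def s1_def by (rule reg_ode)
  have sr: "regular_at_zero (V_shift (complex_of_real l)) (\<lambda>x. of_real (s x)) (\<lambda>x. of_real (s1 x))"
    unfolding s_def s1_def by (intro regular_of_real reg_regular)
  have sc: "continuous_on {0<..} s" by (rule ode_solution_continuous(1)[OF so])
  \<comment> \<open>A bump over {1..2}. The maximum with 0 keeps the datum continuous, so the
    preimage solves the equation classically.\<close>
  define \<beta> :: "real \<Rightarrow> real" where "\<beta> x = max 0 ((x - 1) * (2 - x))" for x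
  have b0: "\<beta> x = 0" if "x \<le> 1 \<or> 2 \<le> x" for x
  proof -
    have "(x - 1) * (2 - x) \<le> 0"
      using that by (auto intro: mult_nonpos_nonneg mult_nonneg_nonpos)
    then show ?thesis by (simp add: \<beta>_def)
  qed
  define Y where "Y x = complex_of_real (s x * \<beta> x)" for x
  have Yc: "continuous_on {0<..} Y" unfolding Y_def \<beta>_def by (intro continuous_intros sc)
  have "bounded (Y ` {1..2})" by (intro compact_imp_bounded compact_continuous_image continuous_on_subset[OF Yc]) auto
  then obtain M where M: "\<forall>w\<in>Y ` {1..2}. norm w \<le> M" unfolding bounded_iff by blast
  have M0: "0 \<le> M" using M norm_ge_zero[of "Y 1"] by (metis atLeastAtMost_iff imageI one_le_numeral order_refl order_trans)
  have hH: "inH (to_u Y)"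
  proof (rule inH_to_u[OF Yc exp_bound_imp_sq_bounded[OF Yc, of 1]])
    fix x :: real assume "0 < x"
    show "norm (Y x) \<le> (M * exp 2) * exp (- 1 * x)"
    proof (cases "x \<in> {1..2}")
      case True
      then have "norm (Y x) \<le> M * 1" using M by simp
      also have "\<dots> \<le> M * exp (2 - x)" using True M0 by (intro mult_left_mono) auto
      finally show ?thesis by (simp add: exp_diff exp_minus field_simps)
    next
      case False
      then have "Y x = 0" using b0[of x] by (auto simp: Y_def)
      then show ?thesis using M0 by simp
    qed
  qed simp
  obtain u where u: "shifted_graph f (of_real l) u (to_u Y)" using surj hH unfolding surj_shift_def by blast
  define y where "y x = of_real (sinh x) * u (tanh x)" for x
  obtain y1 where y1': "\<forall>x>0. ((\<lambda>x. of_real (sinh x) * u (tanh x)) has_vector_derivative y1 x) (at x)"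
    "\<forall>x>0. (y1 has_vector_derivative (V_shift (of_real l) x * (of_real (sinh x) * u (tanh x)) + of_real (sinh x) * to_u Y (tanh x))) (at x)"
    "sq_bounded {0<..} (\<lambda>x. of_real (sinh x) * u (tanh x))"
    using shifted_graph_ode_exists[OF u to_u_cont'[OF Yc]] by blast
  have y1: "\<And>x. 0 < x \<Longrightarrow> (y has_vector_derivative y1 x) (at x)"
    "\<And>x. 0 < x \<Longrightarrow> (y1 has_vector_derivative (V_shift (of_real l) x * y x + of_real (sinh x) * to_u Y (tanh x))) (at x)" "sq_bounded {0<..} y"
    unfolding y_def[abs_def] using y1' by blast+
  have Yx: "of_real (sinh x) * to_u Y (tanh x) = Y x" if "0 < x" for x
    using that by (simp add: to_u_def artanh_tanh_real)
  have low: "ode_solution {0<..<1} (V_shift (of_real l)) y y1"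
    unfolding ode_solution_def
  proof (intro ballI conjI)
    fix x :: real assume x: "x \<in> {0<..<1}"
    then show "(y has_vector_derivative y1 x) (at x)" by (intro y1) auto
    show "(y1 has_vector_derivative V_shift (of_real l) x * y x) (at x)" using y1(2)[of x] Yx[of x] b0[of x] x by (auto simp: Y_def)
  qed
  have high: "ode_solution {2<..} (V_shift (of_real l)) y y1"
    unfolding ode_solution_def
  proof (intro ballI conjI)
    fix x :: real assume x: "x \<in> {2<..}"
    then show "(y has_vector_derivative y1 x) (at x)" by (intro y1) auto
    show "(y1 has_vector_derivative V_shift (of_real l) x * y x) (at x)" using y1(2)[of x] Yx[of x] b0[of x] x by (auto simp: Y_def)
  qed
  have L1: "sq_bounded {0<..<1} y" "sq_bounded {2<..} y" by (rule sq_bounded_subset[OF y1(3)]; auto)+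
  \<comment> \<open>To the left of the bump the L2 bound makes y a multiple of s; to its right only
    the zero solution is square integrable. Either way the Wronskian with s is 0.\<close>
  obtain c where c: "\<And>x. x \<in> {0<..<1} \<Longrightarrow> y x = c * of_real (s x) \<and> y1 x = c * of_real (s1 x)"
    using sq_bounded_multiple_of_regular[OF low _ sr L1(1)] by auto
  have y0: "y x = 0 \<and> y1 x = 0" if "x > 2" for x
    by (rule no_sq_bounded_nonneg[OF high _ L1(2) l that]) simp
  define w where "w x = Re (y1 x * of_real (s x) - y x * of_real (s1 x))" for x
  have dw: "(w has_real_derivative (s x)\<^sup>2 * \<beta> x) (at x)" if x: "0 < x" for x
  proof -
    have xs: "x \<in> {0<..}" using x by simp
    have so': "ode_solution {0<..} (V_shift (complex_of_real l)) (\<lambda>x. of_real (s x)) (\<lambda>x. of_real (s1 x))"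
      using sr by (simp add: regular_at_zero_def)
    note d = ode_solutionD[OF so' xs]
    have "((\<lambda>x. y1 x * of_real (s x) - y x * of_real (s1 x)) has_vector_derivative
      ((y1 x * of_real (s1 x) + (V_shift (of_real l) x * y x + Y x) * of_real (s x)) -
       (y x * (V_shift (of_real l) x * of_real (s x)) + y1 x * of_real (s1 x)))) (at x)"
      using y1(2)[OF x] unfolding Yx[OF x] by (intro has_vector_derivative_diff has_vector_derivative_mult d y1(1)[OF x])
    from bounded_linear.has_vector_derivative[OF bounded_linear_Re this]
    have "(w has_real_derivative Re ((y1 x * of_real (s1 x) + (V_shift (of_real l) x * y x + Y x) * of_real (s x)) -
       (y x * (V_shift (of_real l) x * of_real (s x)) + y1 x * of_real (s1 x)))) (at x)"
      unfolding w_def by (simp only: has_real_derivative_iff_has_vector_derivative)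
    moreover have "(y1 x * of_real (s1 x) + (V_shift (of_real l) x * y x + Y x) * of_real (s x)) -
       (y x * (V_shift (of_real l) x * of_real (s x)) + y1 x * of_real (s1 x)) = of_real ((s x)\<^sup>2 * \<beta> x)"
      by (simp add: Y_def algebra_simps power2_eq_square)
    ultimately show ?thesis by (simp only: Re_complex_of_real)
  qed
  have w0: "w (1/2) = 0" using c[of "1/2"] by (simp add: w_def)
  have w3: "w 3 = 0" using y0[of 3] by (simp add: w_def)
  have mono: "w a \<le> w b" if "0 < a" "a \<le> b" for a b
  proof (rule DERIV_nonneg_imp_nondecreasing[OF that(2)])
    fix t assume t: "a \<le> t" "t \<le> b"
    have "0 \<le> (s t)\<^sup>2 * \<beta> t" by (simp add: \<beta>_def)
    then show "\<exists>d. (w has_real_derivative d) (at t) \<and> 0 \<le> d" using dw[of t] t that by auto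
  qed
  have wz: "w x = 0" if "x \<in> {1/2<..<3}" for x
    using mono[of "1/2" x] mono[of x 3] w0 w3 that by simp
  have s0: "s x = 0" if x: "x \<in> {1<..<2}" for x
  proof -
    have "((\<lambda>_. 0) has_real_derivative (s x)\<^sup>2 * \<beta> x) (at x)"
      by (rule has_field_derivative_transform_within_open[OF dw, where S = "{1/2<..<3}"]) (use x wz in auto)
    then have "(s x)\<^sup>2 * \<beta> x = 0" using DERIV_unique DERIV_const by blast
    moreover have "\<beta> x > 0" using x by (simp add: \<beta>_def)
    ultimately show ?thesis by simp
  qed
  have "((\<lambda>_. 0) has_vector_derivative s1 (3/2)) (at (3/2))"
    by (rule has_vector_derivative_transform_within_open[OF ode_solutionD(1)[OF so], where S = "{1<..<2}"]) (use s0 in auto)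
  then have "s1 (3/2) = 0" using vector_derivative_unique_at has_vector_derivative_const by blast
  then have "s x = 0 \<and> s1 x = 0" if "0 < x" for x
    using ode_solution_unique[OF so _ V_shift_cont, of "3/2" x] s0[of "3/2"] that by (simp add: is_interval_1)
  moreover obtain a where "0 < a" "complex_of_real (s a) \<noteq> 0" using regular_nonzero[OF sr, of 1] by (metis zero_less_one)
  ultimately show False by auto
qed

section \<open>Density of the range on the half line\<close>

lemma indicator_wt_closed:
  fixes c :: "real \<Rightarrow> 'a::real_vector"
  shows "(\<lambda>t. indicator {0<..<1} t *\<^sub>R (wt t *\<^sub>R c t)) = (\<lambda>t. indicator {0..1} t *\<^sub>R (wt t *\<^sub>R c t))"
proof -
  have "wt 0 = 0" "wt 1 = 0" by (auto simp: wt_def)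
  note w = this
  show ?thesis
  proof
    fix t :: real
    consider "t = 0" | "t = 1" | "t \<noteq> 0" "t \<noteq> 1" by blast
    then show "indicator {0<..<1} t *\<^sub>R (wt t *\<^sub>R c t) = indicator {0..1} t *\<^sub>R (wt t *\<^sub>R c t)"
      by cases (auto simp: w indicator_def)
  qed
qed

lemma wt_nonneg: "0 \<le> wt r"
  by (simp add: wt_def)

lemma inH_integrable:
  assumes "inH u"
  shows "(\<lambda>r. wt r * (cmod (u r))\<^sup>2) integrable_on {0..1}"
    and "normH u = sqrt (integral {0..1} (\<lambda>r. wt r * (cmod (u r))\<^sup>2))"
proof -
  note e = indicator_wt_closed[of "\<lambda>r. (cmod (u r))\<^sup>2", unfolded real_scaleR_def]
  have 1: "set_integrable lebesgue {0..1} (\<lambda>r. wt r * (cmod (u r))\<^sup>2)"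
    using assms unfolding inH_def set_integrable_def by (simp add: e)
  then show "(\<lambda>r. wt r * (cmod (u r))\<^sup>2) integrable_on {0..1}" by (rule set_lebesgue_integral_eq_integral(1))
  show "normH u = sqrt (integral {0..1} (\<lambda>r. wt r * (cmod (u r))\<^sup>2))"
    using set_lebesgue_integral_eq_integral(2)[OF 1] unfolding normH_def set_lebesgue_integral_def by (simp add: e)
qed

lemma product_integrable_closed:
  assumes "inH u" "inH h"
  shows "(\<lambda>r. u r * h r * of_real (wt r)) absolutely_integrable_on {0..1}"
  using product_integrable[OF assms] indicator_wt_closed[of "\<lambda>r. u r * h r"]
  unfolding set_integrable_def by (simp add: scaleR_conv_of_real mult.commute)

lemma inH_indicator:
  assumes u: "inH u" and S: "S \<in> sets borel"
  shows "inH (\<lambda>r. indicator S r *\<^sub>R u r)"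
proof -
  have Sl: "S \<in> sets lebesgue" using S by simp
  have "set_integrable lebesgue {0<..<1} (\<lambda>r. wt r * (cmod (u r))\<^sup>2)" using u by (simp add: inH_def)
  then have "integrable lebesgue (\<lambda>r. indicator S r *\<^sub>R (indicator {0<..<1} r *\<^sub>R (wt r * (cmod (u r))\<^sup>2)))"
    unfolding set_integrable_def by (rule integrable_mult_indicator[OF Sl])
  also have "(\<lambda>r. indicator S r *\<^sub>R (indicator {0<..<1} r *\<^sub>R (wt r * (cmod (u r))\<^sup>2))) =
      (\<lambda>r. indicator {0<..<1} r *\<^sub>R (wt r * (cmod (indicator S r *\<^sub>R u r))\<^sup>2))"
    by (auto simp: fun_eq_iff indicator_def)
  finally have 1: "set_integrable lebesgue {0<..<1} (\<lambda>r. wt r * (cmod (indicator S r *\<^sub>R u r))\<^sup>2)"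
    by (simp add: set_integrable_def)
  have "(\<lambda>r. indicator {0<..<1} r *\<^sub>R u r) \<in> borel_measurable lebesgue" using u by (simp add: inH_def set_borel_measurable_def)
  then have "(\<lambda>r. indicat_real S r *\<^sub>R (indicator {0<..<1} r *\<^sub>R u r)) \<in> borel_measurable lebesgue"
    using Sl by measurable
  then have "set_borel_measurable lebesgue {0<..<1} (\<lambda>r. indicator S r *\<^sub>R u r)"
    unfolding set_borel_measurable_def by (simp add: mult.commute)
  then show ?thesis using 1 by (simp add: inH_def)
qed

lemma cutoff_inH:
  assumes a: "continuous_on {0<..} a" "\<And>x. 0 < x \<Longrightarrow> x \<le> X \<Longrightarrow> cmod (a x) \<le> M" and X: "0 < X"
  shows "inH (\<lambda>r. indicator {0<..tanh X} r *\<^sub>R to_u a r)"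
proof -
  define y where "y x = a (min x X) * of_real (exp (- (max x X - X)))" for x
  have yc: "continuous_on {0<..} y"
    unfolding y_def by (intro continuous_intros continuous_on_compose2[OF a(1)]) (use X in auto)
  have "cmod (y x) \<le> (M * exp X) * exp (- 1 * x)" if "0 < x" for x
  proof -
    have "cmod (a (min x X)) \<le> M" using that X by (intro a(2)) auto
    moreover have "exp (- (max x X - X)) \<le> exp (X - x)" by simp
    ultimately have "cmod (a (min x X)) * exp (- (max x X - X)) \<le> M * exp (X - x)"
      by (intro mult_mono) (auto intro: order_trans[OF norm_ge_zero])
    also have "M * exp (X - x) = (M * exp X) * exp (- 1 * x)" by (simp add: exp_diff exp_minus field_simps)
    finally show ?thesis unfolding y_def norm_mult norm_of_real abs_exp_cancel .
  qed
  then have "inH (to_u y)" by (intro inH_to_u yc exp_bound_imp_sq_bounded[OF yc, of 1]) auto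
  then have "inH (\<lambda>r. indicator {0<..tanh X} r *\<^sub>R to_u y r)" by (rule inH_indicator) simp
  then show ?thesis
  proof (rule inH_cong[THEN iffD1, rotated])
    fix r :: real assume r: "r \<in> {0<..<1}"
    show "indicator {0<..tanh X} r *\<^sub>R to_u y r = indicator {0<..tanh X} r *\<^sub>R to_u a r"
    proof (cases "r \<le> tanh X")
      case True
      then have "artanh r \<le> X" using artanh_unit(2)[OF r] by (metis tanh_real_le_iff)
      then show ?thesis by (simp add: to_u_def y_def)
    qed simp
  qed
qed

text \<open>Truncate the datum at \<open>tanh R\<close> and make it orthogonal to the regular solution by subtracting a multiple of the
  truncated regular solution. The Green formula then yields a preimage supported in \<open>{0..tanh R}\<close>. The correction is
  small because the regular solution is not square integrable.\<close>

lemma dense_range_nonneg: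
  assumes l: "0 \<le> l"
  shows "dense_range_shift f (of_real l)"
  unfolding dense_range_shift_def
proof (intro allI impI)
  fix h and \<epsilon> :: real assume h: "inH h" and e: "0 < \<epsilon>"
  define s :: "real \<Rightarrow> complex" where "s x = of_real (reg l x)" for x
  define s1 :: "real \<Rightarrow> complex" where "s1 x = of_real (reg1 l x)" for x
  have sr: "regular_at_zero (V_shift (complex_of_real l)) s s1"
    unfolding s_def s1_def by (intro regular_of_real reg_regular)
  have so: "ode_solution {0<..} (V_shift (of_real l)) s s1" using sr by (simp add: regular_at_zero_def)
  have sc: "continuous_on {0<..} s" by (rule ode_solution_continuous(1)[OF so])
  define U where "U = to_u s"
  have Uc: "continuous_on {0<..<1} U" unfolding U_def by (rule to_u_cont'[OF sc])
  \<comment> \<open>For real l the regular solution is real, so the bilinear pairing that occurs in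
    the Green formula is the inner product with it.\<close>
  have Ureal: "U r * U r = of_real ((cmod (U r))\<^sup>2)" for r
    unfolding U_def to_u_def s_def by (simp add: power2_eq_square norm_divide)
  obtain b b1 :: "real \<Rightarrow> complex" and W where b: "ode_solution {0<..} (V_shift (of_real l)) b b1" and W0: "W \<noteq> 0"
    and W: "\<And>x. 0 < x \<Longrightarrow> s x * b1 x - s1 x * b x = W"
    using second_solution_exists[OF sr l] by metis
  have bc: "continuous_on {0<..} b" by (rule ode_solution_continuous(1)[OF b])
  \<comment> \<open>The correction costs at most 4 tau^2 and the tail of h at most tau^2, together 5
    tau^2, which is below (3 tau)^2.\<close>
  define \<tau> where "\<tau> = \<epsilon> / 3"
  have \<tau>: "0 < \<tau>" using e by (simp add: \<tau>_def)
  define \<phi> where "\<phi> r = wt r * (cmod (h r))\<^sup>2" for r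
  have \<phi>I: "\<phi> integrable_on {0..1}" unfolding \<phi>_def by (rule inH_integrable(1)[OF h])
  have \<phi>0: "0 \<le> \<phi> r" for r using wt_nonneg by (simp add: \<phi>_def)
  obtain r0 where r0: "r0 \<in> {0<..<1}" "integral {r0..1} \<phi> \<le> \<tau>\<^sup>2"
  proof -
    have "continuous_on {0..1} (\<lambda>x. integral {0..x} \<phi>)" by (rule indefinite_integral_continuous_1[OF \<phi>I])
    then have "((\<lambda>x. integral {0..x} \<phi>) \<longlongrightarrow> integral {0..1} \<phi>) (at 1 within {0..1})" by (auto simp: continuous_on_def)
    then have "\<forall>\<^sub>F x in at 1 within {0..1}. dist (integral {0..x} \<phi>) (integral {0..1} \<phi>) < \<tau>\<^sup>2"
      using \<tau> by (intro tendstoD) auto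
    then obtain d where d: "d > 0" "\<And>x. x \<in> {0..1} \<Longrightarrow> x \<noteq> 1 \<Longrightarrow> dist x 1 < d \<Longrightarrow> dist (integral {0..x} \<phi>) (integral {0..1} \<phi>) < \<tau>\<^sup>2"
      unfolding eventually_at by auto
    define r0 where "r0 = max (1/2) (1 - d/2)"
    have r0: "r0 \<in> {0<..<1}" "dist r0 1 < d" using d(1) by (auto simp: r0_def dist_real_def)
    have "integral {0..r0} \<phi> + integral {r0..1} \<phi> = integral {0..1} \<phi>"
      by (rule Henstock_Kurzweil_Integration.integral_combine[OF _ _ \<phi>I]) (use r0 in auto)
    moreover have "dist (integral {0..r0} \<phi>) (integral {0..1} \<phi>) < \<tau>\<^sup>2" by (rule d(2)) (use r0 in auto)
    ultimately have "integral {r0..1} \<phi> \<le> \<tau>\<^sup>2" by (simp add: dist_real_def)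
    then show ?thesis using r0 that by blast
  qed
  have sbound: "\<exists>M>0. \<forall>x. 0 < x \<longrightarrow> x \<le> R \<longrightarrow> cmod (s x) \<le> M * x\<^sup>2 \<and> cmod (b x) \<le> M / x" for R
    using compact_bounds[OF sr b, of R] by metis
  have sb: "\<exists>M. \<forall>x. 0 < x \<longrightarrow> x \<le> R \<longrightarrow> cmod (s x) \<le> M" for R
  proof -
    obtain M where M: "M > 0" "\<And>x. 0 < x \<Longrightarrow> x \<le> R \<Longrightarrow> cmod (s x) \<le> M * x\<^sup>2" using sbound[of R] by blast
    have "cmod (s x) \<le> M * R\<^sup>2" if "0 < x" "x \<le> R" for x
    proof -
      have "M * x\<^sup>2 \<le> M * R\<^sup>2" using M(1) that by (intro mult_left_mono power_mono) auto
      then show ?thesis using M(2)[OF that] by linarith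
    qed
    then show ?thesis by blast
  qed
  have lowI: "set_integrable lebesgue {0..r} (\<lambda>t. U t * k t * of_real (wt t))" if "r \<in> {0<..<1}" "inH k" for r k
  proof -
    obtain M where M: "\<And>x. 0 < x \<Longrightarrow> x \<le> artanh r \<Longrightarrow> cmod (s x) \<le> M" using sb by metis
    show ?thesis using product_integrable_low[OF sc M artanh_unit(1)[OF that(1)] that(2)]
      unfolding U_def artanh_unit(2)[OF that(1)] by blast
  qed
  define \<sigma> where "\<sigma> R r = indicator {0<..tanh R} r *\<^sub>R U r" for R r
  have \<sigma>H: "inH (\<sigma> R)" if R: "0 < R" for R
  proof -
    obtain M where M: "\<And>x. 0 < x \<Longrightarrow> x \<le> R \<Longrightarrow> cmod (s x) \<le> M" using sb by metis
    show ?thesis unfolding \<sigma>_def[abs_def] U_def by (rule cutoff_inH[OF sc M R])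
  qed
  define D where "D R = integral {0..1} (\<lambda>r. wt r * (cmod (\<sigma> R r))\<^sup>2)" for R
  define A where "A = integral {0..r0} (\<lambda>t. cmod (U t * h t * of_real (wt t)))"
  have AI: "(\<lambda>t. cmod (U t * h t * of_real (wt t))) integrable_on {0..r0}"
    using set_lebesgue_integral_eq_integral(1) absolutely_integrable_norm[OF lowI[OF r0(1) h]] by (auto simp: o_def)
  have A0: "0 \<le> A" unfolding A_def by (intro integral_nonneg AI) auto
  have nsq: "\<not> sq_bounded {0<..} s" using not_inj_iff[OF sr] inj_nonneg[OF l] by blast
  \<comment> \<open>The regular solution is not square integrable, so its truncated norm exceeds any
    bound. The one chosen makes A at most tau * sqrt (D R), and the 1 keeps \<open>D R\<close>
    positive.\<close>
  obtain a1 a2 where a12: "a1 < a2" "{a1..a2} \<subseteq> {0<..}" "integral {a1..a2} (\<lambda>x. (norm (s x))\<^sup>2) > max 1 ((A / \<tau>)\<^sup>2)"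
    using nsq unfolding sq_bounded_def by (metis not_le)
  have a1: "0 < a1" using a12(1,2) by (metis atLeastAtMost_iff greaterThan_iff less_imp_le order_refl subsetD)
  define R where "R = max a2 (artanh r0 + 1)"
  have R: "0 < R" "a2 \<le> R" "r0 < tanh R"
  proof -
    show "0 < R" "a2 \<le> R" using a1 a12(1) by (auto simp: R_def)
    have "tanh (artanh r0) < tanh R" by (subst tanh_real_less_iff) (simp add: R_def)
    then show "r0 < tanh R" by (simp only: artanh_unit(2)[OF r0(1)])
  qed
  have tR: "tanh R \<in> {0<..<1}" using R tanh_real_lt_1[of R] by simp
  note \<sigma>I = inH_integrable(1)[OF \<sigma>H[OF R(1)]]
  have DR: "D R > max 1 ((A / \<tau>)\<^sup>2)"
  proof -
    have sub: "{tanh a1..tanh a2} \<subseteq> {0<..<1}" by (rule tanh_Icc_subset[OF a1])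
    have "integral {a1..a2} (\<lambda>x. (norm (s x))\<^sup>2) = integral {a1..a2} (\<lambda>x. (norm (of_real (sinh x) * U (tanh x)))\<^sup>2)"
      by (rule integral_cong) (use a1 in \<open>auto simp: U_def to_u_def artanh_tanh_real\<close>)
    also have "\<dots> = integral {tanh a1..tanh a2} (\<lambda>r. wt r * (cmod (U r))\<^sup>2)"
      by (rule integral_sq_transfer[OF Uc a1]) (use a12 in simp)
    also have "\<dots> = integral {tanh a1..tanh a2} (\<lambda>r. wt r * (cmod (\<sigma> R r))\<^sup>2)"
    proof (rule integral_cong)
      fix r assume r: "r \<in> {tanh a1..tanh a2}"
      then have "0 < r" using sub by auto
      moreover have "tanh a2 \<le> tanh R" using R by simp
      then have "r \<le> tanh R" using r by (meson atLeastAtMost_iff order_trans)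
      ultimately show "wt r * (cmod (U r))\<^sup>2 = wt r * (cmod (\<sigma> R r))\<^sup>2" by (simp add: \<sigma>_def)
    qed
    also have "\<dots> \<le> D R"
      unfolding D_def
    proof (rule integral_subset_le)
      show "{tanh a1..tanh a2} \<subseteq> {0..1}" by (rule subset_trans[OF sub]) auto
      then show "(\<lambda>r. wt r * (cmod (\<sigma> R r))\<^sup>2) integrable_on {tanh a1..tanh a2}"
        by (rule integrable_on_subinterval[OF \<sigma>I])
    qed (use \<sigma>I wt_nonneg in auto)
    finally show ?thesis using a12(3) by linarith
  qed
  then have D0: "0 < D R" by linarith
  define N where "N = integral {0..1} (\<lambda>r. \<sigma> R r * h r * of_real (wt r))"
  note NI = product_integrable_closed[OF \<sigma>H[OF R(1)] h]
  have NI': "(\<lambda>r. \<sigma> R r * h r * of_real (wt r)) integrable_on {0..1}" by (rule set_lebesgue_integral_eq_integral(1)[OF NI])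
  have NIn: "(\<lambda>r. cmod (\<sigma> R r * h r * of_real (wt r))) integrable_on {0..1}"
    using set_lebesgue_integral_eq_integral(1)[OF absolutely_integrable_norm[OF NI]] by (simp add: o_def)
  \<comment> \<open>Split at r0: below it the pairing is bounded by A independently of R, above it
    Cauchy-Schwarz with the small tail of h applies. Each part is at most tau * sqrt (D R);
    \<open>\<mu>\<close> balances the two terms of the second.\<close>
  have Nb: "cmod N \<le> 2 * \<tau> * sqrt (D R)"
  proof -
    define \<mu> where "\<mu> = \<tau> / sqrt (D R)"
    have \<mu>: "0 < \<mu>" using \<tau> D0 by (simp add: \<mu>_def)
    have "cmod N \<le> integral {0..1} (\<lambda>r. cmod (\<sigma> R r * h r * of_real (wt r)))"
      unfolding N_def by (rule integral_norm_bound_integral[OF NI' NIn]) simp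
    also have "\<dots> = integral {0..r0} (\<lambda>r. cmod (\<sigma> R r * h r * of_real (wt r))) + integral {r0..1} (\<lambda>r. cmod (\<sigma> R r * h r * of_real (wt r)))"
      by (rule Henstock_Kurzweil_Integration.integral_combine[OF _ _ NIn, symmetric]) (use r0 in auto)
    also have "integral {0..r0} (\<lambda>r. cmod (\<sigma> R r * h r * of_real (wt r))) \<le> A"
      unfolding A_def
    proof (rule integral_le[OF _ AI])
      show "(\<lambda>r. cmod (\<sigma> R r * h r * of_real (wt r))) integrable_on {0..r0}"
        by (rule integrable_on_subinterval[OF NIn]) (use r0 in auto)
    qed (auto simp: \<sigma>_def indicator_def)
    also have "A \<le> \<tau> * sqrt (D R)"
    proof -
      have "(A / \<tau>)\<^sup>2 \<le> D R" using DR by simp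
      then have "A / \<tau> \<le> sqrt (D R)" by (rule real_le_rsqrt)
      then show ?thesis using \<tau> by (simp add: field_simps)
    qed
    also have "integral {r0..1} (\<lambda>r. cmod (\<sigma> R r * h r * of_real (wt r))) \<le>
        integral {r0..1} (\<lambda>r. \<mu> / 2 * (wt r * (cmod (\<sigma> R r))\<^sup>2) + 1 / (2 * \<mu>) * \<phi> r)"
    proof (rule integral_le)
      show "(\<lambda>r. cmod (\<sigma> R r * h r * of_real (wt r))) integrable_on {r0..1}"
        by (rule integrable_on_subinterval[OF NIn]) (use r0 in auto)
      show "(\<lambda>r. \<mu> / 2 * (wt r * (cmod (\<sigma> R r))\<^sup>2) + 1 / (2 * \<mu>) * \<phi> r) integrable_on {r0..1}"
        by (intro integrable_add integrable_on_mult_right integrable_on_subinterval[OF \<sigma>I] integrable_on_subinterval[OF \<phi>I]) (use r0 in auto)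
      fix r
      have "2 * (\<mu> * cmod (\<sigma> R r)) * cmod (h r) \<le> (\<mu> * cmod (\<sigma> R r))\<^sup>2 + (cmod (h r))\<^sup>2" by (rule sum_squares_bound)
      then have "2 * \<mu> * (cmod (\<sigma> R r) * cmod (h r)) * (wt r / (2 * \<mu>)) \<le> ((\<mu> * cmod (\<sigma> R r))\<^sup>2 + (cmod (h r))\<^sup>2) * (wt r / (2 * \<mu>))"
        using \<mu> wt_nonneg[of r] by (intro mult_right_mono) auto
      then show "cmod (\<sigma> R r * h r * of_real (wt r)) \<le> \<mu> / 2 * (wt r * (cmod (\<sigma> R r))\<^sup>2) + 1 / (2 * \<mu>) * \<phi> r"
        using \<mu> wt_nonneg[of r] by (simp add: norm_mult \<phi>_def field_simps power2_eq_square)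
    qed
    also have "\<dots> = \<mu> / 2 * integral {r0..1} (\<lambda>r. wt r * (cmod (\<sigma> R r))\<^sup>2) + 1 / (2 * \<mu>) * integral {r0..1} \<phi>"
    proof -
      have "(\<lambda>r. wt r * (cmod (\<sigma> R r))\<^sup>2) integrable_on {r0..1}" "\<phi> integrable_on {r0..1}"
        by (rule integrable_on_subinterval[OF \<sigma>I] integrable_on_subinterval[OF \<phi>I]; use r0 in auto)+
      then show ?thesis by (subst integral_add) (use integrable_on_mult_right[of _ _ "1 / (2 * \<mu>)"] integrable_on_mult_right[of _ _ "\<mu> / 2"] in auto)
    qed
    also have "\<dots> \<le> \<mu> / 2 * D R + 1 / (2 * \<mu>) * \<tau>\<^sup>2"
    proof (intro add_mono mult_left_mono r0(2))
      show "integral {r0..1} (\<lambda>r. wt r * (cmod (\<sigma> R r))\<^sup>2) \<le> D R"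
        unfolding D_def
        by (rule integral_subset_le[OF _ integrable_on_subinterval[OF \<sigma>I] \<sigma>I]) (use r0 wt_nonneg in auto)
    qed (use \<mu> in auto)
    also have "\<dots> = \<tau> * sqrt (D R)"
    proof -
      define q where "q = sqrt (D R)"
      have q: "0 < q" "D R = q\<^sup>2" using D0 by (auto simp: q_def)
      show ?thesis unfolding \<mu>_def q_def[symmetric] q(2) using q(1) \<tau> by (simp add: field_simps power2_eq_square)
    qed
    finally show ?thesis by simp
  qed
  define c where "c = N / of_real (D R)"
  have cD: "(cmod c)\<^sup>2 * D R \<le> 4 * \<tau>\<^sup>2"
  proof -
    have "(cmod N)\<^sup>2 \<le> (2 * \<tau> * sqrt (D R))\<^sup>2" using Nb by (intro power_mono) auto
    also have "\<dots> = 4 * \<tau>\<^sup>2 * D R" using D0 by (simp add: power_mult_distrib)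
    finally show ?thesis using D0 by (simp add: c_def norm_divide power_divide field_simps power2_eq_square)
  qed
  define k where "k r = indicator {0<..tanh R} r *\<^sub>R h r + (- c) * \<sigma> R r" for r
  have kH: "inH k"
    unfolding k_def[abs_def]
    by (intro inH_add inH_indicator h inH_cmult_bounded[OF \<sigma>H[OF R(1)], of _ "cmod c"]) auto
  have k0: "k r = 0" if "r > tanh R" for r using that by (simp add: k_def \<sigma>_def)
  have Uk: "U r * k r * of_real (wt r) = \<sigma> R r * h r * of_real (wt r) - c * of_real (wt r * (cmod (\<sigma> R r))\<^sup>2)" if "r \<in> {0..1}" for r
  proof (cases "r \<in> {0<..tanh R}")
    case True
    then have "\<sigma> R r = U r" by (simp add: \<sigma>_def)
    have "U r * k r = U r * h r - c * (U r * U r)" using True by (simp add: k_def \<sigma>_def algebra_simps)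
    then have "U r * k r * of_real (wt r) = (U r * h r - c * of_real ((cmod (U r))\<^sup>2)) * of_real (wt r)" unfolding Ureal by simp
    then show ?thesis unfolding \<open>\<sigma> R r = U r\<close> of_real_mult by algebra
  next
    case False
    moreover have "wt 0 = 0" by (simp add: wt_def)
    ultimately show ?thesis using that by (cases "r = 0") (auto simp: k_def \<sigma>_def)
  qed
  have UkI: "((\<lambda>r. U r * k r * of_real (wt r)) has_integral 0) {0..1}"
  proof -
    have "((\<lambda>r. wt r * (cmod (\<sigma> R r))\<^sup>2) has_integral D R) {0..1}" unfolding D_def using \<sigma>I by (rule integrable_integral)
    then have "((\<lambda>r. complex_of_real (wt r * (cmod (\<sigma> R r))\<^sup>2)) has_integral of_real (D R)) {0..1}" by (rule has_integral_of_real)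
    then have "((\<lambda>r. \<sigma> R r * h r * of_real (wt r) - c * of_real (wt r * (cmod (\<sigma> R r))\<^sup>2)) has_integral (N - c * of_real (D R))) {0..1}"
      using integrable_integral[OF NI'] unfolding N_def by (intro has_integral_diff has_integral_mult_right)
    moreover have "N - c * of_real (D R) = 0" using D0 by (simp add: c_def)
    ultimately show ?thesis by (subst has_integral_cong[OF Uk]) simp_all
  qed
  obtain M where M: "M > 0" "\<And>x. 0 < x \<Longrightarrow> x \<le> R \<Longrightarrow> cmod (s x) \<le> M * x\<^sup>2 \<and> cmod (b x) \<le> M / x" using sbound[of R] by blast
  note hH = h
  interpret green f B C "of_real l" W s s1 b b1 k
  proof
    show "s x * b1 x - s1 x * b x = W" if "0 < x" for x using W that by simp
    fix r :: real assume r: "r \<in> {0<..<1}"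
    define X where "X = artanh r"
    have X: "0 < X" "tanh X = r" using artanh_unit[OF r] by (auto simp: X_def)
    show "set_integrable lebesgue {0..r} (\<lambda>t. to_u s t * k t * of_real (wt t))"
      using lowI[OF r kH] by (simp add: U_def)
    \<comment> \<open>The datum k vanishes beyond tanh R, so b may be replaced there by a decaying
      continuation without changing the integrand.\<close>
    define b' where "b' x = b (min x R) * of_real (exp (- (max x R - R)))" for x
    have bc': "continuous_on {0<..} b'"
      unfolding b'_def by (intro continuous_intros continuous_on_compose2[OF bc]) (use R in auto)
    have "set_integrable lebesgue {r..1} (\<lambda>t. to_u b' t * k t * of_real (wt t))"
      unfolding X(2)[symmetric]
    proof (rule product_integrable_high[OF bc' _ X(1) zero_less_one kH])
      fix x :: real assume x: "X \<le> x"
      have "cmod (b (min x R)) \<le> M / min x R" using M(2)[of "min x R"] x X R by auto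
      also have "\<dots> \<le> M / min X R" using x X R M(1) by (intro divide_left_mono) auto
      finally have 1: "cmod (b (min x R)) \<le> M / min X R" .
      have "exp (- (max x R - R)) \<le> exp (R - x)" by simp
      then have "cmod (b (min x R)) * exp (- (max x R - R)) \<le> M / min X R * exp (R - x)"
        using 1 X R M(1) by (intro mult_mono) auto
      also have "\<dots> = M / min X R * exp R * exp (- 1 * x)" by (simp add: exp_diff exp_minus field_simps)
      finally show "cmod (b' x) \<le> M / min X R * exp R * exp (- 1 * x)"
        unfolding b'_def norm_mult norm_of_real abs_exp_cancel .
    qed
    then show "set_integrable lebesgue {r..1} (\<lambda>t. to_u b t * k t * of_real (wt t))"
    proof (rule set_integrable_cong[THEN iffD1, rotated -1])
      fix t assume t: "t \<in> {r..1}"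
      show "to_u b' t * k t * of_real (wt t) = to_u b t * k t * of_real (wt t)"
      proof (cases "t > tanh R")
        case False
        then have t1: "t \<in> {0<..<1}" using t r tR by auto
        have "tanh (artanh t) \<le> tanh R" using False artanh_unit(2)[OF t1] by simp
        then have "artanh t \<le> R" by (simp only: tanh_real_le_iff)
        then show ?thesis by (simp add: to_u_def b'_def)
      qed (simp add: k0)
    qed auto
  qed (rule so b W0 kH)+
  have after: "r > tanh R" if r: "r \<in> {0<..<1}" "artanh r \<notin> {..R}" for r
  proof -
    have "tanh R < tanh (artanh r)" using r(2) by simp
    then show ?thesis using artanh_unit(2)[OF r(1)] by simp
  qed
  have "inH gu"
  \<comment> \<open>Any positive rate would do: up to R the kernel is bounded by M^2 R, and the
    factor exp R compensates the exponential.\<close>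
  proof (rule gu_inH[of 1 "M\<^sup>2 * R * exp R" "{..R}"])
    show "0 \<le> M\<^sup>2 * R * exp R" using R by simp
    fix t x :: real assume tx: "0 < t" "t \<le> x" "x \<in> {..R}"
    have "cmod (s t) * cmod (b x) \<le> (M * t\<^sup>2) * (M / x)"
      using M(1) M(2)[of t] M(2)[of x] tx by (intro mult_mono) auto
    also have "\<dots> = M\<^sup>2 * (t * (t / x))" by (simp add: power2_eq_square)
    also have "\<dots> \<le> M\<^sup>2 * (R * 1)" using tx R by (intro mult_left_mono mult_mono) auto
    also have "\<dots> \<le> M\<^sup>2 * (R * (exp R * exp (- 1 * (x - t))))"
    proof (intro mult_left_mono)
      have "1 \<le> exp (R + (t - x))" using tx R by simp
      then show "1 \<le> exp R * exp (- 1 * (x - t))" by (simp add: exp_add[symmetric])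
    qed (use R in auto)
    finally show "cmod (s t) * cmod (b x) \<le> M\<^sup>2 * R * exp R * exp (- 1 * (x - t))" by (simp add: mult.assoc)
  next
    fix r :: real assume r: "r \<in> {0<..<1}" "artanh r \<notin> {..R}"
    have rR: "r > tanh R" by (rule after[OF r])
    then show "k r = 0" by (rule k0)
    \<comment> \<open>Past tanh R the datum is 0, so Q vanishes there, while P has become the full
      pairing of k with the regular solution, which is 0 by the choice of c.\<close>
    have z1: "integral {r..1} (\<lambda>t. U t * k t * of_real (wt t)) = 0" "integral {r..1} (\<lambda>t. to_u b t * k t * of_real (wt t)) = 0"
      by (rule integral_unique, rule has_integral_is_0, use rR k0 in auto)+
    have "integral {0..r} (\<lambda>t. U t * k t * of_real (wt t)) + integral {r..1} (\<lambda>t. U t * k t * of_real (wt t)) = integral {0..1} (\<lambda>t. U t * k t * of_real (wt t))"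
      by (rule Henstock_Kurzweil_Integration.integral_combine) (use r UkI in auto)
    then have "P r = 0" using z1(1) integral_unique[OF UkI] by (simp add: P_def U_def)
    moreover have "Q r = 0" using z1(2) by (simp add: Q_def)
    ultimately show "gu r = 0" by (simp add: gu_def)
  qed simp
  then have G: "shifted_graph f (of_real l) gu k" by (rule shifted_graph_gu)
  have khH: "inH (\<lambda>r. k r - h r)"
  proof -
    have "inH (\<lambda>r. (- 1) * h r)" by (rule inH_cmult_bounded[OF hH, where c = "\<lambda>_. - 1" and M = 1]) auto
    then have "inH (\<lambda>r. k r + (- 1) * h r)" by (rule inH_add[OF kH])
    then show ?thesis by simp
  qed
  have "integral {0..1} (\<lambda>r. wt r * (cmod (k r - h r))\<^sup>2) \<le>
      integral {0..1} (\<lambda>r. (cmod c)\<^sup>2 * (wt r * (cmod (\<sigma> R r))\<^sup>2) + (if r \<in> {r0..1} then \<phi> r else 0))"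
  proof (rule integral_le[OF inH_integrable(1)[OF khH]])
    have "(\<lambda>r. if r \<in> {r0..1} then \<phi> r else 0) integrable_on {0..1}"
      using integrable_on_subinterval[OF \<phi>I, of r0 1] r0 by (subst integrable_restrict_Int) (auto simp: Int_absorb2)
    then show "(\<lambda>r. (cmod c)\<^sup>2 * (wt r * (cmod (\<sigma> R r))\<^sup>2) + (if r \<in> {r0..1} then \<phi> r else 0)) integrable_on {0..1}"
      by (intro integrable_add integrable_on_mult_right \<sigma>I)
    fix r :: real assume r: "r \<in> {0..1}"
    show "wt r * (cmod (k r - h r))\<^sup>2 \<le> (cmod c)\<^sup>2 * (wt r * (cmod (\<sigma> R r))\<^sup>2) + (if r \<in> {r0..1} then \<phi> r else 0)"
    proof (cases "r \<in> {0<..tanh R}")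
      case True
      then have "k r - h r = - c * \<sigma> R r" by (simp add: k_def)
      then have eq: "wt r * (cmod (k r - h r))\<^sup>2 = (cmod c)\<^sup>2 * (wt r * (cmod (\<sigma> R r))\<^sup>2)" by (simp add: norm_mult power_mult_distrib)
      show ?thesis unfolding eq using \<phi>0[of r] by auto
    next
      case False
      moreover have "wt 0 = 0" by (simp add: wt_def)
      ultimately consider "wt r = 0" | "r > tanh R" using r by force
      then show ?thesis
      proof cases
        case 2
        then have "wt r * (cmod (k r - h r))\<^sup>2 = \<phi> r" using k0 by (simp add: \<phi>_def)
        then show ?thesis using 2 R(3) r wt_nonneg[of r] by simp
      qed (use \<phi>0 in auto)
    qed
  qed
  also have "\<dots> = (cmod c)\<^sup>2 * D R + integral {r0..1} \<phi>"
  proof -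
    have 1: "((\<lambda>r. (cmod c)\<^sup>2 * (wt r * (cmod (\<sigma> R r))\<^sup>2)) has_integral (cmod c)\<^sup>2 * D R) {0..1}"
      unfolding D_def by (intro has_integral_mult_right integrable_integral \<sigma>I)
    have "(\<phi> has_integral integral {r0..1} \<phi>) {r0..1}"
      by (intro integrable_integral integrable_on_subinterval[OF \<phi>I]) (use r0 in auto)
    then have 2: "((\<lambda>r. if r \<in> {r0..1} then \<phi> r else 0) has_integral integral {r0..1} \<phi>) {0..1}"
      using r0 by (subst has_integral_restrict) auto
    show ?thesis by (rule integral_unique[OF has_integral_add[OF 1 2]])
  qed
  also have "\<dots> \<le> 5 * \<tau>\<^sup>2" using cD r0(2) by simp
  also have "\<dots> < \<epsilon>\<^sup>2" using e by (simp add: \<tau>_def power_divide)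
  finally have "normH (\<lambda>r. k r - h r) < \<epsilon>"
    unfolding inH_integrable(2)[OF khH] using e by (intro real_less_lsqrt) auto
  then show "\<exists>u k. shifted_graph f (of_real l) u k \<and> normH (\<lambda>r. k r - h r) < \<epsilon>" using G by blast
qed

end

section \<open>Oscillation of the regular solution\<close>

lemma simple_zero_sign:
  fixes y :: "real \<Rightarrow> real"
  assumes d: "(y has_real_derivative d) (at p)" and y: "y p = 0" and d0: "d \<noteq> 0"
  obtains \<rho> where "\<rho> > 0" "\<And>x. x \<noteq> p \<Longrightarrow> \<bar>x - p\<bar> < \<rho> \<Longrightarrow> 0 < y x * d * (x - p)"
proof -
  have "((\<lambda>x. y x / (x - p)) \<longlongrightarrow> d) (at p)" using d y by (simp add: has_field_derivative_iff)
  then have "((\<lambda>x. y x / (x - p) * d) \<longlongrightarrow> d * d) (at p)" by (intro tendsto_intros)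
  moreover have "0 < d * d" using d0 not_real_square_gt_zero[of d] by blast
  ultimately have "\<forall>\<^sub>F x in at p. 0 < y x / (x - p) * d" by (rule order_tendstoD)
  then obtain \<rho> where \<rho>: "\<rho> > 0" "\<And>x. x \<noteq> p \<Longrightarrow> dist x p < \<rho> \<Longrightarrow> 0 < y x / (x - p) * d"
    unfolding eventually_at by auto
  have "0 < y x * d * (x - p)" if "x \<noteq> p" "\<bar>x - p\<bar> < \<rho>" for x
  proof -
    have "0 < (y x / (x - p) * d) * (x - p)\<^sup>2"
      using that by (intro mult_pos_pos \<rho>(2)) (simp_all add: dist_real_def)
    also have "(y x / (x - p) * d) * (x - p)\<^sup>2 = y x * d * (x - p)" using that by (simp add: power2_eq_square)
    finally show ?thesis .
  qed
  then show ?thesis using that \<rho>(1) by blast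
qed

lemma finite_separation:
  fixes Z :: "real set"
  assumes "finite Z"
  obtains \<rho> where "\<rho> > 0" "\<And>p q. p \<in> Z \<Longrightarrow> q \<in> Z \<Longrightarrow> p \<noteq> q \<Longrightarrow> 2 * \<rho> \<le> \<bar>p - q\<bar>"
proof -
  have "\<exists>\<rho>>0. \<forall>p\<in>Z. \<forall>q\<in>Z. p \<noteq> q \<longrightarrow> \<rho> \<le> \<bar>p - q\<bar>"
    using assms
  proof (induction Z)
    case (insert a Z)
    then obtain \<rho> where \<rho>: "\<rho> > 0" "\<forall>p\<in>Z. \<forall>q\<in>Z. p \<noteq> q \<longrightarrow> \<rho> \<le> \<bar>p - q\<bar>" by blast
    obtain d where d: "d > 0" "\<forall>x\<in>Z. x \<noteq> a \<longrightarrow> d \<le> dist a x" using finite_set_avoid[OF insert(1)] by blast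
    show ?case
      by (rule exI[of _ "min \<rho> d"]) (use \<rho> d in \<open>auto simp: dist_real_def abs_minus_commute min_le_iff_disj\<close>)
  qed (auto intro: exI[of _ 1])
  then obtain \<rho> where "\<rho> > 0" "\<forall>p\<in>Z. \<forall>q\<in>Z. p \<noteq> q \<longrightarrow> \<rho> \<le> \<bar>p - q\<bar>" by blast
  then show ?thesis using that[of "\<rho> / 2"] by auto
qed

lemma constant_sign:
  fixes y :: "real \<Rightarrow> real"
  assumes c: "continuous_on S y" and S: "connected S" and nz: "\<And>x. x \<in> S \<Longrightarrow> y x \<noteq> 0"
  obtains \<sigma> where "\<sigma> = 1 \<or> \<sigma> = (-1::real)" "\<And>x. x \<in> S \<Longrightarrow> 0 < \<sigma> * y x"
proof (cases "\<exists>x\<in>S. 0 < y x")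
  case True
  then obtain a where a: "a \<in> S" "0 < y a" by blast
  have "0 < y x" if "x \<in> S" for x
  proof (rule ccontr)
    assume "\<not> 0 < y x"
    then have "0 \<in> {y x..y a}" using a by simp
    moreover have "connected (y ` S)" by (rule connected_continuous_image[OF c S])
    ultimately have "0 \<in> y ` S" using connected_contains_Icc[of "y ` S" "y x" "y a"] that a by blast
    then show False using nz by force
  qed
  then show ?thesis using that[of 1] by simp
next
  case False
  then have "y x < 0" if "x \<in> S" for x using nz[OF that] that by (metis linorder_neqE_linordered_idom)
  then show ?thesis using that[of "-1"] by simp
qed

section \<open>Dependence of the zeros on the spectral parameter\<close>

context inverse_square_potential
begin

abbreviation y0 :: "real \<Rightarrow> real \<Rightarrow> real" where "y0 \<equiv> reg"
abbreviation y1 :: "real \<Rightarrow> real \<Rightarrow> real" where "y1 \<equiv> reg1"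

definition zeros :: "real \<Rightarrow> real set" where "zeros l = {x. 0 < x \<and> y0 l x = 0}"

lemma y0_deriv: "0 < x \<Longrightarrow> (y0 l has_real_derivative y1 l x) (at x)"
  using ode_solutionD(1)[OF reg_ode, of x l] by (simp add: has_real_derivative_iff_has_vector_derivative)

lemma y1_deriv: "0 < x \<Longrightarrow> (y1 l has_real_derivative (V x - l) * y0 l x) (at x)"
  using ode_solutionD(2)[OF reg_ode, of x l] by (simp add: has_real_derivative_iff_has_vector_derivative V_shift_def)

lemma y0_cont: "continuous_on {0<..} (y0 l)" and y1_cont: "continuous_on {0<..} (y1 l)"
  using ode_solution_continuous[OF reg_ode] by auto

lemma zero_simple:
  assumes "0 < p" "y0 l p = 0"
  shows "y1 l p \<noteq> 0"
proof
  assume "y1 l p = 0"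
  then have "y0 l x = 0 \<and> y1 l x = 0" if "0 < x" for x
    using ode_solution_unique[OF reg_ode _ V_shift_cont, of p l x] assms that by (simp add: is_interval_1)
  moreover obtain a where "0 < a" "y0 l a \<noteq> 0" using regular_nonzero[OF reg_regular, of 1] by (metis zero_less_one)
  ultimately show False by blast
qed

text \<open>The factor eta = y / x^2 is included because absolute closeness of y cannot exclude
  zeros near the origin, where y itself tends to 0, whereas closeness of eta can.\<close>

lemma reg_dependence:
  fixes l0 X :: real
  assumes X: "0 < X"
  obtains K where "K > 0" "\<And>l x. \<bar>l - l0\<bar> \<le> 1 \<Longrightarrow> 0 < x \<Longrightarrow> x \<le> X \<Longrightarrow>
    \<bar>reg_eta l x - reg_eta l0 x\<bar> \<le> K * \<bar>l - l0\<bar> \<and> \<bar>y0 l x - y0 l0 x\<bar> \<le> K * \<bar>l - l0\<bar> \<and> \<bar>y1 l x - y1 l0 x\<bar> \<le> K * \<bar>l - l0\<bar>"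
proof -
  \<comment> \<open>One bound, and hence one exponential rate, for all parameters within distance 1
    of l0.\<close>
  define L where "L = \<bar>l0\<bar> + 1"
  define m where "m = 2 * (B + L) + 1"
  have L: "0 \<le> B + L" using B_nonneg by (simp add: L_def)
  have m: "0 < m" using L by (simp add: m_def)
  define K1 where "K1 = 4 / m\<^sup>2 * exp (m * X)"
  define K2 where "K2 = 4 * X * exp (m * X)"
  have K: "0 < K1" "0 < K2" using m X by (auto simp: K1_def K2_def)
  define K where "K = K1 + X\<^sup>2 * K1 + 2 * X * K1 + X\<^sup>2 * K2"
  have e: "\<bar>reg_eta l x - reg_eta l0 x\<bar> \<le> K1 * \<bar>l - l0\<bar>" "\<bar>reg_eta1 l x - reg_eta1 l0 x\<bar> \<le> K2 * \<bar>l - l0\<bar>"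
    if l: "\<bar>l - l0\<bar> \<le> 1" and x: "0 < x" "x \<le> X" for l x
  proof -
    have nl: "norm l \<le> L" "norm l0 \<le> L" using l by (auto simp: L_def)
    note A = reg_eta[OF nl(1) m_def] and A0 = reg_eta[OF nl(2) m_def]
    have w: "volterra_weight (p_reg :: real \<Rightarrow> real) m" using A(1) by (simp add: volterra_def)
    have u: "norm (U_reg l t - U_reg l0 t) \<le> \<bar>l - l0\<bar>" for t by (simp add: U_reg_def)
    note dep = volterra_weight.volterra_solution_dependence[OF w A(1) A0(1) A(2) A0(2) u, of x]
    have ex: "exp (m * x) \<le> exp (m * X)" using m x by simp
    have "\<bar>reg_eta l x - reg_eta l0 x\<bar> \<le> 4 * \<bar>l - l0\<bar> / m\<^sup>2 * exp (m * x)" using dep(1) x by simp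
    also have "\<dots> \<le> 4 * \<bar>l - l0\<bar> / m\<^sup>2 * exp (m * X)" using ex m by (intro mult_left_mono) auto
    finally show "\<bar>reg_eta l x - reg_eta l0 x\<bar> \<le> K1 * \<bar>l - l0\<bar>" by (simp add: K1_def mult_ac)
    have "\<bar>reg_eta1 l x - reg_eta1 l0 x\<bar> \<le> 4 * \<bar>l - l0\<bar> * x * exp (m * x)" using dep(2) x by (simp add: reg_eta1_def)
    also have "\<dots> \<le> 4 * \<bar>l - l0\<bar> * X * exp (m * X)" using ex x by (intro mult_mono mult_left_mono) auto
    finally show "\<bar>reg_eta1 l x - reg_eta1 l0 x\<bar> \<le> K2 * \<bar>l - l0\<bar>" by (simp add: K2_def mult.commute mult.left_commute)
  qed
  show ?thesis
  proof (rule that)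
    show "K > 0" using K X by (auto simp: K_def intro!: add_pos_pos)
    fix l x :: real assume l: "\<bar>l - l0\<bar> \<le> 1" and x: "0 < x" "x \<le> X"
    note e = e[OF l x]
    define d where "d = \<bar>l - l0\<bar>"
    have d: "0 \<le> d" by (simp add: d_def)
    have x2: "x\<^sup>2 \<le> X\<^sup>2" using x by (intro power_mono) auto
    have t0: "0 \<le> K1 * d" "0 \<le> X\<^sup>2 * (K1 * d)" "0 \<le> 2 * X * (K1 * d)" "0 \<le> X\<^sup>2 * (K2 * d)" using K X d by auto
    have Kd: "K * d = K1 * d + X\<^sup>2 * (K1 * d) + 2 * X * (K1 * d) + X\<^sup>2 * (K2 * d)" by (simp add: K_def algebra_simps)
    have a1: "\<bar>y0 l x - y0 l0 x\<bar> = x\<^sup>2 * \<bar>reg_eta l x - reg_eta l0 x\<bar>"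
      by (simp add: reg_def abs_mult flip: right_diff_distrib)
    have a2: "x\<^sup>2 * \<bar>reg_eta l x - reg_eta l0 x\<bar> \<le> X\<^sup>2 * (K1 * d)"
      using x2 e(1) by (intro mult_mono) (auto simp: d_def)
    have "y1 l x - y1 l0 x = 2 * x * (reg_eta l x - reg_eta l0 x) + x\<^sup>2 * (reg_eta1 l x - reg_eta1 l0 x)"
      by (simp add: reg1_def algebra_simps)
    then have "\<bar>y1 l x - y1 l0 x\<bar> \<le> 2 * x * \<bar>reg_eta l x - reg_eta l0 x\<bar> + x\<^sup>2 * \<bar>reg_eta1 l x - reg_eta1 l0 x\<bar>"
      using abs_triangle_ineq[of "2 * x * (reg_eta l x - reg_eta l0 x)" "x\<^sup>2 * (reg_eta1 l x - reg_eta1 l0 x)"] x by (simp add: abs_mult)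
    also have "\<dots> \<le> 2 * X * (K1 * d) + X\<^sup>2 * (K2 * d)"
      using x x2 e by (intro add_mono mult_mono) (auto simp: d_def)
    finally have a3: "\<bar>y1 l x - y1 l0 x\<bar> \<le> 2 * X * (K1 * d) + X\<^sup>2 * (K2 * d)" .
    show "\<bar>reg_eta l x - reg_eta l0 x\<bar> \<le> K * \<bar>l - l0\<bar> \<and> \<bar>y0 l x - y0 l0 x\<bar> \<le> K * \<bar>l - l0\<bar> \<and> \<bar>y1 l x - y1 l0 x\<bar> \<le> K * \<bar>l - l0\<bar>"
      unfolding d_def[symmetric] Kd using e(1)[folded d_def] a1 a2 a3 t0 by linarith
  qed
qed

lemma reg_eventually_close:
  fixes l0 X e :: real
  assumes X: "0 < X" and e: "0 < e"
  shows "\<exists>d>0. \<forall>l x. \<bar>l - l0\<bar> < d \<longrightarrow> 0 < x \<longrightarrow> x \<le> X \<longrightarrow>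
    \<bar>reg_eta l x - reg_eta l0 x\<bar> < e \<and> \<bar>y0 l x - y0 l0 x\<bar> < e \<and> \<bar>y1 l x - y1 l0 x\<bar> < e"
proof -
  obtain K where K: "K > 0" "\<And>l x. \<bar>l - l0\<bar> \<le> 1 \<Longrightarrow> 0 < x \<Longrightarrow> x \<le> X \<Longrightarrow>
    \<bar>reg_eta l x - reg_eta l0 x\<bar> \<le> K * \<bar>l - l0\<bar> \<and> \<bar>y0 l x - y0 l0 x\<bar> \<le> K * \<bar>l - l0\<bar> \<and> \<bar>y1 l x - y1 l0 x\<bar> \<le> K * \<bar>l - l0\<bar>"
    using reg_dependence[OF X, of l0] by metis
  define d where "d = min 1 (e / K)"
  have "K * \<bar>l - l0\<bar> < e" if "\<bar>l - l0\<bar> < d" for l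
    using that K(1) by (auto simp: d_def field_simps)
  then have lt: "K * \<bar>l - l0\<bar> < e" "\<bar>l - l0\<bar> \<le> 1" if "\<bar>l - l0\<bar> < d" for l using that by (auto simp: d_def)
  show ?thesis
  proof (intro exI[of _ d] conjI allI impI)
    show "0 < d" using K(1) e by (simp add: d_def)
    fix l x :: real assume a: "\<bar>l - l0\<bar> < d" "0 < x" "x \<le> X"
    note k = K(2)[OF lt(2)[OF a(1)] a(2,3)]
    show "\<bar>reg_eta l x - reg_eta l0 x\<bar> < e" "\<bar>y0 l x - y0 l0 x\<bar> < e" "\<bar>y1 l x - y1 l0 x\<bar> < e"
      using k lt(1)[OF a(1)] by linarith+
  qed
qed

text \<open>Zeros cannot enter from the origin: eta is close to 1 there, uniformly for l near
  l0.\<close>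

lemma eta_pos_near_zero:
  "\<exists>\<delta>>0. \<exists>d>0. \<forall>l x. \<bar>l - l0\<bar> < d \<longrightarrow> 0 < x \<longrightarrow> x < \<delta> \<longrightarrow> 0 < y0 l x"
proof -
  have "\<forall>\<^sub>F x in at_right 0. reg_eta l0 x > (1/2 :: real)" by (rule order_tendstoD(1)[OF reg_eta_tendsto]) simp
  then obtain \<delta> where \<delta>: "\<delta> > 0" "\<And>x. 0 < x \<Longrightarrow> x < \<delta> \<Longrightarrow> reg_eta l0 x > (1/2 :: real)"
    unfolding eventually_at_right_field by auto
  obtain d where d: "d > 0" "\<forall>l x. \<bar>l - l0\<bar> < d \<longrightarrow> 0 < x \<longrightarrow> x \<le> \<delta> \<longrightarrow>
    \<bar>reg_eta l x - reg_eta l0 x\<bar> < 1/2 \<and> \<bar>y0 l x - y0 l0 x\<bar> < 1/2 \<and> \<bar>y1 l x - y1 l0 x\<bar> < 1/2"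
    using reg_eventually_close[OF \<delta>(1), of "1/2" l0] by auto
  have "0 < y0 l x" if "\<bar>l - l0\<bar> < d" "0 < x" "x < \<delta>" for l x
  proof -
    have "\<bar>reg_eta l x - reg_eta l0 x\<bar> < 1/2" using d(2) that by simp
    then have "0 < reg_eta l x" using \<delta>(2)[OF that(2,3)] by linarith
    then show ?thesis using that by (simp add: reg_def)
  qed
  then show ?thesis using \<delta>(1) d(1) by blast
qed

lemma finite_zeros_compact: "finite (zeros l \<inter> {..X})"
proof (rule ccontr)
  assume inf: "infinite (zeros l \<inter> {..X})"
  obtain \<delta> where \<delta>: "\<delta> > 0" "\<And>x. 0 < x \<Longrightarrow> x < \<delta> \<Longrightarrow> 0 < y0 l x"
  proof -
    obtain \<delta> d where \<delta>: "\<delta> > 0" "d > 0" "\<forall>l' x. \<bar>l' - l\<bar> < d \<longrightarrow> 0 < x \<longrightarrow> x < \<delta> \<longrightarrow> 0 < y0 l' x"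
      using eta_pos_near_zero[of l] by blast
    show ?thesis by (rule that[OF \<delta>(1)]) (use \<delta>(2,3) in auto)
  qed
  have sub: "zeros l \<inter> {..X} \<subseteq> {\<delta>..X}" using \<delta>(2) by (force simp: zeros_def)
  obtain p where p: "p \<in> {\<delta>..X}" "p islimpt (zeros l \<inter> {..X})"
    using Heine_Borel_imp_Bolzano_Weierstrass[OF _ inf sub] by auto
  have p0: "0 < p" using p(1) \<delta>(1) by auto
  have "y0 l p = 0"
  proof (rule ccontr)
    assume "y0 l p \<noteq> 0"
    moreover have "isCont (y0 l) p" using y0_cont p0 by (simp add: continuous_on_eq_continuous_at)
    ultimately have "\<forall>\<^sub>F x in at p. y0 l x \<noteq> 0"
      using tendsto_imp_eventually_ne[of "y0 l" "y0 l p" "at p" 0] by (simp add: isCont_def)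
    then have "\<forall>\<^sub>F x in at p. x \<in> zeros l \<inter> {..X} \<longrightarrow> False" by eventually_elim (auto simp: zeros_def)
    moreover have "\<exists>\<^sub>F x in at p. x \<in> zeros l \<inter> {..X}" using p(2) by (simp add: islimpt_iff_eventually frequently_def)
    ultimately have "\<exists>\<^sub>F x in at p. False" by (rule frequently_mp)
    then show False by simp
  qed
  from simple_zero_sign[OF y0_deriv[OF p0] this zero_simple[OF p0 this]]
  obtain \<rho> where \<rho>: "\<rho> > 0" "\<And>x. x \<noteq> p \<Longrightarrow> \<bar>x - p\<bar> < \<rho> \<Longrightarrow> 0 < y0 l x * y1 l p * (x - p)" by metis
  have "\<exists>x'\<in>zeros l \<inter> {..X}. x' \<noteq> p \<and> dist x' p < \<rho>" using p(2) \<rho>(1) unfolding islimpt_approachable by blast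
  then show False using \<rho>(2) by (force simp: zeros_def dist_real_def)
qed

text \<open>Simple zeros persist: the sign change around each survives a small perturbation, and the
  separation of at least 2 rho keeps the perturbed zeros distinct. An injection is used instead of
  cardinalities so that nothing is claimed about finiteness of the zeros for l.\<close>

lemma zeros_lower_semicontinuous:
  assumes Z: "finite Z" "Z \<subseteq> zeros l0"
  shows "\<exists>d>0. \<forall>l. \<bar>l - l0\<bar> < d \<longrightarrow> (\<exists>g. inj_on g Z \<and> g ` Z \<subseteq> zeros l)"
proof -
  obtain \<rho> where \<rho>: "\<rho> > 0" "\<And>p q. p \<in> Z \<Longrightarrow> q \<in> Z \<Longrightarrow> p \<noteq> q \<Longrightarrow> 2 * \<rho> \<le> \<bar>p - q\<bar>"
    using finite_separation[OF Z(1)] by metis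
  have "\<exists>d>0. \<forall>l. \<bar>l - l0\<bar> < d \<longrightarrow> (\<exists>q\<in>zeros l. \<bar>q - p\<bar> < \<rho>)" if p: "p \<in> Z" for p
  proof -
    have p0: "0 < p" "y0 l0 p = 0" using p Z by (auto simp: zeros_def)
    obtain r where r: "r > 0" "\<And>x. x \<noteq> p \<Longrightarrow> \<bar>x - p\<bar> < r \<Longrightarrow> 0 < y0 l0 x * y1 l0 p * (x - p)"
      using simple_zero_sign[OF y0_deriv[OF p0(1)] p0(2) zero_simple[OF p0]] by metis
    define t where "t = min (min r \<rho>) p / 2"
    have t: "0 < t" "t < r" "t < \<rho>" "t < p" using r \<rho> p0 by (auto simp: t_def)
    define a where "a = p - t"
    define b where "b = p + t"
    have ab: "0 < a" "a < p" "p < b" using t by (auto simp: a_def b_def)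
    have "0 < y0 l0 a * y1 l0 p * (a - p)" "0 < y0 l0 b * y1 l0 p * (b - p)"
      using r(2)[of a] r(2)[of b] t by (auto simp: a_def b_def)
    then have sgn: "y0 l0 a * y1 l0 p < 0" "0 < y0 l0 b * y1 l0 p"
      using ab by (auto simp: zero_less_mult_iff)
    then have ne: "y0 l0 a \<noteq> 0" "y0 l0 b \<noteq> 0" by auto
    define e where "e = min \<bar>y0 l0 a\<bar> \<bar>y0 l0 b\<bar>"
    have e: "0 < e" using ne by (simp add: e_def)
    have b0: "0 < b" using ab by simp
    obtain d where d: "d > 0" "\<forall>l x. \<bar>l - l0\<bar> < d \<longrightarrow> 0 < x \<longrightarrow> x \<le> b \<longrightarrow>
      \<bar>reg_eta l x - reg_eta l0 x\<bar> < e \<and> \<bar>y0 l x - y0 l0 x\<bar> < e \<and> \<bar>y1 l x - y1 l0 x\<bar> < e"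
      using reg_eventually_close[OF b0 e, of l0] by blast
    have "\<exists>q\<in>zeros l. \<bar>q - p\<bar> < \<rho>" if l: "\<bar>l - l0\<bar> < d" for l
    proof -
      have cl: "\<bar>y0 l a - y0 l0 a\<bar> < \<bar>y0 l0 a\<bar>" "\<bar>y0 l b - y0 l0 b\<bar> < \<bar>y0 l0 b\<bar>"
        using d(2) l ab b0 by (auto simp: e_def)
      have cab: "continuous_on {a..b} (y0 l)" by (rule continuous_on_subset[OF y0_cont]) (use ab in auto)
      have "\<exists>q. a \<le> q \<and> q \<le> b \<and> y0 l q = 0"
      proof (cases "0 < y1 l0 p")
        case True
        then have "y0 l0 a < 0" "0 < y0 l0 b" using sgn by (auto simp: zero_less_mult_iff mult_less_0_iff)
        then have "y0 l a \<le> 0" "0 \<le> y0 l b" using cl by linarith+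
        then show ?thesis using IVT'[of "y0 l" a 0 b] ab cab by auto
      next
        case False
        then have "0 < y0 l0 a" "y0 l0 b < 0" using sgn by (auto simp: zero_less_mult_iff mult_less_0_iff)
        then have "y0 l b \<le> 0" "0 \<le> y0 l a" using cl by linarith+
        then show ?thesis using IVT2'[of "y0 l" b 0 a] ab cab by auto
      qed
      then obtain q where q: "a \<le> q" "q \<le> b" "y0 l q = 0" by blast
      then have "\<bar>q - p\<bar> \<le> t" by (auto simp: a_def b_def)
      then show ?thesis using q ab t by (intro bexI[of _ q]) (auto simp: zeros_def)
    qed
    then show ?thesis using d(1) by blast
  qed
  then obtain D where D: "\<And>p. p \<in> Z \<Longrightarrow> D p > 0 \<and> (\<forall>l. \<bar>l - l0\<bar> < D p \<longrightarrow> (\<exists>q\<in>zeros l. \<bar>q - p\<bar> < \<rho>))" by metis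
  define d where "d = Min (insert 1 (D ` Z))"
  have d: "0 < d" "\<And>p. p \<in> Z \<Longrightarrow> d \<le> D p" using D Z(1) by (auto simp: d_def)
  have "\<exists>g. inj_on g Z \<and> g ` Z \<subseteq> zeros l" if l: "\<bar>l - l0\<bar> < d" for l
  proof -
    have "\<exists>q\<in>zeros l. \<bar>q - p\<bar> < \<rho>" if "p \<in> Z" for p using D[OF that] d(2)[OF that] l by auto
    then obtain g where g: "\<And>p. p \<in> Z \<Longrightarrow> g p \<in> zeros l \<and> \<bar>g p - p\<bar> < \<rho>" by metis
    have "inj_on g Z"
    proof (rule inj_onI, rule ccontr)
      fix p q assume pq: "p \<in> Z" "q \<in> Z" "g p = g q" "p \<noteq> q"
      then show False using g[of p] g[of q] \<rho>(2)[of p q] by linarith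
    qed
    then show ?thesis using g by blast
  qed
  then show ?thesis using d(1) by blast
qed

text \<open>Every zero of the perturbed solution in {..X} lies near a zero for l0. Two of them near
  the same one would by Rolle enclose a critical point, contradicting the lower bound on the
  derivative there. The cutoff at X matters, as zeros can arrive from infinity.\<close>

lemma zeros_upper_semicontinuous:
  assumes X: "0 < X"
  shows "\<exists>d>0. \<forall>l. \<bar>l - l0\<bar> < d \<longrightarrow> card (zeros l \<inter> {..X}) \<le> card (zeros l0 \<inter> {..X})"
proof -
  define Z where "Z = zeros l0 \<inter> {..X}"
  have Z: "finite Z" unfolding Z_def by (rule finite_zeros_compact)
  obtain \<delta> d1 where \<delta>: "\<delta> > 0" "d1 > 0" "\<forall>l x. \<bar>l - l0\<bar> < d1 \<longrightarrow> 0 < x \<longrightarrow> x < \<delta> \<longrightarrow> 0 < y0 l x"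
    using eta_pos_near_zero[of l0] by blast
  have "\<exists>r>0. \<exists>\<kappa>>0. \<forall>x. \<bar>x - p\<bar> < r \<longrightarrow> \<kappa> \<le> \<bar>y1 l0 x\<bar>" if p: "p \<in> Z" for p
  proof -
    have p0: "0 < p" "y0 l0 p = 0" using p by (auto simp: Z_def zeros_def)
    have n: "0 < \<bar>y1 l0 p\<bar>" using zero_simple[OF p0] by simp
    have "isCont (y1 l0) p" using y1_cont p0 by (simp add: continuous_on_eq_continuous_at)
    then have "\<exists>r>0. \<forall>x. dist x p < r \<longrightarrow> dist (y1 l0 x) (y1 l0 p) < \<bar>y1 l0 p\<bar> / 2"
      unfolding continuous_at_eps_delta using n by (metis half_gt_zero)
    then obtain r where "r > 0" "\<forall>x. dist x p < r \<longrightarrow> dist (y1 l0 x) (y1 l0 p) < \<bar>y1 l0 p\<bar> / 2" by blast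
    then have r: "r > 0" "\<And>x. \<bar>x - p\<bar> < r \<Longrightarrow> \<bar>y1 l0 x - y1 l0 p\<bar> < \<bar>y1 l0 p\<bar> / 2" by (auto simp: dist_real_def)
    have "\<bar>y1 l0 p\<bar> / 2 \<le> \<bar>y1 l0 x\<bar>" if "\<bar>x - p\<bar> < r" for x using r(2)[OF that] by arith
    then show ?thesis using n r(1) by (intro exI[of _ r] conjI exI[of _ "\<bar>y1 l0 p\<bar> / 2"]) auto
  qed
  then obtain r \<kappa> where r: "\<And>p. p \<in> Z \<Longrightarrow> r p > 0 \<and> \<kappa> p > 0 \<and> (\<forall>x. \<bar>x - p\<bar> < r p \<longrightarrow> \<kappa> p \<le> \<bar>y1 l0 x\<bar>)" by metis
  define \<rho> where "\<rho> = Min (insert 1 (r ` Z))"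
  define k where "k = Min (insert 1 (\<kappa> ` Z))"
  have \<rho>: "0 < \<rho>" "0 < k" "\<And>p. p \<in> Z \<Longrightarrow> \<rho> \<le> r p \<and> k \<le> \<kappa> p" using r Z by (auto simp: \<rho>_def k_def)
  have k: "k \<le> \<bar>y1 l0 x\<bar>" if "p \<in> Z" "\<bar>x - p\<bar> < \<rho>" for p x
  proof -
    have "\<bar>x - p\<bar> < r p" using \<rho>(3)[OF that(1)] that(2) by linarith
    then have "\<kappa> p \<le> \<bar>y1 l0 x\<bar>" using r[OF that(1)] by blast
    then show ?thesis using \<rho>(3)[OF that(1)] by linarith
  qed
  \<comment> \<open>Away from the origin and from its zeros, |y0 l0| has a positive minimum by
    compactness.\<close>
  define T where "T = {\<delta>..X} - (\<Union>p\<in>Z. ball p \<rho>)"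
  have T: "compact T" unfolding T_def by (intro compact_diff open_UN) auto
  have "\<exists>e>0. \<forall>x\<in>T. e \<le> \<bar>y0 l0 x\<bar>"
  proof (cases "T = {}")
    case False
    have "continuous_on T (\<lambda>x. \<bar>y0 l0 x\<bar>)"
      by (intro continuous_intros continuous_on_subset[OF y0_cont]) (use \<delta> in \<open>auto simp: T_def\<close>)
    from continuous_attains_inf[OF T False this] obtain t where t: "t \<in> T" "\<forall>x\<in>T. \<bar>y0 l0 t\<bar> \<le> \<bar>y0 l0 x\<bar>" by blast
    have "y0 l0 t \<noteq> 0"
    proof
      assume "y0 l0 t = 0"
      then have "t \<in> Z" using t(1) \<delta>(1) by (auto simp: T_def Z_def zeros_def)
      then show False using t(1) \<rho>(1) by (auto simp: T_def)
    qed
    then show ?thesis using t(2) by (intro exI[of _ "\<bar>y0 l0 t\<bar>"]) auto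
  qed (auto intro: exI[of _ 1])
  then obtain e where e: "e > 0" "\<And>x. x \<in> T \<Longrightarrow> e \<le> \<bar>y0 l0 x\<bar>" by blast
  have ek: "0 < min e k" using e \<rho> by simp
  obtain d2 where d2: "d2 > 0" "\<forall>l x. \<bar>l - l0\<bar> < d2 \<longrightarrow> 0 < x \<longrightarrow> x \<le> X \<longrightarrow>
    \<bar>reg_eta l x - reg_eta l0 x\<bar> < min e k \<and> \<bar>y0 l x - y0 l0 x\<bar> < min e k \<and> \<bar>y1 l x - y1 l0 x\<bar> < min e k"
    using reg_eventually_close[OF X ek, of l0] by blast
  have "card (zeros l \<inter> {..X}) \<le> card Z" if l: "\<bar>l - l0\<bar> < min d1 d2" for l
  proof -
    have close: "\<bar>y0 l x - y0 l0 x\<bar> < e" "\<bar>y1 l x - y1 l0 x\<bar> < k" if "0 < x" "x \<le> X" for x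
      using d2(2) l that by auto
    have near: "\<exists>p\<in>Z. \<bar>q - p\<bar> < \<rho>" if q: "q \<in> zeros l \<inter> {..X}" for q
    proof (rule ccontr)
      assume far: "\<not> ?thesis"
      have q0: "0 < q" "y0 l q = 0" "q \<le> X" using q by (auto simp: zeros_def)
      have "\<not> q < \<delta>" using \<delta>(3) l q0 by force
      then have "q \<in> T" using far q0 by (auto simp: T_def dist_real_def abs_minus_commute)
      then show False using e(2)[of q] close(1)[OF q0(1,3)] q0(2) by simp
    qed
    then obtain g where g: "\<And>q. q \<in> zeros l \<inter> {..X} \<Longrightarrow> g q \<in> Z \<and> \<bar>q - g q\<bar> < \<rho>" by metis
    have lt: False if q: "q \<in> zeros l \<inter> {..X}" "q' \<in> zeros l \<inter> {..X}" "g q = g q'" "q < q'" for q q'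
    proof -
      have q0: "0 < q" "y0 l q = 0" "y0 l q' = 0" "q' \<le> X" using q by (auto simp: zeros_def)
      have df: "y0 l differentiable (at x)" if "0 < x" for x using y0_deriv[OF that, of l] real_differentiable_def by blast
      have "\<exists>z. q < z \<and> z < q' \<and> (y0 l has_real_derivative 0) (at z)"
        by (rule Rolle[OF q(4)]) (use q0 df in \<open>auto intro!: continuous_on_subset[OF y0_cont[of l]]\<close>)
      then obtain z where z: "q < z" "z < q'" "(y0 l has_real_derivative 0) (at z)" by blast
      have z0: "0 < z" "z \<le> X" using z q0 by auto
      have "y1 l z = 0" using DERIV_unique[OF y0_deriv[OF z0(1)] z(3)] .
      moreover have "\<bar>z - g q\<bar> < \<rho>" using g[OF q(1)] g[OF q(2)] q(3) z by linarith
      then have "k \<le> \<bar>y1 l0 z\<bar>" using k g[OF q(1)] by blast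
      ultimately show False using close(2)[OF z0] by simp
    qed
    have "inj_on g (zeros l \<inter> {..X})"
      by (rule inj_onI) (metis lt linorder_neqE_linordered_idom)
    then show ?thesis using g Z by (intro card_inj_on_le[of g]) auto
  qed
  moreover have "0 < min d1 d2" using \<delta> d2 by simp
  ultimately show ?thesis unfolding Z_def by blast
qed

section \<open>Monotonicity of the product of the solution and its derivative\<close>

lemma product_deriv: "0 < x \<Longrightarrow> ((\<lambda>x. y0 l x * y1 l x) has_real_derivative ((y1 l x)\<^sup>2 + (V x - l) * (y0 l x)\<^sup>2)) (at x)"
  by (auto intro!: derivative_eq_intros y0_deriv y1_deriv simp: power2_eq_square algebra_simps)

lemma product_mono:
  assumes X: "0 < X" and V: "\<And>x. X \<le> x \<Longrightarrow> 0 \<le> V x - l" and ab: "X \<le> a" "a \<le> b"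
  shows "y0 l a * y1 l a \<le> y0 l b * y1 l b"
proof (rule DERIV_nonneg_imp_nondecreasing[OF ab(2)])
  fix t assume "a \<le> t" "t \<le> b"
  then show "\<exists>d. ((\<lambda>x. y0 l x * y1 l x) has_real_derivative d) (at t) \<and> 0 \<le> d"
    using product_deriv[of t l] V[of t] X ab(1) by (intro exI conjI) auto
qed

text \<open>If y y' vanished on the interval, so would its derivative y'^2 + (V - l) y^2, a sum of
  nonnegative terms; then y and y' would vanish together.\<close>

lemma no_two_flat:
  assumes ab: "0 < a" "a < b" and V: "\<And>x. a < x \<Longrightarrow> x < b \<Longrightarrow> 0 < V x - l"
    and z: "\<And>x. a < x \<Longrightarrow> x < b \<Longrightarrow> y0 l x * y1 l x = 0"
  shows False
proof -
  define m where "m = (a + b) / 2"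
  have m: "a < m" "m < b" "0 < m" using ab by (auto simp: m_def)
  have "((\<lambda>_. 0) has_real_derivative ((y1 l m)\<^sup>2 + (V m - l) * (y0 l m)\<^sup>2)) (at m)"
    by (rule has_field_derivative_transform_within_open[OF product_deriv[OF m(3)], where S = "{a<..<b}"]) (use m z in auto)
  then have "(y1 l m)\<^sup>2 + (V m - l) * (y0 l m)\<^sup>2 = 0" using DERIV_unique DERIV_const by blast
  moreover have "0 \<le> (V m - l) * (y0 l m)\<^sup>2" "0 \<le> (y1 l m)\<^sup>2" using V[OF m(1,2)] by auto
  ultimately have "(y1 l m)\<^sup>2 = 0" "(V m - l) * (y0 l m)\<^sup>2 = 0" by linarith+
  then have "y1 l m = 0" "y0 l m = 0" using V[OF m(1,2)] by auto
  then show False using zero_simple[OF m(3)] by blast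
qed

text \<open>The product y y' is nondecreasing and vanishes at both zeros, hence everywhere between
  them.\<close>

lemma at_most_one_zero_beyond:
  assumes X: "0 < X" and V: "\<And>x. X \<le> x \<Longrightarrow> 0 < V x - l"
    and p: "p \<in> zeros l" "q \<in> zeros l" "X \<le> p" "p < q"
  shows False
proof (rule no_two_flat)
  show "0 < p" "p < q" using p X by auto
  fix x assume x: "p < x" "x < q"
  then show "0 < V x - l" using V p by simp
  have V': "0 \<le> V t - l" if "X \<le> t" for t using V[OF that] by simp
  have "y0 l p * y1 l p \<le> y0 l x * y1 l x" by (rule product_mono[OF X V']) (use x p in auto)
  moreover have "y0 l x * y1 l x \<le> y0 l q * y1 l q" by (rule product_mono[OF X V']) (use x p in auto)
  ultimately show "y0 l x * y1 l x = 0" using p by (simp add: zeros_def)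
qed

lemma card_zeros_beyond:
  assumes X: "0 < X" and V: "\<And>x. X \<le> x \<Longrightarrow> 0 < V x - l"
  shows "finite (zeros l)" "card (zeros l) \<le> card (zeros l \<inter> {..X}) + 1"
proof -
  have "finite (zeros l \<inter> {X..}) \<and> card (zeros l \<inter> {X..}) \<le> 1"
  proof (cases "zeros l \<inter> {X..} = {}")
    case False
    then obtain p where p: "p \<in> zeros l \<inter> {X..}" by blast
    have "zeros l \<inter> {X..} \<subseteq> {p}"
    proof
      fix q assume q: "q \<in> zeros l \<inter> {X..}"
      then have "\<not> p < q" "\<not> q < p"
        using at_most_one_zero_beyond[OF X V, of p q] at_most_one_zero_beyond[OF X V, of q p] p by auto
      then show "q \<in> {p}" by simp
    qed
    then show ?thesis using card_mono[of "{p}" "zeros l \<inter> {X..}"] finite_subset by auto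
  qed simp
  moreover have "zeros l = (zeros l \<inter> {..X}) \<union> (zeros l \<inter> {X..})" by auto
  ultimately show "finite (zeros l)" "card (zeros l) \<le> card (zeros l \<inter> {..X}) + 1"
    using finite_zeros_compact[of l X] card_Un_le[of "zeros l \<inter> {..X}" "zeros l \<inter> {X..}"] by (metis finite_UnI, metis add_left_mono order_trans)
qed

text \<open>Once y y' is positive it stays positive. This criterion at one point is stable under
  small changes of l, in contrast to the absence of zeros on an unbounded interval.\<close>

lemma no_zero_beyond:
  assumes X: "0 < X" and V: "\<And>x. X \<le> x \<Longrightarrow> 0 < V x - l" and pos: "0 < y0 l X * y1 l X"
  shows "zeros l = zeros l \<inter> {..X}"
proof -
  have nz: "y0 l x \<noteq> 0" if "X \<le> x" for x
  proof -
    have V': "0 \<le> V t - l" if "X \<le> t" for t using V[OF that] by simp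
    have "y0 l X * y1 l X \<le> y0 l x * y1 l x" by (rule product_mono[OF X V']) (use that in auto)
    then show ?thesis using pos by auto
  qed
  have "x \<le> X" if "x \<in> zeros l" for x
  proof (rule ccontr)
    assume "\<not> x \<le> X"
    then show False using nz[of x] that by (simp add: zeros_def)
  qed
  then show ?thesis by auto
qed

lemma potential_above:
  assumes "l < 0"
  obtains X where "0 < X" "\<And>x. X \<le> x \<Longrightarrow> l < V x"
proof -
  define X where "X = 1 + C / (- l)"
  have Cl: "0 \<le> C / (- l)" using C_nonneg assms by (intro divide_nonneg_pos) auto
  then have X: "1 \<le> X" by (simp add: X_def)
  have "l < V x" if x: "X \<le> x" for x
  proof -
    have x1: "1 \<le> x" using x X by simp
    have "x \<le> x ^ 4" using x1 power_increasing[of 1 4 x] by simp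
    have "C / (- l) < x" using x by (simp add: X_def)
    then have "C < - l * x ^ 4"
      using assms \<open>x \<le> x ^ 4\<close> by (smt (verit) mult.commute mult_left_mono pos_divide_less_eq)
    then have "C / x ^ 4 < - l" using x1 by (simp add: pos_divide_less_eq)
    moreover have "\<bar>V x\<bar> \<le> C / x ^ 4" using x1 by (intro V_decay4) auto
    ultimately show ?thesis by linarith
  qed
  then show ?thesis using that[of X] X by simp
qed

lemma finite_zeros_neg: "l < 0 \<Longrightarrow> finite (zeros l)"
proof -
  assume "l < 0"
  then obtain X where X: "0 < X" "\<And>x. X \<le> x \<Longrightarrow> l < V x" using potential_above by metis
  show ?thesis by (rule card_zeros_beyond(1)[OF X(1)]) (use X(2) in simp)
qed

lemma product_tendsto_zero: "((\<lambda>x. y0 l x * y1 m x) \<longlongrightarrow> 0) (at_right 0)"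
proof -
  obtain K \<delta> where 1: "K > 0" "\<delta> > 0" "\<And>x. x \<in> {0<..<\<delta>} \<Longrightarrow> norm (y0 l x) \<le> K * x\<^sup>2"
    using reg_regular[of l] unfolding regular_at_zero_def by blast
  obtain K' \<delta>' where 2: "K' > 0" "\<delta>' > 0" "\<And>x. x \<in> {0<..<\<delta>'} \<Longrightarrow> norm (y1 m x) \<le> K' * x"
    using reg_regular[of m] unfolding regular_at_zero_def by blast
  have "\<forall>\<^sub>F x in at_right 0. 0 < x \<and> x < min \<delta> \<delta>'"
    using 1 2 unfolding eventually_at_right_field by (intro exI[of _ "min \<delta> \<delta>'"]) auto
  then have ev: "\<forall>\<^sub>F x in at_right 0. norm (y0 l x * y1 m x) \<le> (K * x\<^sup>2) * (K' * x)"
  proof eventually_elim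
    case (elim x)
    then show ?case unfolding norm_mult using 1(1,3) 2(3) by (intro mult_mono) auto
  qed
  have "((\<lambda>x. (K * x\<^sup>2) * (K' * x)) \<longlongrightarrow> (K * 0\<^sup>2) * (K' * 0)) (at_right 0)" by (intro tendsto_intros)
  then show ?thesis by (intro Lim_null_comparison[OF ev]) simp
qed

text \<open>Since V >= 2 / x^2 - B, the potential lies above l on the whole half line; y y' then
  increases from its limit 0 at the origin, and a zero p would force it to vanish before p.\<close>

lemma no_zeros_low:
  assumes l: "l \<le> - B - 1"
  shows "zeros l = {}"
proof (rule ccontr)
  assume "zeros l \<noteq> {}"
  then obtain p where p: "0 < p" "y0 l p = 0" by (auto simp: zeros_def)
  have V: "0 < V x - l" if "0 < x" for x
  proof -
    have "0 \<le> 2 / x\<^sup>2" by simp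
    then show ?thesis using V_near[OF that] l by linarith
  qed
  have mono: "y0 l a * y1 l a \<le> y0 l b * y1 l b" if "0 < a" "a \<le> b" for a b
    by (rule product_mono[OF that(1) less_imp_le[OF V] order_refl that(2)]) (use that in auto)
  have ge: "0 \<le> y0 l x * y1 l x" if x: "0 < x" for x
  proof (rule tendsto_upperbound[OF product_tendsto_zero])
    have "\<forall>\<^sub>F t in at_right 0. 0 < t \<and> t < x" using x unfolding eventually_at_right_field by blast
    then show "\<forall>\<^sub>F t in at_right 0. y0 l t * y1 l t \<le> y0 l x * y1 l x" by eventually_elim (use mono in auto)
  qed simp
  show False
  proof (rule no_two_flat[of "p/2" p l])
    fix x assume x: "p / 2 < x" "x < p"
    then show "0 < V x - l" using p by (intro V) auto
    have "y0 l x * y1 l x \<le> y0 l p * y1 l p" by (rule mono) (use x p in auto)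
    then show "y0 l x * y1 l x = 0" using ge[of x] x p by simp
  qed (use p in auto)
qed

text \<open>If y y' stayed nonpositive beyond X, integrating (y y')' >= c y^2 with c = - l / 2 would
  bound every tail integral of y^2 by - (y y') (X) / c, so y would be square integrable.\<close>

lemma not_sq_bounded_growth:
  assumes l: "l < 0" and n: "\<not> sq_bounded {0<..} (y0 l)" and X: "0 < X"
    and V: "\<And>x. X \<le> x \<Longrightarrow> l / 2 < V x"
  shows "\<exists>x\<ge>X. 0 < y0 l x * y1 l x"
proof (rule ccontr)
  assume "\<not> ?thesis"
  then have le: "y0 l x * y1 l x \<le> 0" if "X \<le> x" for x using that by (meson not_le)
  define c where "c = - l / 2"
  have c: "0 < c" using l by (simp add: c_def)
  have Vc: "c \<le> V x - l" if "X \<le> x" for x using V[OF that] by (simp add: c_def)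
  define T where "T = - (y0 l X * y1 l X)"
  have yc: "continuous_on {a..b} (\<lambda>x. (norm (y0 l x))\<^sup>2)" if "0 < a" for a b
    by (intro continuous_intros continuous_on_subset[OF y0_cont]) (use that in auto)
  have tail: "integral {a..b} (\<lambda>x. (norm (y0 l x))\<^sup>2) \<le> T / c" if ab: "X \<le> a" "a \<le> b" for a b
  proof -
    have I: "((\<lambda>x. (y1 l x)\<^sup>2 + (V x - l) * (y0 l x)\<^sup>2) has_integral (y0 l b * y1 l b - y0 l a * y1 l a)) {a..b}"
    proof (rule fundamental_theorem_of_calculus[OF ab(2)])
      fix x assume "x \<in> {a..b}"
      then have "0 < x" using ab X by auto
      from product_deriv[OF this, of l] show "((\<lambda>x. y0 l x * y1 l x) has_vector_derivative (y1 l x)\<^sup>2 + (V x - l) * (y0 l x)\<^sup>2) (at x within {a..b})"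
        unfolding has_real_derivative_iff_has_vector_derivative by (rule has_vector_derivative_at_within)
    qed
    have i: "(\<lambda>x. (norm (y0 l x))\<^sup>2) integrable_on {a..b}" by (rule integrable_continuous_real[OF yc]) (use ab X in auto)
    have "c * integral {a..b} (\<lambda>x. (norm (y0 l x))\<^sup>2) = integral {a..b} (\<lambda>x. c * (norm (y0 l x))\<^sup>2)" by simp
    also have "\<dots> \<le> integral {a..b} (\<lambda>x. (y1 l x)\<^sup>2 + (V x - l) * (y0 l x)\<^sup>2)"
    proof (rule integral_le)
      show "(\<lambda>x. c * (norm (y0 l x))\<^sup>2) integrable_on {a..b}" using i by (rule integrable_on_mult_right)
      show "(\<lambda>x. (y1 l x)\<^sup>2 + (V x - l) * (y0 l x)\<^sup>2) integrable_on {a..b}" using I by blast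
      fix x assume "x \<in> {a..b}"
      then have "c * (y0 l x)\<^sup>2 \<le> (V x - l) * (y0 l x)\<^sup>2" using Vc ab by (intro mult_right_mono) auto
      moreover have "0 \<le> (y1 l x)\<^sup>2" by simp
      ultimately show "c * (norm (y0 l x))\<^sup>2 \<le> (y1 l x)\<^sup>2 + (V x - l) * (y0 l x)\<^sup>2" unfolding real_norm_def power2_abs by linarith
    qed
    also have "\<dots> = y0 l b * y1 l b - y0 l a * y1 l a" by (rule integral_unique[OF I])
    also have "\<dots> \<le> T"
    proof -
      have "y0 l X * y1 l X \<le> y0 l a * y1 l a"
      proof (rule product_mono[OF X])
        show "0 \<le> V x - l" if "X \<le> x" for x using Vc[OF that] c by simp
      qed (use ab in auto)
      moreover have "y0 l b * y1 l b \<le> 0" using ab by (intro le) auto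
      ultimately show ?thesis by (simp add: T_def)
    qed
    finally show ?thesis using c by (simp add: field_simps)
  qed
  obtain M where M: "\<And>x. 0 < x \<Longrightarrow> x \<le> X \<Longrightarrow> (norm (y0 l x))\<^sup>2 \<le> M" "0 \<le> M"
  proof -
    obtain K \<delta> where \<delta>: "\<delta> > 0" "\<And>x. x \<in> {0<..<\<delta>} \<Longrightarrow> norm (y0 l x) \<le> K * x\<^sup>2"
      using reg_regular[of l] unfolding regular_at_zero_def by blast
    have "bounded (y0 l ` {\<delta>..X})"
      by (intro compact_imp_bounded compact_continuous_image continuous_on_subset[OF y0_cont]) (use \<delta> in auto)
    then obtain K2 where K2: "\<forall>w\<in>y0 l ` {\<delta>..X}. norm w \<le> K2" unfolding bounded_iff by blast
    define K3 where "K3 = \<bar>K\<bar> * X\<^sup>2 + \<bar>K2\<bar>"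
    have K3: "norm (y0 l x) \<le> K3" if x: "0 < x" "x \<le> X" for x
    proof (cases "x < \<delta>")
      case True
      have "K * x\<^sup>2 \<le> \<bar>K\<bar> * X\<^sup>2" using x by (intro mult_mono power_mono) auto
      then show ?thesis using \<delta>(2)[of x] True x by (simp add: K3_def)
    next
      case False
      then have "norm (y0 l x) \<le> K2" using K2 x by auto
      moreover have "0 \<le> \<bar>K\<bar> * X\<^sup>2" by simp
      ultimately show ?thesis unfolding K3_def by linarith
    qed
    show ?thesis by (rule that[of "K3\<^sup>2"]) (use K3 in \<open>auto intro!: power_mono simp del: real_norm_def power2_abs\<close>)
  qed
  have head: "integral {a..b} (\<lambda>x. (norm (y0 l x))\<^sup>2) \<le> M * X" if ab: "0 < a" "a \<le> b" "b \<le> X" for a b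
  proof -
    have "integral {a..b} (\<lambda>x. (norm (y0 l x))\<^sup>2) \<le> integral {a..b} (\<lambda>_. M)"
      by (rule integral_le[OF integrable_continuous_real[OF yc]]) (use M ab in auto)
    also have "\<dots> = M * (b - a)" using ab by simp
    also have "\<dots> \<le> M * X" using M(2) ab by (intro mult_left_mono) auto
    finally show ?thesis .
  qed
  have "integral {a..b} (\<lambda>x. (norm (y0 l x))\<^sup>2) \<le> M * X + T / c" if ab: "a < b" "{a..b} \<subseteq> {0<..}" for a b
  proof -
    have a: "0 < a" using ab by (metis atLeastAtMost_iff greaterThan_iff less_imp_le order_refl subsetD)
    have "0 \<le> T" using le[of X] by (simp add: T_def)
    then have T: "0 \<le> T / c" using c by simp
    have MX: "0 \<le> M * X" using M X by simp
    consider "b \<le> X" | "X \<le> a" | "a < X" "X < b" by linarith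
    then show ?thesis
    proof cases
      case 3
      have "integral {a..X} (\<lambda>x. (norm (y0 l x))\<^sup>2) + integral {X..b} (\<lambda>x. (norm (y0 l x))\<^sup>2) = integral {a..b} (\<lambda>x. (norm (y0 l x))\<^sup>2)"
        by (rule Henstock_Kurzweil_Integration.integral_combine[OF _ _ integrable_continuous_real[OF yc]]) (use 3 a in auto)
      then show ?thesis using head[OF a, of X] tail[of X b] 3 by simp
    qed (use head[OF a, of b] tail[of a b] ab T MX in auto)
  qed
  then have "sq_bounded {0<..} (y0 l)" unfolding sq_bounded_def by blast
  then show False using n by blast
qed

end

lemma deriv_sign_right:
  fixes y :: "real \<Rightarrow> real"
  assumes d: "(y has_real_derivative d) (at p)" and y: "y p = 0" and ev: "\<forall>\<^sub>F x in at_right p. 0 < \<sigma> * y x"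
  shows "0 \<le> \<sigma> * d"
proof (rule tendsto_lowerbound)
  have "(y has_real_derivative d) (at_right p)" by (rule has_field_derivative_at_within[OF d])
  then have "((\<lambda>x. y x / (x - p)) \<longlongrightarrow> d) (at_right p)" using y by (simp add: has_field_derivative_iff)
  then show "((\<lambda>x. \<sigma> * (y x / (x - p))) \<longlongrightarrow> \<sigma> * d) (at_right p)" by (rule tendsto_mult_left)
  show "\<forall>\<^sub>F x in at_right p. 0 \<le> \<sigma> * (y x / (x - p))"
    using ev eventually_at_right_less[of p]
  proof eventually_elim
    case (elim x)
    then have "0 \<le> (\<sigma> * y x) / (x - p)" by (intro divide_nonneg_nonneg) auto
    then show ?case by simp
  qed
qed simp

lemma deriv_sign_left:
  fixes y :: "real \<Rightarrow> real"
  assumes d: "(y has_real_derivative d) (at p)" and y: "y p = 0" and ev: "\<forall>\<^sub>F x in at_left p. 0 < \<sigma> * y x"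
  shows "\<sigma> * d \<le> 0"
proof (rule tendsto_upperbound)
  have "(y has_real_derivative d) (at_left p)" by (rule has_field_derivative_at_within[OF d])
  then have "((\<lambda>x. y x / (x - p)) \<longlongrightarrow> d) (at_left p)" using y by (simp add: has_field_derivative_iff)
  then show "((\<lambda>x. \<sigma> * (y x / (x - p))) \<longlongrightarrow> \<sigma> * d) (at_left p)" by (rule tendsto_mult_left)
  have "\<forall>\<^sub>F x in at_left p. x < p" by (simp add: eventually_at_filter)
  with ev show "\<forall>\<^sub>F x in at_left p. \<sigma> * (y x / (x - p)) \<le> 0"
  proof eventually_elim
    case (elim x)
    then have "(\<sigma> * y x) / (x - p) \<le> 0" by (intro divide_nonneg_nonpos) auto
    then show ?case by simp
  qed
qed simp

section \<open>Sturm comparison\<close>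

context inverse_square_potential
begin

definition wr :: "real \<Rightarrow> real \<Rightarrow> real \<Rightarrow> real" where
  "wr l m x = y1 l x * y0 m x - y0 l x * y1 m x"

lemma wr_deriv: "0 < x \<Longrightarrow> (wr l m has_real_derivative (m - l) * (y0 l x * y0 m x)) (at x)"
  unfolding wr_def[abs_def]
  by (auto intro!: derivative_eq_intros y0_deriv y1_deriv simp: algebra_simps)

text \<open>The signed Wronskian starts nonnegative: its limit at the origin is 0, and at a zero a
  of \<open>y0 l\<close> it equals y1 l a * y0 m a, whose signs are known from the right. Treating
  the origin as a further zero unifies the first gap with the others.\<close>

lemma wr_tendsto:
  assumes a: "a \<in> insert 0 (zeros l)" and s: "\<forall>\<^sub>F x in at_right a. 0 < s * y0 l x" and t: "\<forall>\<^sub>F x in at_right a. 0 < t * y0 m x"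
  obtains L where "((\<lambda>x. s * t * wr l m x) \<longlongrightarrow> L) (at_right a)" "0 \<le> L"
proof (cases "a = 0")
  case True
  have "((\<lambda>x. s * t * (y0 m x * y1 l x - y0 l x * y1 m x)) \<longlongrightarrow> s * t * (0 - 0)) (at_right 0)"
    by (intro tendsto_intros product_tendsto_zero)
  then show ?thesis using that[of 0] True by (simp add: wr_def mult.commute)
next
  case False
  then have a0: "0 < a" "y0 l a = 0" using a by (auto simp: zeros_def)
  have ym: "(y0 m \<longlongrightarrow> y0 m a) (at_right a)"
    using DERIV_isCont[OF y0_deriv[OF a0(1)]] unfolding isCont_def by (rule tendsto_within_subset) simp
  have "0 \<le> t * y0 m a"
    by (rule tendsto_lowerbound[OF tendsto_mult_left[OF ym]]) (use t in \<open>auto elim: eventually_mono\<close>)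
  moreover have "0 \<le> s * y1 l a" by (rule deriv_sign_right[OF y0_deriv[OF a0(1)] a0(2) s])
  ultimately have "0 \<le> (s * y1 l a) * (t * y0 m a)" by simp
  then have L: "0 \<le> s * t * wr l m a" using a0 by (simp add: wr_def mult_ac)
  have "(wr l m \<longlongrightarrow> wr l m a) (at_right a)"
    using DERIV_isCont[OF wr_deriv[OF a0(1)]] unfolding isCont_def by (rule tendsto_within_subset) simp
  from tendsto_mult_left[OF this] L show ?thesis by (rule that)
qed

lemma wr_pos:
  assumes a: "a \<in> insert 0 (zeros l)" and b: "a < b" and lm: "l < m"
    and st: "\<And>x. a < x \<Longrightarrow> x < b \<Longrightarrow> 0 < s * y0 l x" "\<And>x. a < x \<Longrightarrow> x < b \<Longrightarrow> 0 < t * y0 m x"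
    and x: "a < x" "x < b"
  shows "0 < s * t * wr l m x"
proof -
  have a0: "0 \<le> a" using a by (auto simp: zeros_def)
  have ev: "\<forall>\<^sub>F x in at_right a. a < x \<and> x < b" using b unfolding eventually_at_right_field by blast
  have "\<forall>\<^sub>F x in at_right a. 0 < s * y0 l x" "\<forall>\<^sub>F x in at_right a. 0 < t * y0 m x"
    using ev by (eventually_elim, use st in blast)+
  from wr_tendsto[OF a this] obtain L where L: "((\<lambda>x. s * t * wr l m x) \<longlongrightarrow> L) (at_right a)" "0 \<le> L" by metis
  have inc: "s * t * wr l m u < s * t * wr l m v" if uv: "a < u" "u < v" "v < b" for u v
  proof (rule DERIV_pos_imp_increasing[OF uv(2)])
    fix z assume z: "u \<le> z" "z \<le> v"
    then have z': "a < z" "z < b" "0 < z" using uv a0 by auto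
    have "((\<lambda>x. s * t * wr l m x) has_real_derivative (s * t) * ((m - l) * (y0 l z * y0 m z))) (at z)"
      by (rule DERIV_cmult[OF wr_deriv[OF z'(3)]])
    moreover have "0 < (m - l) * ((s * y0 l z) * (t * y0 m z))"
      using lm by (intro mult_pos_pos[OF _ mult_pos_pos[OF st(1)[OF z'(1,2)] st(2)[OF z'(1,2)]]]) simp
    ultimately show "\<exists>d. ((\<lambda>x. s * t * wr l m x) has_real_derivative d) (at z) \<and> 0 < d"
      by (intro exI[of _ "(s * t) * ((m - l) * (y0 l z * y0 m z))"]) (simp add: mult_ac)
  qed
  define c where "c = (a + x) / 2"
  have c: "a < c" "c < x" using x by (auto simp: c_def)
  have "L \<le> s * t * wr l m c"
  proof (rule tendsto_upperbound[OF L(1)])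
    have "\<forall>\<^sub>F z in at_right a. a < z \<and> z < c" using c unfolding eventually_at_right_field by blast
    then show "\<forall>\<^sub>F z in at_right a. s * t * wr l m z \<le> s * t * wr l m c"
      by eventually_elim (use inc c x in force)
  qed simp
  also have "\<dots> < s * t * wr l m x" by (rule inc) (use c x in auto)
  finally show ?thesis using L(2) by simp
qed

text \<open>If \<open>y0 m\<close> had no zero in the gap, the signed Wronskian would increase from
  a nonnegative limit at a and be positive inside, yet at p the sign of \<open>y1 l p\<close> makes
  it nonpositive.\<close>

lemma zeros_interlace_compact:
  assumes a: "a \<in> insert 0 (zeros l)" and p: "p \<in> zeros l" "a < p" and nz: "\<And>x. a < x \<Longrightarrow> x < p \<Longrightarrow> y0 l x \<noteq> 0" and lm: "l < m"
  shows "\<exists>q\<in>zeros m. a < q \<and> q < p"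
proof (rule ccontr)
  assume n: "\<not> ?thesis"
  have a0: "0 \<le> a" using a by (auto simp: zeros_def)
  then have nm: "y0 m x \<noteq> 0" if "x \<in> {a<..<p}" for x using n that by (auto simp: zeros_def)
  have nl: "y0 l x \<noteq> 0" if "x \<in> {a<..<p}" for x using nz that by simp
  have cont: "continuous_on {a<..<p} (y0 z)" for z
    by (rule continuous_on_subset[OF y0_cont]) (use a0 in auto)
  obtain s where s: "\<And>x. x \<in> {a<..<p} \<Longrightarrow> 0 < s * y0 l x" using constant_sign[OF cont connected_Ioo nl] by blast
  obtain t where t: "\<And>x. x \<in> {a<..<p} \<Longrightarrow> 0 < t * y0 m x" using constant_sign[OF cont connected_Ioo nm] by blast
  note st = s t
  define c where "c = (a + p) / 2"
  have c: "a < c" "c < p" "0 < c" using p a0 by (auto simp: c_def)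
  have pos: "0 < s * t * wr l m c"
    by (rule wr_pos[OF a p(2) lm]) (use st c in auto)
  have p0: "0 < p" "y0 l p = 0" using p by (auto simp: zeros_def)
  have ev: "\<forall>\<^sub>F x in at_left p. x \<in> {a<..<p}" using p(2) unfolding eventually_at_left_field by auto
  have ev1: "\<forall>\<^sub>F x in at_left p. 0 < s * y0 l x" and ev2: "\<forall>\<^sub>F x in at_left p. 0 \<le> t * y0 m x"
    using ev by (eventually_elim, use st in \<open>auto intro: less_imp_le\<close>)+
  have s1: "s * y1 l p \<le> 0" by (rule deriv_sign_left[OF y0_deriv[OF p0(1)] p0(2) ev1])
  have ym: "(y0 m \<longlongrightarrow> y0 m p) (at_left p)"
    using DERIV_isCont[OF y0_deriv[OF p0(1)]] unfolding isCont_def by (rule tendsto_within_subset) simp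
  have "0 \<le> t * y0 m p"
    by (rule tendsto_lowerbound[OF tendsto_mult_left[OF ym] ev2]) simp
  then have "(s * y1 l p) * (t * y0 m p) \<le> 0" by (rule mult_nonpos_nonneg[OF s1])
  then have neg: "s * t * wr l m p \<le> 0" using p0 by (simp add: wr_def mult_ac)
  have "s * t * wr l m c \<le> s * t * wr l m p"
  proof (rule DERIV_nonneg_imp_nondecreasing[OF less_imp_le[OF c(2)]])
    fix z assume z: "c \<le> z" "z \<le> p"
    have "((\<lambda>x. s * t * wr l m x) has_real_derivative (s * t) * ((m - l) * (y0 l z * y0 m z))) (at z)"
      by (rule DERIV_cmult[OF wr_deriv]) (use z c in auto)
    moreover have "0 \<le> (m - l) * ((s * y0 l z) * (t * y0 m z))"
    proof (cases "z = p")
      case False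
      then have "z \<in> {a<..<p}" using z c by auto
      then have "0 < (s * y0 l z) * (t * y0 m z)" by (intro mult_pos_pos[OF st])
      then show ?thesis using lm by simp
    qed (use p0 in simp)
    ultimately show "\<exists>d. ((\<lambda>x. s * t * wr l m x) has_real_derivative d) (at z) \<and> 0 \<le> d"
      by (intro exI[of _ "(s * t) * ((m - l) * (y0 l z * y0 m z))"]) (simp add: mult_ac)
  qed
  then show False using pos neg by simp
qed

text \<open>Beyond the last zero of the smaller solution \<open>y0 l\<close> the quotient \<open>y0 m / y0 l\<close> would decrease at a
  definite rate, because the Wronskian is bounded below and \<open>y0 l\<close> is bounded.\<close>

lemma zeros_interlace_infinity:
  assumes a: "a \<in> insert 0 (zeros l)" and nz: "\<And>x. a < x \<Longrightarrow> y0 l x \<noteq> 0" and lm: "l < m"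
    and M: "\<And>x. X \<le> x \<Longrightarrow> \<bar>y0 l x\<bar> \<le> M"
  shows "\<exists>q\<in>zeros m. a < q"
proof (rule ccontr)
  assume n: "\<not> ?thesis"
  have a0: "0 \<le> a" using a by (auto simp: zeros_def)
  then have nm: "y0 m x \<noteq> 0" if "x \<in> {a<..}" for x using n that by (auto simp: zeros_def)
  have nl: "y0 l x \<noteq> 0" if "x \<in> {a<..}" for x using nz that by simp
  have cont: "continuous_on {a<..} (y0 z)" for z
    by (rule continuous_on_subset[OF y0_cont]) (use a0 in auto)
  have con: "connected {a<..}" by simp
  obtain s where s1: "s = 1 \<or> s = (-1::real)" and s: "\<And>x. x \<in> {a<..} \<Longrightarrow> 0 < s * y0 l x"
    using constant_sign[OF cont con nl] by blast
  obtain t where t: "\<And>x. x \<in> {a<..} \<Longrightarrow> 0 < t * y0 m x" using constant_sign[OF cont con nm] by blast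
  note st = s t
  define T where "T = max (a + 1) X"
  have T: "a < T" "X \<le> T" "0 < T" using a0 by (auto simp: T_def)
  define w0 where "w0 = s * t * wr l m T"
  have wp: "0 < s * t * wr l m x" if "a < x" for x
    by (rule wr_pos[OF a _ lm, of "x + 1"]) (use st that in auto)
  have w0: "0 < w0" unfolding w0_def by (rule wp[OF T(1)])
  have wge: "w0 \<le> s * t * wr l m x" if "T \<le> x" for x
    unfolding w0_def
  proof (rule DERIV_nonneg_imp_nondecreasing[OF that])
    fix z assume z: "T \<le> z" "z \<le> x"
    have "((\<lambda>x. s * t * wr l m x) has_real_derivative (s * t) * ((m - l) * (y0 l z * y0 m z))) (at z)"
      by (rule DERIV_cmult[OF wr_deriv]) (use z T in auto)
    moreover have "0 < (s * y0 l z) * (t * y0 m z)" using z T by (intro mult_pos_pos[OF st]) auto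
    then have "0 \<le> (m - l) * ((s * y0 l z) * (t * y0 m z))" using lm by simp
    ultimately show "\<exists>d. ((\<lambda>x. s * t * wr l m x) has_real_derivative d) (at z) \<and> 0 \<le> d"
      by (intro exI[of _ "(s * t) * ((m - l) * (y0 l z * y0 m z))"]) (simp add: mult_ac)
  qed
  have yT: "y0 l T \<noteq> 0" by (rule nz[OF T(1)])
  have M0: "0 < M" using M[OF T(2)] yT by linarith
  define R where "R x = s * t * (y0 m x / y0 l x)" for x
  \<comment> \<open>The derivative of the signed quotient is minus the signed Wronskian over (y0
    l)^2, hence at most - w0 / M^2 beyond T. The positive quotient would become nonpositive at T + R
    T / e.\<close>
  define e where "e = w0 / M\<^sup>2"
  have e: "0 < e" using w0 M0 by (simp add: e_def)
  have Rd: "R x + e * x \<le> R T + e * T" if "T \<le> x" for x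
  proof (rule DERIV_nonpos_imp_nonincreasing[OF that])
    fix z assume z: "T \<le> z" "z \<le> x"
    have z0: "0 < z" "y0 l z \<noteq> 0" using z T nz[of z] by auto
    have "(R has_real_derivative s * t * ((y1 m z * y0 l z - y0 m z * y1 l z) / (y0 l z * y0 l z))) (at z)"
      unfolding R_def[abs_def] by (intro DERIV_cmult DERIV_divide y0_deriv z0)
    moreover have "s * t * ((y1 m z * y0 l z - y0 m z * y1 l z) / (y0 l z * y0 l z)) = - (s * t * wr l m z / (y0 l z)\<^sup>2)"
      by (simp add: wr_def power2_eq_square mult_ac flip: minus_divide_left minus_mult_right)
         (simp add: field_simps z0)
    ultimately have "(R has_real_derivative - (s * t * wr l m z / (y0 l z)\<^sup>2)) (at z)" by simp
    then have D: "((\<lambda>x. R x + e * x) has_real_derivative - (s * t * wr l m z / (y0 l z)\<^sup>2) + e) (at z)"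
      by (auto intro!: derivative_eq_intros)
    have "(y0 l z)\<^sup>2 \<le> M\<^sup>2" using M[of z] z T M0 by (intro abs_le_square_iff[THEN iffD1]) simp
    then have "e \<le> w0 / (y0 l z)\<^sup>2" unfolding e_def using w0 z0 M0 by (intro divide_left_mono) auto
    also have "\<dots> \<le> s * t * wr l m z / (y0 l z)\<^sup>2" using wge[OF z(1)] by (intro divide_right_mono) auto
    finally show "\<exists>d. ((\<lambda>x. R x + e * x) has_real_derivative d) (at z) \<and> d \<le> 0"
      using D by (intro exI[of _ "- (s * t * wr l m z / (y0 l z)\<^sup>2) + e"]) auto
  qed
  have Rpos: "0 < R x" if "a < x" for x
  proof -
    have "R x = (t * y0 m x) / (s * y0 l x)" using s1 by (auto simp: R_def)
    also have "0 < \<dots>" using st that by (intro divide_pos_pos) auto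
    finally show ?thesis .
  qed
  have RT: "0 < R T / e" using Rpos[OF T(1)] e by simp
  have "0 < R (T + R T / e)" using Rpos[of "T + R T / e"] RT T by simp
  moreover have "R (T + R T / e) + e * (T + R T / e) \<le> R T + e * T" by (rule Rd) (use RT in simp)
  moreover have "e * (T + R T / e) = e * T + R T" using e by (simp add: field_simps)
  ultimately show False by simp
qed

text \<open>Square integrability makes the regular solution a multiple of the Jost solution, which
  is bounded far out.\<close>

lemma sq_bounded_reg_bounded:
  assumes l: "l < 0" and y: "sq_bounded {0<..} (y0 l)"
  shows "\<exists>M X. \<forall>x\<ge>X. \<bar>y0 l x\<bar> \<le> M"
proof -
  define k where "k = complex_of_real (sqrt (- l))"
  have k2: "- (k\<^sup>2) = complex_of_real l" using l by (simp add: k_def flip: of_real_power)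
  have k0: "0 \<le> Re k" using l by (simp add: k_def)
  obtain p p1 where p: "jost_solution k (V_shift (complex_of_real l)) p p1" using jost_exists[OF k0] k2 by metis
  have o: "ode_solution {0<..} (V_shift (complex_of_real l)) (\<lambda>x. of_real (y0 l x)) (\<lambda>x. of_real (y1 l x))"
    using regular_of_real[OF reg_regular] by (simp add: regular_at_zero_def)
  have L2: "sq_bounded {0<..} (\<lambda>x. complex_of_real (y0 l x))" using y by (simp add: sq_bounded_def)
  obtain c where c: "\<And>x. x > 0 \<Longrightarrow> complex_of_real (y0 l x) = c * p x \<and> complex_of_real (y1 l x) = c * p1 x"
    by (rule sq_bounded_multiple_of_jost[OF k0 o order_refl p L2]) blast
  obtain X where X: "X > 0" "\<And>x. X \<le> x \<Longrightarrow> exp (- Re k * x) / 2 \<le> norm (p x) \<and> norm (p x) \<le> 2 * exp (- Re k * x)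
      \<and> norm (p1 x) \<le> (norm k + 1) * exp (- Re k * x)" using jost_solutionD[OF p] by blast
  have "\<bar>y0 l x\<bar> \<le> cmod c * 2" if x: "X \<le> x" for x
  proof -
    have "exp (- Re k * x) \<le> 1" using k0 x X(1) by simp
    then have "norm (p x) \<le> 2" using X(2)[OF x] by linarith
    moreover have "\<bar>y0 l x\<bar> = cmod (complex_of_real (y0 l x))" by simp
    ultimately show ?thesis using c[of x] x X(1) by (simp add: norm_mult mult_left_mono del: norm_of_real)
  qed
  then show ?thesis by blast
qed

text \<open>The zeros of \<open>y0 l\<close> cut the half line into one more gap than there are
  zeros, and each gap contains a zero of \<open>y0 m\<close>. Square integrability is used for the
  unbounded gap, and it is this gap that makes the inequality strict.\<close>

lemma card_zeros_less:
  assumes lm: "l < m" and l: "l < 0" and y: "sq_bounded {0<..} (y0 l)" and fin: "finite (zeros m)"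
  shows "card (zeros l) < card (zeros m)"
proof -
  obtain M X where M: "\<And>x. X \<le> x \<Longrightarrow> \<bar>y0 l x\<bar> \<le> M" using sq_bounded_reg_bounded[OF l y] by blast
  have finl: "finite (zeros l)" by (rule finite_zeros_neg[OF l])
  have "\<exists>q\<in>zeros m. a < q \<and> (\<forall>p\<in>zeros l. a < p \<longrightarrow> q < p)" if a: "a \<in> insert 0 (zeros l)" for a
  proof (cases "{p\<in>zeros l. a < p} = {}")
    case True
    have "\<And>x. a < x \<Longrightarrow> y0 l x \<noteq> 0" using True a by (force simp: zeros_def)
    from zeros_interlace_infinity[OF a this lm M] show ?thesis using True by blast
  next
    case False
    define p where "p = Min {p\<in>zeros l. a < p}"
    have fp: "finite {p\<in>zeros l. a < p}" using finl by simp
    have p: "p \<in> zeros l" "a < p" using Min_in[OF fp False] by (auto simp: p_def)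
    have le: "p \<le> x" if "x \<in> zeros l" "a < x" for x using that fp by (auto simp: p_def)
    have a0: "0 \<le> a" using a by (auto simp: zeros_def)
    have nz: "y0 l x \<noteq> 0" if "a < x" "x < p" for x using le[of x] that a0 by (auto simp: zeros_def)
    show ?thesis using zeros_interlace_compact[OF a p nz lm] le by force
  qed
  then obtain g where g: "\<And>a. a \<in> insert 0 (zeros l) \<Longrightarrow> g a \<in> zeros m \<and> a < g a \<and> (\<forall>p\<in>zeros l. a < p \<longrightarrow> g a < p)" by metis
  have lt: "g a < g b" if ab: "a \<in> insert 0 (zeros l)" "b \<in> insert 0 (zeros l)" "a < b" for a b
  proof -
    have "0 \<le> a" using ab by (auto simp: zeros_def)
    then have "b \<in> zeros l" using ab by auto
    then show ?thesis using g[OF ab(1)] g[OF ab(2)] ab(3) by force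
  qed
  have "inj_on g (insert 0 (zeros l))"
    by (rule linorder_inj_onI') (use lt in \<open>auto dest: less_imp_neq\<close>)
  then have "card (insert 0 (zeros l)) \<le> card (zeros m)" using g fin by (intro card_inj_on_le[of g]) auto
  moreover have "0 \<notin> zeros l" by (simp add: zeros_def)
  ultimately show ?thesis using finl by simp
qed

section \<open>Existence and enumeration of the eigenvalues\<close>

lemma product_pos_stable:
  assumes x: "0 < x" and pos: "0 < y0 l0 x * y1 l0 x"
  shows "\<exists>d>0. \<forall>l. \<bar>l - l0\<bar> < d \<longrightarrow> 0 < y0 l x * y1 l x"
proof -
  define e where "e = min \<bar>y0 l0 x\<bar> \<bar>y1 l0 x\<bar>"
  have e: "0 < e" using pos by (auto simp: e_def)
  obtain d where d: "d > 0" "\<forall>l t. \<bar>l - l0\<bar> < d \<longrightarrow> 0 < t \<longrightarrow> t \<le> x \<longrightarrow>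
    \<bar>reg_eta l t - reg_eta l0 t\<bar> < e \<and> \<bar>y0 l t - y0 l0 t\<bar> < e \<and> \<bar>y1 l t - y1 l0 t\<bar> < e"
    using reg_eventually_close[OF x e, of l0] by blast
  have "0 < y0 l x * y1 l x" if l: "\<bar>l - l0\<bar> < d" for l
  proof -
    have c: "\<bar>y0 l x - y0 l0 x\<bar> < \<bar>y0 l0 x\<bar>" "\<bar>y1 l x - y1 l0 x\<bar> < \<bar>y1 l0 x\<bar>" using d(2) l x by (auto simp: e_def)
    from pos consider "0 < y0 l0 x" "0 < y1 l0 x" | "y0 l0 x < 0" "y1 l0 x < 0" by (auto simp: zero_less_mult_iff)
    then show ?thesis
    proof cases
      case 1
      then have "0 < y0 l x" "0 < y1 l x" using c by linarith+
      then show ?thesis by simp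
    next
      case 2
      then have "y0 l x < 0" "y1 l x < 0" using c by linarith+
      then show ?thesis by (rule mult_neg_neg)
    qed
  qed
  then show ?thesis using d(1) by blast
qed

text \<open>The eigenvalue is the infimum of the parameters with more than \<open>k\<close> zeros: there the number of zeros jumps, and
  since zeros move continuously the additional one comes from infinity, which forces square integrability.\<close>

lemma eigenvalue_exists:
  assumes fin: "finite (zeros 0)" and k: "k < card (zeros 0)"
  shows "\<exists>l<0. sq_bounded {0<..} (y0 l) \<and> card (zeros l) = k"
proof -
  have fin': "finite (zeros l)" if "l \<le> 0" for l using finite_zeros_neg[of l] fin that by (cases "l = 0") auto
  define S where "S = {l. l \<le> 0 \<and> k < card (zeros l)}"
  have S0: "0 \<in> S" using k by (simp add: S_def)
  have bdd: "bdd_below S"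
  proof (rule bdd_belowI)
    fix l assume "l \<in> S"
    then show "- B - 1 \<le> l" using no_zeros_low[of l] by (force simp: S_def)
  qed
  define L where "L = Inf S"
  have L0: "L \<le> 0" unfolding L_def by (rule cInf_lower[OF S0 bdd])
  have below: "card (zeros l) \<le> k" if "l < L" for l
  proof (rule ccontr)
    assume "\<not> card (zeros l) \<le> k"
    then have "l \<in> S" using that L0 by (simp add: S_def)
    then have "L \<le> l" unfolding L_def by (rule cInf_lower[OF _ bdd])
    then show False using that by simp
  qed
  \<comment> \<open>The zeros at L persist for parameters slightly below L, where there are at most
    k of them; in particular L is not in S.\<close>
  have NL: "card (zeros L) \<le> k"
  proof -
    obtain d where d: "d > 0" "\<forall>l. \<bar>l - L\<bar> < d \<longrightarrow> (\<exists>g. inj_on g (zeros L) \<and> g ` zeros L \<subseteq> zeros l)"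
      using zeros_lower_semicontinuous[OF fin'[OF L0] order_refl] by blast
    have "\<bar>(L - d / 2) - L\<bar> < d" using d(1) by simp
    then obtain g where "inj_on g (zeros L)" "g ` zeros L \<subseteq> zeros (L - d / 2)" using d(2) by blast
    then have "card (zeros L) \<le> card (zeros (L - d / 2))"
      using fin'[of "L - d / 2"] L0 d(1) by (intro card_inj_on_le) auto
    also have "\<dots> \<le> k" using d(1) by (intro below) simp
    finally show ?thesis .
  qed
  then have "L \<noteq> 0" using k by auto
  then have Lneg: "L < 0" using L0 by simp
  have near: "\<exists>l\<in>S. \<bar>l - L\<bar> < e" if e: "0 < e" for e
  proof -
    obtain l where l: "l \<in> S" "l < L + e" using cInf_lessD[of S "L + e"] S0 e by (auto simp: L_def)
    have "L \<le> l" unfolding L_def by (rule cInf_lower[OF l(1) bdd])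
    then show ?thesis using l by (intro bexI[of _ l]) auto
  qed
  \<comment> \<open>The value L / 2 separates: V exceeds it beyond X, and all parameters close to L
    lie below it, so one X serves all of them.\<close>
  obtain X where X: "0 < X" "\<And>x. X \<le> x \<Longrightarrow> L / 2 < V x" using potential_above[of "L / 2"] Lneg by auto
  have half: "l < L / 2" if "\<bar>l - L\<bar> < - L / 2" for l using that by linarith
  \<comment> \<open>Otherwise y y' is positive at some point beyond X, also for parameters near L,
    so all their zeros stay in a fixed compact part. Upper semicontinuity then gives at most k
    zeros, contradicting membership in S arbitrarily close to L.\<close>
  have "sq_bounded {0<..} (y0 L)"
  proof (rule ccontr)
    assume n: "\<not> ?thesis"
    obtain x where x: "X \<le> x" "0 < y0 L x * y1 L x" using not_sq_bounded_growth[OF Lneg n X] by blast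
    have x0: "0 < x" using x X by simp
    obtain d1 where d1: "d1 > 0" "\<forall>l. \<bar>l - L\<bar> < d1 \<longrightarrow> 0 < y0 l x * y1 l x" using product_pos_stable[OF x0 x(2)] by blast
    obtain d2 where d2: "d2 > 0" "\<forall>l. \<bar>l - L\<bar> < d2 \<longrightarrow> card (zeros l \<inter> {..x}) \<le> card (zeros L \<inter> {..x})"
      using zeros_upper_semicontinuous[OF x0] by blast
    obtain l where l: "l \<in> S" "\<bar>l - L\<bar> < min (min d1 d2) (- L / 2)" using near[of "min (min d1 d2) (- L / 2)"] d1(1) d2(1) Lneg by auto
    have "zeros l = zeros l \<inter> {..x}"
    proof (rule no_zero_beyond[OF x0])
      show "0 < y0 l x * y1 l x" using d1(2) l by simp
      fix z assume "x \<le> z"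
      then have "L / 2 < V z" using X x by simp
      moreover have "l < L / 2" using l(2) by (intro half) simp
      ultimately show "0 < V z - l" by linarith
    qed
    moreover have "card (zeros l \<inter> {..x}) \<le> card (zeros L \<inter> {..x})" using d2(2) l by simp
    ultimately have "card (zeros l) \<le> card (zeros L \<inter> {..x})" by simp
    also have "\<dots> \<le> card (zeros L)" by (rule card_mono[OF fin'[OF L0]]) simp
    finally show False using l(1) NL by (simp add: S_def)
  qed
  \<comment> \<open>Beyond X a nearby solution has at most one zero, so at most one is gained from
    infinity.\<close>
  moreover have "k \<le> card (zeros L)"
  proof -
    obtain d where d: "d > 0" "\<forall>l. \<bar>l - L\<bar> < d \<longrightarrow> card (zeros l \<inter> {..X}) \<le> card (zeros L \<inter> {..X})"
      using zeros_upper_semicontinuous[OF X(1)] by blast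
    obtain l where l: "l \<in> S" "\<bar>l - L\<bar> < min d (- L / 2)" using near[of "min d (- L / 2)"] d(1) Lneg by auto
    have "card (zeros l) \<le> card (zeros l \<inter> {..X}) + 1"
    proof (rule card_zeros_beyond(2)[OF X(1)])
      fix z assume "X \<le> z"
      then have "L / 2 < V z" by (rule X(2))
      moreover have "l < L / 2" using l(2) by (intro half) simp
      ultimately show "0 < V z - l" by linarith
    qed
    also have "card (zeros l \<inter> {..X}) \<le> card (zeros L \<inter> {..X})" using d(2) l by simp
    also have "card (zeros L \<inter> {..X}) \<le> card (zeros L)" by (rule card_mono[OF fin'[OF L0]]) simp
    finally show ?thesis using l(1) by (simp add: S_def)
  qed
  ultimately show ?thesis using NL Lneg by auto
qed

text \<open>The number of zeros labels the eigenvalues: it is strictly increasing along them, it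
  stays below n by comparison with the parameter 0, and every label below n occurs.\<close>

lemma eigenvalues_enumerated:
  assumes fin: "finite (zeros 0)" and n: "card (zeros 0) = n"
  shows "\<exists>L :: nat \<Rightarrow> real. (\<forall>i j. i < j \<and> j < n \<longrightarrow> L i < L j) \<and> {l. l < 0 \<and> sq_bounded {0<..} (y0 l)} = L ` {..<n}"
proof -
  have "\<exists>l<0. sq_bounded {0<..} (y0 l) \<and> card (zeros l) = k" if "k < n" for k using eigenvalue_exists[OF fin] that n by blast
  then obtain L where L: "\<And>k. k < n \<Longrightarrow> L k < 0 \<and> sq_bounded {0<..} (y0 (L k)) \<and> card (zeros (L k)) = k" by metis
  have less: "card (zeros l) < card (zeros m)" if "l < m" "m < 0" "sq_bounded {0<..} (y0 l)" for l m
    by (rule card_zeros_less) (use that finite_zeros_neg in auto)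
  have inj: "l = m" if "l < 0" "m < 0" "sq_bounded {0<..} (y0 l)" "sq_bounded {0<..} (y0 m)" "card (zeros l) = card (zeros m)" for l m
    using less[of l m] less[of m l] that by (metis less_irrefl linorder_neqE_linordered_idom)
  have "L i < L j" if ij: "i < j" "j < n" for i j
  proof (rule ccontr)
    assume "\<not> L i < L j"
    then consider "L i = L j" | "L j < L i" by linarith
    then show False
    proof cases
      case 1
      then show False using L[of i] L[of j] ij by (metis less_irrefl less_trans)
    next
      case 2
      then have "card (zeros (L j)) < card (zeros (L i))" using L[of i] L[of j] ij by (intro less) auto
      then show False using L[of i] L[of j] ij by simp
    qed
  qed
  moreover have "{l. l < 0 \<and> sq_bounded {0<..} (y0 l)} = L ` {..<n}"
  proof
    show "L ` {..<n} \<subseteq> {l. l < 0 \<and> sq_bounded {0<..} (y0 l)}" using L by auto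
    show "{l. l < 0 \<and> sq_bounded {0<..} (y0 l)} \<subseteq> L ` {..<n}"
    proof
      fix l assume "l \<in> {l. l < 0 \<and> sq_bounded {0<..} (y0 l)}"
      then have l: "l < 0" "sq_bounded {0<..} (y0 l)" by auto
      have c: "card (zeros l) < n" using card_zeros_less[OF l(1) l fin] n by simp
      have "l = L (card (zeros l))" using L[OF c] l by (intro inj) auto
      then show "l \<in> L ` {..<n}" using c by blast
    qed
  qed
  ultimately show ?thesis by (intro exI[of _ L]) auto
qed

end

section \<open>Analytic profiles\<close>

text \<open>The power series converges on a full neighbourhood of \<open>x\<close> even if \<open>x\<close> is an endpoint of the interval.\<close>

lemma real_analytic_01_local:
  assumes f: "real_analytic_01 f" and x: "x \<in> {0..1}"
  obtains R G G1 G2 where "0 < R" "\<And>h. \<bar>h\<bar> < R \<Longrightarrow> (G has_real_derivative G1 h) (at h)"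
    "\<And>h. \<bar>h\<bar> < R \<Longrightarrow> (G1 has_real_derivative G2 h) (at h)" "\<And>y. y \<in> {0..1} \<Longrightarrow> \<bar>y - x\<bar> < R \<Longrightarrow> f y = G (y - x)"
proof -
  obtain r c where r: "r > 0" "\<forall>y\<in>{0..1}. \<bar>y - x\<bar> < r \<longrightarrow> (\<lambda>k. c k * (y - x) ^ k) sums f y"
    using f x unfolding real_analytic_01_def by blast
  define R where "R = min r (1/2)"
  have R: "0 < R" using r(1) by (simp add: R_def)
  have sm: "summable (\<lambda>k. c k * h ^ k)" if h: "norm h < R" for h :: real
  proof -
    define s where "s = (\<bar>h\<bar> + R) / 2"
    have s: "\<bar>h\<bar> < s" "s < R" "0 < s" using h R by (auto simp: s_def)
    \<comment> \<open>A step towards the interior, so that x + k lies in the unit interval where the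
      series is known to converge; this yields convergence on both sides for smaller h.\<close>
    define k where "k = (if x \<le> 1/2 then s else - s)"
    have "\<bar>k\<bar> < r" "x + k \<in> {0..1}" using s x by (auto simp: k_def R_def)
    then have "(\<lambda>n. c n * (x + k - x) ^ n) sums f (x + k)" using r(2) by force
    then have "summable (\<lambda>n. c n * k ^ n)" by (simp add: sums_iff)
    then show ?thesis by (rule powser_inside) (use s in \<open>auto simp: k_def\<close>)
  qed
  have sm1: "summable (\<lambda>k. diffs c k * h ^ k)" if "norm h < R" for h :: real
    by (rule termdiff_converges[OF that sm])
  show ?thesis
  proof (rule that[OF R])
    fix h :: real assume h: "\<bar>h\<bar> < R"
    then show "((\<lambda>h. \<Sum>k. c k * h ^ k) has_real_derivative (\<Sum>k. diffs c k * h ^ k)) (at h)"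
      by (intro termdiffs_strong'[OF sm]) auto
    show "((\<lambda>h. \<Sum>k. diffs c k * h ^ k) has_real_derivative (\<Sum>k. diffs (diffs c) k * h ^ k)) (at h)"
      using h by (intro termdiffs_strong'[OF sm1]) auto
  next
    fix y assume "y \<in> {0..1}" "\<bar>y - x\<bar> < R"
    then have "(\<lambda>k. c k * (y - x) ^ k) sums f y" using r(2) by (simp add: R_def)
    then show "f y = (\<Sum>k. c k * (y - x) ^ k)" by (simp add: sums_iff)
  qed
qed

lemma real_analytic_01_deriv:
  assumes f: "real_analytic_01 f" and x: "x \<in> {0<..<1}"
  shows "(f has_real_derivative deriv f x) (at x)" "(deriv f has_real_derivative (deriv ^^ 2) f x) (at x)"
proof -
  have x': "x \<in> {0..1}" using x by simp
  obtain R G G1 G2 where R: "0 < R" and G: "\<And>h. \<bar>h\<bar> < R \<Longrightarrow> (G has_real_derivative G1 h) (at h)"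
    "\<And>h. \<bar>h\<bar> < R \<Longrightarrow> (G1 has_real_derivative G2 h) (at h)" "\<And>y. y \<in> {0..1} \<Longrightarrow> \<bar>y - x\<bar> < R \<Longrightarrow> f y = G (y - x)"
    using real_analytic_01_local[OF f x'] by blast
  define S where "S = {0<..<1} \<inter> {x - R<..<x + R}"
  have S: "open S" "x \<in> S" using x R by (auto simp: S_def)
  have sR: "\<bar>y - x\<bar> < R" "y \<in> {0..1}" if "y \<in> S" for y using that by (auto simp: S_def)
  have d1: "(f has_real_derivative G1 (y - x)) (at y)" if y: "y \<in> S" for y
  proof (rule has_field_derivative_transform_within_open[OF _ S(1) y])
    have "(G has_real_derivative G1 (y - x)) (at (y - x))" by (rule G(1)[OF sR(1)[OF y]])
    then have "(G has_real_derivative G1 (y - x)) (at (y + (- x)))" by simp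
    then show "((\<lambda>z. G (z - x)) has_real_derivative G1 (y - x)) (at y)" unfolding DERIV_shift by simp
    show "G (z - x) = f z" if "z \<in> S" for z using G(3)[OF sR(2,1)[OF that]] by simp
  qed
  have e: "deriv f y = G1 (y - x)" if "y \<in> S" for y by (rule DERIV_imp_deriv[OF d1[OF that]])
  show "(f has_real_derivative deriv f x) (at x)" using d1[OF S(2)] e[OF S(2)] by simp
  have d2: "(deriv f has_real_derivative G2 0) (at x)"
  proof (rule has_field_derivative_transform_within_open[OF _ S])
    have "(G1 has_real_derivative G2 0) (at (x + (- x)))" using G(2)[of 0] R by simp
    then show "((\<lambda>z. G1 (z - x)) has_real_derivative G2 0) (at x)" unfolding DERIV_shift by simp
    show "G1 (z - x) = deriv f z" if "z \<in> S" for z using e[OF that] by simp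
  qed
  moreover have "(deriv ^^ 2) f x = G2 0" using DERIV_imp_deriv[OF d2] by (simp add: numeral_2_eq_2)
  ultimately show "(deriv f has_real_derivative (deriv ^^ 2) f x) (at x)" by simp
qed

lemma real_analytic_01_linear_bound:
  assumes f: "real_analytic_01 f" and f0: "f 0 = 0"
  obtains K \<delta> where "0 < \<delta>" "\<delta> \<le> 1" "0 \<le> K" "\<And>x. 0 < x \<Longrightarrow> x < \<delta> \<Longrightarrow> \<bar>f x\<bar> \<le> K * x"
proof -
  obtain R G G1 G2 where R: "0 < R" and G: "\<And>h. \<bar>h\<bar> < R \<Longrightarrow> (G has_real_derivative G1 h) (at h)"
    "\<And>h. \<bar>h\<bar> < R \<Longrightarrow> (G1 has_real_derivative G2 h) (at h)" "\<And>y. y \<in> {0..1} \<Longrightarrow> \<bar>y - 0\<bar> < R \<Longrightarrow> f y = G (y - 0)"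
    using real_analytic_01_local[OF f, of 0] by (metis atLeastAtMost_iff order_refl zero_le_one)
  have G0: "G 0 = 0" using G(3)[of 0] f0 R by simp
  have "(G has_real_derivative G1 0) (at 0)" using G(1)[of 0] R by simp
  then have "((\<lambda>h. norm (G h / h)) \<longlongrightarrow> norm (G1 0)) (at 0)" using G0 by (intro tendsto_norm) (simp add: has_field_derivative_iff)
  then have "\<forall>\<^sub>F h in at 0. norm (G h / h) < norm (G1 0) + 1" by (rule order_tendstoD) simp
  then obtain d where d: "d > 0" "\<And>h. h \<noteq> 0 \<Longrightarrow> \<bar>h\<bar> < d \<Longrightarrow> \<bar>G h / h\<bar> < \<bar>G1 0\<bar> + 1" unfolding eventually_at by (auto simp: dist_real_def)
  show ?thesis
  proof (rule that[of "min 1 (min d R)" "\<bar>G1 0\<bar> + 1"])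
    fix x :: real assume x: "0 < x" "x < min 1 (min d R)"
    have "\<bar>G x / x\<bar> < \<bar>G1 0\<bar> + 1" using d(2)[of x] x by simp
    then have "\<bar>G x\<bar> \<le> (\<bar>G1 0\<bar> + 1) * x" using x by (simp add: divide_less_eq less_imp_le)
    moreover have "f x = G x" using G(3)[of x] x by simp
    ultimately show "\<bar>f x\<bar> \<le> (\<bar>G1 0\<bar> + 1) * x" by simp
  qed (use d R in auto)
qed

text \<open>The constant 72 is 2 * 36: sinh x >= x^3 / 6 gives sinh^2 x >= x^6 / 36, and together
  with sinh x >= x it gives sinh^2 x >= x^4 / 6. For B, the identity 1 - cos (2 f) = 2 sin^2 f and
  |sin f| <= L r bound the distance of V to 2 / sinh^2 by 4 L^2; replacing sinh^2 by x^2 costs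
  2.\<close>

lemma profile_potential_locale:
  assumes f: "real_analytic_01 f" and f0: "f 0 = 0"
  shows "\<exists>B. profile_op f B 72"
proof -
  have fd: "(f has_real_derivative deriv f x) (at x)" if "x \<in> {0<..<1}" for x by (rule real_analytic_01_deriv(1)[OF f that])
  have fc: "continuous_on {0<..<1} f" by (rule DERIV_continuous_on[OF has_field_derivative_at_within[OF fd]])
  obtain K \<delta> where K: "0 < \<delta>" "\<delta> \<le> 1" "0 \<le> K" "\<And>x. 0 < x \<Longrightarrow> x < \<delta> \<Longrightarrow> \<bar>f x\<bar> \<le> K * x"
    by (rule real_analytic_01_linear_bound[OF f f0]) blast
  \<comment> \<open>K serves below \<open>\<delta>\<close>, where f is linearly bounded, and 1 /
    \<open>\<delta>\<close> beyond it, where the sine is at most 1.\<close>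
  define L where "L = K + 1 / \<delta>"
  have sinf: "\<bar>sin (f x)\<bar> \<le> L * x" if x: "0 < x" for x
  proof (cases "x < \<delta>")
    case True
    have "\<bar>sin (f x)\<bar> \<le> \<bar>f x\<bar>" by (rule abs_sin_x_le_abs_x)
    also have "\<dots> \<le> K * x" by (rule K(4)[OF x True])
    also have "\<dots> \<le> L * x" using K x by (intro mult_right_mono) (auto simp: L_def)
    finally show ?thesis .
  next
    case False
    then have "1 \<le> 1 / \<delta> * x" using K(1) by (simp add: field_simps)
    also have "\<dots> \<le> L * x" using K x by (intro mult_right_mono) (auto simp: L_def)
    finally show ?thesis using abs_sin_le_one[of "f x"] by linarith
  qed
  have "profile_op f (4 * L\<^sup>2 + 2) 72"
  proof
    show "continuous_on {0<..<1} f" by (rule fc)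
    show "profile_potential f 0 = 0" by (simp add: profile_potential_def)
    show "continuous_on {0<..} (profile_potential f)"
      unfolding profile_potential_def[abs_def]
      by (intro continuous_intros continuous_on_compose2[OF fc]) (auto dest: tanh_cosh_sinh)
    fix x :: real assume x: "0 < x"
    note t = tanh_cosh_sinh[OF x] and s = sinh_lower_bounds[OF x] and i = inverse_sinh_square_bounds[OF x]
    have V2: "\<bar>profile_potential f x\<bar> \<le> 2 / (sinh x)\<^sup>2"
      unfolding profile_potential_def abs_divide
      using abs_cos_le_one[of "2 * f (tanh x)"] by (auto simp: abs_mult intro!: divide_right_mono simp del: abs_cos_le_one)
    show "\<bar>profile_potential f x\<bar> \<le> 72 / x ^ 4"
    proof -
      have "x * (x ^ 3 / 6) \<le> sinh x * sinh x" using s x by (intro mult_mono) auto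
      then have "x ^ 4 / 6 \<le> (sinh x)\<^sup>2" by (simp add: power2_eq_square eval_nat_numeral)
      moreover have "0 \<le> x ^ 4" using x by simp
      ultimately have "x ^ 4 / 36 \<le> (sinh x)\<^sup>2" by linarith
      then have "2 / (sinh x)\<^sup>2 \<le> 2 / (x ^ 4 / 36)" using x by (intro divide_left_mono) auto
      then show ?thesis using V2 by simp
    qed
    show "\<bar>profile_potential f x\<bar> \<le> 72 / x ^ 6"
    proof -
      have "(x ^ 3 / 6) * (x ^ 3 / 6) \<le> sinh x * sinh x" using s x by (intro mult_mono) auto
      then have "x ^ 6 / 36 \<le> (sinh x)\<^sup>2" by (simp add: power2_eq_square eval_nat_numeral)
      then have "2 / (sinh x)\<^sup>2 \<le> 2 / (x ^ 6 / 36)" using x by (intro divide_left_mono) auto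
      then show ?thesis using V2 by simp
    qed
    show "\<bar>profile_potential f x - 2 / x\<^sup>2\<bar> \<le> 4 * L\<^sup>2 + 2"
    proof -
      define S where "S = 4 * (sin (f (tanh x)))\<^sup>2 / (sinh x)\<^sup>2"
      have "(sin (f (tanh x)))\<^sup>2 \<le> (L * tanh x)\<^sup>2"
        using sinf[of "tanh x"] t(3) power_mono[of "\<bar>sin (f (tanh x))\<bar>" "L * tanh x" 2] by simp
      also have "\<dots> = L\<^sup>2 * ((sinh x)\<^sup>2 / (cosh x)\<^sup>2)" by (simp add: power_mult_distrib t(2))
      also have "\<dots> \<le> L\<^sup>2 * (sinh x)\<^sup>2"
        using cosh_real_ge_1[of x] by (intro mult_left_mono) (auto simp: divide_le_eq mult_le_cancel_left1)
      finally have "S \<le> 4 * L\<^sup>2" using t(4) by (simp add: S_def divide_le_eq)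
      moreover have "0 \<le> S" by (simp add: S_def)
      moreover have "profile_potential f x = 2 / (sinh x)\<^sup>2 - S"
        unfolding profile_potential_def S_def cos_double_sin by (simp add: diff_divide_distrib right_diff_distrib)
      moreover have "2 / (sinh x)\<^sup>2 = 2 * (1 / (sinh x)\<^sup>2)" "2 / x\<^sup>2 = 2 * (1 / x\<^sup>2)" by simp_all
      ultimately show ?thesis using i zero_le_power2[of L] unfolding abs_le_iff by linarith
    qed
  qed
  then show ?thesis by blast
qed

section \<open>The zero energy solution coming from the profile\<close>

context profile_op
begin

text \<open>The derivative of the profile along the dilation flow solves the equation at \<open>\<lambda> = 0\<close>.\<close>

lemma zeros_zero:
  assumes f: "real_analytic_01 f"
    and ode: "\<And>r. r \<in> {0<..<1} \<Longrightarrow> (deriv ^^ 2) f r + 2 / r * deriv f r - sin (2 * f r) / (r\<^sup>2 * (1 - r\<^sup>2)) = 0"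
    and fin: "finite {r\<in>{0<..<1}. deriv f r = 0}"
  shows "zeros 0 = artanh ` {r\<in>{0<..<1}. deriv f r = 0}"
proof -
  define y where "y x = (tanh x)\<^sup>2 * deriv f (tanh x)" for x
  \<comment> \<open>The derivative of y: the profile equation times r^2 (1 - r^2) states exactly
    this. Differentiating the sine once more produces the potential.\<close>
  define z where "z x = sin (2 * f (tanh x))" for x
  have fd: "((\<lambda>x. f (tanh x)) has_real_derivative deriv f (tanh x) * (1 - (tanh x)\<^sup>2)) (at x)"
    and gd: "((\<lambda>x. deriv f (tanh x)) has_real_derivative (deriv ^^ 2) f (tanh x) * (1 - (tanh x)\<^sup>2)) (at x)" if x: "0 < x" for x
  proof -
    have "cosh x \<noteq> 0" using tanh_cosh_sinh(5)[OF x] by simp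
    then have "(tanh has_real_derivative (1 - (tanh x)\<^sup>2)) (at x)" by (auto intro!: derivative_eq_intros)
    from DERIV_chain2[OF _ this] real_analytic_01_deriv[OF f tanh_cosh_sinh(3)[OF x]]
    show "((\<lambda>x. f (tanh x)) has_real_derivative deriv f (tanh x) * (1 - (tanh x)\<^sup>2)) (at x)"
      "((\<lambda>x. deriv f (tanh x)) has_real_derivative (deriv ^^ 2) f (tanh x) * (1 - (tanh x)\<^sup>2)) (at x)" by blast+
  qed
  have yd: "(y has_real_derivative z x) (at x)" if x: "0 < x" for x
  proof -
    define r where "r = tanh x"
    have r: "r \<in> {0<..<1}" using tanh_cosh_sinh(3)[OF x] by (simp add: r_def)
    then have r1: "0 < 1 - r\<^sup>2" by (simp add: abs_square_less_1)
    have c: "cosh x \<noteq> 0" using tanh_cosh_sinh(5)[OF x] by simp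
    have "(y has_real_derivative (2 * r * (1 - r\<^sup>2)) * deriv f r + r\<^sup>2 * ((deriv ^^ 2) f r * (1 - r\<^sup>2))) (at x)"
      unfolding y_def[abs_def] r_def by (rule derivative_eq_intros gd x c refl | simp)+
    also have "(2 * r * (1 - r\<^sup>2)) * deriv f r + r\<^sup>2 * ((deriv ^^ 2) f r * (1 - r\<^sup>2)) =
        r\<^sup>2 * (1 - r\<^sup>2) * ((deriv ^^ 2) f r + 2 / r * deriv f r)"
      using r by (simp add: field_simps power2_eq_square)
    also have "\<dots> = r\<^sup>2 * (1 - r\<^sup>2) * (sin (2 * f r) / (r\<^sup>2 * (1 - r\<^sup>2)))" using ode[OF r] by simp
    also have "\<dots> = z x" using r r1 by (simp add: z_def r_def)
    finally show ?thesis .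
  qed
  have zd: "(z has_real_derivative profile_potential f x * y x) (at x)" if x: "0 < x" for x
  proof -
    note t = tanh_cosh_sinh[OF x]
    have "(z has_real_derivative cos (2 * f (tanh x)) * (2 * (deriv f (tanh x) * (1 - (tanh x)\<^sup>2)))) (at x)"
      unfolding z_def[abs_def] by (rule derivative_eq_intros fd x refl | simp)+
    also have "cos (2 * f (tanh x)) * (2 * (deriv f (tanh x) * (1 - (tanh x)\<^sup>2))) = profile_potential f x * y x"
      unfolding profile_potential_def y_def t(1) unfolding t(2) using t(4,5) by (simp add: field_simps)
    finally show ?thesis .
  qed
  have o: "ode_solution {0<..} (V_shift 0) y z"
    unfolding ode_solution_def using yd zd by (simp add: V_shift_def has_real_derivative_iff_has_vector_derivative)
  have yc: "continuous_on {0<..} y" using ode_solution_continuous[OF o] by simp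
  \<comment> \<open>Since |y'| <= 1, the mean value theorem bounds y near the origin. Boundedness
    there is already enough to make y a multiple of the regular solution, without its
    asymptotics.\<close>
  have bound: "\<bar>y x\<bar> \<le> \<bar>y 1\<bar> + 1" if x: "x \<in> {0<..<1}" for x
  proof -
    obtain t where t: "x < t" "t < 1" "y 1 - y x = (1 - x) * z t" using MVT2[of x 1 y z] yd x by auto
    have "\<bar>(1 - x) * z t\<bar> \<le> 1 * 1" unfolding abs_mult using x by (intro mult_mono) (auto simp: z_def)
    then show ?thesis using t(3) by linarith
  qed
  have L2: "sq_bounded {0<..<1} y"
    unfolding sq_bounded_def
  proof (intro exI allI impI)
    fix a b :: real assume ab: "a < b" "{a..b} \<subseteq> {0<..<1}"
    then have "a \<in> {a..b}" "b \<in> {a..b}" by auto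
    then have ab': "0 < a" "b < 1" using ab(2) by auto
    have "norm (integral {a..b} (\<lambda>x. (norm (y x))\<^sup>2)) \<le> (\<bar>y 1\<bar> + 1)\<^sup>2 * (b - a)"
    proof (rule integral_bound[OF less_imp_le[OF ab(1)]])
      show "continuous_on {a..b} (\<lambda>x. (norm (y x))\<^sup>2)"
        by (intro continuous_intros continuous_on_subset[OF yc]) (use ab' in auto)
      fix t assume "t \<in> {a..b}"
      then have "\<bar>y t\<bar> \<le> \<bar>y 1\<bar> + 1" using ab(2) by (intro bound) auto
      then have "\<bar>y t\<bar>\<^sup>2 \<le> (\<bar>y 1\<bar> + 1)\<^sup>2" by (intro power_mono) auto
      then show "norm ((norm (y t))\<^sup>2) \<le> (\<bar>y 1\<bar> + 1)\<^sup>2" by simp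
    qed
    also have "\<dots> \<le> (\<bar>y 1\<bar> + 1)\<^sup>2 * 1" using ab' by (intro mult_left_mono) auto
    finally show "integral {a..b} (\<lambda>x. (norm (y x))\<^sup>2) \<le> (\<bar>y 1\<bar> + 1)\<^sup>2 * 1" by simp
  qed
  obtain c where c: "\<And>x. 0 < x \<Longrightarrow> y x = c * reg 0 x \<and> z x = c * reg1 0 x"
    using sq_bounded_multiple_of_regular'[OF o reg_regular L2] by blast
  \<comment> \<open>Finitely many zeros of the derivative leave a point where y is nonzero, so the
    factor c is nonzero.\<close>
  have "infinite ({0<..<1} - {r\<in>{0<..<1}. deriv f r = 0})" using fin infinite_Ioo[of 0 "1::real"] by (intro Diff_infinite_finite) auto
  then have "{0<..<1} - {r\<in>{0<..<1}. deriv f r = 0} \<noteq> {}" by (rule infinite_imp_nonempty)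
  then obtain r where r: "r \<in> {0<..<1}" "deriv f r \<noteq> 0" by blast
  have "y (artanh r) \<noteq> 0" using r artanh_unit[OF r(1)] by (simp add: y_def)
  then have c0: "c \<noteq> 0" using c[OF artanh_unit(1)[OF r(1)]] by auto
  have iff: "x \<in> zeros 0 \<longleftrightarrow> 0 < x \<and> deriv f (tanh x) = 0" for x
    using c[of x] c0 tanh_cosh_sinh(3)[of x] by (auto simp: zeros_def y_def)
  show ?thesis
  proof (intro equalityI subsetI)
    fix x assume "x \<in> zeros 0"
    then have "0 < x" "deriv f (tanh x) = 0" using iff by auto
    then show "x \<in> artanh ` {r\<in>{0<..<1}. deriv f r = 0}"
      using tanh_cosh_sinh(3)[of x] by (intro image_eqI[of _ _ "tanh x"]) (auto simp: artanh_tanh_real)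
  qed (use iff artanh_unit in auto)
qed

section \<open>The three parts of the spectrum\<close>

lemma point_spec_iff: "z \<in> point_spec f \<longleftrightarrow> (\<exists>l<0. z = complex_of_real l \<and> sq_bounded {0<..} (y0 l))"
proof -
  have r: "\<not> inj_shift f (complex_of_real l) \<longleftrightarrow> sq_bounded {0<..} (y0 l)" for l
    using not_inj_iff[OF regular_of_real[OF reg_regular], of l] by (simp add: sq_bounded_def)
  show ?thesis
  proof
    assume z: "z \<in> point_spec f"
    then have "Im z = 0" using inj_nonreal[of z] by (auto simp: point_spec_def)
    then have z': "z = complex_of_real (Re z)" by (simp add: complex_eq_iff)
    then have "Re z < 0" using inj_nonneg[of "Re z"] z by (force simp: point_spec_def)
    moreover have "sq_bounded {0<..} (y0 (Re z))" using z z' r[of "Re z"] by (simp add: point_spec_def)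
    ultimately show "\<exists>l<0. z = complex_of_real l \<and> sq_bounded {0<..} (y0 l)" using z' by blast
  qed (use r in \<open>auto simp: point_spec_def\<close>)
qed

lemma cont_spec_eq: "cont_spec f = complex_of_real ` {0..}"
proof (intro equalityI subsetI)
  fix z assume "z \<in> cont_spec f"
  then show "z \<in> complex_of_real ` {0..}" using surj_off_half_line[of z] by (auto simp: cont_spec_def)
qed (use inj_nonneg not_surj_nonneg dense_range_nonneg in \<open>auto simp: cont_spec_def\<close>)

lemma res_spec_eq: "res_spec f = {}"
proof -
  have "dense_range_shift f z" if "inj_shift f z" for z
    using surj_imp_dense[OF surj_off_half_line[OF _ that]] dense_range_nonneg by (cases "z \<in> complex_of_real ` {0..}") auto
  then show ?thesis by (auto simp: res_spec_def)
qed

end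

theorem mainTheorem4:
  fixes n :: nat and f :: "real \<Rightarrow> real"
  assumes "is_profile n f"
  shows "cont_spec f = complex_of_real ` {0..} \<and> res_spec f = {} \<and>
    (\<exists>lam :: nat \<Rightarrow> real. (\<forall>i j. 1 \<le> i \<and> i < j \<and> j \<le> n \<longrightarrow> lam j < lam i) \<and>
       (\<forall>i. 1 \<le> i \<and> i \<le> n \<longrightarrow> lam i < 0) \<and>
       point_spec f = (\<lambda>i. complex_of_real (lam i)) ` {1..n})"
proof -
  have f: "real_analytic_01 f" "f 0 = 0"
    and ode: "\<And>r. r \<in> {0<..<1} \<Longrightarrow> (deriv ^^ 2) f r + 2 / r * deriv f r - sin (2 * f r) / (r\<^sup>2 * (1 - r\<^sup>2)) = 0"
    and Z: "finite {r\<in>{0<..<1}. r * sqrt (1 - r\<^sup>2) * deriv f r = 0}" "card {r\<in>{0<..<1}. r * sqrt (1 - r\<^sup>2) * deriv f r = 0} = n"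
    using assms unfolding is_profile_def by blast+
  have "r * sqrt (1 - r\<^sup>2) * deriv f r = 0 \<longleftrightarrow> deriv f r = 0" if "r \<in> {0<..<1}" for r
  proof -
    have "r\<^sup>2 < 1" using that by (simp add: abs_square_less_1)
    then show ?thesis using that by simp
  qed
  then have e: "{r\<in>{0<..<1}. r * sqrt (1 - r\<^sup>2) * deriv f r = 0} = {r\<in>{0<..<1}. deriv f r = 0}" by blast
  obtain B where "profile_op f B 72" using profile_potential_locale[OF f] by blast
  then interpret profile_op f B 72 .
  note z0 = zeros_zero[OF f(1) ode Z(1)[unfolded e]]
  have "inj_on artanh {r\<in>{0<..<1}. deriv f r = 0}"
    by (rule inj_on_inverseI[of _ tanh]) (use artanh_unit in auto)
  then have "finite (zeros 0)" "card (zeros 0) = n" using Z z0 e by (auto simp: card_image)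
  then obtain L :: "nat \<Rightarrow> real" where L: "\<forall>i j. i < j \<and> j < n \<longrightarrow> L i < L j" "{l. l < 0 \<and> sq_bounded {0<..} (y0 l)} = L ` {..<n}"
    using eigenvalues_enumerated by blast
  have Lneg: "L i < 0" if "i < n" for i using L(2) that by blast
  \<comment> \<open>The enumeration L increases and starts at index 0, whereas the claim lists the
    eigenvalues decreasingly from index 1; hence the index n - i.\<close>
  have rev: "{..<n} = (\<lambda>i. n - i) ` {1..n}"
  proof (intro equalityI subsetI)
    fix k assume "k \<in> {..<n}"
    then show "k \<in> (\<lambda>i. n - i) ` {1..n}" by (intro image_eqI[of _ _ "n - k"]) auto
  qed auto
  have "point_spec f = complex_of_real ` {l. l < 0 \<and> sq_bounded {0<..} (y0 l)}" using point_spec_iff by blast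
  also have "\<dots> = (\<lambda>i. complex_of_real (L (n - i))) ` {1..n}" unfolding L(2) rev by (simp add: image_image)
  finally have "point_spec f = (\<lambda>i. complex_of_real (L (n - i))) ` {1..n}" .
  then show ?thesis
    using cont_spec_eq res_spec_eq L(1) Lneg by (intro conjI exI[of _ "\<lambda>i. L (n - i)"]) auto
qed

end
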